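(* Let $\omega$ be the surface measure on the unit sphere $S^{n-1}=\{x\in\mathbb{R}^n:\|x\|=1\}$. If $n\geq3$ and if $D\subseteq(-1,1)$ is a closed set, then $\lim_{r\to\infty}\gamma_r(G)=\alpha_\omega(G)$, where $G=G(S^{n-1},D)$ is the graph with vertex set $S^{n-1}$ in which $x,y\in S^{n-1}$ are adjacent if $x\cdot y\in D$.
   Context: $x\cdot y$ is the Euclidean inner product; "closed" means closed as a subset of $\mathbb{R}$. A set of vertices of a graph is independent if it contains no edge, and $\alpha_\omega(G)=\sup\{\omega(I): I\subseteq V\text{ independent and measurable}\}$ for a graph with vertex set $V$. Let $V=S^{n-1}$ with the measure $\omega$. $L^2_{\rm sym}(V)$ is the space of real kernels $A\in L^2(V\times V)$ with $A(x,y)=A(y,x)$ almost everywhere; $\langle\cdot,\cdot\rangle$ is the $L^2$ inner product. A kernel $A\in L^2_{\rm sym}(V)$ is positive semidefinite if $\int_V\int_V A(x,y)f(x)f(y)\,d\omega(y)\,d\omega(x)\ge0$ for all $f\in L^2(V)$. For $F\colon V^{r+2}\to\mathbb{R}$ let $(\mathcal{R}_{\mathcal{S}_{r+2}}F)(x_1,\dots,x_{r+2})=\frac1{(r+2)!}\sum_{\pi\in\mathcal{S}_{r+2}}F(x_{\pi(1)},\dots,x_{\pi(r+2)})$, where $\mathcal{S}_{r+2}$ is the symmetric group. For an integer $r\ge1$ let $\mathcal{C}_r(V)=\{A\in L^2_{\rm sym}(V):\mathcal{R}_{\mathcal{S}_{r+2}}(A\otimes\mathbf{1}^{\otimes r})\ge0\text{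 a.e.}\}$, where $(A\otimes\mathbf 1^{\otimes r})(x_1,\dots,x_{r+2})=A(x_1,x_2)$, and let $\mathcal{C}_r^*(V)=\{A\in L^2_{\rm sym}(V):\langle A,Z\rangle\ge0\text{ for all }Z\in\mathcal{C}_r(V)\}$. For a graph $G=(V,E)$, $\gamma_r(G)$ is the supremum of $\langle A,J\rangle=\int_V\int_V A(x,y)\,d\omega(y)\,d\omega(x)$ (with $J$ the constant-one kernel) over all continuous positive-semidefinite kernels $A\in\mathcal{C}_r^*(V)$ such that $\int_V A(x,x)\,d\omega(x)=1$ and $A(x,y)=0$ whenever $xy\in E$. *)

theory Defs
  imports "HOL-Probability.Probability"
begin

text \<open>
  A graph is given by a measure \<open>M\<close>, whose space is the vertex set, and a set \<open>E\<close> of edges, an edge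
  being a set \<open>{x, y}\<close> of vertices. Kernels are functions on pairs; they and all other elements of
  \<open>L\<^sup>2\<close> are represented by functions instead of classes modulo null sets.
\<close>

definition indep_set :: "'a set set \<Rightarrow> 'a set \<Rightarrow> bool" where
  "indep_set E I \<longleftrightarrow> \<not> (\<exists>e\<in>E. e \<subseteq> I)"

definition indep_number :: "'a measure \<Rightarrow> 'a set set \<Rightarrow> ereal" where
  "indep_number M E = (SUP I \<in> {I \<in> sets M. indep_set E I}. enn2ereal (emeasure M I))"

definition L2 :: "'a measure \<Rightarrow> ('a \<Rightarrow> real) set" where
  "L2 M = {f \<in> borel_measurable M. integrable M (\<lambda>x. (f x)\<^sup>2)}"

definition L2_sym :: "'a measure \<Rightarrow> ('a \<times> 'a \<Rightarrow> real) set" where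
  "L2_sym M = {A \<in> L2 (M \<Otimes>\<^sub>M M). AE (x, y) in M \<Otimes>\<^sub>M M. A (x, y) = A (y, x)}"

definition kernel_inner :: "'a measure \<Rightarrow> ('a \<times> 'a \<Rightarrow> real) \<Rightarrow> ('a \<times> 'a \<Rightarrow> real) \<Rightarrow> real" where
  "kernel_inner M A B = (\<integral>p. A p * B p \<partial>(M \<Otimes>\<^sub>M M))"

definition psd_kernel :: "'a measure \<Rightarrow> ('a \<times> 'a \<Rightarrow> real) \<Rightarrow> bool" where
  "psd_kernel M A \<longleftrightarrow> A \<in> L2_sym M \<and>
     (\<forall>f \<in> L2 M. 0 \<le> (\<integral>x. (\<integral>y. A (x, y) * f x * f y \<partial>M) \<partial>M))"

text \<open>
  A point of \<open>V\<^sup>k\<close> is a function \<open>x\<close> on the indices \<open>0, \<dots>, k - 1\<close> (the carrier of \<open>PiM {..<k}\<close>).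
\<close>

definition symmetrize :: "nat \<Rightarrow> ((nat \<Rightarrow> 'a) \<Rightarrow> real) \<Rightarrow> (nat \<Rightarrow> 'a) \<Rightarrow> real" where
  "symmetrize k F x = (\<Sum>p | p permutes {..<k}. F (\<lambda>i. x (p i))) / fact k"

definition tensor_ones :: "('a \<times> 'a \<Rightarrow> real) \<Rightarrow> (nat \<Rightarrow> 'a) \<Rightarrow> real" where
  "tensor_ones A x = A (x 0, x 1)"

definition C_cone :: "nat \<Rightarrow> 'a measure \<Rightarrow> ('a \<times> 'a \<Rightarrow> real) set" where
  "C_cone r M = {A \<in> L2_sym M.
     AE x in PiM {..<r + 2} (\<lambda>_. M). 0 \<le> symmetrize (r + 2) (tensor_ones A) x}"

definition C_cone_dual :: "nat \<Rightarrow> 'a measure \<Rightarrow> ('a \<times> 'a \<Rightarrow> real) set" where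
  "C_cone_dual r M = {A \<in> L2_sym M. \<forall>Z \<in> C_cone r M. 0 \<le> kernel_inner M A Z}"

definition gamma_feasible ::
  "nat \<Rightarrow> 'a::topological_space measure \<Rightarrow> 'a set set \<Rightarrow> ('a \<times> 'a \<Rightarrow> real) set" where
  "gamma_feasible r M E = {A \<in> C_cone_dual r M.
     continuous_on (space M \<times> space M) A \<and> psd_kernel M A \<and>
     (\<integral>x. A (x, x) \<partial>M) = 1 \<and>
     (\<forall>x \<in> space M. \<forall>y \<in> space M. {x, y} \<in> E \<longrightarrow> A (x, y) = 0)}"

definition gamma_bound :: "nat \<Rightarrow> 'a::topological_space measure \<Rightarrow> 'a set set \<Rightarrow> ereal" where
  "gamma_bound r M E =
     (SUP A \<in> gamma_feasible r M E. ereal (\<integral>x. (\<integral>y. A (x, y) \<partial>M) \<partial>M))"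

text \<open>
  The surface measure of a Borel subset \<open>A\<close> of the unit sphere is the dimension times the volume of
  the cone \<open>{t x | 0 < t \<le> 1, x \<in> A}\<close>; \<open>sgn x\<close> is \<open>x / \<parallel>x\<parallel>\<close>.
\<close>

definition surface_measure :: "'a::euclidean_space measure" where
  "surface_measure = scale_measure (of_nat DIM('a))
     (distr (restrict_space lborel (cball 0 1 - {0})) (restrict_space borel (sphere 0 1)) sgn)"

lemma space_surface_measure: "space surface_measure = sphere 0 1"
  by (simp add: surface_measure_def space_scale_measure space_restrict_space)

lemma sets_surface_measure: "sets surface_measure = sets (restrict_space borel (sphere 0 1))"
  by (simp add: surface_measure_def)

lemma emeasure_surface_measure:
  fixes A :: "'a::euclidean_space set"
  assumes "A \<in> sets surface_measure"
  shows "emeasure surface_measure A =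
    of_nat DIM('a) * emeasure lborel {x \<in> cball 0 1 - {0}. x /\<^sub>R norm x \<in> A}"
proof -
  have A: "A \<in> sets (restrict_space borel (sphere 0 1))"
    using assms by (simp add: sets_surface_measure)
  have sgn: "sgn \<in> restrict_space lborel (cball 0 1 - {0}) \<rightarrow>\<^sub>M restrict_space borel (sphere (0::'a) 1)"
    by (intro measurable_restrict_space3) (auto simp: norm_sgn sgn_div_norm)
  let ?C = "{x \<in> cball 0 1 - {0}. x /\<^sub>R norm x \<in> A}"
  have "sgn -` A \<inter> (cball 0 1 - {0}) = ?C"
    by (auto simp: sgn_div_norm)
  moreover have "emeasure (restrict_space lborel (cball 0 1 - {0})) ?C = emeasure lborel ?C"
    by (rule emeasure_restrict_space) auto
  ultimately show ?thesis
    using A sgn by (simp add: surface_measure_def emeasure_distr space_restrict_space)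
qed

definition sphere_edges :: "real set \<Rightarrow> 'a::euclidean_space set set" where
  "sphere_edges D = {{x, y} | x y. x \<in> sphere 0 1 \<and> y \<in> sphere 0 1 \<and> x \<bullet> y \<in> D}"

end

(*
  Lower bound: a compact independent set C has a neighbourhood that is still independent, and the
  normalized rank-one kernel of a continuous bump equal to 1 on C is feasible for every r.

  Upper bound: let a be the independence number. If Z = (a + 2 e) K + M W - J has all its averages
  over finite point sets bounded below by a positive constant, then Z lies in C_r for large r, and
  pairing with Z bounds gamma_r. Here K is the convolution square of a narrow mollifier, so <A, K>
  is at most the trace, and W is a sum of bumps concentrated near inner products in D. In
  dimension at least three, the zonal average of a positive semidefinite kernel is equicontinuous
  on compact subsets of (-1, 1), with a modulus that depends only on the trace; hence <A, W> is
  small for feasible A even if the bumps are fixed before A. If no choice of K, M and W worked,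
  the violating point sets, mollified, would be densities with squared L2 norm at most about 1 /
  (a + 2 e) and almost no mass on pairs with inner product in D. Their weak limit g inherits both
  properties. By Lebesgue density, compact subsets of {g > 0} on which g is bounded below become
  independent after removing sets of arbitrarily small measure, so {g > 0} has measure at most a.
  Cauchy-Schwarz then gives 1 <= a / (a + 2 e), a contradiction.
*)

theory Submission
  imports Defs "HOL-Complex_Analysis.Great_Picard"
begin

section \<open>Surface measure\<close>

text \<open>The kernel \<open>(a + 2 e) K + M W - J\<close> is the continuous form of the
  Motzkin-Straus certificate \<open>a (I + Adj) - J\<close> for finite graphs: \<open>K\<close>
  replaces the identity, which is not an L2 kernel, and \<open>W\<close> the adjacency matrix. The
  obstacle is that \<open>D\<close> may be a single number. The edges then form a null set of pairs,
  which integrals against L2 kernels do not see, so bumps of positive width must stand in for them.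
  Bumps also cover non-edges, where a feasible \<open>A\<close> may be nonzero, and \<open>A\<close>
  is known only after \<open>r\<close>, hence after the bumps; the a priori modulus of continuity
  controls \<open>A\<close> there. It comes from averages over circles of latitude, which need
  dimension three; near inner products 1 and -1 these circles shrink to points, and there it is used
  that \<open>D\<close> avoids both ends. The lower bound on the averages of \<open>Z\<close> must
  be strictly positive because they include repeated points while the cone does not: among
  \<open>r + 2\<close> points, the \<open>r + 2\<close> diagonal pairs are negligible against
  \<open>(r + 2)^2\<close>. Of the three \<open>e\<close> in the final bound, two make the
  contradiction strict and one pays for \<open>M\<close> times the pairing with
  \<open>W\<close>.\<close>

lemma linear_image_scales_measure:
  fixes f :: "real^'n \<Rightarrow> real^'n"
  assumes "linear f"
  shows "\<exists>m\<ge>0. \<forall>S\<in>lmeasurable. f ` S \<in> lmeasurable \<and> measure lebesgue (f ` S) = m * measure lebesgue S"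
    (is "?P f")
proof (rule induct_linear_elementary[OF assms])
  fix f g :: "real^'n \<Rightarrow> real^'n"
  assume "?P f" "?P g"
  then obtain m k where "0 \<le> m" "0 \<le> k"
    and f: "\<And>S. S \<in> lmeasurable \<Longrightarrow> f ` S \<in> lmeasurable \<and> measure lebesgue (f ` S) = m * measure lebesgue S"
    and g: "\<And>S. S \<in> lmeasurable \<Longrightarrow> g ` S \<in> lmeasurable \<and> measure lebesgue (g ` S) = k * measure lebesgue S"
    by blast
  have "(f \<circ> g) ` S \<in> lmeasurable \<and> measure lebesgue ((f \<circ> g) ` S) = m * k * measure lebesgue S"
    if "S \<in> lmeasurable" for S
    unfolding image_comp[symmetric] using f[of "g ` S"] g[OF that] by simp
  then show "?P (f \<circ> g)"
    using \<open>0 \<le> m\<close> \<open>0 \<le> k\<close> by (intro exI[of _ "m * k"]) simp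
next
  fix f :: "real^'n \<Rightarrow> real^'n" and i
  assume f: "linear f" and 0: "\<And>x. f x $ i = 0"
  then have "\<not> inj f"
    by (metis (full_types) linear_injective_imp_surjective one_neq_zero surjE vec_component)
  then have "negligible (f ` S)" for S
    by (rule negligible_linear_singular_image[OF f])
  then show "?P f"
    by (intro exI[of _ 0]) (auto simp: negligible_imp_measure0 negligible_imp_measurable)
next
  fix c :: "'n \<Rightarrow> real"
  show "?P (\<lambda>x. \<chi> i. c i * x $ i)"
    by (intro exI[of _ "\<bar>prod c UNIV\<bar>"]) (simp add: measurable_stretch measure_stretch)
next
  fix m n :: 'n assume "m \<noteq> n"
  let ?h = "\<lambda>v::real^'n. \<chi> i. v $ Transposition.transpose m n i"
  have lin: "linear ?h"
    by (rule linearI) (simp_all add: plus_vec_def scaleR_vec_def)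
  have "measure lebesgue (?h ` cbox a b) = 1 * measure lebesgue (cbox a b)" for a b
  proof (cases "cbox a b = {}")
    case False
    have eq: "?h ` (cbox a b) = cbox (?h a) (?h b)"
      by (auto simp: image_iff lambda_swap_Galois mem_box_cart) (metis transpose_involutory)+
    then show ?thesis
      using False prod.permute[OF permutes_swap_id, where S=UNIV and g="\<lambda>i. (b - a)$i", symmetric]
      by (simp add: content_cbox_cart) (metis (no_types, lifting) content_cbox_cart image_is_empty vec_lambda_beta prod.cong)
  qed simp
  then have "?h ` S \<in> lmeasurable \<and> 1 * measure lebesgue S = measure lebesgue (?h ` S)"
    if "S \<in> lmeasurable" for S
    using measure_linear_sufficient[OF lin that, of 1] by blast
  then show "?P ?h"
    by (intro exI[of _ 1] conjI ballI) (simp_all only: zero_le_one)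
next
  fix m n :: 'n assume mn: "m \<noteq> n"
  let ?h = "\<lambda>v::real^'n. \<chi> i. if i = m then v $ m + v $ n else v $ i"
  have lin: "linear ?h"
    by (rule linearI) (auto simp: algebra_simps plus_vec_def scaleR_vec_def vec_eq_iff)
  have "measure lebesgue (?h ` cbox a b) = 1 * measure lebesgue (cbox a b)" for a b
  proof (cases "cbox a b = {}")
    case False
    \<comment> \<open>\<open>measure_shear_interval\<close> wants the \<open>n\<close>-th
      coordinates of the box to be nonnegative. Translating by \<open>v\<close> moves their lower
      bound to 0, and a linear map turns translations into translations.\<close>
    define v :: "real^'n" where "v = axis n (- a $ n)"
    have "?h ` cbox (a + v) (b + v) = (+) (?h v) ` ?h ` cbox a b"
      using linear_add[OF lin] by (simp only: image_comp o_def cbox_translation add.commute[of _ v])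
    then have "measure lebesgue (?h ` cbox a b) = measure lebesgue (?h ` cbox (a + v) (b + v))"
      by (simp add: measure_translation)
    also have "\<dots> = measure lebesgue (cbox (a + v) (b + v))"
      using False mn
      by (intro measure_shear_interval) (auto simp: interval_ne_empty_cart v_def axis_def)
    also have "\<dots> = measure lebesgue (cbox a b)"
      by (simp add: cbox_translation[of v] add.commute[of _ v] measure_translation)
    finally show ?thesis by simp
  qed simp
  then have "?h ` S \<in> lmeasurable \<and> 1 * measure lebesgue S = measure lebesgue (?h ` S)"
    if "S \<in> lmeasurable" for S
    using measure_linear_sufficient[OF lin that, of 1] by blast
  then show "?P ?h"
    by (intro exI[of _ 1] conjI ballI) (simp_all only: zero_le_one)
qed

text \<open>The scaling factor of a linear map can be read off from the unit ball, which an
  orthogonal map preserves; no determinant has to be evaluated.\<close>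

lemma orthogonal_image_measure:
  fixes f :: "real^'n \<Rightarrow> real^'n"
  assumes "orthogonal_transformation f" "S \<in> lmeasurable"
  shows "measure lebesgue (f ` S) = measure lebesgue S"
proof -
  obtain m where m: "\<And>S. S \<in> lmeasurable \<Longrightarrow> measure lebesgue (f ` S) = m * measure lebesgue S"
    using linear_image_scales_measure[OF orthogonal_transformation_linear[OF assms(1)]] by blast
  have "f ` ball 0 1 = ball 0 1"
    using image_orthogonal_transformation_ball[OF assms(1), of 0 1] assms(1)
    by (simp add: orthogonal_transformation_linear linear_0)
  then have "m = 1"
    using m[of "ball 0 1"] content_ball_pos[of 1 "0::real^'n"] by simp
  then show ?thesis using m assms(2) by simp
qed
text \<open>Two points in a cube of side \<open>s\<close> differ by at most
  \<open>DIM('a) * s\<close> in norm, so the part of \<open>S\<close> in that cube is mapped into a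
  cube of side \<open>2 * L * DIM('a) * s\<close>. Covering \<open>S\<close> by such cubes inside a
  slightly larger open set gives the bound. The constant is crude; later only its dependence on
  \<open>L\<close> and the dimension alone matters. The set \<open>T\<close> stands for the image,
  so that measurability of images is no issue.\<close>

lemma measure_Lipschitz_image_le:
  fixes f :: "'a::euclidean_space \<Rightarrow> 'a"
  assumes S: "S \<in> lmeasurable" "bounded S" and "0 \<le> L"
    and lip: "\<And>x y. x \<in> S \<Longrightarrow> y \<in> S \<Longrightarrow> norm (f x - f y) \<le> L * norm (x - y)"
    and T: "T \<in> lmeasurable" "T \<subseteq> f ` S"
  shows "measure lebesgue T \<le> (2 * L * DIM('a)) ^ DIM('a) * measure lebesgue S"
proof (rule field_le_epsilon)
  let ?d = "DIM('a)" and ?C = "(2 * L * DIM('a)) ^ DIM('a)"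
  fix e :: real assume "0 < e"
  have C: "0 \<le> ?C" using \<open>0 \<le> L\<close> by simp
  define e' where "e' = e / (?C + 1)"
  have e': "0 < e'" "?C * e' \<le> e"
    using \<open>0 < e\<close> C by (auto simp: e'_def field_simps mult_left_mono)
  obtain U where U: "open U" "S \<subseteq> U" "U \<in> lmeasurable" "measure lebesgue U < measure lebesgue S + e'"
  proof -
    obtain U where U: "open U" "S \<subseteq> U" "U - S \<in> lmeasurable" "emeasure lebesgue (U - S) < ennreal e'"
      using sets_lebesgue_outer_open[OF fmeasurableD[OF S(1)] e'(1)] by metis
    have "measure lebesgue (U - S) < e'"
      using U(3,4) e'(1) by (simp add: emeasure_eq_measure2 ennreal_less_iff)
    moreover have "U = S \<union> (U - S)" using U by blast
    then have "U \<in> lmeasurable" "measure lebesgue U \<le> measure lebesgue S + measure lebesgue (U - S)"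
      using S(1) U(3) by (metis fmeasurable.Un, metis measure_Un_le fmeasurableD)
    ultimately show ?thesis using U(1,2) that by auto
  qed
  \<comment> \<open>A cube, not just a box: its dyadic subdivisions have equal sides, so their
    volume is the power of the side that is compared with the image cube.\<close>
  obtain c where c: "0 < c" "S \<subseteq> cbox (- (c *\<^sub>R One)) (c *\<^sub>R One)"
  proof -
    obtain a where a: "S \<subseteq> cbox (-a) a" using bounded_subset_cbox_symmetric[OF S(2)] .
    have "cbox (-a) a \<subseteq> cbox (- ((norm a + 1) *\<^sub>R One)) ((norm a + 1) *\<^sub>R One)"
    proof
      fix x assume x: "x \<in> cbox (-a) a"
      have "\<bar>a \<bullet> i\<bar> \<le> norm a" if "i \<in> Basis" for i by (rule Basis_le_norm[OF that])
      with x show "x \<in> cbox (- ((norm a + 1) *\<^sub>R One)) ((norm a + 1) *\<^sub>R One)"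
        by (fastforce simp: mem_box)
    qed
    with a show ?thesis by (intro that[of "norm a + 1"]) (auto intro: add_nonneg_pos)
  qed
  have "\<forall>x\<in>S. \<exists>r>0. ball x r \<subseteq> U" using U open_contains_ball by (metis subsetD)
  then obtain r where r: "\<And>x. x \<in> S \<Longrightarrow> 0 < r x" "\<And>x. x \<in> S \<Longrightarrow> ball x (r x) \<subseteq> U" by metis
  \<comment> \<open>A gauge is defined everywhere; its radius off \<open>S\<close> is arbitrary,
    because \<open>covering_lemma\<close> chooses the tags in \<open>S\<close>.\<close>
  define g where "g x = ball x (if x \<in> S then r x else 1)" for x
  have "gauge g" unfolding g_def by (rule gauge_ball_dependent) (use r in auto)
  moreover have "box (- (c *\<^sub>R One)) (c *\<^sub>R One) \<noteq> ({}::'a set)" using c by (simp add: box_ne_empty)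
  ultimately obtain \<D> where D: "countable \<D>" 
      "\<And>K. K \<in> \<D> \<Longrightarrow> interior K \<noteq> {} \<and> (\<exists>c d. K = cbox c d)"
      "pairwise (\<lambda>A B. interior A \<inter> interior B = {}) \<D>"
      "\<And>K. K \<in> \<D> \<Longrightarrow> \<exists>x \<in> S \<inter> K. K \<subseteq> g x"
      "\<And>u v. cbox u v \<in> \<D> \<Longrightarrow> \<exists>n. \<forall>i \<in> Basis. v \<bullet> i - u \<bullet> i = (c *\<^sub>R One \<bullet> i - (- (c *\<^sub>R One)) \<bullet> i) / 2^n"
      "S \<subseteq> \<Union>\<D>"
    using covering_lemma[OF c(2), of g] by metis
  have "\<exists>Q. Q \<in> lmeasurable \<and> f ` (S \<inter> K) \<subseteq> Q \<and> measure lebesgue Q \<le> ?C * measure lebesgue K"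
    if K: "K \<in> \<D>" for K
  proof -
    obtain u v where uv: "K = cbox u v" using D(2)[OF K] by blast
    obtain n where n: "\<And>i. i \<in> Basis \<Longrightarrow> v \<bullet> i - u \<bullet> i = (c *\<^sub>R One \<bullet> i - (- (c *\<^sub>R One)) \<bullet> i) / 2^n"
      using D(5) K uv by blast
    define s where "s = 2 * c / 2^n"
    have s: "v \<bullet> i - u \<bullet> i = s" if "i \<in> Basis" for i using n[OF that] that by (simp add: s_def)
    have s0: "0 < s" using c by (simp add: s_def)
    obtain x where x: "x \<in> S" "x \<in> K" using D(4)[OF K] by blast
    let ?R = "L * (?d * s)"
    have R0: "0 \<le> ?R" using \<open>0 \<le> L\<close> s0 by simp
    let ?Q = "cbox (f x - ?R *\<^sub>R One) (f x + ?R *\<^sub>R One)"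
    have "f y \<in> ?Q" if y: "y \<in> S" "y \<in> K" for y
    proof -
      have "\<bar>(y - x) \<bullet> i\<bar> \<le> s" if "i \<in> Basis" for i
        using x(2) y(2) s[OF that] that unfolding uv mem_box by (auto simp: inner_diff_left) (smt (verit))+
      then have "norm (y - x) \<le> ?d * s"
        using norm_le_l1[of "y - x"] sum_bounded_above[of Basis "\<lambda>i. \<bar>(y - x) \<bullet> i\<bar>" s] by force
      then have "norm (f y - f x) \<le> ?R"
        using lip[OF y(1) x(1)] mult_left_mono[OF _ \<open>0 \<le> L\<close>] order_trans by blast
      then have "\<bar>(f y - f x) \<bullet> i\<bar> \<le> ?R" if "i \<in> Basis" for i using Basis_le_norm[OF that, of "f y - f x"] by linarith
      then show ?thesis by (fastforce simp: mem_box inner_diff_left inner_add_left)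
    qed
    moreover have "measure lebesgue ?Q = (2 * ?R) ^ ?d"
      using R0 by (simp add: content_cbox_if box_eq_empty inner_diff_left inner_add_left mult_ac)
    moreover have "measure lebesgue K = s ^ ?d"
      using s s0 unfolding uv by (force simp: content_cbox_if box_eq_empty)
    ultimately show ?thesis
      by (intro exI[of _ ?Q]) (auto simp: power_mult_distrib algebra_simps)
  qed
  then obtain Q where Q: "\<And>K. K \<in> \<D> \<Longrightarrow> Q K \<in> lmeasurable" "\<And>K. K \<in> \<D> \<Longrightarrow> f ` (S \<inter> K) \<subseteq> Q K"
     "\<And>K. K \<in> \<D> \<Longrightarrow> measure lebesgue (Q K) \<le> ?C * measure lebesgue K" by metis
  have sub: "\<Union>\<D> \<subseteq> U"
  proof
    fix z assume "z \<in> \<Union>\<D>" then obtain K where "K \<in> \<D>" "z \<in> K" by blast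
    then show "z \<in> U" using D(4)[of K] r(2) by (force simp: g_def)
  qed
  \<comment> \<open>The cubes have disjoint interiors, so they overlap in negligible sets and their
    volumes add up to at most the volume of \<open>U\<close>.\<close>
  have fin: "measure lebesgue (\<Union>K\<in>\<F>. Q K) \<le> ?C * measure lebesgue U" if "finite \<F>" "\<F> \<subseteq> \<D>" for \<F>
  proof -
    have FD: "K \<in> \<D>" if "K \<in> \<F>" for K using that \<open>\<F> \<subseteq> \<D>\<close> by blast
    have "measure lebesgue (\<Union>K\<in>\<F>. Q K) \<le> (\<Sum>K\<in>\<F>. measure lebesgue (Q K))"
      using that Q(1) by (intro measure_UNION_le) (auto dest!: FD)
    also have "\<dots> \<le> (\<Sum>K\<in>\<F>. ?C * measure lebesgue K)" using FD Q(3) by (intro sum_mono) auto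
    also have "(\<Sum>K\<in>\<F>. measure lebesgue K) = measure lebesgue (\<Union>\<F>)"
    proof (rule measure_negligible_finite_Union[symmetric, OF \<open>finite \<F>\<close>])
      show "K \<in> lmeasurable" if "K \<in> \<F>" for K using D(2)[OF FD[OF that]] by auto
      show "pairwise (\<lambda>S T. negligible (S \<inter> T)) \<F>"
      proof (rule pairwiseI)
        fix A B assume AB: "A \<in> \<F>" "B \<in> \<F>" "A \<noteq> B"
        then have "interior A \<inter> interior B = {}" using pairwiseD[OF D(3)] FD by blast
        moreover obtain a b c d where "A = cbox a b" "B = cbox c d" using D(2) AB FD by meson
        ultimately show "negligible (A \<inter> B)"
          by (simp add: Int_interval box_Int_box negligible_interval(1))
      qed
    qed
    then have "(\<Sum>K\<in>\<F>. ?C * measure lebesgue K) = ?C * measure lebesgue (\<Union>\<F>)"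
      by (simp only: sum_distrib_left[symmetric])
    also have "\<dots> \<le> ?C * measure lebesgue U"
    proof (intro mult_left_mono measure_mono_fmeasurable)
      have "K \<in> sets lebesgue" if KF: "K \<in> \<F>" for K
      proof -
        obtain a b where "K = cbox a b" using D(2)[OF FD[OF KF]] by blast
        then show ?thesis by simp
      qed
      then show "\<Union>\<F> \<in> sets lebesgue" using \<open>finite \<F>\<close> by (intro sets.finite_Union) auto
    qed (use U(3) sub that C in auto)
    finally show ?thesis .
  qed
  have TQ: "T \<subseteq> (\<Union>K\<in>\<D>. Q K)"
  proof
    fix z assume "z \<in> T" then obtain x where "x \<in> S" "z = f x" using T by blast
    then show "z \<in> (\<Union>K\<in>\<D>. Q K)" using D(6) Q(2) by blast
  qed
  have *: "(\<Union>K\<in>\<D>. Q K) \<in> lmeasurable \<and> measure lebesgue (\<Union>K\<in>\<D>. Q K) \<le> ?C * measure lebesgue U"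
    by (intro conjI fmeasurable_UN_bound[OF D(1) Q(1), where B="?C * measure lebesgue U"]
        measure_UN_bound[OF D(1) Q(1)] fin)
  have "measure lebesgue T \<le> measure lebesgue (\<Union>K\<in>\<D>. Q K)"
    using * TQ T by (intro measure_mono_fmeasurable) auto
  also have "\<dots> \<le> ?C * (measure lebesgue S + e')"
    using * U(4) C by (meson less_imp_le mult_left_mono order_trans)
  also have "\<dots> \<le> ?C * measure lebesgue S + e" using e' by (simp add: distrib_left)
  finally show "measure lebesgue T \<le> ?C * measure lebesgue S + e" .
qed

section \<open>Surface measure through cones: finiteness, positivity, invariance\<close>

notation surface_measure ("\<omega>")

lemma measurable_ident_surface: "(\<lambda>x. x) \<in> \<omega> \<rightarrow>\<^sub>M borel"
proof -
  have "(\<lambda>x. x) \<in> restrict_space borel (sphere 0 1) \<rightarrow>\<^sub>M borel"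
    by (rule measurable_restrict_space1) simp
  then show ?thesis
    using measurable_cong_sets[OF sets_surface_measure refl] by blast
qed

lemma borel_measurable_surface:
  "f \<in> borel \<rightarrow>\<^sub>M N \<Longrightarrow> f \<in> \<omega> \<rightarrow>\<^sub>M N"
  using measurable_compose[OF measurable_ident_surface] .

lemma space_surface [simp]: "space \<omega> = sphere 0 1"
  by (rule space_surface_measure)

lemma surface_sets_iff: "A \<in> sets \<omega> \<longleftrightarrow> A \<in> sets borel \<and> A \<subseteq> sphere (0::'a::euclidean_space) 1"
  by (auto simp: sets_surface_measure sets_restrict_space_iff)

lemma surface_setsI: "A \<in> sets borel \<Longrightarrow> A \<inter> sphere 0 1 \<in> sets \<omega>"
  by (simp add: surface_sets_iff)

text \<open>The cone over \<open>A\<close> without its apex, cut off at radius \<open>r\<close>.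
  Here \<open>A\<close> may be any set of vectors, of which only the unit vectors count; this lets
  cones be compared by linear and Lipschitz maps of the whole space.\<close>

definition sector :: "real \<Rightarrow> 'a::euclidean_space set \<Rightarrow> 'a set" where
  "sector r A = {x. x \<noteq> 0 \<and> norm x \<le> r \<and> x /\<^sub>R norm x \<in> A}"

lemma sector_borel [measurable]:
  assumes [measurable]: "A \<in> sets borel" shows "sector r A \<in> sets borel"
  unfolding sector_def by measurable

lemma sector_subset: "sector r A \<subseteq> cball 0 r"
  by (auto simp: sector_def)

lemma sector_lmeasurable [simp, intro]: "A \<in> sets borel \<Longrightarrow> sector r A \<in> lmeasurable"
  by (rule bounded_set_imp_lmeasurable)
    (auto intro: bounded_subset[OF bounded_cball sector_subset] simp: sets_completionI_sets sector_borel)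

lemma measure_surface:
  fixes A :: "'a::euclidean_space set"
  assumes "A \<in> sets borel"
  shows "measure \<omega> (A \<inter> sphere 0 1) = DIM('a) * measure lebesgue (sector 1 A)"
proof -
  have "sector 1 A = {x \<in> cball 0 1 - {0}. x /\<^sub>R norm x \<in> A \<inter> sphere 0 1}"
    by (auto simp: sector_def)
  then have "emeasure \<omega> (A \<inter> sphere 0 1) = of_nat DIM('a) * emeasure lborel (sector 1 A)"
    using emeasure_surface_measure[OF surface_setsI[OF assms]] by simp
  also have "emeasure lborel (sector 1 A) = emeasure lebesgue (sector 1 A)"
    using assms by simp
  finally show ?thesis
    unfolding measure_def by (simp add: enn2real_mult)
qed

lemma finite_measure_surface: "finite_measure (\<omega> :: 'a::euclidean_space measure)"
proof
  have "{x \<in> cball 0 1 - {0}. x /\<^sub>R norm x \<in> sphere 0 1} \<subseteq> cball (0::'a) 1" by auto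
  then have "emeasure lborel {x \<in> cball 0 1 - {0}. x /\<^sub>R norm x \<in> sphere (0::'a) 1} \<le> emeasure lborel (cball (0::'a) 1)"
    by (intro emeasure_mono) auto
  also have "\<dots> < \<infinity>" using emeasure_lborel_cball_finite by auto
  finally show "emeasure \<omega> (space (\<omega> :: 'a measure)) \<noteq> \<infinity>"
    by (subst emeasure_surface_measure)
      (auto simp: surface_sets_iff ennreal_mult_eq_top_iff)
qed

interpretation surface: finite_measure "\<omega> :: 'a::euclidean_space measure"
  by (rule finite_measure_surface)

interpretation surface2: pair_sigma_finite "\<omega> :: 'a::euclidean_space measure" "\<omega> :: 'a measure" ..

lemma finite_measure_surface_pair: "finite_measure (\<omega> \<Otimes>\<^sub>M (\<omega> :: 'a::euclidean_space measure))"
  by (intro finite_measure_pair_measure finite_measure_surface)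

interpretation surface_pair: finite_measure "\<omega> \<Otimes>\<^sub>M (\<omega> :: 'a::euclidean_space measure)"
  by (rule finite_measure_surface_pair)

lemma space_surface_pair [simp]: "space (\<omega> \<Otimes>\<^sub>M \<omega>) = sphere 0 1 \<times> sphere 0 1"
  by (simp add: space_pair_measure)

text \<open>The cone over \<open>U\<close> without its apex, cut to the open unit ball, is open and
  contains half of \<open>x\<close>; nonempty open sets have positive volume.\<close>

lemma measure_surface_pos:
  fixes U :: "'a::euclidean_space set"
  assumes "open U" "x \<in> U" "norm x = 1"
  shows "0 < measure \<omega> (U \<inter> sphere 0 1)"
proof -
  have U[measurable]: "U \<in> sets borel" using assms by auto
  let ?g = "\<lambda>x. x /\<^sub>R norm x"
  have "open ((ball 0 1 - {0}) \<inter> ?g -` U)"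
    by (intro continuous_open_preimage) (auto intro!: continuous_intros assms)
  moreover have "(1/2) *\<^sub>R x \<in> (ball 0 1 - {0}) \<inter> ?g -` U"
    using assms by auto
  ultimately have "0 < measure lebesgue ((ball 0 1 - {0}) \<inter> ?g -` U)"
    by (metis (no_types, lifting) bounded_Int bounded_ball bounded_diff emptyE inf.commute inf_commute lmeasurable_open
        measure_le_0_iff negligible_iff_measure0 not_le open_not_negligible)
  also have "\<dots> \<le> measure lebesgue (sector 1 U)"
  proof (rule measure_mono_fmeasurable)
    show "(ball 0 1 - {0}) \<inter> ?g -` U \<subseteq> sector 1 U" by (auto simp: sector_def)
    show "(ball 0 1 - {0}) \<inter> ?g -` U \<in> sets lebesgue"
      using \<open>open ((ball 0 1 - {0}) \<inter> ?g -` U)\<close> by auto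
  qed (auto simp: U)
  finally show ?thesis by (simp add: measure_surface U)
qed

lemma sector_image_orthogonal:
  fixes R :: "'a::euclidean_space \<Rightarrow> 'a"
  assumes "orthogonal_transformation R"
  shows "R ` sector r (R -` A) = sector r A"
proof -
  have lin: "linear R" and nrm: "\<And>x. norm (R x) = norm x"
    using assms by (auto simp: orthogonal_transformation)
  have sur: "surj R" using orthogonal_transformation_surj[OF assms] .
  have [simp]: "R x = 0 \<longleftrightarrow> x = 0" for x by (metis nrm norm_eq_zero)
  show ?thesis
  proof safe
    fix x assume "x \<in> sector r (R -` A)" then show "R x \<in> sector r A"
      by (auto simp: sector_def nrm linear_scale[OF lin])
  next
    fix y assume y: "y \<in> sector r A"
    obtain x where "y = R x" using sur by auto
    with y have "x \<in> sector r (R -` A)" by (auto simp: sector_def nrm linear_scale[OF lin])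
    then show "y \<in> R ` sector r (R -` A)" using \<open>y = R x\<close> by auto
  qed
qed

lemma measurable_orthogonal:
  fixes R :: "'a::euclidean_space \<Rightarrow> 'a"
  assumes "orthogonal_transformation R" shows "R \<in> borel \<rightarrow>\<^sub>M borel"
  by (intro borel_measurable_continuous_onI linear_continuous_on)
    (metis assms linear_linear orthogonal_transformation_linear)

lemma measurable_orthogonal_surface:
  fixes R :: "'a::euclidean_space \<Rightarrow> 'a"
  assumes "orthogonal_transformation R" shows "R \<in> \<omega> \<rightarrow>\<^sub>M \<omega>"
proof -
  have "R \<in> \<omega> \<rightarrow>\<^sub>M restrict_space borel (sphere 0 1)"
    using assms by (intro measurable_restrict_space2 borel_measurable_surface measurable_orthogonal)
      (auto simp: orthogonal_transformation)
  then show ?thesis using measurable_cong_sets[OF refl sets_surface_measure] by blast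
qed

text \<open>An orthogonal map carries the cone over the preimage of a set onto the cone over the
  set, and it preserves volume.\<close>

lemma distr_surface_orthogonal:
  fixes R :: "real^'n \<Rightarrow> real^'n"
  assumes "orthogonal_transformation R"
  shows "distr \<omega> \<omega> R = \<omega>"
proof (rule measure_eqI)
  fix A assume "A \<in> sets (distr \<omega> \<omega> R)"
  then have A: "A \<in> sets borel" "A \<subseteq> sphere 0 1" "A \<in> sets \<omega>" by (auto simp: surface_sets_iff)
  note Rm = measurable_orthogonal_surface[OF assms]
  have RA: "R -` A \<in> sets borel"
    using measurable_sets[OF measurable_orthogonal[OF assms] A(1)] by simp
  have "measure \<omega> (R -` A \<inter> sphere 0 1) = CARD('n) * measure lebesgue (sector 1 (R -` A))"
    using measure_surface[OF RA] by simp
  also have "measure lebesgue (sector 1 (R -` A)) = measure lebesgue (R ` sector 1 (R -` A))"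
    by (rule orthogonal_image_measure[symmetric]) (use assms RA in auto)
  also have "\<dots> = measure lebesgue (sector 1 A)" by (simp add: sector_image_orthogonal[OF assms])
  finally have "measure \<omega> (R -` A \<inter> sphere 0 1) = measure \<omega> (A \<inter> sphere 0 1)"
    using measure_surface[OF A(1)] by simp
  then show "emeasure (distr \<omega> \<omega> R) A = emeasure \<omega> A"
    using A Rm by (simp add: emeasure_distr surface.emeasure_eq_measure Int_absorb2)
qed simp

lemma integral_surface_orthogonal:
  fixes R :: "real^'n \<Rightarrow> real^'n" and f :: "real^'n \<Rightarrow> real"
  assumes "orthogonal_transformation R" "f \<in> borel_measurable \<omega>"
  shows "(\<integral>x. f (R x) \<partial>\<omega>) = (\<integral>x. f x \<partial>\<omega>)"
  using integral_distr[OF measurable_orthogonal_surface[OF assms(1)] assms(2)]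
  by (simp add: distr_surface_orthogonal[OF assms(1)])

lemma distr_surface_pair_orthogonal:
  fixes R :: "real^'n \<Rightarrow> real^'n"
  assumes "orthogonal_transformation R"
  shows "distr (\<omega> \<Otimes>\<^sub>M \<omega>) (\<omega> \<Otimes>\<^sub>M \<omega>) (\<lambda>(x, y). (R x, R y)) = \<omega> \<Otimes>\<^sub>M \<omega>"
proof -
  have "distr \<omega> \<omega> R \<Otimes>\<^sub>M distr \<omega> \<omega> R = distr (\<omega> \<Otimes>\<^sub>M \<omega>) (\<omega> \<Otimes>\<^sub>M \<omega>) (\<lambda>(x, y). (R x, R y))"
    by (rule pair_measure_distr) (use assms in \<open>auto simp: measurable_orthogonal_surface
        distr_surface_orthogonal surface.sigma_finite_measure\<close>)
  then show ?thesis using distr_surface_orthogonal[OF assms] by simp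
qed

lemma measurable_orthogonal_surface_pair:
  fixes R :: "'a::euclidean_space \<Rightarrow> 'a"
  assumes "orthogonal_transformation R"
  shows "(\<lambda>(x, y). (R x, R y)) \<in> \<omega> \<Otimes>\<^sub>M \<omega> \<rightarrow>\<^sub>M \<omega> \<Otimes>\<^sub>M \<omega>"
  using measurable_orthogonal_surface[OF assms] by measurable

lemma integral_surface_pair_orthogonal:
  fixes R :: "real^'n \<Rightarrow> real^'n" and f :: "_ \<Rightarrow> real"
  assumes "orthogonal_transformation R" "f \<in> borel_measurable (\<omega> \<Otimes>\<^sub>M \<omega>)"
  shows "(\<integral>p. f (R (fst p), R (snd p)) \<partial>(\<omega> \<Otimes>\<^sub>M \<omega>)) = (\<integral>p. f p \<partial>(\<omega> \<Otimes>\<^sub>M \<omega>))"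
  using integral_distr[OF measurable_orthogonal_surface_pair[OF assms(1)] assms(2)]
    distr_surface_pair_orthogonal[OF assms(1)]
  by (simp add: case_prod_beta')

lemma borel_measurable_continuous_on_surface:
  fixes f :: "'a::euclidean_space \<Rightarrow> 'b::real_normed_vector"
  assumes "continuous_on (sphere 0 1) f" shows "f \<in> borel_measurable \<omega>"
  using borel_measurable_continuous_on_restrict[OF assms]
    measurable_cong_sets[OF sets_surface_measure refl] by blast

lemma measurable_ident_surface_pair: "(\<lambda>x. x) \<in> \<omega> \<Otimes>\<^sub>M \<omega> \<rightarrow>\<^sub>M borel \<Otimes>\<^sub>M borel"
proof -
  have "(\<lambda>p. (fst p, snd p)) \<in> \<omega> \<Otimes>\<^sub>M \<omega> \<rightarrow>\<^sub>M borel \<Otimes>\<^sub>M borel"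
    by (intro measurable_Pair measurable_compose[OF measurable_fst] measurable_compose[OF measurable_snd])
      (rule measurable_ident_surface)+
  then show ?thesis by simp
qed

lemma borel_measurable_continuous_on_surface_pair:
  fixes f :: "'a::euclidean_space \<times> 'a \<Rightarrow> real"
  assumes "continuous_on (sphere 0 1 \<times> sphere 0 1) f" shows "f \<in> borel_measurable (\<omega> \<Otimes>\<^sub>M \<omega>)"
proof -
  let ?V = "sphere 0 1 \<times> sphere (0::'a) 1"
  have "(\<lambda>p. indicator ?V p *\<^sub>R f p) \<in> borel_measurable borel"
    by (rule borel_measurable_continuous_on_indicator) (use assms in \<open>auto intro!: borel_closed closed_Times\<close>)
  then have "(\<lambda>p. indicator ?V p *\<^sub>R f p) \<in> borel_measurable (borel \<Otimes>\<^sub>M borel)"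
    by (simp add: borel_prod)
  then have "(\<lambda>p. indicator ?V p *\<^sub>R f p) \<in> borel_measurable (\<omega> \<Otimes>\<^sub>M \<omega>)"
    by (rule measurable_compose[OF measurable_ident_surface_pair])
  then show ?thesis
    by (rule measurable_cong[THEN iffD1, rotated]) auto
qed

lemma bounded_continuous_on_sphere:
  fixes f :: "'a::euclidean_space \<Rightarrow> real"
  assumes "continuous_on (sphere 0 1) f"
  obtains B where "0 < B" "\<And>x. norm x = 1 \<Longrightarrow> \<bar>f x\<bar> \<le> B"
  using compact_imp_bounded[OF compact_continuous_image[OF assms compact_sphere]]
  unfolding bounded_pos by auto

lemma bounded_continuous_on_sphere_pair:
  fixes f :: "'a::euclidean_space \<times> 'a \<Rightarrow> real"
  assumes "continuous_on (sphere 0 1 \<times> sphere 0 1) f"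
  obtains B where "0 < B" "\<And>x y. norm x = 1 \<Longrightarrow> norm y = 1 \<Longrightarrow> \<bar>f (x, y)\<bar> \<le> B"
  using compact_imp_bounded[OF compact_continuous_image[OF assms compact_Times[OF compact_sphere compact_sphere]]]
  unfolding bounded_pos by auto

lemma integrable_surface_bounded:
  fixes f :: "'a::euclidean_space \<Rightarrow> real"
  assumes "f \<in> borel_measurable \<omega>" "\<And>x. norm x = 1 \<Longrightarrow> \<bar>f x\<bar> \<le> B"
  shows "integrable \<omega> f"
  by (rule surface.integrable_const_bound[where B=B]) (use assms in auto)

lemma integrable_surface_pair_bounded:
  fixes f :: "'a::euclidean_space \<times> 'a \<Rightarrow> real"
  assumes "f \<in> borel_measurable (\<omega> \<Otimes>\<^sub>M \<omega>)" "\<And>x y. norm x = 1 \<Longrightarrow> norm y = 1 \<Longrightarrow> \<bar>f (x, y)\<bar> \<le> B"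
  shows "integrable (\<omega> \<Otimes>\<^sub>M \<omega>) f"
  by (rule surface_pair.integrable_const_bound[where B=B]) (use assms in auto)

lemma integrable_continuous_on_surface:
  fixes f :: "'a::euclidean_space \<Rightarrow> real"
  assumes "continuous_on (sphere 0 1) f" shows "integrable \<omega> f"
  using bounded_continuous_on_sphere[OF assms] integrable_surface_bounded
    borel_measurable_continuous_on_surface[OF assms] by metis

lemma integrable_continuous_on_surface_pair:
  fixes f :: "'a::euclidean_space \<times> 'a \<Rightarrow> real"
  assumes "continuous_on (sphere 0 1 \<times> sphere 0 1) f" shows "integrable (\<omega> \<Otimes>\<^sub>M \<omega>) f"
  using bounded_continuous_on_sphere_pair[OF assms] integrable_surface_pair_bounded
    borel_measurable_continuous_on_surface_pair[OF assms] by metis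

text \<open>A positive value would persist on a product of two caps, which has positive measure.
  This is the tool that turns identities almost everywhere into identities at every pair: symmetry
  of a kernel, its invariance, positivity of normalizing constants.\<close>

lemma integral_surface_pair_eq_0_imp:
  fixes f :: "'a::euclidean_space \<times> 'a \<Rightarrow> real"
  assumes cont: "continuous_on (sphere 0 1 \<times> sphere 0 1) f"
    and nonneg: "\<And>x y. norm x = 1 \<Longrightarrow> norm y = 1 \<Longrightarrow> 0 \<le> f (x, y)"
    and zero: "(\<integral>p. f p \<partial>(\<omega> \<Otimes>\<^sub>M \<omega>)) = 0"
    and xy: "norm x = 1" "norm y = 1"
  shows "f (x, y) = 0"
proof (rule ccontr)
  assume "f (x, y) \<noteq> 0"
  then have pos: "0 < f (x, y)" using nonneg[OF xy] by simp
  let ?V = "sphere 0 1 \<times> sphere (0::'a) 1"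
  have "\<exists>d>0. \<forall>q\<in>?V. dist q (x, y) < d \<longrightarrow> dist (f q) (f (x, y)) < f (x, y)"
    using cont xy pos unfolding continuous_on_iff by auto
  then obtain d where d: "d > 0" "\<And>q. q \<in> ?V \<Longrightarrow> dist q (x, y) < d \<Longrightarrow> dist (f q) (f (x, y)) < f (x, y)"
    by blast
  have fpos: "0 < f q" if "q \<in> ?V" "dist q (x, y) < d" for q
    using d(2)[OF that] by (auto simp: dist_real_def)
  obtain U W where UW: "open U" "open W" "(x, y) \<in> U \<times> W" "U \<times> W \<subseteq> ball (x, y) d"
    using open_prod_elim[OF open_ball, of "(x, y)" "(x, y)" d] d(1) by auto
  let ?P = "(U \<inter> sphere 0 1) \<times> (W \<inter> sphere 0 1)"
  have "AE p in \<omega> \<Otimes>\<^sub>M \<omega>. f p = 0"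
  proof -
    have "AE p in \<omega> \<Otimes>\<^sub>M \<omega>. 0 \<le> f p" using nonneg by (intro AE_I2) auto
    then show ?thesis
      using integral_nonneg_eq_0_iff_AE[OF integrable_continuous_on_surface_pair[OF cont]] zero by simp
  qed
  then have "AE p in \<omega> \<Otimes>\<^sub>M \<omega>. p \<notin> ?P"
  proof (eventually_elim, safe)
    fix a b assume "f (a, b) = 0" "a \<in> U" "a \<in> sphere 0 1" "b \<in> W" "b \<in> sphere 0 1"
    then show False using fpos[of "(a, b)"] UW(4) by (auto simp: subset_eq dist_commute)
  qed
  moreover have [measurable]: "U \<inter> sphere 0 1 \<in> sets \<omega>" "W \<inter> sphere 0 1 \<in> sets \<omega>"
    using UW by (auto intro!: surface_setsI)
  ultimately have "emeasure (\<omega> \<Otimes>\<^sub>M \<omega>) ?P = 0"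
    by (subst (asm) AE_iff_measurable[where N="?P"]) (auto)
  moreover have "emeasure (\<omega> \<Otimes>\<^sub>M \<omega>) ?P = emeasure \<omega> (U \<inter> sphere 0 1) * emeasure \<omega> (W \<inter> sphere 0 1)"
    by (rule surface.emeasure_pair_measure_Times) measurable
  ultimately show False
    using measure_surface_pos[OF UW(1), of x] measure_surface_pos[OF UW(2), of y] UW(3) xy
    by (auto simp: surface.emeasure_eq_measure)
qed

section \<open>Membership in the cone\<close>

text \<open>Two coordinates are split off by Fubini, and each of the others contributes the integral
  of \<open>f\<close>. Nonnegative integrals come first, since nothing has to be known about
  integrability there.\<close>

lemma nn_integral_PiM_pair:
  assumes "sigma_finite_measure M" "finite I" and ab: "a \<in> I" "b \<in> I" "a \<noteq> b"
    and [measurable]: "F \<in> borel_measurable (M \<Otimes>\<^sub>M M)" "f \<in> borel_measurable M"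
  shows "(\<integral>\<^sup>+x. F (x a, x b) * (\<Prod>i\<in>I. f (x i)) \<partial>PiM I (\<lambda>_. M)) =
    (\<integral>\<^sup>+y. (\<integral>\<^sup>+z. F (y, z) * (f y * f z) \<partial>M) \<partial>M) * (\<integral>\<^sup>+y. f y \<partial>M) ^ (card I - 2)"
proof -
  interpret product_sigma_finite "\<lambda>_. M" by (rule product_sigma_finite.intro) (rule assms)
  interpret M: sigma_finite_measure M by fact
  define J where "J = I - {a, b}"
  have J: "finite J" "a \<notin> J" "b \<notin> J" "I = insert a (insert b J)" "card J = card I - 2"
    using assms by (auto simp: J_def card_Diff_subset)
  let ?G = "\<lambda>x. F (x a, x b) * (\<Prod>i\<in>I. f (x i))"
  have [measurable]: "?G \<in> borel_measurable (PiM I (\<lambda>_. M))"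
    using ab by measurable
  have upd: "?G ((x(b := z))(a := y)) = F (y, z) * (f y * f z) * (\<Prod>i\<in>J. f (x i))" for x y z
  proof -
    have "(\<Prod>i\<in>J. f (((x(b := z))(a := y)) i)) = (\<Prod>i\<in>J. f (x i))"
      using J by (intro prod.cong) auto
    then show ?thesis
      using J ab by (simp add: mult_ac)
  qed
  have "(\<integral>\<^sup>+x. ?G x \<partial>PiM I (\<lambda>_. M)) =
      (\<integral>\<^sup>+y. (\<integral>\<^sup>+x. ?G (x(a := y)) \<partial>PiM (insert b J) (\<lambda>_. M)) \<partial>M)"
    unfolding J(4) by (rule product_nn_integral_insert_rev) (use J ab in \<open>auto simp flip: J(4)\<close>)
  also have "\<dots> = (\<integral>\<^sup>+y. (\<integral>\<^sup>+z. (\<integral>\<^sup>+x. ?G ((x(b := z))(a := y)) \<partial>PiM J (\<lambda>_. M)) \<partial>M) \<partial>M)"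
  proof (rule nn_integral_cong)
    fix y assume "y \<in> space M"
    then have "(\<lambda>x. x(a := y)) \<in> PiM (insert b J) (\<lambda>_. M) \<rightarrow>\<^sub>M PiM I (\<lambda>_. M)"
      unfolding J(4) by (intro measurable_fun_upd[where J="insert b J"]) auto
    from measurable_compose[OF this, of ?G borel]
    show "(\<integral>\<^sup>+x. ?G (x(a := y)) \<partial>PiM (insert b J) (\<lambda>_. M)) =
        (\<integral>\<^sup>+z. (\<integral>\<^sup>+x. ?G ((x(b := z))(a := y)) \<partial>PiM J (\<lambda>_. M)) \<partial>M)"
      using J by (intro product_nn_integral_insert_rev) auto
  qed
  also have "\<dots> = (\<integral>\<^sup>+y. (\<integral>\<^sup>+z. F (y, z) * (f y * f z) * (\<integral>\<^sup>+y. f y \<partial>M) ^ (card I - 2) \<partial>M) \<partial>M)"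
    unfolding upd using J product_nn_integral_prod[of J "\<lambda>_. f"]
    by (intro nn_integral_cong, subst nn_integral_cmult) (auto simp: J(5)[symmetric])
  also have "\<dots> = (\<integral>\<^sup>+y. (\<integral>\<^sup>+z. F (y, z) * (f y * f z) \<partial>M) \<partial>M) * (\<integral>\<^sup>+y. f y \<partial>M) ^ (card I - 2)"
  proof -
    have "(\<integral>\<^sup>+z. F (y, z) * (f y * f z) * c \<partial>M) = (\<integral>\<^sup>+z. F (y, z) * (f y * f z) \<partial>M) * c" if "y \<in> space M" for y c
      using that by (intro nn_integral_multc) measurable
    then have "(\<integral>\<^sup>+y. (\<integral>\<^sup>+z. F (y, z) * (f y * f z) * c \<partial>M) \<partial>M) =
        (\<integral>\<^sup>+y. (\<integral>\<^sup>+z. F (y, z) * (f y * f z) \<partial>M) * c \<partial>M)" for c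
      by (intro nn_integral_cong) auto
    then show ?thesis by (simp add: nn_integral_multc)
  qed
  finally show ?thesis .
qed

lemma L2_imp_integrable:
  assumes "finite_measure M" "f \<in> L2 M"
  shows "integrable M f"
proof -
  interpret finite_measure M by fact
  have f: "f \<in> borel_measurable M" "integrable M (\<lambda>x. (f x)\<^sup>2)" using assms by (auto simp: L2_def)
  show ?thesis
  proof (rule Bochner_Integration.integrable_bound)
    show "integrable M (\<lambda>x. 1 + (f x)\<^sup>2)" using f by simp
    have "\<bar>f x\<bar> \<le> 1 + (f x)\<^sup>2" for x
      using sum_squares_ge_zero[of "\<bar>f x\<bar> - 1" 0] by (simp add: power2_eq_square algebra_simps abs_if split: if_splits)
    then show "AE x in M. norm (f x) \<le> norm (1 + (f x)\<^sup>2)" by simp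
  qed (use f in auto)
qed

lemma L2_bounded:
  assumes "finite_measure M" "f \<in> borel_measurable M" "\<And>x. x \<in> space M \<Longrightarrow> \<bar>f x\<bar> \<le> B"
  shows "f \<in> L2 M"
proof -
  interpret finite_measure M by fact
  have "(f x)\<^sup>2 \<le> B\<^sup>2" if "x \<in> space M" for x
    using power_mono[OF assms(3)[OF that], of 2] by simp
  then show ?thesis
    using assms by (auto simp: L2_def intro!: integrable_const_bound[where B="B\<^sup>2"])
qed

text \<open>Applied with \<open>f\<close> a test function for membership in the cone, and with
  \<open>f = 1\<close> for averages over independent points.\<close>

lemma integral_PiM_pair:
  fixes Z :: "'a \<times> 'a \<Rightarrow> real" and f :: "'a \<Rightarrow> real"
  assumes M: "finite_measure M" and I: "finite I" "a \<in> I" "b \<in> I" "a \<noteq> b"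
    and Z: "integrable (M \<Otimes>\<^sub>M M) Z"
    and f[measurable]: "f \<in> borel_measurable M" and fB: "\<And>x. 0 \<le> f x" "\<And>x. f x \<le> B"
  shows "integrable (PiM I (\<lambda>_. M)) (\<lambda>x. Z (x a, x b) * (\<Prod>i\<in>I. f (x i)))" (is ?A)
    and "(\<integral>x. Z (x a, x b) * (\<Prod>i\<in>I. f (x i)) \<partial>PiM I (\<lambda>_. M)) =
      (\<integral>p. Z p * (f (fst p) * f (snd p)) \<partial>(M \<Otimes>\<^sub>M M)) * (\<integral>y. f y \<partial>M) ^ (card I - 2)" (is ?B)
proof -
  interpret finite_measure M by fact
  interpret MM: pair_sigma_finite M M ..
  have [measurable]: "Z \<in> borel_measurable (M \<Otimes>\<^sub>M M)" using Z by simp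
  have fint: "integrable M f" using fB by (intro integrable_const_bound[where B=B]) auto
  have int: "integrable (M \<Otimes>\<^sub>M M) (\<lambda>p. Z p * (f (fst p) * f (snd p)))"
  proof (rule Bochner_Integration.integrable_bound)
    show "integrable (M \<Otimes>\<^sub>M M) (\<lambda>p. \<bar>Z p\<bar> * (B * B))" using Z by simp
    have "f x * f y \<le> B * B" for x y using fB by (intro mult_mono) (auto intro: order_trans[OF fB(1) fB(2)])
    then show "AE p in M \<Otimes>\<^sub>M M. norm (Z p * (f (fst p) * f (snd p))) \<le> norm (\<bar>Z p\<bar> * (B * B))"
      using fB by (intro AE_I2) (auto simp: abs_mult intro!: mult_left_mono)
  qed measurable
  have key: "(\<integral>\<^sup>+x. ennreal (Y (x a, x b) * (\<Prod>i\<in>I. f (x i))) \<partial>PiM I (\<lambda>_. M)) =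
     (\<integral>\<^sup>+p. ennreal (Y p * (f (fst p) * f (snd p))) \<partial>(M \<Otimes>\<^sub>M M)) * ennreal ((\<integral>y. f y \<partial>M) ^ (card I - 2))"
    if Y[measurable]: "Y \<in> borel_measurable (M \<Otimes>\<^sub>M M)" for Y
  proof -
    have "(\<integral>\<^sup>+x. ennreal (Y (x a, x b) * (\<Prod>i\<in>I. f (x i))) \<partial>PiM I (\<lambda>_. M)) =
      (\<integral>\<^sup>+x. ennreal (Y (x a, x b)) * (\<Prod>i\<in>I. ennreal (f (x i))) \<partial>PiM I (\<lambda>_. M))"
      by (intro nn_integral_cong) (simp add: ennreal_mult'' prod_nonneg fB prod_ennreal)
    also have "\<dots> = (\<integral>\<^sup>+y. (\<integral>\<^sup>+z. ennreal (Y (y, z)) * (ennreal (f y) * ennreal (f z)) \<partial>M) \<partial>M) *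
        (\<integral>\<^sup>+y. ennreal (f y) \<partial>M) ^ (card I - 2)"
      by (rule nn_integral_PiM_pair) (use I in \<open>auto simp: sigma_finite_measure_axioms\<close>)
    also have "(\<integral>\<^sup>+y. ennreal (f y) \<partial>M) = ennreal (\<integral>y. f y \<partial>M)"
      using fint fB by (intro nn_integral_eq_integral) auto
    also have "(\<integral>\<^sup>+y. (\<integral>\<^sup>+z. ennreal (Y (y, z)) * (ennreal (f y) * ennreal (f z)) \<partial>M) \<partial>M) =
       (\<integral>\<^sup>+y. (\<integral>\<^sup>+z. ennreal (Y (y, z) * (f y * f z)) \<partial>M) \<partial>M)"
      by (intro nn_integral_cong) (simp add: ennreal_mult'' ennreal_mult fB)
    also have "\<dots> = (\<integral>\<^sup>+p. ennreal (Y p * (f (fst p) * f (snd p))) \<partial>(M \<Otimes>\<^sub>M M))"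
      by (subst nn_integral_fst[symmetric]) auto
    finally show ?thesis by (simp add: ennreal_power integral_nonneg_AE fB)
  qed
  have [measurable]: "(\<lambda>x. Z (x a, x b) * (\<Prod>i\<in>I. f (x i))) \<in> borel_measurable (PiM I (\<lambda>_. M))"
    using I by measurable
  have "(\<integral>\<^sup>+x. ennreal (norm (Z (x a, x b) * (\<Prod>i\<in>I. f (x i)))) \<partial>PiM I (\<lambda>_. M)) =
      (\<integral>\<^sup>+p. ennreal (norm (Z p * (f (fst p) * f (snd p)))) \<partial>(M \<Otimes>\<^sub>M M)) * ennreal ((\<integral>y. f y \<partial>M) ^ (card I - 2))"
    using key[of "\<lambda>p. \<bar>Z p\<bar>"] fB by (simp add: abs_mult prod_nonneg)
  also have "\<dots> < \<infinity>"
    using int by (simp add: integrable_iff_bounded ennreal_mult_less_top)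
  finally show ?A by (intro integrableI_bounded) auto
  have "0 \<le> (\<integral>y. f y \<partial>M) ^ (card I - 2)" using fB by (simp add: integral_nonneg_AE)
  \<comment> \<open>\<open>ennreal\<close> truncates negative values to 0, so \<open>key\<close> for
    \<open>Z\<close> and for \<open>- Z\<close> yields the positive and the negative part of the
    integral.\<close>
  then show ?B
    using key[of Z] key[of "\<lambda>p. - Z p"]
    unfolding real_lebesgue_integral_def[OF \<open>?A\<close>] real_lebesgue_integral_def[OF int]
    by (simp add: enn2real_mult left_diff_distrib)
qed

text \<open>Integrate the symmetrized inequality against the tensor power of \<open>f\<close>. This
  power is symmetric, so every permutation contributes the same number, the quadratic form of
  \<open>Z\<close> at \<open>f\<close> times a positive factor. Hence the kernel
  \<open>f x * f y\<close> lies in the dual cone for every \<open>r\<close>.\<close>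

lemma C_cone_test:
  fixes f :: "'a \<Rightarrow> real"
  assumes M: "finite_measure M" and Z: "Z \<in> C_cone r M"
    and f[measurable]: "f \<in> borel_measurable M" and fB: "\<And>x. 0 \<le> f x" "\<And>x. f x \<le> B"
    and pos: "0 < (\<integral>y. f y \<partial>M)"
  shows "0 \<le> (\<integral>p. Z p * (f (fst p) * f (snd p)) \<partial>(M \<Otimes>\<^sub>M M))"
proof -
  interpret finite_measure M by fact
  let ?I = "{..<r + 2}" let ?P = "PiM ?I (\<lambda>_. M)"
  let ?c = "\<integral>p. Z p * (f (fst p) * f (snd p)) \<partial>(M \<Otimes>\<^sub>M M)"
  have Z': "integrable (M \<Otimes>\<^sub>M M) Z"
    using Z by (intro L2_imp_integrable finite_measure_pair_measure M) (auto simp: C_cone_def L2_sym_def)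
  have ab: "p 0 \<in> ?I" "p 1 \<in> ?I" "p 0 \<noteq> p 1" if "p permutes ?I" for p
    using permutes_in_image[OF that, of 0] permutes_in_image[OF that, of 1] permutes_inj[OF that]
    by (auto simp: inj_eq)
  have ip: "integrable ?P (\<lambda>x. Z (x (p 0), x (p 1)) * (\<Prod>i\<in>?I. f (x i)))"
    "(\<integral>x. Z (x (p 0), x (p 1)) * (\<Prod>i\<in>?I. f (x i)) \<partial>?P) = ?c * (\<integral>y. f y \<partial>M) ^ r"
    if "p permutes ?I" for p
    using integral_PiM_pair[OF M finite_lessThan ab[OF that] Z' f fB] by simp_all
  have "0 \<le> (\<integral>x. symmetrize (r + 2) (tensor_ones Z) x * (\<Prod>i\<in>?I. f (x i)) \<partial>?P)"
    using Z fB by (intro integral_nonneg_AE) (auto simp: C_cone_def prod_nonneg elim!: eventually_mono)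
  also have "\<dots> = (\<integral>x. (\<Sum>p | p permutes ?I. Z (x (p 0), x (p 1)) * (\<Prod>i\<in>?I. f (x i))) / fact (r + 2) \<partial>?P)"
    by (intro Bochner_Integration.integral_cong) (auto simp: symmetrize_def tensor_ones_def sum_distrib_right)
  also have "\<dots> = (\<Sum>p | p permutes ?I. (\<integral>x. Z (x (p 0), x (p 1)) * (\<Prod>i\<in>?I. f (x i)) \<partial>?P)) / fact (r + 2)"
    using ip(1) by (simp add: Bochner_Integration.integral_sum del: One_nat_def)
  also have "\<dots> = (\<Sum>p | p permutes ?I. ?c * (\<integral>y. f y \<partial>M) ^ r) / fact (r + 2)"
    using ip(2) by (intro arg_cong2[where f="(/)"] sum.cong) auto
  also have "\<dots> = ?c * (\<integral>y. f y \<partial>M) ^ r"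
  proof -
    have "card {p. p permutes ?I} = fact (r + 2)" by (rule card_permutations) auto
    then show ?thesis by (simp only: sum_constant) (simp del: fact_Suc)
  qed
  finally show ?thesis using zero_less_power[OF pos, of r] by (auto simp: zero_le_mult_iff)
qed

text \<open>Permutations act transitively on ordered pairs of distinct indices, so the sum over
  permutations is the same whichever pair replaces \<open>(0, 1)\<close>. Summing over all pairs and
  exchanging the sums, each permutation merely rearranges the pairs.\<close>

lemma sum_permutations_pair_nonneg:
  fixes g :: "nat \<Rightarrow> nat \<Rightarrow> real"
  assumes k: "2 \<le> k" and nonneg: "0 \<le> (\<Sum>(i, j) | i < k \<and> j < k \<and> i \<noteq> j. g i j)"
  shows "0 \<le> (\<Sum>p | p permutes {..<k}. g (p 0) (p 1))"
proof -
  let ?S = "\<Sum>p | p permutes {..<k}. g (p 0) (p 1)" and ?O = "{(i, j). i < k \<and> j < k \<and> i \<noteq> j}"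
  have finO: "finite ?O" by (rule finite_subset[of _ "{..<k} \<times> {..<k}"]) auto
  have eq: "(\<Sum>p | p permutes {..<k}. g (p i) (p j)) = ?S" if "i < k" "j < k" "i \<noteq> j" for i j
  proof -
    \<comment> \<open>The first swap sends 0 to \<open>i\<close>; the second sends the current image
      of 1 to \<open>j\<close> and leaves \<open>i\<close> alone.\<close>
    define t where "t = Transposition.transpose (Transposition.transpose 0 i 1) j \<circ> Transposition.transpose 0 i"
    have "i \<noteq> Transposition.transpose 0 i 1" by (auto simp: Transposition.transpose_def)
    then have t: "t 0 = i" "t 1 = j" using that by (auto simp: t_def Transposition.transpose_def)
    have "t permutes {..<k}"
      unfolding t_def using that k
      by (intro permutes_compose permutes_swap_id) (auto simp: Transposition.transpose_def)
    from sum_permutations_compose_right[OF this, of "\<lambda>p. g (p 0) (p 1)"] show ?thesis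
      by (simp add: t del: One_nat_def)
  qed
  have "(\<Sum>(i, j)\<in>?O. (\<Sum>p | p permutes {..<k}. g (p i) (p j))) = (\<Sum>_\<in>?O. ?S)"
    by (rule sum.cong[OF refl], clarify, rule eq)
  then have "real (card ?O) * ?S = (\<Sum>(i, j)\<in>?O. (\<Sum>p | p permutes {..<k}. g (p i) (p j)))"
    by simp
  also have "\<dots> = (\<Sum>p | p permutes {..<k}. (\<Sum>(i, j)\<in>?O. g (p i) (p j)))"
    unfolding case_prod_beta' by (rule sum.swap)
  also have "\<dots> = (\<Sum>p | p permutes {..<k}. (\<Sum>(i, j)\<in>?O. g i j))"
  proof (rule sum.cong[OF refl])
    fix p assume "p \<in> {p. p permutes {..<k}}"
    then have p: "p permutes {..<k}" by simp
    have sub: "(\<lambda>(i, j). (q i, q j)) ` ?O \<subseteq> ?O" if q: "q permutes {..<k}" for q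
    proof -
      have "q i < k \<longleftrightarrow> i < k" "q i = q j \<longleftrightarrow> i = j" for i j
        using permutes_in_image[OF q, of i] permutes_inj[OF q] by (auto dest: injD)
      then show ?thesis by auto
    qed
    have "bij_betw (\<lambda>(i, j). (p i, p j)) ?O ?O"
      by (rule bij_betw_byWitness[where f' = "\<lambda>(i, j). (inv p i, inv p j)"])
        (use permutes_inverses[OF p] sub[OF p] sub[OF permutes_inv[OF p]] in auto)
    from sum.reindex_bij_betw[OF this, of "\<lambda>(i, j). g i j"]
    show "(\<Sum>(i, j)\<in>?O. g (p i) (p j)) = (\<Sum>(i, j)\<in>?O. g i j)"
      by (simp add: case_prod_beta')
  qed
  also have "\<dots> \<ge> 0" using nonneg by (rule sum_nonneg)
  finally have "0 \<le> real (card ?O) * ?S" .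
  moreover have "(0, 1) \<in> ?O" using k by auto
  then have "0 < card ?O" using finO by (auto simp: card_gt_0_iff)
  ultimately show ?thesis by (simp add: zero_le_mult_iff)
qed

text \<open>Of the total, at least \<open>c\<close> times the number of all pairs, the diagonal
  accounts for at most \<open>B\<close> per point. With \<open>r + 2\<close> points and
  \<open>B \<le> c * (real r + 2)\<close>, the sum over pairs of distinct indices stays nonnegative,
  and that sum decides membership.\<close>

lemma C_coneI_mean_pos:
  assumes Z: "Z \<in> L2_sym M" and B: "\<And>x. x \<in> space M \<Longrightarrow> Z (x, x) \<le> B" and "0 < c"
    and pos: "\<And>x :: nat \<Rightarrow> 'a. \<And>k. (\<And>i. i < k \<Longrightarrow> x i \<in> space M) \<Longrightarrow>
        c * real k * real k \<le> (\<Sum>i<k. \<Sum>j<k. Z (x i, x j))"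
    and r: "B \<le> c * (real r + 2)"
  shows "Z \<in> C_cone r M"
proof -
  have "0 \<le> symmetrize (r + 2) (tensor_ones Z) x" if x: "x \<in> space (PiM {..<r + 2} (\<lambda>_. M))" for x
  proof -
    let ?k = "r + 2"
    have xi: "x i \<in> space M" if "i < ?k" for i using x that by (auto simp: space_PiM PiE_iff)
    let ?O = "{(i, j). i < ?k \<and> j < ?k \<and> i \<noteq> j}" and ?D = "(\<lambda>i. (i, i)) ` {..<?k}"
    have fin: "finite ?O" by (rule finite_subset[of _ "{..<?k} \<times> {..<?k}"]) auto
    have "(\<Sum>i<?k. \<Sum>j<?k. Z (x i, x j)) = (\<Sum>(i, j)\<in>{..<?k} \<times> {..<?k}. Z (x i, x j))"
      by (simp only: sum.cartesian_product)
    also have "{..<?k} \<times> {..<?k} = ?O \<union> ?D" by auto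
    also have "(\<Sum>(i, j)\<in>?O \<union> ?D. Z (x i, x j)) = (\<Sum>(i, j)\<in>?O. Z (x i, x j)) + (\<Sum>(i, j)\<in>?D. Z (x i, x j))"
      by (rule sum.union_disjoint) (use fin in auto)
    also have "(\<Sum>(i, j)\<in>?D. Z (x i, x j)) = (\<Sum>i<?k. Z (x i, x i))"
      by (subst sum.reindex) (auto simp: inj_on_def)
    also have "\<dots> \<le> (\<Sum>i<?k. B)" using xi by (intro sum_mono B) auto
    finally have "c * ?k * ?k \<le> (\<Sum>(i, j)\<in>?O. Z (x i, x j)) + ?k * B"
      using pos[of ?k x, OF xi] by simp
    moreover have "?k * B \<le> ?k * (c * (real r + 2))" using r by (intro mult_left_mono) auto
    ultimately have "0 \<le> (\<Sum>(i, j)\<in>?O. Z (x i, x j))" by (simp add: algebra_simps)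
    from sum_permutations_pair_nonneg[OF _ this] show ?thesis
      by (simp add: symmetrize_def tensor_ones_def)
  qed
  then show ?thesis using Z by (auto simp: C_cone_def)
qed

section \<open>Lower bound\<close>

lemma edge_in_sphere_edges_iff:
  "{x, y} \<in> sphere_edges D \<longleftrightarrow> norm x = 1 \<and> norm y = 1 \<and> x \<bullet> y \<in> D"
  by (auto simp: sphere_edges_def doubleton_eq_iff inner_commute)

lemma indep_sphere_edges_iff:
  assumes "I \<subseteq> sphere 0 1"
  shows "indep_set (sphere_edges D) I \<longleftrightarrow> (\<forall>x\<in>I. \<forall>y\<in>I. x \<bullet> y \<notin> D)"
proof -
  have ex: "(\<exists>e\<in>sphere_edges D. e \<subseteq> I) \<longleftrightarrow> (\<exists>x\<in>I. \<exists>y\<in>I. {x, y} \<in> sphere_edges D)"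
  proof
    assume "\<exists>e\<in>sphere_edges D. e \<subseteq> I"
    then obtain e where e: "e \<in> sphere_edges D" "e \<subseteq> I" by blast
    then obtain x y where "e = {x, y}" unfolding sphere_edges_def by blast
    then show "\<exists>x\<in>I. \<exists>y\<in>I. {x, y} \<in> sphere_edges D" using e by blast
  next
    assume "\<exists>x\<in>I. \<exists>y\<in>I. {x, y} \<in> sphere_edges D"
    then obtain x y where "x \<in> I" "y \<in> I" "{x, y} \<in> sphere_edges D" by blast
    then show "\<exists>e\<in>sphere_edges D. e \<subseteq> I" by (intro bexI[of _ "{x, y}"]) auto
  qed
  have "{x, y} \<in> sphere_edges D \<longleftrightarrow> x \<bullet> y \<in> D" if "x \<in> I" "y \<in> I" for x y
    using assms that by (auto simp: edge_in_sphere_edges_iff)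
  then show ?thesis
    unfolding indep_set_def ex by blast
qed

lemma inner_diff_le_unit:
  fixes x y a b :: "'a::real_inner"
  assumes "norm y = 1" "norm a = 1"
  shows "\<bar>x \<bullet> y - a \<bullet> b\<bar> \<le> norm (x - a) + norm (y - b)"
proof -
  have "x \<bullet> y - a \<bullet> b = (x - a) \<bullet> y + a \<bullet> (y - b)" by (simp add: inner_diff_left inner_diff_right)
  then show ?thesis
    using Cauchy_Schwarz_ineq2[of "x - a" y] Cauchy_Schwarz_ineq2[of a "y - b"] assms by auto
qed

text \<open>\<open>C_cone_test\<close> gives membership in the dual cone, whatever \<open>r\<close>
  is; the quadratic form of a rank-one kernel is a square.\<close>

lemma rank_one_feasible:
  fixes f :: "'a::euclidean_space \<Rightarrow> real"
  assumes cont: "continuous_on UNIV f" and f01: "\<And>x. 0 \<le> f x" "\<And>x. f x \<le> 1"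
    and pos: "0 < (\<integral>x. (f x)\<^sup>2 \<partial>\<omega>)"
    and indep: "\<And>x y. norm x = 1 \<Longrightarrow> norm y = 1 \<Longrightarrow> x \<bullet> y \<in> D \<Longrightarrow> f x * f y = 0"
  shows "(\<lambda>(x, y). f x * f y / (\<integral>x. (f x)\<^sup>2 \<partial>\<omega>)) \<in> gamma_feasible r \<omega> (sphere_edges D)"
proof -
  define c where "c = (\<integral>x. (f x)\<^sup>2 \<partial>\<omega>)"
  have c: "0 < c" using pos by (simp add: c_def)
  let ?A = "\<lambda>(x, y). f x * f y / c"
  have "f \<in> borel_measurable borel" using cont by (rule borel_measurable_continuous_onI)
  then have f[measurable]: "f \<in> borel_measurable \<omega>" by (rule borel_measurable_surface)
  have fint: "integrable \<omega> f" "integrable \<omega> (\<lambda>x. (f x)\<^sup>2)"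
    using f01 by (auto intro!: integrable_surface_bounded[where B=1] power_le_one)
  \<comment> \<open>Values in the unit interval give \<open>f^2 \<le> f\<close>, so the positive
    energy forces the positive integral that \<open>C_cone_test\<close> asks for.\<close>
  have "(\<integral>x. (f x)\<^sup>2 \<partial>\<omega>) \<le> (\<integral>x. f x \<partial>\<omega>)"
    using fint f01 by (intro integral_mono) (auto simp: power2_eq_square mult_left_le_one_le)
  then have If: "0 < (\<integral>x. f x \<partial>\<omega>)" using pos by simp
  have "\<bar>?A p\<bar> \<le> 1 / c" for p
    using f01 c by (auto simp: split_beta divide_right_mono mult_le_one)
  then have sym: "?A \<in> L2_sym \<omega>"
    by (auto simp: L2_sym_def mult.commute intro!: L2_bounded[where B="1/c"] finite_measure_surface_pair)
  have "0 \<le> kernel_inner \<omega> ?A Z" if Z: "Z \<in> C_cone r \<omega>" for Z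
  proof -
    have "kernel_inner \<omega> ?A Z = (\<integral>p. Z p * (f (fst p) * f (snd p)) / c \<partial>(\<omega> \<Otimes>\<^sub>M \<omega>))"
      unfolding kernel_inner_def by (intro Bochner_Integration.integral_cong) (auto simp: split_beta)
    also have "\<dots> = (\<integral>p. Z p * (f (fst p) * f (snd p)) \<partial>(\<omega> \<Otimes>\<^sub>M \<omega>)) / c" by simp
    also have "\<dots> \<ge> 0"
      using C_cone_test[OF finite_measure_surface Z f f01 If] c by simp
    finally show ?thesis .
  qed
  moreover have "continuous_on (sphere 0 1 \<times> sphere 0 1) ?A"
    unfolding split_beta using c
    by (intro continuous_intros continuous_on_compose2[OF cont]) auto
  moreover have "0 \<le> (\<integral>x. (\<integral>y. ?A (x, y) * g x * g y \<partial>\<omega>) \<partial>\<omega>)" for g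
  proof -
    have inner: "(\<integral>y. ?A (x, y) * g x * g y \<partial>\<omega>) = (\<integral>y. f y * g y \<partial>\<omega>) / c * (f x * g x)" for x
    proof -
      have "(\<integral>y. ?A (x, y) * g x * g y \<partial>\<omega>) = (\<integral>y. (f x * g x / c) * (f y * g y) \<partial>\<omega>)"
        by (intro Bochner_Integration.integral_cong) auto
      then show ?thesis by (simp add: mult.commute)
    qed
    have "(\<integral>x. (\<integral>y. ?A (x, y) * g x * g y \<partial>\<omega>) \<partial>\<omega>) = (\<integral>y. f y * g y \<partial>\<omega>) / c * (\<integral>x. f x * g x \<partial>\<omega>)"
      by (simp only: inner) simp
    then show ?thesis using c by simp
  qed
  moreover have "(\<integral>x. ?A (x, x) \<partial>\<omega>) = 1"
    using c by (simp add: c_def power2_eq_square[symmetric])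
  ultimately show ?thesis
    using sym indep
    by (auto simp: gamma_feasible_def C_cone_dual_def psd_kernel_def edge_in_sphere_edges_iff c_def[symmetric])
qed

text \<open>The inner products of points of \<open>C\<close> form a compact set, so they keep a
  positive distance \<open>d\<close> from \<open>D\<close>. This leaves room for a continuous bump
  around \<open>C\<close> whose support still contains no edge.\<close>

lemma gamma_bound_ge_compact:
  fixes C :: "'a::euclidean_space set"
  assumes D: "closed D" and C: "compact C" "C \<subseteq> sphere 0 1" "0 < measure \<omega> C"
    and indep: "\<And>x y. x \<in> C \<Longrightarrow> y \<in> C \<Longrightarrow> x \<bullet> y \<notin> D"
  shows "ereal (measure \<omega> C) \<le> gamma_bound r \<omega> (sphere_edges D :: 'a set set)"
proof -
  have ne: "C \<noteq> {}" using C(3) by auto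
  have [measurable]: "C \<in> sets \<omega>" using C by (auto simp: surface_sets_iff compact_imp_closed)
  have "compact ((\<lambda>(x, y). x \<bullet> y) ` (C \<times> C))"
    by (intro compact_continuous_image compact_Times C) (auto simp: split_beta intro!: continuous_intros)
  moreover have "(\<lambda>(x, y). x \<bullet> y) ` (C \<times> C) \<inter> D = {}" using indep by auto
  ultimately obtain d where d: "0 < d" "\<And>s t. s \<in> (\<lambda>(x, y). x \<bullet> y) ` (C \<times> C) \<Longrightarrow> t \<in> D \<Longrightarrow> d \<le> dist s t"
    using separate_compact_closed[OF _ D] by metis
  \<comment> \<open>Half of \<open>d\<close> for each of the two arguments: moving both points
    changes their inner product by at most the sum of the distances.\<close>
  define f where "f x = max 0 (1 - infdist x C / (d / 2))" for x
  have cont: "continuous_on UNIV f" unfolding f_def using d by (intro continuous_intros) auto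
  have f01: "0 \<le> f x" "f x \<le> 1" for x using d by (auto simp: f_def infdist_nonneg)
  have f1: "f x = 1" if "x \<in> C" for x using that by (simp add: f_def)
  have near: "\<exists>a\<in>C. dist x a < d / 2" if "f x \<noteq> 0" for x
  proof -
    have "infdist x C < d / 2" using that d by (auto simp: f_def max_def field_simps split: if_splits)
    then show ?thesis using infdist_attains_inf[OF compact_imp_closed[OF C(1)] ne, of x] by metis
  qed
  have "f \<in> borel_measurable borel" using cont by (rule borel_measurable_continuous_onI)
  then have f[measurable]: "f \<in> borel_measurable \<omega>" by (rule borel_measurable_surface)
  have fint: "integrable \<omega> f" "integrable \<omega> (\<lambda>x. (f x)\<^sup>2)"
    using f01 by (auto intro!: integrable_surface_bounded[where B=1] power_le_one)
  have le: "measure \<omega> C \<le> (\<integral>x. (f x)\<^sup>2 \<partial>\<omega>)"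
  proof -
    have "measure \<omega> C = (\<integral>x. indicator C x \<partial>\<omega>)" using C(2) by (simp add: Int_absorb2)
    also have "\<dots> \<le> (\<integral>x. (f x)\<^sup>2 \<partial>\<omega>)"
    proof (rule integral_mono)
      show "integrable \<omega> (indicator C :: 'a \<Rightarrow> real)"
        by (intro integrable_real_indicator) (auto simp: less_top[symmetric])
    qed (use fint f1 in \<open>auto split: split_indicator\<close>)
    finally show ?thesis .
  qed
  have le2: "(\<integral>x. (f x)\<^sup>2 \<partial>\<omega>) \<le> (\<integral>x. f x \<partial>\<omega>)"
    using fint f01 by (intro integral_mono) (auto simp: power2_eq_square mult_left_le_one_le)
  let ?A = "\<lambda>(x, y). f x * f y / (\<integral>x. (f x)\<^sup>2 \<partial>\<omega>)"
  have "?A \<in> gamma_feasible r \<omega> (sphere_edges D)"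
  proof (rule rank_one_feasible[OF cont f01])
    show "0 < (\<integral>x. (f x)\<^sup>2 \<partial>\<omega>)" using le C(3) by simp
    fix x y :: 'a assume xy: "norm x = 1" "norm y = 1" "x \<bullet> y \<in> D"
    show "f x * f y = 0"
    proof (rule ccontr)
      assume "f x * f y \<noteq> 0"
      then obtain a b where ab: "a \<in> C" "b \<in> C" "dist x a < d / 2" "dist y b < d / 2"
        using near[of x] near[of y] by (metis mult_zero_left mult_zero_right)
      have "dist (a \<bullet> b) (x \<bullet> y) < d"
        using inner_diff_le_unit[of y a x b] xy ab C(2) by (auto simp: dist_norm dist_real_def)
      then show False using d(2)[of "a \<bullet> b" "x \<bullet> y"] ab xy by force
    qed
  qed
  from SUP_upper[OF this, of "\<lambda>A. ereal (\<integral>x. (\<integral>y. A (x, y) \<partial>\<omega>) \<partial>\<omega>)"]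
  have "ereal (\<integral>x. (\<integral>y. ?A (x, y) \<partial>\<omega>) \<partial>\<omega>) \<le> gamma_bound r \<omega> (sphere_edges D :: 'a set set)"
    unfolding gamma_bound_def .
  moreover have "(\<integral>x. (\<integral>y. ?A (x, y) \<partial>\<omega>) \<partial>\<omega>) = (\<integral>x. f x \<partial>\<omega>) * (\<integral>x. f x \<partial>\<omega>) / (\<integral>x. (f x)\<^sup>2 \<partial>\<omega>)"
    by simp
  moreover have "measure \<omega> C \<le> (\<integral>x. f x \<partial>\<omega>) * (\<integral>x. f x \<partial>\<omega>) / (\<integral>x. (f x)\<^sup>2 \<partial>\<omega>)"
  proof -
    \<comment> \<open>Both factors on the right are the integral of \<open>f\<close>, which
      dominates that of \<open>f^2\<close>, which in turn dominates the measure of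
      \<open>C\<close>.\<close>
    have "measure \<omega> C * (\<integral>x. (f x)\<^sup>2 \<partial>\<omega>) \<le> (\<integral>x. f x \<partial>\<omega>) * (\<integral>x. f x \<partial>\<omega>)"
      using le le2 C(3) by (intro mult_mono) auto
    then show ?thesis using le C(3) by (simp add: field_simps)
  qed
  ultimately show ?thesis by (metis ereal_less_eq(3) order_trans)
qed

text \<open>\<open>inner_regular\<close> speaks of measures on the Borel sets of the whole space, so
  the surface measure is first pushed forward along the inclusion.\<close>

lemma measure_surface_le_compact:
  fixes I :: "'a::euclidean_space set"
  assumes I: "I \<in> sets \<omega>" and le: "\<And>K. compact K \<Longrightarrow> K \<subseteq> I \<Longrightarrow> measure \<omega> K \<le> a"
  shows "measure \<omega> I \<le> a"
proof -
  note [measurable] = measurable_ident_surface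
  define M where "M = distr \<omega> (borel :: 'a measure) (\<lambda>x. x)"
  have Mem: "emeasure M A = emeasure \<omega> A" if "A \<in> sets borel" "A \<subseteq> sphere 0 1" for A
    unfolding M_def using that by (subst emeasure_distr) (auto simp: Int_absorb2)
  have I': "I \<in> sets borel" "I \<subseteq> sphere 0 1" using I by (auto simp: surface_sets_iff)
  have a: "0 \<le> a" using le[of "{}"] by simp
  have "emeasure \<omega> I = (SUP K \<in> {K. K \<subseteq> I \<and> compact K}. emeasure M K)"
    using inner_regular[of M I] I' Mem[OF I'] Mem[of "sphere 0 1"]
    by (simp add: M_def emeasure_distr surface.emeasure_finite)
  also have "\<dots> \<le> ennreal a"
  proof (rule SUP_least, clarify)
    fix K assume K: "K \<subseteq> I" "compact K"
    have "emeasure M K = ennreal (measure \<omega> K)"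
      using Mem[of K] K I' by (auto simp: surface.emeasure_eq_measure compact_imp_closed)
    then show "emeasure M K \<le> ennreal a" using le[OF K(2,1)] by (simp add: ennreal_leI)
  qed
  finally show ?thesis using a by (simp add: surface.emeasure_eq_measure)
qed

lemma gamma_bound_ge:
  fixes D :: "real set"
  assumes D: "closed D" "1 \<notin> D"
  shows "indep_number \<omega> (sphere_edges D :: 'a::euclidean_space set set) \<le> gamma_bound r \<omega> (sphere_edges D :: 'a set set)"
proof -
  let ?\<gamma> = "gamma_bound r \<omega> (sphere_edges D :: 'a set set)"
  \<comment> \<open>A supremum over the empty set would be minus infinity, so feasibility has to be
    shown: a small cap is independent, because \<open>D\<close> stays away from 1.\<close>
  have nonneg: "0 \<le> ?\<gamma>"
  proof -
    obtain d where d: "0 < d" "ball 1 d \<inter> D = {}"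
      using D open_contains_ball[of "- D"] by (auto simp: open_Compl disjoint_eq_subset_Compl)
    obtain e :: 'a where e: "norm e = 1" using vector_choose_size[of 1] by auto
    \<comment> \<open>Two points of the cap are at distance at most \<open>2 * \<rho>\<close>, and
      \<open>\<rho> \<le> 1\<close> bounds the square by \<open>\<rho>\<close>; hence
      \<open>1 - x \<bullet> y \<le> 2 * \<rho>\<close>, which is below \<open>d\<close>.\<close>
    define \<rho> where "\<rho> = min 1 (d / 4)"
    have \<rho>: "0 < \<rho>" "\<rho> \<le> 1" "\<rho> \<le> d / 4" using d by (auto simp: \<rho>_def)
    let ?C = "cball e \<rho> \<inter> sphere 0 1"
    have "0 < measure \<omega> (ball e \<rho> \<inter> sphere 0 1)" using e \<rho> by (intro measure_surface_pos[of _ e]) auto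
    also have "\<dots> \<le> measure \<omega> ?C"
      by (intro surface.finite_measure_mono) (auto simp: surface_sets_iff)
    finally have "0 < measure \<omega> ?C" .
    moreover have "x \<bullet> y \<notin> D" if "x \<in> ?C" "y \<in> ?C" for x y
    proof -
      have "norm (x - y) \<le> 2 * \<rho>"
        using that norm_triangle_ineq4[of "x - e" "y - e"] by (auto simp: dist_norm norm_minus_commute)
      then have "(norm (x - y))\<^sup>2 \<le> (2 * \<rho>)\<^sup>2" by (intro power_mono) auto
      also have "\<dots> \<le> 4 * \<rho>" using \<rho> by (simp add: power2_eq_square)
      also have "(norm (x - y))\<^sup>2 = 2 - 2 * (x \<bullet> y)"
        using that unfolding power2_norm_eq_inner by (simp add: inner_diff_left inner_diff_right inner_commute norm_eq_1)
      finally have "1 - x \<bullet> y < d" using \<rho> d by simp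
      moreover have "x \<bullet> y \<le> 1" using that Cauchy_Schwarz_ineq2[of x y] by auto
      ultimately have "x \<bullet> y \<in> ball 1 d" by (auto simp: dist_real_def)
      then show ?thesis using d(2) by auto
    qed
    ultimately have "ereal (measure \<omega> ?C) \<le> ?\<gamma>"
      by (intro gamma_bound_ge_compact D) (auto intro: compact_Int_closed)
    then show ?thesis by (meson ereal_less_eq(5) measure_nonneg order_trans)
  qed
  have "enn2ereal (emeasure \<omega> I) \<le> ?\<gamma>" if I: "I \<in> sets \<omega>" "indep_set (sphere_edges D) I" for I :: "'a set"
  proof -
    have I': "\<forall>x\<in>I. \<forall>y\<in>I. x \<bullet> y \<notin> D" "I \<subseteq> sphere 0 1"
      using I indep_sphere_edges_iff[of I D] by (auto simp: surface_sets_iff)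
    show ?thesis
    proof (cases ?\<gamma>)
      case (real c)
      have "measure \<omega> K \<le> c" if K: "compact K" "K \<subseteq> I" for K
      proof (cases "measure \<omega> K = 0")
        case True
        then show ?thesis using nonneg real by simp
      next
        case False
        then have "ereal (measure \<omega> K) \<le> ?\<gamma>"
          using K I' by (intro gamma_bound_ge_compact D) (auto simp: zero_less_measure_iff)
        then show ?thesis using real by simp
      qed
      from measure_surface_le_compact[OF I(1) this] show ?thesis
        using real by (simp add: surface.emeasure_eq_measure enn2ereal_ennreal)
    qed (use nonneg in auto)
  qed
  then show ?thesis unfolding indep_number_def by (intro SUP_least) auto
qed

section \<open>Positive definite kernels\<close>

text \<open>Positivity on finite point sets instead of L2 functions. This form concerns values at
  points, so it passes to pointwise limits and rotations and can be tested on chosen configurations.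
  Values off the sphere are ignored.\<close>

definition pos_def_kernel :: "('a::euclidean_space \<times> 'a \<Rightarrow> real) \<Rightarrow> bool" where
  "pos_def_kernel A \<longleftrightarrow> (\<forall>x y. norm x = 1 \<longrightarrow> norm y = 1 \<longrightarrow> A (x, y) = A (y, x)) \<and>
     (\<forall>(n::nat) x c. (\<forall>i<n. norm (x i) = 1) \<longrightarrow> 0 \<le> (\<Sum>i<n. \<Sum>j<n. c i * c j * A (x i, x j)))"

lemma pos_def_kernel_sum:
  "pos_def_kernel A \<Longrightarrow> (\<And>i. i < n \<Longrightarrow> norm (x i) = 1) \<Longrightarrow> 0 \<le> (\<Sum>i<(n::nat). \<Sum>j<n. c i * c j * A (x i, x j))"
  by (auto simp: pos_def_kernel_def)

lemma pos_def_kernel_sym: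
  "pos_def_kernel A \<Longrightarrow> norm x = 1 \<Longrightarrow> norm y = 1 \<Longrightarrow> A (x, y) = A (y, x)"
  by (auto simp: pos_def_kernel_def)

lemma pos_def_kernel_diag_nonneg:
  assumes "pos_def_kernel A" "norm x = 1" shows "0 \<le> A (x, x)"
  using pos_def_kernel_sum[OF assms(1), of 1 "\<lambda>_. x" "\<lambda>_. 1"] assms(2) by simp

text \<open>Two points with coefficients 1 and 1, or 1 and -1. The arithmetic mean on the right is
  linear in \<open>A\<close>, so it can be integrated against another kernel.\<close>

lemma pos_def_kernel_abs_le:
  assumes A: "pos_def_kernel A" and xy: "norm x = 1" "norm y = 1"
  shows "\<bar>A (x, y)\<bar> \<le> (A (x, x) + A (y, y)) / 2"
proof -
  have "0 \<le> A (x, x) + A (y, y) + 2 * (s * A (x, y))" if "s * s = 1" for s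
  proof -
    have "0 \<le> (\<Sum>i<(2::nat). \<Sum>j<(2::nat). (if i = 0 then 1 else s) * (if j = 0 then 1 else s) *
        A (if i = 0 then x else y, if j = 0 then x else y))"
      by (rule pos_def_kernel_sum[OF A]) (use xy in auto)
    also have "\<dots> = A (x, x) + A (y, y) + 2 * (s * A (x, y))"
      using that pos_def_kernel_sym[OF A xy] by (simp add: numeral_2_eq_2)
    finally show ?thesis .
  qed
  from this[of 1] this[of "-1"] show ?thesis by auto
qed

lemma uniform_continuity_sphere_pair:
  fixes A :: "'a::euclidean_space \<times> 'a \<Rightarrow> real"
  assumes cont: "continuous_on (sphere 0 1 \<times> sphere 0 1) A" and e: "0 < e"
  obtains d where "0 < d" "\<And>x y x' y'. norm x = 1 \<Longrightarrow> norm y = 1 \<Longrightarrow> norm x' = 1 \<Longrightarrow> norm y' = 1 \<Longrightarrow>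
    dist x x' < d \<Longrightarrow> dist y y' < d \<Longrightarrow> \<bar>A (x, y) - A (x', y')\<bar> < e"
proof -
  have "uniformly_continuous_on (sphere 0 1 \<times> sphere 0 1) A"
    by (intro compact_uniformly_continuous cont compact_Times compact_sphere)
  then obtain d where d: "0 < d"
    "\<And>p q. p \<in> sphere 0 1 \<times> sphere 0 1 \<Longrightarrow> q \<in> sphere 0 1 \<times> sphere 0 1 \<Longrightarrow> dist q p < d \<Longrightarrow> dist (A q) (A p) < e"
    unfolding uniformly_continuous_on_def using e by metis
  show ?thesis
  proof (rule that[of "d / 2"])
    fix x y x' y' :: 'a
    assume *: "norm x = 1" "norm y = 1" "norm x' = 1" "norm y' = 1" "dist x x' < d / 2" "dist y y' < d / 2"
    have "dist (x, y) (x', y') \<le> dist x x' + dist y y'"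
      unfolding dist_Pair_Pair by (rule sqrt_sum_squares_le_sum) auto
    then show "\<bar>A (x, y) - A (x', y')\<bar> < e"
      using d(2)[of "(x', y')" "(x, y)"] * by (auto simp: dist_real_def)
  qed (use d in auto)
qed

text \<open>Point masses are replaced by normalized indicators of small caps. By uniform continuity
  this changes the quadratic form by at most \<open>e\<close> times the square of the sum of the
  absolute coefficients.\<close>

lemma psd_kernel_imp_pos_def:
  fixes A :: "'a::euclidean_space \<times> 'a \<Rightarrow> real"
  assumes cont: "continuous_on (sphere 0 1 \<times> sphere 0 1) A" and psd: "psd_kernel \<omega> A"
  shows "pos_def_kernel A"
proof -
  note [measurable] = borel_measurable_continuous_on_surface_pair[OF cont]
  obtain BA where BA0: "0 < BA" and BA: "\<And>x y. norm x = 1 \<Longrightarrow> norm y = 1 \<Longrightarrow> \<bar>A (x, y)\<bar> \<le> BA"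
    using bounded_continuous_on_sphere_pair[OF cont] by metis
  have sym: "A (x, y) = A (y, x)" if xy: "norm x = 1" "norm y = 1" for x y
  proof -
    have cont': "continuous_on (sphere 0 1 \<times> sphere 0 1) (\<lambda>p. A (snd p, fst p))"
      by (intro continuous_on_compose2[OF cont] continuous_intros) auto
    have "AE p in \<omega> \<Otimes>\<^sub>M \<omega>. A p = A (snd p, fst p)"
      using psd by (simp add: psd_kernel_def L2_sym_def split_beta')
    \<comment> \<open>Symmetry is given only almost everywhere; the vanishing integral of a
      continuous square makes it hold everywhere.\<close>
    then have "(\<integral>p. (A p - A (snd p, fst p))\<^sup>2 \<partial>(\<omega> \<Otimes>\<^sub>M \<omega>)) = 0"
      by (intro integral_eq_zero_AE) auto
    then have "(A (x, y) - A (snd (x, y), fst (x, y)))\<^sup>2 = 0"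
      by (intro integral_surface_pair_eq_0_imp[OF _ _ _ xy, of "\<lambda>p. (A p - A (snd p, fst p))\<^sup>2"])
        (intro continuous_intros cont cont', auto)
    then show ?thesis by simp
  qed
  moreover have "0 \<le> (\<Sum>i<n. \<Sum>j<n. c i * c j * A (x i, x j))" if x: "\<And>i. i < n \<Longrightarrow> norm (x i) = 1"
    for n :: nat and x c
  proof (rule field_le_epsilon)
    fix e0 :: real assume "0 < e0"
    define C where "C = (\<Sum>i<n. \<bar>c i\<bar>)"
    have C0: "0 \<le> C" unfolding C_def by (rule sum_nonneg) auto
    \<comment> \<open>The summand 1 keeps the denominator positive when all coefficients
      vanish.\<close>
    define e where "e = e0 / (C * C + 1)"
    have e: "0 < e" "e * (C * C) \<le> e0"
      using \<open>0 < e0\<close> C0 by (auto simp: e_def field_simps add_pos_nonneg mult_left_mono)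
    obtain d where d: "0 < d" "\<And>x y x' y'. norm x = 1 \<Longrightarrow> norm y = 1 \<Longrightarrow> norm x' = 1 \<Longrightarrow> norm y' = 1 \<Longrightarrow>
        dist x x' < d \<Longrightarrow> dist y y' < d \<Longrightarrow> \<bar>A (x, y) - A (x', y')\<bar> < e"
      by (rule uniform_continuity_sphere_pair[OF cont e(1)]) (rule that)
    define m where "m i = measure \<omega> (ball (x i) d \<inter> sphere 0 1)" for i
    have m: "0 < m i" if "i < n" for i
      unfolding m_def using x[OF that] d by (intro measure_surface_pos) auto
    have [measurable]: "ball a d \<inter> sphere 0 1 \<in> sets \<omega>" for a :: 'a by (intro surface_setsI) auto
    define g where "g i y = indicator (ball (x i) d \<inter> sphere 0 1) y / m i" for i y
    have [measurable]: "g i \<in> borel_measurable \<omega>" for i unfolding g_def by measurable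
    have gb: "0 \<le> g i y" "g i y \<le> 1 / m i" if "i < n" for i y
      using m[OF that] by (auto simp: g_def indicator_def)
    have gi: "(\<integral>y. g i y \<partial>\<omega>) = 1" if "i < n" for i
      using m[OF that] by (simp add: g_def m_def)
    have gint: "integrable \<omega> (g i)" if "i < n" for i
      using gb[OF that] by (intro integrable_surface_bounded[where B="1 / m i"]) auto
    have ggint: "integrable (\<omega> \<Otimes>\<^sub>M \<omega>) (\<lambda>p. g i (fst p) * g j (snd p))" if "i < n" "j < n" for i j
    proof (rule integrable_surface_pair_bounded[where B="1 / m i * (1 / m j)"])
      fix x y
      have "g i x * g j y \<le> 1 / m i * (1 / m j)"
        using gb[OF that(1)] gb[OF that(2)] m[OF that(1)] by (intro mult_mono) auto
      then show "\<bar>g i (fst (x, y)) * g j (snd (x, y))\<bar> \<le> 1 / m i * (1 / m j)"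
        using gb(1)[OF that(1)] gb(1)[OF that(2)] by (simp add: abs_mult)
    qed measurable
    have gg1: "(\<integral>p. g i (fst p) * g j (snd p) \<partial>(\<omega> \<Otimes>\<^sub>M \<omega>)) = 1" if "i < n" "j < n" for i j
      using surface2.integral_fst'[OF ggint[OF that]] gi[OF that(1)] gi[OF that(2)] by simp
    have Aggint: "integrable (\<omega> \<Otimes>\<^sub>M \<omega>) (\<lambda>p. A p * (g i (fst p) * g j (snd p)))" if ij: "i < n" "j < n" for i j
    proof (rule Bochner_Integration.integrable_bound[OF integrable_mult_right[OF ggint[OF ij], of BA]])
      show "AE p in \<omega> \<Otimes>\<^sub>M \<omega>. norm (A p * (g i (fst p) * g j (snd p))) \<le> norm (BA * (g i (fst p) * g j (snd p)))"
        using gb[OF ij(1)] gb[OF ij(2)] BA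
        by (intro AE_I2) (auto simp: abs_mult intro!: mult_right_mono order_trans[OF BA abs_ge_self])
    qed measurable
    define f where "f y = (\<Sum>i<n. c i * g i y)" for y
    have f[measurable]: "f \<in> borel_measurable \<omega>" unfolding f_def by measurable
    define Bf where "Bf = (\<Sum>i<n. \<bar>c i\<bar> * (1 / m i))"
    have fB: "\<bar>f y\<bar> \<le> Bf" for y
    proof -
      have "\<bar>c i * g i y\<bar> \<le> \<bar>c i\<bar> * (1 / m i)" if "i < n" for i
        using mult_left_mono[OF gb(2)[OF that], of "\<bar>c i\<bar>"] gb(1)[OF that] by (simp add: abs_mult)
      then show ?thesis
        unfolding f_def Bf_def by (intro order_trans[OF sum_abs] sum_mono) auto
    qed
    have "f \<in> L2 \<omega>" by (rule L2_bounded[OF finite_measure_surface f]) (rule fB)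
    then have "0 \<le> (\<integral>x. (\<integral>y. A (x, y) * f x * f y \<partial>\<omega>) \<partial>\<omega>)" using psd by (auto simp: psd_kernel_def)
    also have "\<dots> = (\<integral>p. A p * f (fst p) * f (snd p) \<partial>(\<omega> \<Otimes>\<^sub>M \<omega>))"
    proof -
      have Bf0: "0 \<le> Bf" using fB[of 0] by linarith
      then have "0 \<le> BA * Bf" using BA0 by simp
      with Bf0 have "integrable (\<omega> \<Otimes>\<^sub>M \<omega>) (\<lambda>p. A p * f (fst p) * f (snd p))"
        by (intro integrable_surface_pair_bounded[where B="BA * Bf * Bf"])
          (auto simp: abs_mult intro!: mult_mono BA fB order_trans[OF abs_ge_zero BA])
      from surface2.integral_fst'[OF this] show ?thesis by simp
    qed
    also have "\<dots> = (\<integral>p. (\<Sum>i<n. \<Sum>j<n. c i * c j * (A p * (g i (fst p) * g j (snd p)))) \<partial>(\<omega> \<Otimes>\<^sub>M \<omega>))"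
      by (intro Bochner_Integration.integral_cong refl) (simp add: f_def sum_distrib_left sum_distrib_right mult_ac)
    also have "\<dots> = (\<Sum>i<n. \<Sum>j<n. c i * c j * (\<integral>p. A p * (g i (fst p) * g j (snd p)) \<partial>(\<omega> \<Otimes>\<^sub>M \<omega>)))"
    proof (subst Bochner_Integration.integral_sum)
      show "(\<Sum>i<n. \<integral>p. (\<Sum>j<n. c i * c j * (A p * (g i (fst p) * g j (snd p)))) \<partial>(\<omega> \<Otimes>\<^sub>M (\<omega> :: 'a measure))) =
        (\<Sum>i<n. \<Sum>j<n. c i * c j * (\<integral>p. A p * (g i (fst p) * g j (snd p)) \<partial>(\<omega> \<Otimes>\<^sub>M \<omega>)))"
        by (intro sum.cong refl, subst Bochner_Integration.integral_sum)
          (auto intro!: integrable_mult_right Aggint)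
    qed (auto intro!: Bochner_Integration.integrable_sum integrable_mult_right Aggint)
    also have "\<dots> \<le> (\<Sum>i<n. \<Sum>j<n. c i * c j * A (x i, x j) + \<bar>c i\<bar> * \<bar>c j\<bar> * e)"
    proof (intro sum_mono)
      fix i j assume "i \<in> {..<n}" "j \<in> {..<n}"
      then have ij: "i < n" "j < n" by auto
      let ?a = "\<integral>p. A p * (g i (fst p) * g j (snd p)) \<partial>(\<omega> \<Otimes>\<^sub>M \<omega>)"
      have "\<bar>?a - A (x i, x j)\<bar> = \<bar>\<integral>p. (A p - A (x i, x j)) * (g i (fst p) * g j (snd p)) \<partial>(\<omega> \<Otimes>\<^sub>M \<omega>)\<bar>"
        using Aggint[OF ij] ggint[OF ij] gg1[OF ij] by (simp add: left_diff_distrib)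
      also have "\<dots> \<le> (\<integral>p. e * (g i (fst p) * g j (snd p)) \<partial>(\<omega> \<Otimes>\<^sub>M \<omega>))"
      proof (rule integral_abs_bound_integral)
        show "integrable (\<omega> \<Otimes>\<^sub>M \<omega>) (\<lambda>p. (A p - A (x i, x j)) * (g i (fst p) * g j (snd p)))"
          using Aggint[OF ij] ggint[OF ij] by (simp add: left_diff_distrib)
        fix p :: "'a \<times> 'a" assume "p \<in> space (\<omega> \<Otimes>\<^sub>M \<omega>)"
        then have p: "norm (fst p) = 1" "norm (snd p) = 1" by auto
        show "\<bar>(A p - A (x i, x j)) * (g i (fst p) * g j (snd p))\<bar> \<le> e * (g i (fst p) * g j (snd p))"
        proof (cases "g i (fst p) * g j (snd p) = 0")
          case False
          then have "dist (fst p) (x i) < d" "dist (snd p) (x j) < d"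
            by (auto simp: g_def indicator_def dist_commute split: if_splits)
          then have "\<bar>A (fst p, snd p) - A (x i, x j)\<bar> < e" using d(2) p x ij by blast
          then show ?thesis using gb[OF ij(1)] gb[OF ij(2)] by (auto simp: abs_mult intro!: mult_right_mono)
        qed (metis abs_zero mult_zero_right order_refl)
      qed (use ggint[OF ij] in auto)
      also have "\<dots> = e" using gg1[OF ij] by simp
      finally have "\<bar>c i * c j\<bar> * \<bar>?a - A (x i, x j)\<bar> \<le> \<bar>c i * c j\<bar> * e" by (intro mult_left_mono) auto
      then have "\<bar>c i * c j * ?a - c i * c j * A (x i, x j)\<bar> \<le> \<bar>c i\<bar> * \<bar>c j\<bar> * e"
        by (simp add: abs_mult[symmetric] right_diff_distrib)
      then show "c i * c j * ?a \<le> c i * c j * A (x i, x j) + \<bar>c i\<bar> * \<bar>c j\<bar> * e" by linarith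
    qed
    also have "\<dots> = (\<Sum>i<n. \<Sum>j<n. c i * c j * A (x i, x j)) + e * (C * C)"
      by (simp add: sum.distrib C_def sum_product sum_distrib_left sum_distrib_right mult_ac)
    finally show "0 \<le> (\<Sum>i<n. \<Sum>j<n. c i * c j * A (x i, x j)) + e0" using e(2) by linarith
  qed
  ultimately show ?thesis by (auto simp: pos_def_kernel_def)
qed

section \<open>Averaging over rotations\<close>

text \<open>The properties of \<open>A\<close> that survive averaging over rotations.\<close>

definition zonal_companion :: "('a::euclidean_space \<times> 'a \<Rightarrow> real) \<Rightarrow> ('a \<times> 'a \<Rightarrow> real) \<Rightarrow> bool" where
  "zonal_companion A B \<longleftrightarrow>
     pos_def_kernel B \<and>
     (\<forall>e d. (\<forall>p\<in>sphere 0 1 \<times> sphere 0 1. \<forall>q\<in>sphere 0 1 \<times> sphere 0 1. dist p q < d \<longrightarrow> \<bar>A p - A q\<bar> \<le> e) \<longrightarrow>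
            (\<forall>p\<in>sphere 0 1 \<times> sphere 0 1. \<forall>q\<in>sphere 0 1 \<times> sphere 0 1. dist p q < d \<longrightarrow> \<bar>B p - B q\<bar> \<le> e)) \<and>
     (\<forall>b. (\<forall>p\<in>sphere 0 1 \<times> sphere 0 1. \<bar>A p\<bar> \<le> b) \<longrightarrow> (\<forall>p\<in>sphere 0 1 \<times> sphere 0 1. \<bar>B p\<bar> \<le> b)) \<and>
     (\<forall>t. (\<forall>x y. norm x = 1 \<longrightarrow> norm y = 1 \<longrightarrow> x \<bullet> y = t \<longrightarrow> A (x, y) = 0) \<longrightarrow>
          (\<forall>x y. norm x = 1 \<longrightarrow> norm y = 1 \<longrightarrow> x \<bullet> y = t \<longrightarrow> B (x, y) = 0)) \<and>
     (\<integral>x. B (x, x) \<partial>\<omega>) = (\<integral>x. A (x, x) \<partial>\<omega>) \<and>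
     (\<forall>w. continuous_on UNIV w \<longrightarrow>
        (\<integral>p. w (fst p \<bullet> snd p) * B p \<partial>(\<omega> \<Otimes>\<^sub>M \<omega>)) = (\<integral>p. w (fst p \<bullet> snd p) * A p \<partial>(\<omega> \<Otimes>\<^sub>M \<omega>)))"

lemma zonal_companion_refl: "pos_def_kernel A \<Longrightarrow> zonal_companion A A"
  unfolding zonal_companion_def by blast

lemma zonal_companionD:
  assumes "zonal_companion A B"
  shows "pos_def_kernel B"
    and "(\<integral>x. B (x, x) \<partial>\<omega>) = (\<integral>x. A (x, x) \<partial>\<omega>)"
    and "continuous_on UNIV w \<Longrightarrow>
      (\<integral>p. w (fst p \<bullet> snd p) * B p \<partial>(\<omega> \<Otimes>\<^sub>M \<omega>)) = (\<integral>p. w (fst p \<bullet> snd p) * A p \<partial>(\<omega> \<Otimes>\<^sub>M \<omega>))"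
  using assms by (simp_all only: zonal_companion_def)

lemma zonal_companion_bound:
  assumes "zonal_companion A B" "\<forall>p\<in>sphere 0 1 \<times> sphere 0 1. \<bar>A p\<bar> \<le> b" "p \<in> sphere 0 1 \<times> sphere 0 1"
  shows "\<bar>B p\<bar> \<le> b"
  using assms(1)[unfolded zonal_companion_def, THEN conjunct2, THEN conjunct2, THEN conjunct1,
      THEN spec, THEN mp, OF assms(2), THEN bspec, OF assms(3)] .

lemma zonal_companion_zero:
  assumes "zonal_companion A B" "\<forall>x y. norm x = 1 \<longrightarrow> norm y = 1 \<longrightarrow> x \<bullet> y = t \<longrightarrow> A (x, y) = 0"
    "norm x = 1" "norm y = 1" "x \<bullet> y = t"
  shows "B (x, y) = 0"
  using assms(1)[unfolded zonal_companion_def, THEN conjunct2, THEN conjunct2, THEN conjunct2, THEN conjunct1,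
      THEN spec, THEN mp, OF assms(2), rule_format, OF assms(3-5)] .

lemma zonal_companion_modulus:
  assumes "zonal_companion A B"
    and "\<forall>p\<in>sphere 0 1 \<times> sphere 0 1. \<forall>q\<in>sphere 0 1 \<times> sphere 0 1. dist p q < d \<longrightarrow> \<bar>A p - A q\<bar> \<le> e"
    and "p \<in> sphere 0 1 \<times> sphere 0 1" "q \<in> sphere 0 1 \<times> sphere 0 1" "dist p q < d"
  shows "\<bar>B p - B q\<bar> \<le> e"
  using assms(1)[unfolded zonal_companion_def, THEN conjunct2, THEN conjunct1, THEN spec, THEN spec,
      THEN mp, OF assms(2), THEN bspec, OF assms(3), THEN bspec, OF assms(4), THEN mp, OF assms(5)] .

text \<open>All companions inherit the modulus of continuity of \<open>A\<close>, so one
  \<open>d\<close> serves them all. This is the equicontinuity that Arzela-Ascoli asks for.\<close>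

lemma zonal_companion_equicontinuous:
  fixes A :: "'a::euclidean_space \<times> 'a \<Rightarrow> real"
  assumes cont: "continuous_on (sphere 0 1 \<times> sphere 0 1) A" and e: "0 < e"
  obtains d where "0 < d" "\<And>B p q. zonal_companion A B \<Longrightarrow> p \<in> sphere 0 1 \<times> sphere 0 1 \<Longrightarrow>
    q \<in> sphere 0 1 \<times> sphere 0 1 \<Longrightarrow> dist p q < d \<Longrightarrow> \<bar>B p - B q\<bar> \<le> e"
proof -
  have "uniformly_continuous_on (sphere 0 1 \<times> sphere 0 1) A"
    by (intro compact_uniformly_continuous cont compact_Times compact_sphere)
  then obtain d where d: "0 < d"
    "\<And>p q. p \<in> sphere 0 1 \<times> sphere 0 1 \<Longrightarrow> q \<in> sphere 0 1 \<times> sphere 0 1 \<Longrightarrow> dist q p < d \<Longrightarrow> dist (A q) (A p) < e"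
    unfolding uniformly_continuous_on_def using e by metis
  have "\<bar>A p - A q\<bar> \<le> e" if "p \<in> sphere 0 1 \<times> sphere 0 1" "q \<in> sphere 0 1 \<times> sphere 0 1" "dist p q < d" for p q
    using d(2)[OF that(2,1)] that(3) by (simp add: dist_real_def dist_commute abs_minus_commute)
  then have "\<forall>p\<in>sphere 0 1 \<times> sphere 0 1. \<forall>q\<in>sphere 0 1 \<times> sphere 0 1. dist p q < d \<longrightarrow> \<bar>A p - A q\<bar> \<le> e"
    by simp
  from zonal_companion_modulus[OF _ this] show ?thesis by (rule that[OF d(1)])
qed

lemma zonal_companion_continuous:
  fixes A :: "'a::euclidean_space \<times> 'a \<Rightarrow> real"
  assumes "continuous_on (sphere 0 1 \<times> sphere 0 1) A" "zonal_companion A B"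
  shows "continuous_on (sphere 0 1 \<times> sphere 0 1) B"
  unfolding continuous_on_iff
proof (intro ballI allI impI)
  fix p :: "'a \<times> 'a" and e :: real assume p: "p \<in> sphere 0 1 \<times> sphere 0 1" and e: "0 < e"
  obtain d where "0 < d" "\<And>B p q. zonal_companion A B \<Longrightarrow> p \<in> sphere 0 1 \<times> sphere 0 1 \<Longrightarrow>
    q \<in> sphere 0 1 \<times> sphere 0 1 \<Longrightarrow> dist p q < d \<Longrightarrow> \<bar>B p - B q\<bar> \<le> e / 2"
    by (rule zonal_companion_equicontinuous[OF assms(1), of "e / 2"]) (use e in simp, rule that)
  then show "\<exists>d>0. \<forall>q\<in>sphere 0 1 \<times> sphere 0 1. dist q p < d \<longrightarrow> dist (B q) (B p) < e"
    using assms(2) p e by (intro exI[of _ d]) (force simp: dist_real_def)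
qed

lemma zonal_companion_orthogonal:
  fixes A B :: "(real^'n) \<times> (real^'n) \<Rightarrow> real"
  assumes cont: "continuous_on (sphere 0 1 \<times> sphere 0 1) A" and B: "zonal_companion A B"
    and R: "orthogonal_transformation R"
  shows "zonal_companion A (\<lambda>p. B (R (fst p), R (snd p)))"
proof -
  note contB = zonal_companion_continuous[OF cont B]
  have [simp]: "norm (R x) = norm x" "R x \<bullet> R y = x \<bullet> y" for x y
    using R by (simp_all add: orthogonal_transformation_norm orthogonal_transformation_def)
  have dist: "dist (R (fst p), R (snd p)) (R (fst q), R (snd q)) = dist p q" for p q
    using R by (simp add: orthogonal_transformation_isometry dist_prod_def)
  have RV: "(R (fst p), R (snd p)) \<in> sphere 0 1 \<times> sphere 0 1" if "p \<in> sphere 0 1 \<times> sphere 0 1" for p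
    using that by auto
  have contd: "continuous_on (sphere 0 1) (\<lambda>x. B (x, x))"
    by (intro continuous_on_compose2[OF contB] continuous_intros) auto
  have "pos_def_kernel (\<lambda>p. B (R (fst p), R (snd p)))"
    using zonal_companionD(1)[OF B] unfolding pos_def_kernel_def by simp
  moreover have "(\<integral>x. B (R (fst (x, x)), R (snd (x, x))) \<partial>\<omega>) = (\<integral>x. A (x, x) \<partial>\<omega>)"
    using integral_surface_orthogonal[OF R borel_measurable_continuous_on_surface[OF contd]] zonal_companionD(2)[OF B]
    by simp
  moreover have "(\<integral>p. w (fst p \<bullet> snd p) * B (R (fst p), R (snd p)) \<partial>(\<omega> \<Otimes>\<^sub>M \<omega>)) =
       (\<integral>p. w (fst p \<bullet> snd p) * A p \<partial>(\<omega> \<Otimes>\<^sub>M \<omega>))" if w: "continuous_on UNIV w" for w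
  proof -
    have "continuous_on (sphere 0 1 \<times> sphere 0 1) (\<lambda>p. w (fst p \<bullet> snd p) * B p)"
      by (intro continuous_intros contB continuous_on_compose2[OF w]) auto
    from integral_surface_pair_orthogonal[OF R borel_measurable_continuous_on_surface_pair[OF this]]
    have "(\<integral>p. w (fst p \<bullet> snd p) * B (R (fst p), R (snd p)) \<partial>(\<omega> \<Otimes>\<^sub>M \<omega>)) =
       (\<integral>p. w (fst p \<bullet> snd p) * B p \<partial>(\<omega> \<Otimes>\<^sub>M \<omega>))" by simp
    then show ?thesis using zonal_companionD(3)[OF B w] by simp
  qed
  moreover have "\<bar>B (R (fst p), R (snd p)) - B (R (fst q), R (snd q))\<bar> \<le> e"
    if "\<forall>p\<in>sphere 0 1 \<times> sphere 0 1. \<forall>q\<in>sphere 0 1 \<times> sphere 0 1. dist p q < d \<longrightarrow> \<bar>A p - A q\<bar> \<le> e"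
     "p \<in> sphere 0 1 \<times> sphere 0 1" "q \<in> sphere 0 1 \<times> sphere 0 1" "dist p q < d" for e d p q
    using zonal_companion_modulus[OF B that(1) RV[OF that(2)] RV[OF that(3)]] that(4) dist by simp
  moreover have "\<bar>B (R (fst p), R (snd p))\<bar> \<le> b"
    if "\<forall>p\<in>sphere 0 1 \<times> sphere 0 1. \<bar>A p\<bar> \<le> b" "p \<in> sphere 0 1 \<times> sphere 0 1" for b p
    by (rule zonal_companion_bound[OF B that(1) RV[OF that(2)]])
  moreover have "B (R (fst (x, y)), R (snd (x, y))) = 0"
    if "\<forall>x y. norm x = 1 \<longrightarrow> norm y = 1 \<longrightarrow> x \<bullet> y = t \<longrightarrow> A (x, y) = 0"
      "norm x = 1" "norm y = 1" "x \<bullet> y = t" for t x y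
    using zonal_companion_zero[OF B that(1)] that(2-4) by simp
  ultimately show ?thesis unfolding zonal_companion_def by blast
qed

text \<open>Convexity is required only at midpoints, where the parallelogram identity will use
  it.\<close>

lemma zonal_companion_midpoint:
  fixes A B :: "'a::euclidean_space \<times> 'a \<Rightarrow> real"
  assumes cont: "continuous_on (sphere 0 1 \<times> sphere 0 1) A" and B: "zonal_companion A B" and C: "zonal_companion A C"
  shows "zonal_companion A (\<lambda>p. (B p + C p) / 2)"
proof -
  note contB = zonal_companion_continuous[OF cont B] and contC = zonal_companion_continuous[OF cont C]
  have contd: "continuous_on (sphere 0 1) (\<lambda>x. B (x, x))" "continuous_on (sphere 0 1) (\<lambda>x. C (x, x))"
    by (intro continuous_on_compose2[OF contB] continuous_on_compose2[OF contC] continuous_intros; auto)+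
  have "pos_def_kernel (\<lambda>p. (B p + C p) / 2)"
  proof -
    have eq: "(\<Sum>i<n. \<Sum>j<n. c i * c j * ((B (x i, x j) + C (x i, x j)) / 2)) =
      ((\<Sum>i<n. \<Sum>j<n. c i * c j * B (x i, x j)) + (\<Sum>i<n. \<Sum>j<n. c i * c j * C (x i, x j))) / 2" for n :: nat and x c
      by (simp only: sum.distrib[symmetric] sum_divide_distrib distrib_left times_divide_eq_right add_divide_distrib)
    note pB = zonal_companionD(1)[OF B] and pC = zonal_companionD(1)[OF C]
    show ?thesis
      unfolding pos_def_kernel_def
    proof (intro conjI allI impI)
      show "(B (x, y) + C (x, y)) / 2 = (B (y, x) + C (y, x)) / 2" if "norm x = 1" "norm y = 1" for x y
        using pos_def_kernel_sym[OF pB that] pos_def_kernel_sym[OF pC that] by simp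
      fix n :: nat and x :: "nat \<Rightarrow> 'a" and c :: "nat \<Rightarrow> real"
      assume "\<forall>i<n. norm (x i) = 1"
      then show "0 \<le> (\<Sum>i<n. \<Sum>j<n. c i * c j * ((B (x i, x j) + C (x i, x j)) / 2))"
        unfolding eq using pos_def_kernel_sum[OF pB, of n x c] pos_def_kernel_sum[OF pC, of n x c] by simp
    qed
  qed
  moreover have "(\<integral>x. (B (x, x) + C (x, x)) / 2 \<partial>\<omega>) = (\<integral>x. A (x, x) \<partial>\<omega>)"
    using zonal_companionD(2)[OF B] zonal_companionD(2)[OF C] by (simp add: integrable_continuous_on_surface contd)
  moreover have "(\<integral>p. w (fst p \<bullet> snd p) * ((B p + C p) / 2) \<partial>(\<omega> \<Otimes>\<^sub>M \<omega>)) =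
       (\<integral>p. w (fst p \<bullet> snd p) * A p \<partial>(\<omega> \<Otimes>\<^sub>M \<omega>))" if w: "continuous_on UNIV w" for w
  proof -
    have "continuous_on (sphere 0 1 \<times> sphere 0 1) (\<lambda>p. w (fst p \<bullet> snd p) * B p)"
       "continuous_on (sphere 0 1 \<times> sphere 0 1) (\<lambda>p. w (fst p \<bullet> snd p) * C p)"
      by (intro continuous_intros contB contC continuous_on_compose2[OF w]; auto)+
    then have "(\<integral>p. w (fst p \<bullet> snd p) * ((B p + C p) / 2) \<partial>(\<omega> \<Otimes>\<^sub>M \<omega>)) =
      ((\<integral>p. w (fst p \<bullet> snd p) * B p \<partial>(\<omega> \<Otimes>\<^sub>M \<omega>)) + (\<integral>p. w (fst p \<bullet> snd p) * C p \<partial>(\<omega> \<Otimes>\<^sub>M \<omega>))) / 2"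
      by (simp add: distrib_left integrable_continuous_on_surface_pair)
    then show ?thesis using zonal_companionD(3)[OF B w] zonal_companionD(3)[OF C w] by simp
  qed
  moreover have "\<bar>(B p + C p) / 2 - (B q + C q) / 2\<bar> \<le> e"
    if "\<forall>p\<in>sphere 0 1 \<times> sphere 0 1. \<forall>q\<in>sphere 0 1 \<times> sphere 0 1. dist p q < d \<longrightarrow> \<bar>A p - A q\<bar> \<le> e"
     "p \<in> sphere 0 1 \<times> sphere 0 1" "q \<in> sphere 0 1 \<times> sphere 0 1" "dist p q < d" for e d p q
    using zonal_companion_modulus[OF B that] zonal_companion_modulus[OF C that] by (simp add: abs_le_iff field_simps)
  moreover have "\<bar>(B p + C p) / 2\<bar> \<le> b"
    if "\<forall>p\<in>sphere 0 1 \<times> sphere 0 1. \<bar>A p\<bar> \<le> b" "p \<in> sphere 0 1 \<times> sphere 0 1" for b p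
  proof -
    show ?thesis
      using zonal_companion_bound[OF B that] zonal_companion_bound[OF C that] by (simp add: abs_le_iff)
  qed
  moreover have "(B (x, y) + C (x, y)) / 2 = 0"
    if "\<forall>x y. norm x = 1 \<longrightarrow> norm y = 1 \<longrightarrow> x \<bullet> y = t \<longrightarrow> A (x, y) = 0"
      "norm x = 1" "norm y = 1" "x \<bullet> y = t" for t x y
    using zonal_companion_zero[OF B that] zonal_companion_zero[OF C that] by simp
  ultimately show ?thesis unfolding zonal_companion_def by blast
qed

text \<open>Every clause is either a closed condition on values at points or an identity of
  integrals, and the common bound \<open>bA\<close> dominates the latter.\<close>

lemma zonal_companion_limit:
  fixes A B :: "'a::euclidean_space \<times> 'a \<Rightarrow> real"
  assumes cont: "continuous_on (sphere 0 1 \<times> sphere 0 1) A" and F: "\<And>n. zonal_companion A (F n)"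
    and lim: "\<And>p. p \<in> sphere 0 1 \<times> sphere 0 1 \<Longrightarrow> (\<lambda>n. F n p) \<longlonglongrightarrow> B p"
    and contB: "continuous_on (sphere 0 1 \<times> sphere 0 1) B"
  shows "zonal_companion A B"
proof -
  obtain bA where "\<And>x y. norm x = 1 \<Longrightarrow> norm y = 1 \<Longrightarrow> \<bar>A (x, y)\<bar> \<le> bA"
    using bounded_continuous_on_sphere_pair[OF cont] by metis
  then have bF: "\<bar>F n p\<bar> \<le> bA" if "p \<in> sphere 0 1 \<times> sphere 0 1" for n p
    using zonal_companion_bound[OF F, of bA p n] that by auto
  note contF = zonal_companion_continuous[OF cont F]
  have limxy: "(\<lambda>n. F n (x, y)) \<longlonglongrightarrow> B (x, y)" if "norm x = 1" "norm y = 1" for x y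
    using lim[of "(x, y)"] that by simp
  have contd: "continuous_on (sphere 0 1) (\<lambda>x. G (x, x))" if "continuous_on (sphere 0 1 \<times> sphere 0 1) G"
    for G :: "'a \<times> 'a \<Rightarrow> real"
    by (intro continuous_on_compose2[OF that] continuous_intros) auto
  have "B (x, y) = B (y, x)" if "norm x = 1" "norm y = 1" for x y
  proof -
    have "F n (x, y) = F n (y, x)" for n
      by (rule pos_def_kernel_sym[OF zonal_companionD(1)[OF F] that])
    then show ?thesis using limxy[OF that] limxy[OF that(2,1)] LIMSEQ_unique by auto
  qed
  moreover have "0 \<le> (\<Sum>i<k. \<Sum>j<k. c i * c j * B (x i, x j))" if x: "\<And>i. i < k \<Longrightarrow> norm (x i) = 1"
    for k :: nat and x c
  proof (rule LIMSEQ_le_const)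
    show "(\<lambda>n. \<Sum>i<k. \<Sum>j<k. c i * c j * F n (x i, x j)) \<longlonglongrightarrow> (\<Sum>i<k. \<Sum>j<k. c i * c j * B (x i, x j))"
      by (intro tendsto_sum tendsto_mult tendsto_const limxy x) auto
    show "\<exists>N. \<forall>n\<ge>N. 0 \<le> (\<Sum>i<k. \<Sum>j<k. c i * c j * F n (x i, x j))"
      using pos_def_kernel_sum[OF zonal_companionD(1)[OF F], of k x c] x by blast
  qed
  ultimately have "pos_def_kernel B" by (auto simp: pos_def_kernel_def)
  moreover have "(\<integral>x. B (x, x) \<partial>\<omega>) = (\<integral>x. A (x, x) \<partial>\<omega>)"
  proof (rule LIMSEQ_unique)
    show "(\<lambda>n. \<integral>x. F n (x, x) \<partial>\<omega>) \<longlonglongrightarrow> (\<integral>x. B (x, x) \<partial>\<omega>)"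
      by (rule integral_dominated_convergence[where w="\<lambda>_. bA"])
        (auto intro!: borel_measurable_continuous_on_surface contd contF contB limxy bF)
    show "(\<lambda>n. \<integral>x. F n (x, x) \<partial>\<omega>) \<longlonglongrightarrow> (\<integral>x. A (x, x) \<partial>\<omega>)"
      by (simp add: zonal_companionD(2)[OF F])
  qed
  moreover have "(\<integral>p. w (fst p \<bullet> snd p) * B p \<partial>(\<omega> \<Otimes>\<^sub>M \<omega>)) =
       (\<integral>p. w (fst p \<bullet> snd p) * A p \<partial>(\<omega> \<Otimes>\<^sub>M \<omega>))" if w: "continuous_on UNIV w" for w
  proof (rule LIMSEQ_unique)
    have cw: "continuous_on (sphere 0 1 \<times> sphere 0 1) (\<lambda>p::'a\<times>'a. w (fst p \<bullet> snd p))"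
      by (intro continuous_intros continuous_on_compose2[OF w]) auto
    obtain bw where bw: "0 < bw" "\<And>x y :: 'a. norm x = 1 \<Longrightarrow> norm y = 1 \<Longrightarrow> \<bar>w (x \<bullet> y)\<bar> \<le> bw"
      using bounded_continuous_on_sphere_pair[OF cw] by auto
    have "\<bar>w (fst p \<bullet> snd p) * F n p\<bar> \<le> bw * bA" if "p \<in> sphere 0 1 \<times> sphere 0 1" for n p
      using bw(2)[of "fst p" "snd p"] bF[OF that, of n] bw(1) that by (auto simp: abs_mult intro!: mult_mono)
    then show "(\<lambda>n. \<integral>p. w (fst p \<bullet> snd p) * F n p \<partial>(\<omega> \<Otimes>\<^sub>M \<omega>)) \<longlonglongrightarrow> (\<integral>p. w (fst p \<bullet> snd p) * B p \<partial>(\<omega> \<Otimes>\<^sub>M \<omega>))"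
      by (intro integral_dominated_convergence[where w="\<lambda>_. bw * bA"])
        (auto intro!: borel_measurable_continuous_on_surface_pair continuous_intros contF contB cw tendsto_mult limxy)
    show "(\<lambda>n. \<integral>p. w (fst p \<bullet> snd p) * F n p \<partial>(\<omega> \<Otimes>\<^sub>M \<omega>)) \<longlonglongrightarrow> (\<integral>p. w (fst p \<bullet> snd p) * A p \<partial>(\<omega> \<Otimes>\<^sub>M \<omega>))"
      by (simp add: zonal_companionD(3)[OF F w])
  qed
  moreover have "\<bar>B p - B q\<bar> \<le> e"
    if "\<forall>p\<in>sphere 0 1 \<times> sphere 0 1. \<forall>q\<in>sphere 0 1 \<times> sphere 0 1. dist p q < d \<longrightarrow> \<bar>A p - A q\<bar> \<le> e"
     "p \<in> sphere 0 1 \<times> sphere 0 1" "q \<in> sphere 0 1 \<times> sphere 0 1" "dist p q < d" for e d p q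
  proof (rule LIMSEQ_le_const2)
    show "(\<lambda>n. \<bar>F n p - F n q\<bar>) \<longlonglongrightarrow> \<bar>B p - B q\<bar>" by (intro tendsto_intros lim that)
    show "\<exists>N. \<forall>n\<ge>N. \<bar>F n p - F n q\<bar> \<le> e" using zonal_companion_modulus[OF F that] by blast
  qed
  moreover have "\<bar>B p\<bar> \<le> b"
    if "\<forall>p\<in>sphere 0 1 \<times> sphere 0 1. \<bar>A p\<bar> \<le> b" "p \<in> sphere 0 1 \<times> sphere 0 1" for b p
  proof (rule LIMSEQ_le_const2)
    show "(\<lambda>n. \<bar>F n p\<bar>) \<longlonglongrightarrow> \<bar>B p\<bar>" by (intro tendsto_intros lim that)
    show "\<exists>N. \<forall>n\<ge>N. \<bar>F n p\<bar> \<le> b" using zonal_companion_bound[OF F that] by blast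
  qed
  moreover have "B (x, y) = 0"
    if "\<forall>x y. norm x = 1 \<longrightarrow> norm y = 1 \<longrightarrow> x \<bullet> y = t \<longrightarrow> A (x, y) = 0"
      "norm x = 1" "norm y = 1" "x \<bullet> y = t" for t x y
  proof -
    have "F n (x, y) = 0" for n by (rule zonal_companion_zero[OF F that])
    then show ?thesis using limxy[OF that(2,3)] LIMSEQ_unique[of "\<lambda>_. 0"] by auto
  qed
  ultimately show ?thesis unfolding zonal_companion_def by blast
qed

text \<open>An average over the rotation group without its Haar measure: among all companions of
  \<open>A\<close>, take one of least L2 norm. The set of companions is rotation invariant and
  closed under midpoints, so a rotated minimizer is a minimizer too, and two minimizers agree by
  strict convexity of the norm.\<close>

lemma invariant_zonal_companion:
  fixes A :: "(real^'n) \<times> (real^'n) \<Rightarrow> real"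
  assumes cont: "continuous_on (sphere 0 1 \<times> sphere 0 1) A" and pd: "pos_def_kernel A"
  obtains B where "zonal_companion A B" "continuous_on (sphere 0 1 \<times> sphere 0 1) B"
    "\<And>R x y. orthogonal_transformation R \<Longrightarrow> norm x = 1 \<Longrightarrow> norm y = 1 \<Longrightarrow> B (R x, R y) = B (x, y)"
proof -
  let ?V = "sphere (0::real^'n) 1 \<times> sphere (0::real^'n) 1"
  let ?N = "\<lambda>B :: (real^'n) \<times> (real^'n) \<Rightarrow> real. \<integral>p. (B p)\<^sup>2 \<partial>(\<omega> \<Otimes>\<^sub>M \<omega>)"
  define m where "m = (INF B\<in>Collect (zonal_companion A). ?N B)"
  have bdd: "bdd_below (?N ` Collect (zonal_companion A))" by (intro bdd_belowI2[of _ 0]) auto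
  have mle: "m \<le> ?N B" if "zonal_companion A B" for B
    unfolding m_def using that by (intro cINF_lower bdd) auto
  obtain bA where bA: "\<And>x y. norm x = 1 \<Longrightarrow> norm y = 1 \<Longrightarrow> \<bar>A (x, y)\<bar> \<le> bA"
    using bounded_continuous_on_sphere_pair[OF cont] by metis
  have bF: "\<bar>F p\<bar> \<le> bA" if "zonal_companion A F" "p \<in> ?V" for F p
    using zonal_companion_bound[OF that(1) _ that(2), of bA] bA by auto
  have "\<exists>F. zonal_companion A F \<and> ?N F < m + inverse (Suc n)" for n
  proof -
    have "\<exists>F\<in>Collect (zonal_companion A). ?N F < m + inverse (Suc n)"
      unfolding m_def
      by (subst cINF_less_iff[symmetric, OF _ bdd]) (use zonal_companion_refl[OF pd] in auto)
    then show ?thesis by auto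
  qed
  then obtain F where F: "\<And>n. zonal_companion A (F n)" "\<And>n. ?N (F n) < m + inverse (Suc n)" by metis
  \<comment> \<open>A minimizing sequence has a uniformly convergent subsequence, and its limit is
    again a companion.\<close>
  obtain B k where B: "continuous_on ?V B" and k: "strict_mono (k :: nat \<Rightarrow> nat)"
    and lim: "\<And>e. 0 < e \<Longrightarrow> \<exists>N. \<forall>n p. n \<ge> N \<and> p \<in> ?V \<longrightarrow> norm (F (k n) p - B p) < e"
  proof (rule Arzela_Ascoli[of ?V F bA])
    show "compact ?V" by (intro compact_Times compact_sphere)
    show "norm (F n p) \<le> bA" if "p \<in> ?V" for n p using bF[OF F(1) that] by simp
    fix p and e :: real assume p: "p \<in> ?V" and e: "0 < e"
    obtain d where d: "0 < d" "\<And>B p q. zonal_companion A B \<Longrightarrow> p \<in> ?V \<Longrightarrow> q \<in> ?V \<Longrightarrow> dist p q < d \<Longrightarrow> \<bar>B p - B q\<bar> \<le> e / 2"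
      by (rule zonal_companion_equicontinuous[OF cont, of "e / 2"]) (use e in simp, rule that)
    have "norm (F n p - F n q) < e" if "q \<in> ?V" "norm (p - q) < d" for n q
      using d(2)[OF F(1) p that(1), of n] that(2) e by (simp add: dist_norm)
    then show "\<exists>d>0. \<forall>n q. q \<in> ?V \<and> norm (p - q) < d \<longrightarrow> norm (F n p - F n q) < e"
      using d(1) by blast
  qed (rule that)
  have lim': "(\<lambda>n. F (k n) p) \<longlonglongrightarrow> B p" if "p \<in> ?V" for p
    unfolding LIMSEQ_iff using lim that by blast
  have ZB: "zonal_companion A B"
    by (rule zonal_companion_limit[OF cont _ lim' B]) (auto intro: F)
  have NB: "?N B = m"
  proof (rule antisym)
    show "?N B \<le> m"
    proof (rule LIMSEQ_le)
      show "(\<lambda>n. ?N (F (k n))) \<longlonglongrightarrow> ?N B"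
      proof (rule integral_dominated_convergence[where w="\<lambda>_. bA\<^sup>2"])
        have "(F (k n) p)\<^sup>2 \<le> bA\<^sup>2" if "p \<in> ?V" for n p
          using power_mono[OF bF[OF F(1)[of "k n"] that], of 2] by simp
        then show "AE p in \<omega> \<Otimes>\<^sub>M \<omega>. norm ((F (k n) p)\<^sup>2) \<le> bA\<^sup>2" for n by (intro AE_I2) auto
        show "AE p in \<omega> \<Otimes>\<^sub>M \<omega>. (\<lambda>n. (F (k n) p)\<^sup>2) \<longlonglongrightarrow> (B p)\<^sup>2"
          by (intro AE_I2 tendsto_power lim') auto
      qed (auto intro!: borel_measurable_continuous_on_surface_pair continuous_on_power B zonal_companion_continuous[OF cont F(1)])
      show "(\<lambda>n. m + inverse (Suc (k n))) \<longlonglongrightarrow> m"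
        using LIMSEQ_subseq_LIMSEQ[OF LIMSEQ_inverse_real_of_nat_add[of m] k] by (simp add: o_def)
      show "\<exists>N. \<forall>n\<ge>N. ?N (F (k n)) \<le> m + inverse (Suc (k n))" using F(2) less_imp_le by blast
    qed
  qed (rule mle[OF ZB])
  have "B (R x, R y) = B (x, y)" if R: "orthogonal_transformation R" and xy: "norm x = 1" "norm y = 1" for R x y
  proof -
    define C where "C p = B (R (fst p), R (snd p))" for p
    have ZC: "zonal_companion A C"
      unfolding C_def using zonal_companion_orthogonal[OF cont ZB R] .
    note contC = zonal_companion_continuous[OF cont ZC]
    have NC: "?N C = m"
      unfolding C_def NB[symmetric]
      using integral_surface_pair_orthogonal[OF R, of "\<lambda>p. (B p)\<^sup>2"] borel_measurable_continuous_on_surface_pair[OF B]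
      by auto
    have int: "integrable (\<omega> \<Otimes>\<^sub>M \<omega>) (\<lambda>p. (B p)\<^sup>2)" "integrable (\<omega> \<Otimes>\<^sub>M \<omega>) (\<lambda>p. (C p)\<^sup>2)"
       "integrable (\<omega> \<Otimes>\<^sub>M \<omega>) (\<lambda>p. ((B p + C p) / 2)\<^sup>2)" "integrable (\<omega> \<Otimes>\<^sub>M \<omega>) (\<lambda>p. (B p - C p)\<^sup>2)"
      by (intro integrable_continuous_on_surface_pair continuous_intros B contC; simp)+
    \<comment> \<open>Parallelogram identity: the midpoint has norm at least the minimum, so the
      difference has norm at most 0.\<close>
    have "?N (\<lambda>p. B p - C p) = (\<integral>p. 2 * (B p)\<^sup>2 + 2 * (C p)\<^sup>2 - 4 * ((B p + C p) / 2)\<^sup>2 \<partial>(\<omega> \<Otimes>\<^sub>M \<omega>))"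
      by (intro Bochner_Integration.integral_cong refl) (simp add: power2_eq_square field_simps)
    also have "\<dots> = 2 * m + 2 * m - 4 * ?N (\<lambda>p. (B p + C p) / 2)"
      using int NB NC by simp
    also have "\<dots> \<le> 0" using mle[OF zonal_companion_midpoint[OF cont ZB ZC]] by simp
    finally have "?N (\<lambda>p. B p - C p) = 0" by (intro antisym) auto
    then have "(B (x, y) - C (x, y))\<^sup>2 = 0"
      by (intro integral_surface_pair_eq_0_imp[OF _ _ _ xy, of "\<lambda>p. (B p - C p)\<^sup>2"] continuous_intros B contC) auto
    then show ?thesis by (simp add: C_def)
  qed
  then show ?thesis using that ZB B by blast
qed

section \<open>Circles of latitude\<close>

lemma pos_def_kernel_sum_finite:
  assumes A: "pos_def_kernel A" and I: "finite I" and x: "\<And>i. i \<in> I \<Longrightarrow> norm (x i) = 1"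
  shows "0 \<le> (\<Sum>i\<in>I. \<Sum>j\<in>I. c i * c j * A (x i, x j))"
proof -
  obtain b where b: "bij_betw b {..<card I} I"
    using ex_bij_betw_nat_finite[OF I] by (auto simp: atLeast0LessThan)
  have "0 \<le> (\<Sum>i<card I. \<Sum>j<card I. c (b i) * c (b j) * A (x (b i), x (b j)))"
    by (rule pos_def_kernel_sum[OF A]) (use x b in \<open>auto dest: bij_betwE\<close>)
  also have "\<dots> = (\<Sum>i<card I. \<Sum>j\<in>I. c (b i) * c j * A (x (b i), x j))"
    by (intro sum.cong refl sum.reindex_bij_betw[OF b])
  also have "\<dots> = (\<Sum>i\<in>I. \<Sum>j\<in>I. c i * c j * A (x i, x j))"
    by (rule sum.reindex_bij_betw[OF b])
  finally show ?thesis .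
qed

text \<open>Average the inequality over independent points; the diagonal contributes only a fraction \<open>1 / (n - 1)\<close>.\<close>

lemma integral_pos_def_nonneg:
  fixes F :: "'a \<times> 'a \<Rightarrow> real"
  assumes M: "finite_measure M" and F[measurable]: "F \<in> borel_measurable (M \<Otimes>\<^sub>M M)"
    and bnd: "\<And>x y. x \<in> space M \<Longrightarrow> y \<in> space M \<Longrightarrow> \<bar>F (x, y)\<bar> \<le> b"
    and pd: "\<And>(n::nat) x. (\<And>i. i < n \<Longrightarrow> x i \<in> space M) \<Longrightarrow> 0 \<le> (\<Sum>i<n. \<Sum>j<n. F (x i, x j))"
  shows "0 \<le> (\<integral>p. F p \<partial>(M \<Otimes>\<^sub>M M))"
proof (rule ccontr)
  interpret finite_measure M by fact
  interpret MM: finite_measure "M \<Otimes>\<^sub>M M" by (intro finite_measure_pair_measure M)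
  let ?J = "\<integral>p. F p \<partial>(M \<Otimes>\<^sub>M M)" let ?m = "measure M (space M)"
  assume "\<not> 0 \<le> ?J"
  then have J: "?J < 0" by simp
  have m: "0 < ?m"
  proof (rule ccontr)
    assume "\<not> 0 < ?m"
    then have "emeasure M (space M) = 0" by (simp add: emeasure_eq_measure zero_less_measure_iff)
    then have "AE x in M. False" by (auto simp: AE_iff_measurable[of "space M"])
    then have "emeasure (M \<Otimes>\<^sub>M M) (space (M \<Otimes>\<^sub>M M)) = 0"
      using \<open>emeasure M (space M) = 0\<close> by (simp add: space_pair_measure emeasure_pair_measure_Times)
    then have "AE p in M \<Otimes>\<^sub>M M. F p = 0"
      by (intro AE_I[where N="space (M \<Otimes>\<^sub>M M)"]) auto
    then show False using J integral_eq_zero_AE by fastforce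
  qed
  have "?m ^ 2 = measure (M \<Otimes>\<^sub>M M) (space (M \<Otimes>\<^sub>M M))"
    by (simp add: space_pair_measure measure_def emeasure_pair_measure_Times enn2real_mult power2_eq_square)
  then have one: "(\<integral>p. (1::real) \<partial>(M \<Otimes>\<^sub>M M)) = ?m ^ 2" by simp
  \<comment> \<open>Take \<open>n + 2\<close> independent points. Each of the
    \<open>(n + 2) * (n + 1)\<close> off-diagonal pairs contributes \<open>?J\<close> times the mass
    \<open>?m ^ n\<close> of the other coordinates, each diagonal term at most \<open>b\<close>;
    then divide by \<open>(n + 2) * ?m ^ n\<close>.\<close>
  have key: "- (?m ^ 2 * b) \<le> real (n + 1) * ?J" for n
  proof -
    let ?k = "n + 2" let ?P = "PiM {..<?k} (\<lambda>_. M)"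
    have Fint: "integrable (M \<Otimes>\<^sub>M M) F"
      by (rule MM.integrable_const_bound[where B=b]) (use bnd in \<open>auto simp: space_pair_measure\<close>)
    have ip: "integrable ?P (\<lambda>x. F (x i, x j))" "(\<integral>x. F (x i, x j) \<partial>?P) = ?J * ?m ^ n"
      if "i < ?k" "j < ?k" "i \<noteq> j" for i j
      using integral_PiM_pair[OF M finite_lessThan, of i ?k j F "\<lambda>_. 1" 1] that Fint by auto
    \<comment> \<open>The total mass of the product space, obtained from the same lemma with the
      constant kernel 1.\<close>
    have ip1: "integrable ?P (\<lambda>x. 1::real)" "(\<integral>x. (1::real) \<partial>?P) = ?m ^ 2 * ?m ^ n"
    proof -
      have c: "integrable (M \<Otimes>\<^sub>M M) (\<lambda>_. 1::real)" by (rule MM.integrable_const)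
      have q: "0 \<in> {..<?k}" "1 \<in> {..<?k}" "(0::nat) \<noteq> 1" by auto
      have u: "(\<lambda>_. 1::real) \<in> borel_measurable M" "0 \<le> (1::real)" "(1::real) \<le> 1" by simp_all
      note ip11 = integral_PiM_pair[OF M finite_lessThan q c u]
      have "integrable ?P (\<lambda>x. 1 * (\<Prod>i<?k. 1::real))"
        "(\<integral>x. 1 * (\<Prod>i<?k. 1::real) \<partial>?P) = (\<integral>p. 1 * (1 * 1) \<partial>(M \<Otimes>\<^sub>M M)) * (\<integral>y. 1 \<partial>M) ^ (card {..<?k} - 2)"
        by (rule ip11)+
      then show "integrable ?P (\<lambda>x. 1::real)" "(\<integral>x. (1::real) \<partial>?P) = ?m ^ 2 * ?m ^ n"
        unfolding prod.neutral_const mult_1 one by simp_all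
    qed
    let ?O = "{(i, j). i < ?k \<and> j < ?k \<and> i \<noteq> j}" and ?D = "(\<lambda>i. (i, i)) ` {..<?k}"
    have fin: "finite ?O" by (rule finite_subset[of _ "{..<?k} \<times> {..<?k}"]) auto
    have cO: "card ?O = (n + 2) * (n + 1)"
    proof -
      have "?O = {..<?k} \<times> {..<?k} - ?D" by auto
      then have "card ?O = ?k * ?k - card ?D" by (simp only:) (subst card_Diff_subset, auto simp: card_cartesian_product)
      also have "card ?D = ?k" by (subst card_image) (auto simp: inj_on_def)
      finally show ?thesis by (simp add: algebra_simps)
    qed
    have split: "(\<Sum>i<?k. \<Sum>j<?k. F (x i, x j)) \<le> (\<Sum>(i, j)\<in>?O. F (x i, x j)) + ?k * b" if x: "x \<in> space ?P" for x
    proof -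
      have "(\<Sum>i<?k. \<Sum>j<?k. F (x i, x j)) = (\<Sum>(i, j)\<in>{..<?k} \<times> {..<?k}. F (x i, x j))"
        by (simp only: sum.cartesian_product)
      also have "{..<?k} \<times> {..<?k} = ?O \<union> ?D" by auto
      also have "(\<Sum>(i, j)\<in>?O \<union> ?D. F (x i, x j)) = (\<Sum>(i, j)\<in>?O. F (x i, x j)) + (\<Sum>(i, j)\<in>?D. F (x i, x j))"
        by (rule sum.union_disjoint) (use fin in auto)
      also have "(\<Sum>(i, j)\<in>?D. F (x i, x j)) = (\<Sum>i<?k. F (x i, x i))"
        by (subst sum.reindex) (auto simp: inj_on_def)
      also have "\<dots> \<le> (\<Sum>i<?k. b)"
        using bnd x by (intro sum_mono) (auto simp: space_PiM PiE_iff abs_le_iff)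
      finally show ?thesis by simp
    qed
    have "0 \<le> (\<integral>x. (\<Sum>(i, j)\<in>?O. F (x i, x j)) + ?k * b * 1 \<partial>?P)"
    proof (rule integral_nonneg_AE, rule AE_I2)
      fix x assume x: "x \<in> space ?P"
      then have "0 \<le> (\<Sum>i<?k. \<Sum>j<?k. F (x i, x j))"
        by (intro pd) (auto simp: space_PiM PiE_iff)
      then show "0 \<le> (\<Sum>(i, j)\<in>?O. F (x i, x j)) + ?k * b * 1" using split[OF x] by simp
    qed
    also have "\<dots> = (\<Sum>(i, j)\<in>?O. ?J * ?m ^ n) + ?k * b * (?m ^ 2 * ?m ^ n)"
    proof -
      have "integrable ?P (\<lambda>x. case q of (i, j) \<Rightarrow> F (x i, x j))" if "q \<in> ?O" for q using that ip(1) by auto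
      moreover have "(\<integral>x. (case q of (i, j) \<Rightarrow> F (x i, x j)) \<partial>?P) = (case q of (i, j) \<Rightarrow> ?J * ?m ^ n)" if "q \<in> ?O" for q
        using that ip(2) by auto
      ultimately have i1: "integrable ?P (\<lambda>x. \<Sum>(i, j)\<in>?O. F (x i, x j))"
        and e1: "(\<integral>x. (\<Sum>(i, j)\<in>?O. F (x i, x j)) \<partial>?P) = (\<Sum>(i, j)\<in>?O. ?J * ?m ^ n)"
        by (auto simp: Bochner_Integration.integral_sum intro!: Bochner_Integration.integrable_sum sum.cong)
      have i2: "integrable ?P (\<lambda>x. ?k * b * 1)" by (rule integrable_mult_right[OF ip1(1)])
      show ?thesis
        unfolding Bochner_Integration.integral_add[OF i1 i2] e1 integral_mult_right_zero ip1(2) ..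
    qed
    also have "\<dots> = (?k * ?m ^ n) * (real (n + 1) * ?J + ?m ^ 2 * b)"
      using cO by (simp add: algebra_simps)
    finally have "0 \<le> (?k * ?m ^ n) * (real (n + 1) * ?J + ?m ^ 2 * b)" .
    moreover have "0 < ?k * ?m ^ n" using m by simp
    ultimately have "0 \<le> real (n + 1) * ?J + ?m ^ 2 * b" by (simp only: zero_le_mult_iff) linarith
    then show ?thesis by simp
  qed
  obtain n where n: "?m ^ 2 * b / (- ?J) < real n" using reals_Archimedean2 by blast
  then have "?m ^ 2 * b < real n * (- ?J)" using J by (simp add: field_simps)
  also have "\<dots> \<le> real (n + 1) * (- ?J)" using J by (intro mult_right_mono) auto
  finally show False using key[of n] by simp
qed

section \<open>Householder reflections and transitivity on pairs of points\<close>

definition reflection :: "'a::real_inner \<Rightarrow> 'a \<Rightarrow> 'a" where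
  "reflection u v = v - (2 * (u \<bullet> v) / (u \<bullet> u)) *\<^sub>R u"

text \<open>This includes \<open>u = 0\<close>, where the reflection is the identity. Hence
  \<open>reflection (x - y)\<close> may be used without separating the case of equal points.\<close>

lemma orthogonal_transformation_reflection:
  "orthogonal_transformation (reflection (u :: 'a::euclidean_space))"
proof -
  have "linear (reflection u)"
    by (rule linearI) (simp_all add: reflection_def inner_add_right algebra_simps add_divide_distrib)
  moreover have "reflection u v \<bullet> reflection u w = v \<bullet> w" for v w
    by (cases "u = 0") (simp_all add: reflection_def inner_diff_left inner_diff_right inner_commute power2_eq_square field_simps)
  ultimately show ?thesis by (auto simp: orthogonal_transformation_def)
qed

lemma norm_reflection [simp]: "norm (reflection (u :: 'a::euclidean_space) v) = norm v"
  using orthogonal_transformation_reflection by (rule orthogonal_transformation_norm)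

lemma inner_reflection [simp]: "reflection (u :: 'a::euclidean_space) v \<bullet> reflection u w = v \<bullet> w"
  using orthogonal_transformation_reflection[of u] by (simp add: orthogonal_transformation_def)

lemma reflection_diff:
  fixes x y :: "'a::euclidean_space"
  assumes "norm x = norm y"
  shows "reflection (x - y) x = y"
proof (cases "x = y")
  case False
  have "x \<bullet> x = y \<bullet> y" using assms by (simp add: norm_eq)
  then have "2 * ((x - y) \<bullet> x) = (x - y) \<bullet> (x - y)"
    by (simp add: inner_diff_left inner_diff_right inner_commute)
  then show ?thesis using False by (simp add: reflection_def)
qed (simp add: reflection_def)

lemma reflection_fixes: "u \<bullet> v = 0 \<Longrightarrow> reflection u v = v"
  by (simp add: reflection_def)

text \<open>One reflection takes \<open>x\<close> to \<open>x'\<close>. A second one corrects the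
  image \<open>y1\<close> of \<open>y\<close>; it fixes \<open>x'\<close>, which has the same inner
  product with \<open>y1\<close> and \<open>y'\<close> and so is orthogonal to their
  difference.\<close>

lemma orthogonal_transformation_two_points:
  fixes x y x' y' :: "'a::euclidean_space"
  assumes "norm x = 1" "norm y = 1" "norm x' = 1" "norm y' = 1" "x \<bullet> y = x' \<bullet> y'"
  obtains R where "orthogonal_transformation R" "R x = x'" "R y = y'"
proof -
  define y1 where "y1 = reflection (x - x') y"
  have x1: "reflection (x - x') x = x'" using assms by (intro reflection_diff) simp
  have n: "norm y1 = norm y'" using assms by (simp add: y1_def)
  have "x' \<bullet> y1 = x' \<bullet> y'" using inner_reflection[of "x - x'" x y] x1 assms by (simp add: y1_def)
  then have "reflection (y1 - y') x' = x'"
    by (intro reflection_fixes, subst inner_commute) (simp add: inner_diff_right)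
  then show ?thesis
    using reflection_diff[OF n] x1
    by (intro that[of "reflection (y1 - y') \<circ> reflection (x - x')"])
      (auto simp: y1_def intro!: orthogonal_transformation_compose orthogonal_transformation_reflection)
qed


text \<open>Up to the factor \<open>pi\<close>, the density of
  \<open>\<alpha> - \<beta> * cos x\<close> for \<open>x\<close> uniform on \<open>{0..pi}\<close>.
  With \<open>\<alpha> = t * s\<close> and \<open>\<beta> = sqrt (1 - t^2) * sqrt (1 - s^2)\<close>
  it is the law of the inner product of random points on two circles of latitude at heights
  \<open>t\<close> and \<open>s\<close>.\<close>

definition arcsine :: "real \<Rightarrow> real \<Rightarrow> real \<Rightarrow> real" where
  "arcsine \<alpha> \<beta> u = (if \<bar>u - \<alpha>\<bar> < \<beta> then 1 / sqrt (\<beta>\<^sup>2 - (u - \<alpha>)\<^sup>2) else 0)"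

lemma arcsine_measurable [measurable]: "arcsine \<alpha> \<beta> \<in> borel_measurable borel"
  unfolding arcsine_def by measurable

lemma arcsine_nonneg: "0 \<le> arcsine \<alpha> \<beta> u"
proof -
  have "(u - \<alpha>)\<^sup>2 \<le> \<beta>\<^sup>2" if "\<bar>u - \<alpha>\<bar> < \<beta>" using that power_mono[of "\<bar>u - \<alpha>\<bar>" \<beta> 2] by simp
  then show ?thesis by (simp add: arcsine_def)
qed

lemma arcsine_cos:
  assumes "0 < \<beta>" "0 < x" "x < pi"
  shows "arcsine \<alpha> \<beta> (\<alpha> - \<beta> * cos x) * (\<beta> * sin x) = 1"
proof -
  have s: "0 < sin x" using assms by (intro sin_gt_zero) auto
  have "(cos x)\<^sup>2 < 1" using s sin_cos_squared_add[of x] by (smt (verit) zero_less_power)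
  then have "\<bar>cos x\<bar> < 1" by (simp add: abs_square_less_1)
  then have "\<bar>\<beta> * cos x\<bar> < \<beta>" using assms(1) by (simp add: abs_mult)
  moreover have "\<beta>\<^sup>2 - (\<beta> * cos x)\<^sup>2 = (\<beta> * sin x)\<^sup>2"
    by (simp add: power_mult_distrib sin_squared_eq right_diff_distrib)
  ultimately show ?thesis using s assms(1) by (simp add: arcsine_def)
qed

lemma AE_interior_Icc: "AE x in lborel. x \<in> {a..b::real} \<longrightarrow> a < x \<and> x < b"
proof -
  have "AE x in lborel. x \<noteq> a" "AE x in lborel. x \<noteq> b" by (rule AE_lborel_singleton)+
  then show ?thesis by eventually_elim auto
qed

text \<open>The mass does not depend on the parameters, which is the condition on the norms in
  Scheffe's lemma.\<close>

lemma nn_integral_arcsine: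
  assumes "0 < \<beta>"
  shows "(\<integral>\<^sup>+u. ennreal (arcsine \<alpha> \<beta> u) \<partial>lborel) = ennreal pi"
proof -
  let ?g = "\<lambda>x. \<alpha> - \<beta> * cos x"
  have "(\<integral>\<^sup>+u. ennreal (arcsine \<alpha> \<beta> u) \<partial>lborel) = (\<integral>\<^sup>+u. arcsine \<alpha> \<beta> u * indicator {?g 0..?g pi} u \<partial>lborel)"
    by (intro nn_integral_cong) (auto simp: arcsine_def indicator_def)
  also have "\<dots> = (\<integral>\<^sup>+x. arcsine \<alpha> \<beta> (?g x) * (\<beta> * sin x) * indicator {0..pi} x \<partial>lborel)"
    using assms by (intro nn_integral_substitution)
      (auto intro!: derivative_eq_intros continuous_intros mult_nonneg_nonneg sin_ge_zero simp: set_borel_measurable_def)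
  also have "\<dots> = (\<integral>\<^sup>+x. indicator {0..pi} x \<partial>lborel)"
    using AE_interior_Icc[of 0 pi] arcsine_cos[OF assms]
    by (intro nn_integral_cong_AE) (auto simp: indicator_def elim!: eventually_mono)
  finally show ?thesis by simp
qed

lemma integrable_arcsine: "0 < \<beta> \<Longrightarrow> integrable lborel (arcsine \<alpha> \<beta>)"
  using nn_integral_arcsine[of \<beta> \<alpha>] by (intro integrableI_nonneg) (auto simp: arcsine_nonneg)

text \<open>The substitution moves the parameters from the argument of \<open>h\<close> into the
  density. Changes of the parameters are then measured by an L1 distance of densities times the
  bound on \<open>h\<close>, without any modulus of continuity of \<open>h\<close>.\<close>

lemma integral_cos_arcsine:
  fixes h :: "real \<Rightarrow> real"
  assumes b: "0 < \<beta>" and h[measurable]: "h \<in> borel_measurable borel" and M: "\<And>u. \<bar>h u\<bar> \<le> M"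
  shows "integrable lborel (\<lambda>u. h u * arcsine \<alpha> \<beta> u)"
    and "(LBINT x:{0..pi}. h (\<alpha> - \<beta> * cos x)) = (\<integral>u. h u * arcsine \<alpha> \<beta> u \<partial>lborel)"
proof -
  let ?g = "\<lambda>x. \<alpha> - \<beta> * cos x"
  show int: "integrable lborel (\<lambda>u. h u * arcsine \<alpha> \<beta> u)"
  proof (rule Bochner_Integration.integrable_bound)
    show "integrable lborel (\<lambda>u. M * arcsine \<alpha> \<beta> u)" using integrable_arcsine[OF b] by simp
    show "AE u in lborel. norm (h u * arcsine \<alpha> \<beta> u) \<le> norm (M * arcsine \<alpha> \<beta> u)"
      using M by (intro AE_I2) (auto simp: abs_mult intro!: mult_right_mono order_trans[OF M abs_ge_self])
  qed measurable
  have "(\<integral>u. h u * arcsine \<alpha> \<beta> u \<partial>lborel) = (LBINT u. (h u * arcsine \<alpha> \<beta> u) * indicator {?g 0..?g pi} u)"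
    by (intro Bochner_Integration.integral_cong) (auto simp: arcsine_def indicator_def)
  also have "\<dots> = (LBINT x. (h (?g x) * arcsine \<alpha> \<beta> (?g x)) * (\<beta> * sin x) * indicator {0..pi} x)"
  proof (rule integral_substitution(2)[where f="\<lambda>u. h u * arcsine \<alpha> \<beta> u" and g="?g" and g'="\<lambda>x. \<beta> * sin x"])
    show "set_integrable lborel {?g 0..?g pi} (\<lambda>u. h u * arcsine \<alpha> \<beta> u)"
      unfolding set_integrable_def by (rule integrable_mult_indicator[OF _ int]) auto
  qed (use b in \<open>auto intro!: derivative_eq_intros continuous_intros mult_nonneg_nonneg sin_ge_zero\<close>)
  also have "\<dots> = (LBINT x:{0..pi}. h (?g x))"
    unfolding set_lebesgue_integral_def
  proof (rule integral_cong_AE)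
    show "AE x in lborel. h (?g x) * arcsine \<alpha> \<beta> (?g x) * (\<beta> * sin x) * indicator {0..pi} x = indicator {0..pi} x *\<^sub>R h (?g x)"
      using AE_interior_Icc[of 0 pi]
    proof eventually_elim
      case (elim x)
      then show ?case using arcsine_cos[OF b, of x \<alpha>] by (auto simp: indicator_def mult.assoc)
    qed
  qed measurable
  finally show "(LBINT x:{0..pi}. h (\<alpha> - \<beta> * cos x)) = (\<integral>u. h u * arcsine \<alpha> \<beta> u \<partial>lborel)" ..
qed

text \<open>Scheffe: the densities converge away from the two endpoints \<open>a - b\<close> and
  \<open>a + b\<close>, and all have the same mass.\<close>

lemma arcsine_L1_continuous:
  assumes \<alpha>: "\<alpha> \<longlonglongrightarrow> a" and \<beta>: "\<beta> \<longlonglongrightarrow> b" and b: "0 < b" "\<And>n::nat. 0 < \<beta> n"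
  shows "(\<lambda>n. \<integral>u. \<bar>arcsine (\<alpha> n) (\<beta> n) u - arcsine a b u\<bar> \<partial>lborel) \<longlonglongrightarrow> 0"
proof -
  have "(\<lambda>n. \<integral>\<^sup>+u. norm (arcsine (\<alpha> n) (\<beta> n) u - arcsine a b u) \<partial>lborel) \<longlonglongrightarrow> 0"
  proof (rule Scheffe_lemma2)
    show "integrable lborel (arcsine a b)" using b by (intro integrable_arcsine)
    have "AE u in lborel. u \<noteq> a - b" "AE u in lborel. u \<noteq> a + b" by (rule AE_lborel_singleton)+
    then show "AE u in lborel. (\<lambda>n. arcsine (\<alpha> n) (\<beta> n) u) \<longlonglongrightarrow> arcsine a b u"
    proof eventually_elim
      case (elim u)
      have lim: "(\<lambda>n. \<bar>u - \<alpha> n\<bar> - \<beta> n) \<longlonglongrightarrow> \<bar>u - a\<bar> - b" by (intro tendsto_intros \<alpha> \<beta>)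
      have "\<bar>u - a\<bar> \<noteq> b" using elim by (auto simp: abs_if split: if_splits)
      then consider "\<bar>u - a\<bar> < b" | "\<bar>u - a\<bar> > b" by linarith
      then show ?case
      proof cases
        case 1
        have "(u - a)\<^sup>2 < b\<^sup>2" using 1 power_strict_mono[of "\<bar>u - a\<bar>" b 2] by simp
        then have "(\<lambda>n. 1 / sqrt ((\<beta> n)\<^sup>2 - (u - \<alpha> n)\<^sup>2)) \<longlonglongrightarrow> 1 / sqrt (b\<^sup>2 - (u - a)\<^sup>2)"
          by (intro tendsto_intros \<alpha> \<beta>) auto
        moreover have "\<forall>\<^sub>F n in sequentially. \<bar>u - \<alpha> n\<bar> - \<beta> n < 0"
          using order_tendstoD(2)[OF lim, of 0] 1 by simp
        then have "\<forall>\<^sub>F n in sequentially. 1 / sqrt ((\<beta> n)\<^sup>2 - (u - \<alpha> n)\<^sup>2) = arcsine (\<alpha> n) (\<beta> n) u"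
          by eventually_elim (simp add: arcsine_def)
        ultimately have "(\<lambda>n. arcsine (\<alpha> n) (\<beta> n) u) \<longlonglongrightarrow> 1 / sqrt (b\<^sup>2 - (u - a)\<^sup>2)"
          by (rule Lim_transform_eventually)
        then show ?thesis using 1 by (simp add: arcsine_def)
      next
        case 2
        have "\<forall>\<^sub>F n in sequentially. 0 < \<bar>u - \<alpha> n\<bar> - \<beta> n"
          using order_tendstoD(1)[OF lim, of 0] 2 by simp
        then show ?thesis
          using 2 by (intro tendsto_eventually) (auto simp: arcsine_def elim!: eventually_mono)
      qed
    qed
    show "(\<integral>\<^sup>+u. norm (arcsine (\<alpha> n) (\<beta> n) u) \<partial>lborel) \<le> (\<integral>\<^sup>+u. norm (arcsine a b u) \<partial>lborel)" for n
      using b by (simp add: arcsine_nonneg nn_integral_arcsine)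
  qed auto
  moreover have "(\<integral>\<^sup>+u. norm (arcsine (\<alpha> n) (\<beta> n) u - arcsine a b u) \<partial>lborel) =
     ennreal (\<integral>u. \<bar>arcsine (\<alpha> n) (\<beta> n) u - arcsine a b u\<bar> \<partial>lborel)" for n
    using integrable_arcsine[OF b(1), of a] integrable_arcsine[OF b(2), of "\<alpha> n" n]
    by (subst nn_integral_eq_integral) auto
  ultimately show ?thesis
    by (simp add: ennreal_tendsto_0_iff)
qed

text \<open>A full period is independent of the shift \<open>x\<close> and consists of two half
  periods with equal contributions. The sign in \<open>- cos y\<close> matches the increasing
  substitution \<open>\<alpha> - \<beta> * cos x\<close>.\<close>

lemma integral_cos_diff:
  fixes g :: "real \<Rightarrow> real"
  assumes g: "continuous_on UNIV g" and x: "0 \<le> x" "x \<le> 2 * pi"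
  shows "integral {0..2*pi} (\<lambda>y. g (cos (x - y))) = 2 * integral {0..pi} (\<lambda>y. g (- cos y))"
proof -
  define p where "p y = g (cos y)" for y
  have "continuous_on UNIV p" unfolding p_def by (rule continuous_on_compose2[OF g]) (auto intro: continuous_intros)
  then have int: "p integrable_on {a..b}" for a b
    by (rule integrable_continuous_interval[OF continuous_on_subset]) simp
  have "integral {0..2*pi} (\<lambda>y. g (cos (x - y))) = integral {0..2*pi} (p \<circ> (+) (- x))"
    by (intro integral_cong) (metis (no_types, lifting) comp_apply cos_minus minus_diff_eq p_def uminus_add_conv_diff)
  also have "\<dots> = integral {- x..2*pi - x} p"
    by (subst integral_shift_Icc_real) simp
  also have "\<dots> = integral {- x..0} p + integral {0..2*pi - x} p"
    using x int by (intro Henstock_Kurzweil_Integration.integral_combine[symmetric]) auto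
  also have "integral {- x..0} p = integral {- x..0} (p \<circ> (+) (2 * pi))"
    by (intro integral_cong) (simp add: p_def add.commute)
  also have "\<dots> = integral {2*pi - x..2*pi} p"
    by (subst integral_shift_Icc_real) simp
  also have "integral {2*pi - x..2*pi} p + integral {0..2*pi - x} p = integral {0..2*pi} p"
    using x int by (subst add.commute, intro Henstock_Kurzweil_Integration.integral_combine) auto
  also have "\<dots> = integral {0..pi} p + integral {pi..2*pi} p"
    using int by (intro Henstock_Kurzweil_Integration.integral_combine[symmetric]) auto
  also have "integral {0..pi} p = integral {- pi..0} (p \<circ> (+) pi)"
    by (subst integral_shift_Icc_real) simp
  also have "\<dots> = integral {- pi..- 0} (\<lambda>y. (\<lambda>y. g (- cos y)) (- y))"
    by (simp add: p_def comp_def add.commute[of pi])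
  also have "\<dots> = integral {0..pi} (\<lambda>y. g (- cos y))"
    by (rule Henstock_Kurzweil_Integration.integral_reflect_real)
  also have "integral {pi..2*pi} p = integral {0..pi} (p \<circ> (+) pi)"
    by (subst integral_shift_Icc_real) simp
  also have "\<dots> = integral {0..pi} (\<lambda>y. g (- cos y))"
    by (simp add: p_def comp_def add.commute[of pi])
  finally show ?thesis by simp
qed

lemma finite_measure_restrict_Icc: "finite_measure (restrict_space lborel {a..b::real})"
  by (rule finite_measureI) (simp add: space_restrict_space emeasure_restrict_space emeasure_lborel_Icc_eq)

text \<open>The inner integral is twice a half period and does not depend on the outer angle, which
  ranges over a set of length \<open>2 * pi\<close>.\<close>

lemma double_integral_cos_diff:
  fixes g :: "real \<Rightarrow> real"
  assumes g: "continuous_on UNIV g"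
  defines "U \<equiv> restrict_space lborel {0..2 * pi}"
  shows "integrable (U \<Otimes>\<^sub>M U) (\<lambda>p. g (cos (fst p - snd p)))"
    and "(\<integral>p. g (cos (fst p - snd p)) \<partial>(U \<Otimes>\<^sub>M U)) = 4 * pi * (LBINT x:{0..pi}. g (- cos x))"
proof -
  interpret U: finite_measure U unfolding U_def by (rule finite_measure_restrict_Icc)
  interpret UU: pair_sigma_finite U U ..
  interpret UU': finite_measure "U \<Otimes>\<^sub>M U" by (intro finite_measure_pair_measure U.finite_measure_axioms)
  have gm: "g \<in> borel_measurable borel" using g by (rule borel_measurable_continuous_onI)
  have id: "(\<lambda>x. x) \<in> U \<rightarrow>\<^sub>M borel" unfolding U_def by (rule measurable_restrict_space1) simp
  have meas: "(\<lambda>p. g (cos (fst p - snd p))) \<in> borel_measurable (U \<Otimes>\<^sub>M U)"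
  proof -
    have "(\<lambda>p. cos (fst p - snd p)) \<in> borel_measurable (U \<Otimes>\<^sub>M U)"
      by (rule measurable_compose[OF borel_measurable_diff[OF measurable_compose[OF measurable_fst id]
            measurable_compose[OF measurable_snd id]] borel_measurable_cos])
    from measurable_compose[OF this gm] show ?thesis .
  qed
  have "bounded (g ` {-1..1})"
    by (intro compact_imp_bounded compact_continuous_image continuous_on_subset[OF g]) auto
  then obtain b where "\<And>z. z \<in> g ` {-1..1} \<Longrightarrow> norm z \<le> b" unfolding bounded_iff by blast
  then have b: "\<bar>g u\<bar> \<le> b" if "\<bar>u\<bar> \<le> 1" for u using that by (force simp: abs_le_iff)
  show int: "integrable (U \<Otimes>\<^sub>M U) (\<lambda>p. g (cos (fst p - snd p)))"
    by (rule UU'.integrable_const_bound[where B=b]) (auto intro!: b abs_cos_le_one meas)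
  have sint: "set_integrable lborel {c..d} (\<lambda>y. g (f y))" if "continuous_on UNIV f" for c d :: real and f
  proof -
    have "continuous_on {c..d} (\<lambda>y. g (f y))"
      by (rule continuous_on_compose2[OF g continuous_on_subset[OF that]]) auto
    then show ?thesis by (rule borel_integrable_atLeastAtMost')
  qed
  have inner: "(\<integral>y. g (cos (x - y)) \<partial>U) = 2 * (LBINT x:{0..pi}. g (- cos x))" if "x \<in> space U" for x
  proof -
    have "(\<integral>y. g (cos (x - y)) \<partial>U) = (LBINT y:{0..2*pi}. g (cos (x - y)))"
      unfolding U_def by (subst integral_restrict_space) (auto simp: set_lebesgue_integral_def)
    also have "\<dots> = integral {0..2*pi} (\<lambda>y. g (cos (x - y)))"
      by (rule set_borel_integral_eq_integral(2)) (intro sint continuous_intros)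
    also have "\<dots> = 2 * integral {0..pi} (\<lambda>y. g (- cos y))"
      using that by (intro integral_cos_diff g) (auto simp: U_def space_restrict_space)
    also have "integral {0..pi} (\<lambda>y. g (- cos y)) = (LBINT x:{0..pi}. g (- cos x))"
      by (rule set_borel_integral_eq_integral(2)[symmetric]) (intro sint continuous_intros)
    finally show ?thesis .
  qed
  have mU: "measure U (space U) = 2 * pi"
    by (simp add: U_def space_restrict_space measure_restrict_space)
  have "(\<integral>p. g (cos (fst p - snd p)) \<partial>(U \<Otimes>\<^sub>M U)) = (\<integral>x. (\<integral>y. g (cos (x - y)) \<partial>U) \<partial>U)"
    using UU.integral_fst'[OF int] by simp
  also have "\<dots> = (\<integral>x. 2 * (LBINT x:{0..pi}. g (- cos x)) \<partial>U)"
    by (intro Bochner_Integration.integral_cong refl inner)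
  also have "\<dots> = 4 * pi * (LBINT x:{0..pi}. g (- cos x))" by (simp add: mU)
  finally show "(\<integral>p. g (cos (fst p - snd p)) \<partial>(U \<Otimes>\<^sub>M U)) = 4 * pi * (LBINT x:{0..pi}. g (- cos x))" .
qed

section \<open>A point, two circles, and the modulus of continuity of zonal kernels\<close>

text \<open>
  Positive definiteness is tested on a point \<open>e\<close> and the uniform distributions on two circles of
  latitude around \<open>e\<close>. This is where three dimensions are needed.
\<close>

lemma latitude_inequality:
  fixes B :: "'a::euclidean_space \<times> 'a \<Rightarrow> real"
  assumes dim: "3 \<le> DIM('a)" and pd: "pos_def_kernel B" and h: "continuous_on UNIV h"
    and hB: "\<And>x y. norm x = 1 \<Longrightarrow> norm y = 1 \<Longrightarrow> B (x, y) = h (x \<bullet> y)"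
    and t: "\<bar>t\<bar> \<le> 1" and s: "\<bar>s\<bar> \<le> 1"
  shows "(h t - h s)\<^sup>2 \<le> h 1 / pi * ((LBINT x:{0..pi}. h (t * t - (1 - t\<^sup>2) * cos x))
     - 2 * (LBINT x:{0..pi}. h (t * s - sqrt (1 - t\<^sup>2) * sqrt (1 - s\<^sup>2) * cos x))
     + (LBINT x:{0..pi}. h (s * s - (1 - s\<^sup>2) * cos x)))"
proof -
  obtain T where T: "T \<subseteq> (Basis :: 'a set)" "card T = 3" 
    by (rule obtain_subset_with_card_n[OF dim]) (rule that)
  then obtain e0 e1 e2 where e: "T = {e0, e1, e2}" "e0 \<noteq> e1" "e1 \<noteq> e2" "e0 \<noteq> e2" by (auto simp: card_3_iff)
  have ip: "e0 \<bullet> e0 = 1" "e1 \<bullet> e1 = 1" "e2 \<bullet> e2 = 1" "e0 \<bullet> e1 = 0" "e0 \<bullet> e2 = 0" "e1 \<bullet> e2 = 0"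
     "e1 \<bullet> e0 = 0" "e2 \<bullet> e0 = 0" "e2 \<bullet> e1 = 0"
    using e T(1) by (auto simp: inner_Basis)
  \<comment> \<open>The circle at height \<open>c\<close> over the equator orthogonal to
    \<open>e0\<close>; it turns in the plane of \<open>e1\<close> and \<open>e2\<close>.\<close>
  define y where "y c \<theta> = c *\<^sub>R e0 + sqrt (1 - c\<^sup>2) *\<^sub>R (cos \<theta> *\<^sub>R e1 + sin \<theta> *\<^sub>R e2)" for c \<theta>
  have yy: "y c \<theta> \<bullet> y d \<theta>' = c * d + sqrt (1 - c\<^sup>2) * sqrt (1 - d\<^sup>2) * cos (\<theta> - \<theta>')" for c d \<theta> \<theta>'
    by (simp add: y_def inner_add_left inner_add_right ip cos_diff algebra_simps)
  have sq: "sqrt (1 - c\<^sup>2) * sqrt (1 - c\<^sup>2) = 1 - c\<^sup>2" if "\<bar>c\<bar> \<le> 1" for c :: real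
    using that by (simp add: abs_square_le_1)
  have sq': "\<bar>1 - c * c\<bar> = 1 - c * c" if "\<bar>c\<bar> \<le> 1" for c :: real
    using that by (simp add: abs_square_le_1 flip: power2_eq_square)
  have e0y: "e0 \<bullet> y c \<theta> = c" "y c \<theta> \<bullet> e0 = c" for c \<theta>
    by (simp_all add: y_def inner_add_left inner_add_right ip)
  have n1: "norm e0 = 1" "norm (y c \<theta>) = 1" if "\<bar>c\<bar> \<le> 1" for c \<theta>
    using yy[of c \<theta> c \<theta>] sq[OF that] ip by (simp_all add: norm_eq_1 power2_eq_square)
  define Q where "Q = (LBINT x:{0..pi}. h (t * t - (1 - t\<^sup>2) * cos x))
     - 2 * (LBINT x:{0..pi}. h (t * s - sqrt (1 - t\<^sup>2) * sqrt (1 - s\<^sup>2) * cos x))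
     + (LBINT x:{0..pi}. h (s * s - (1 - s\<^sup>2) * cos x))"
  define U where "U = restrict_space lborel {0..2 * pi}"
  have main: "0 \<le> a\<^sup>2 * h 1 + 2 * a * (h t - h s) + Q / pi" for a
  proof -
    \<comment> \<open>Charge \<open>a\<close> at the point \<open>e0\<close>, charge 1 spread over
      the circle at height \<open>t\<close>, and charge -1 over the circle at height
      \<open>s\<close>.\<close>
    define w where "w k = (if k = 0 then a else if k = 1 then 1 else - 1)" for k :: nat
    define z where "z k \<theta> = (if k = 0 then e0 else if k = 1 then y t \<theta> else y s \<theta>)" for k :: nat and \<theta>
    define F where "F p = (\<Sum>k<3. \<Sum>l<3. w k * w l * h (z k (fst p) \<bullet> z l (snd p)))" for p
    have nz: "norm (z k \<theta>) = 1" for k \<theta> using n1 t s by (auto simp: z_def)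
    define g1 where "g1 c = h (t * t + (1 - t\<^sup>2) * c)" for c
    define g2 where "g2 c = h (t * s + sqrt (1 - t\<^sup>2) * sqrt (1 - s\<^sup>2) * c)" for c
    define g3 where "g3 c = h (s * s + (1 - s\<^sup>2) * c)" for c
    have cg: "continuous_on UNIV g1" "continuous_on UNIV g2" "continuous_on UNIV g3"
      unfolding g1_def g2_def g3_def by (rule continuous_on_compose2[OF h], auto intro!: continuous_intros)+
    have F: "F p = (a\<^sup>2 * h 1 + 2 * a * (h t - h s)) + (g1 (cos (fst p - snd p)) - 2 * g2 (cos (fst p - snd p)) + g3 (cos (fst p - snd p)))" for p
    proof -
      have "y s (fst p) \<bullet> y t (snd p) = t * s + sqrt (1 - t\<^sup>2) * sqrt (1 - s\<^sup>2) * cos (fst p - snd p)"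
        by (simp add: yy mult_ac)
      then show ?thesis
        by (simp add: F_def numeral_3_eq_3 w_def z_def e0y ip g1_def g2_def g3_def yy sq'[OF t] sq'[OF s] power2_eq_square algebra_simps)
    qed
    then have F_eq: "F = (\<lambda>p. (a\<^sup>2 * h 1 + 2 * a * (h t - h s)) + (g1 (cos (fst p - snd p)) - 2 * g2 (cos (fst p - snd p)) + g3 (cos (fst p - snd p))))" ..
    interpret U: finite_measure U unfolding U_def by (rule finite_measure_restrict_Icc)
    interpret UU: finite_measure "U \<Otimes>\<^sub>M U" by (intro finite_measure_pair_measure U.finite_measure_axioms)
    note D = double_integral_cos_diff[folded U_def]
    have Fint: "integrable (U \<Otimes>\<^sub>M U) F"
      unfolding F_eq using D(1)[OF cg(1)] D(1)[OF cg(2)] D(1)[OF cg(3)]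
      by (intro Bochner_Integration.integrable_add Bochner_Integration.integrable_diff
        integrable_mult_right UU.integrable_const)
    have hb: "\<bar>h (x \<bullet> y)\<bar> \<le> h 1" if "norm x = 1" "norm y = 1" for x y :: 'a
      using pos_def_kernel_abs_le[OF pd that] that hB by (simp add: norm_eq_1)
    have "\<bar>F p\<bar> \<le> (\<Sum>k<3. \<Sum>l<3. \<bar>w k * w l\<bar> * h 1)" for p
      unfolding F_def by (intro order_trans[OF sum_abs] sum_mono) (auto simp: abs_mult intro!: mult_left_mono hb nz)
    then have "0 \<le> (\<integral>p. F p \<partial>(U \<Otimes>\<^sub>M U))"
    proof (intro integral_pos_def_nonneg[OF U.finite_measure_axioms])
      fix n :: nat and x :: "nat \<Rightarrow> real"
      \<comment> \<open>Positive definiteness is applied to \<open>3 * n\<close> points at once: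
        each of the \<open>n\<close> angles on each of the three carriers, the point
        \<open>e0\<close> being repeated \<open>n\<close> times.\<close>
      have "0 \<le> (\<Sum>i\<in>{..<n} \<times> {..<3}. \<Sum>j\<in>{..<n} \<times> {..<3}. w (snd i) * w (snd j) * B (z (snd i) (x (fst i)), z (snd j) (x (fst j))))"
        by (rule pos_def_kernel_sum_finite[OF pd, where c="\<lambda>i. w (snd i)" and x="\<lambda>i. z (snd i) (x (fst i))"]) (auto simp: nz)
      also have "\<dots> = (\<Sum>i<n. \<Sum>k<3. \<Sum>j<n. \<Sum>l<3. w k * w l * h (z k (x i) \<bullet> z l (x j)))"
        by (simp add: sum.cartesian_product' hB nz)
      also have "\<dots> = (\<Sum>i<n. \<Sum>j<n. F (x i, x j))"
        unfolding F_def fst_conv snd_conv by (rule sum.cong[OF refl], rule sum.swap)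
      finally show "0 \<le> (\<Sum>i<n. \<Sum>j<n. F (x i, x j))" .
    qed (use Fint in auto)
    also have "(\<integral>p. F p \<partial>(U \<Otimes>\<^sub>M U)) = (\<integral>p. (a\<^sup>2 * h 1 + 2 * a * (h t - h s)) \<partial>(U \<Otimes>\<^sub>M U)) +
       ((\<integral>p. g1 (cos (fst p - snd p)) \<partial>(U \<Otimes>\<^sub>M U)) - 2 * (\<integral>p. g2 (cos (fst p - snd p)) \<partial>(U \<Otimes>\<^sub>M U)) + (\<integral>p. g3 (cos (fst p - snd p)) \<partial>(U \<Otimes>\<^sub>M U)))"
      unfolding F_eq using D(1)[OF cg(1)] D(1)[OF cg(2)] D(1)[OF cg(3)] by simp
    also have "\<dots> = (2 * pi)\<^sup>2 * (a\<^sup>2 * h 1 + 2 * a * (h t - h s)) + 4 * pi * Q"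
    proof -
      have "measure (U \<Otimes>\<^sub>M U) (space (U \<Otimes>\<^sub>M U)) = (2 * pi)\<^sup>2"
        by (simp add: space_pair_measure measure_def U.emeasure_pair_measure_Times enn2real_mult power2_eq_square)
          (simp add: U_def space_restrict_space emeasure_restrict_space)
      then show ?thesis unfolding D(2)[OF cg(1)] D(2)[OF cg(2)] D(2)[OF cg(3)]
        by (simp add: g1_def g2_def g3_def Q_def algebra_simps)
    qed
    also have "\<dots> = (4 * pi\<^sup>2) * (a\<^sup>2 * h 1 + 2 * a * (h t - h s) + Q / pi)"
      by (simp add: field_simps power2_eq_square)
    finally show ?thesis by (simp add: zero_le_mult_iff)
  qed
  have h1: "0 \<le> h 1" using pos_def_kernel_diag_nonneg[OF pd n1(1)[OF t]] hB[OF n1(1)[OF t] n1(1)[OF t]] ip by simp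
  show ?thesis
  proof (cases "h 1 = 0")
    case True
    have "h c = 0" if "\<bar>c\<bar> \<le> 1" for c
      using pos_def_kernel_abs_le[OF pd n1(1)[OF t] n1(2)[OF that, of 0]] hB[OF n1(1)[OF t] n1(2)[OF that, of 0]]
        hB[OF n1(1)[OF t] n1(1)[OF t]] hB[OF n1(2)[OF that, of 0] n1(2)[OF that, of 0]] True ip e0y n1(2)[OF that, of 0]
      by (simp add: norm_eq_1)
    then show ?thesis using t s True by simp
  next
    case False
    then have "0 < h 1" using h1 by simp
    \<comment> \<open>The value of \<open>a\<close> that minimizes the quadratic polynomial in
      \<open>main\<close>; its discriminant is the claim.\<close>
    moreover have "0 \<le> h 1 * ((- (h t - h s) / h 1)\<^sup>2 * h 1 + 2 * (- (h t - h s) / h 1) * (h t - h s) + Q / pi)"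
      using main[of "- (h t - h s) / h 1"] h1 by (intro mult_nonneg_nonneg)
    moreover have "k * ((- d / k)\<^sup>2 * k + 2 * (- d / k) * d + q) = - d\<^sup>2 + k * q" if "0 < k" for d k q :: real
      using that by (simp add: power2_eq_square field_simps)
    ultimately have "0 \<le> - (h t - h s)\<^sup>2 + h 1 * (Q / pi)" by metis
    then show ?thesis by (simp add: Q_def)
  qed
qed

text \<open>If \<open>t\<close> and \<open>s\<close> both approach \<open>c\<close>, the three
  densities behind \<open>latitude_inequality\<close> converge in L1 to the same density, and their
  coefficients 1, -2, 1 cancel. The error is relative to \<open>h 1\<close> and involves no other
  property of \<open>h\<close>, so the profiles in a sequence of counterexamples may vary freely;
  only the pairs of heights are passed to a convergent subsequence.\<close>

lemma zonal_equicontinuous: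
  fixes K :: "real set"
  assumes K: "compact K" "K \<subseteq> {-1<..<1}" and e: "0 < \<epsilon>" and dim: "3 \<le> DIM('a::euclidean_space)"
  obtains \<delta> where "0 < \<delta>"
    "\<And>(B :: 'a \<times> 'a \<Rightarrow> real) h t s. pos_def_kernel B \<Longrightarrow> continuous_on UNIV h \<Longrightarrow>
        (\<And>x y. norm x = 1 \<Longrightarrow> norm y = 1 \<Longrightarrow> B (x, y) = h (x \<bullet> y)) \<Longrightarrow> (\<And>u. \<bar>h u\<bar> \<le> h 1) \<Longrightarrow>
        t \<in> K \<Longrightarrow> \<bar>s - t\<bar> < \<delta> \<Longrightarrow> \<bar>s\<bar> < 1 \<and> \<bar>h t - h s\<bar> \<le> \<epsilon> * h 1"
proof -
  let ?P = "\<lambda>t s (h :: real \<Rightarrow> real). \<bar>s\<bar> < 1 \<and> \<bar>h t - h s\<bar> \<le> \<epsilon> * h 1"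
  let ?Q = "\<lambda>(B :: 'a \<times> 'a \<Rightarrow> real) h. pos_def_kernel B \<and> continuous_on UNIV h \<and>
        (\<forall>x y. norm x = 1 \<longrightarrow> norm y = 1 \<longrightarrow> B (x, y) = h (x \<bullet> y)) \<and> (\<forall>u. \<bar>h u\<bar> \<le> h 1)"
  have "\<exists>\<delta>>0. \<forall>B h t s. ?Q B h \<longrightarrow> t \<in> K \<longrightarrow> \<bar>s - t\<bar> < \<delta> \<longrightarrow> ?P t s h"
  proof (rule ccontr)
    assume neg: "\<not> ?thesis"
    have "\<exists>B h t s. ?Q B h \<and> t \<in> K \<and> \<bar>s - t\<bar> < inverse (Suc n) \<and> \<not> ?P t s h" for n
    proof (rule ccontr)
      assume "\<not> ?thesis"
      then have "\<forall>B h t s. ?Q B h \<longrightarrow> t \<in> K \<longrightarrow> \<bar>s - t\<bar> < inverse (Suc n) \<longrightarrow> ?P t s h" by blast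
      then have "\<exists>\<delta>>0. \<forall>B h t s. ?Q B h \<longrightarrow> t \<in> K \<longrightarrow> \<bar>s - t\<bar> < \<delta> \<longrightarrow> ?P t s h"
        by (intro exI[of _ "inverse (Suc n)"] conjI) (simp, assumption)
      with neg show False ..
    qed
    then obtain B h t s where Q: "\<And>n::nat. ?Q (B n) (h n)" and tK: "\<And>n. t n \<in> K"
      and st: "\<And>n. \<bar>s n - t n\<bar> < inverse (Suc n)" and nP: "\<And>n. \<not> ?P (t n) (s n) (h n)" by metis
    obtain c r where c: "c \<in> K" and r: "strict_mono r" and tr: "(t \<circ> r) \<longlonglongrightarrow> c"
      using K(1) tK unfolding compact_def by metis
    have c1: "\<bar>c\<bar> < 1" using subsetD[OF K(2) c] by (simp add: abs_less_iff)
    have "(\<lambda>n. s n - t n) \<longlonglongrightarrow> 0"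
      by (rule Lim_null_comparison[OF _ LIMSEQ_inverse_real_of_nat]) (use st less_imp_le in \<open>auto intro!: always_eventually\<close>)
    from tendsto_add[OF LIMSEQ_subseq_LIMSEQ[OF this r] tr] have sr: "(\<lambda>n. s (r n)) \<longlonglongrightarrow> c" by (simp add: o_def)
    have tr: "(\<lambda>n. t (r n)) \<longlonglongrightarrow> c" using tr by (simp add: o_def)
    have "\<forall>\<^sub>F n in sequentially. \<bar>s (r n)\<bar> < 1"
      using order_tendstoD(2)[OF tendsto_rabs[OF sr] c1] .
    then obtain N where N: "\<And>n. N \<le> n \<Longrightarrow> \<bar>s (r n)\<bar> < 1" by (auto simp: eventually_sequentially)
    \<comment> \<open>After the shift by \<open>N\<close> all heights are below 1 in absolute value,
      so \<open>?P\<close> can fail only through its second half.\<close>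
    define \<tau> \<sigma> g where "\<tau> n = t (r (n + N))" and "\<sigma> n = s (r (n + N))" and "g n = h (r (n + N))" for n
    have \<tau>: "\<tau> \<longlonglongrightarrow> c" and \<sigma>: "\<sigma> \<longlonglongrightarrow> c"
      unfolding \<tau>_def \<sigma>_def using LIMSEQ_ignore_initial_segment tr sr by blast+
    have \<tau>1: "\<bar>\<tau> n\<bar> < 1" and \<sigma>1: "\<bar>\<sigma> n\<bar> < 1" for n
      using subsetD[OF K(2) tK[of "r (n + N)"]] N[of "n + N"] by (simp_all add: \<tau>_def \<sigma>_def abs_less_iff)
    have bad: "\<epsilon> * g n 1 < \<bar>g n (\<tau> n) - g n (\<sigma> n)\<bar>" for n
      using nP[of "r (n + N)"] \<sigma>1[of n] by (auto simp: g_def \<tau>_def \<sigma>_def)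
    define L where "L \<alpha> \<beta> = (\<integral>u. \<bar>arcsine \<alpha> \<beta> u - arcsine (c * c) (1 - c\<^sup>2) u\<bar> \<partial>lborel)" for \<alpha> \<beta>
    have pos: "0 < 1 - u\<^sup>2" if "\<bar>u\<bar> < 1" for u :: real using that by (simp add: abs_square_less_1)
    have lims: "(\<lambda>n. L (\<tau> n * \<tau> n) (1 - (\<tau> n)\<^sup>2)) \<longlonglongrightarrow> 0"
      "(\<lambda>n. L (\<tau> n * \<sigma> n) (sqrt (1 - (\<tau> n)\<^sup>2) * sqrt (1 - (\<sigma> n)\<^sup>2))) \<longlonglongrightarrow> 0"
      "(\<lambda>n. L (\<sigma> n * \<sigma> n) (1 - (\<sigma> n)\<^sup>2)) \<longlonglongrightarrow> 0"
    proof -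
      have "(\<lambda>n. sqrt (1 - (\<tau> n)\<^sup>2) * sqrt (1 - (\<sigma> n)\<^sup>2)) \<longlonglongrightarrow> sqrt (1 - c\<^sup>2) * sqrt (1 - c\<^sup>2)"
        by (intro tendsto_intros \<tau> \<sigma>)
      then have *: "(\<lambda>n. sqrt (1 - (\<tau> n)\<^sup>2) * sqrt (1 - (\<sigma> n)\<^sup>2)) \<longlonglongrightarrow> 1 - c\<^sup>2"
        using pos[OF c1] by simp
      have p: "0 < 1 - (\<tau> n)\<^sup>2" "0 < 1 - (\<sigma> n)\<^sup>2" for n using pos[OF \<tau>1] pos[OF \<sigma>1] .
      have p2: "0 < sqrt (1 - (\<tau> n)\<^sup>2) * sqrt (1 - (\<sigma> n)\<^sup>2)" for n using p by simp
      show "(\<lambda>n. L (\<tau> n * \<tau> n) (1 - (\<tau> n)\<^sup>2)) \<longlonglongrightarrow> 0"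
        unfolding L_def
        by (rule arcsine_L1_continuous[OF tendsto_mult[OF \<tau> \<tau>] tendsto_diff[OF tendsto_const tendsto_power[OF \<tau>]] pos[OF c1] p(1)])
      show "(\<lambda>n. L (\<tau> n * \<sigma> n) (sqrt (1 - (\<tau> n)\<^sup>2) * sqrt (1 - (\<sigma> n)\<^sup>2))) \<longlonglongrightarrow> 0"
        unfolding L_def by (rule arcsine_L1_continuous[OF tendsto_mult[OF \<tau> \<sigma>] * pos[OF c1] p2])
      show "(\<lambda>n. L (\<sigma> n * \<sigma> n) (1 - (\<sigma> n)\<^sup>2)) \<longlonglongrightarrow> 0"
        unfolding L_def
        by (rule arcsine_L1_continuous[OF tendsto_mult[OF \<sigma> \<sigma>] tendsto_diff[OF tendsto_const tendsto_power[OF \<sigma>]] pos[OF c1] p(2)])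
    qed
    define S where "S n = L (\<tau> n * \<tau> n) (1 - (\<tau> n)\<^sup>2) +
       2 * L (\<tau> n * \<sigma> n) (sqrt (1 - (\<tau> n)\<^sup>2) * sqrt (1 - (\<sigma> n)\<^sup>2)) + L (\<sigma> n * \<sigma> n) (1 - (\<sigma> n)\<^sup>2)" for n
    have S0: "S \<longlonglongrightarrow> 0" unfolding S_def using tendsto_add[OF tendsto_add[OF lims(1) tendsto_mult_left[OF lims(2), of 2]] lims(3)] by simp
    have "\<epsilon>\<^sup>2 < S n / pi" for n
    proof -
      have Qn: "pos_def_kernel (B (r (n + N)))" "continuous_on UNIV (g n)" "\<And>u. \<bar>g n u\<bar> \<le> g n 1"
        "\<And>x y. norm x = 1 \<Longrightarrow> norm y = 1 \<Longrightarrow> B (r (n + N)) (x, y) = g n (x \<bullet> y)"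
        using Q[of "r (n + N)"] by (auto simp: g_def)
      have gm: "g n \<in> borel_measurable borel" using Qn(2) by (rule borel_measurable_continuous_onI)
      have g1: "0 \<le> g n 1" using Qn(3)[of 1] by linarith
      define J where "J = (\<integral>u. g n u * arcsine (c * c) (1 - c\<^sup>2) u \<partial>lborel)"
      \<comment> \<open>All three integrals are compared with one number \<open>J\<close>, which
        cancels in their combination.\<close>
      have IJ: "\<bar>(LBINT x:{0..pi}. g n (\<alpha> - \<beta> * cos x)) - J\<bar> \<le> g n 1 * L \<alpha> \<beta>" if "0 < \<beta>" for \<alpha> \<beta>
      proof -
        note i1 = integral_cos_arcsine[OF that gm Qn(3), of \<alpha>]
          and i2 = integral_cos_arcsine(1)[OF pos[OF c1] gm Qn(3), of "c * c"]
        have "\<bar>(LBINT x:{0..pi}. g n (\<alpha> - \<beta> * cos x)) - J\<bar> =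
          \<bar>\<integral>u. g n u * (arcsine \<alpha> \<beta> u - arcsine (c * c) (1 - c\<^sup>2) u) \<partial>lborel\<bar>"
          unfolding i1(2) J_def using i1(1) i2 by (simp add: right_diff_distrib)
        also have "\<dots> \<le> (\<integral>u. g n 1 * \<bar>arcsine \<alpha> \<beta> u - arcsine (c * c) (1 - c\<^sup>2) u\<bar> \<partial>lborel)"
        proof (rule integral_abs_bound_integral)
          show "integrable lborel (\<lambda>u. g n u * (arcsine \<alpha> \<beta> u - arcsine (c * c) (1 - c\<^sup>2) u))"
            using i1(1) i2 by (simp add: right_diff_distrib)
          show "integrable lborel (\<lambda>u. g n 1 * \<bar>arcsine \<alpha> \<beta> u - arcsine (c * c) (1 - c\<^sup>2) u\<bar>)"
            using integrable_arcsine that pos[OF c1] by (intro integrable_mult_right integrable_abs) auto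
        qed (auto simp: abs_mult intro!: mult_right_mono Qn(3))
        finally show ?thesis by (simp add: L_def)
      qed
      have "(\<epsilon> * g n 1)\<^sup>2 < (g n (\<tau> n) - g n (\<sigma> n))\<^sup>2"
        using power_strict_mono[OF bad[of n], of 2] e g1 by simp
      also have "\<dots> \<le> g n 1 / pi * ((LBINT x:{0..pi}. g n (\<tau> n * \<tau> n - (1 - (\<tau> n)\<^sup>2) * cos x))
         - 2 * (LBINT x:{0..pi}. g n (\<tau> n * \<sigma> n - sqrt (1 - (\<tau> n)\<^sup>2) * sqrt (1 - (\<sigma> n)\<^sup>2) * cos x))
         + (LBINT x:{0..pi}. g n (\<sigma> n * \<sigma> n - (1 - (\<sigma> n)\<^sup>2) * cos x)))"
        using \<tau>1 \<sigma>1 less_imp_le by (intro latitude_inequality[OF dim Qn(1,2,4)]) auto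
      also have "\<dots> \<le> g n 1 / pi * (g n 1 * S n)"
      proof (rule mult_left_mono)
        show "(LBINT x:{0..pi}. g n (\<tau> n * \<tau> n - (1 - (\<tau> n)\<^sup>2) * cos x))
         - 2 * (LBINT x:{0..pi}. g n (\<tau> n * \<sigma> n - sqrt (1 - (\<tau> n)\<^sup>2) * sqrt (1 - (\<sigma> n)\<^sup>2) * cos x))
         + (LBINT x:{0..pi}. g n (\<sigma> n * \<sigma> n - (1 - (\<sigma> n)\<^sup>2) * cos x)) \<le> g n 1 * S n"
          using IJ[OF pos[OF \<tau>1[of n]], of "\<tau> n * \<tau> n"] IJ[OF pos[OF \<sigma>1[of n]], of "\<sigma> n * \<sigma> n"]
            IJ[of "sqrt (1 - (\<tau> n)\<^sup>2) * sqrt (1 - (\<sigma> n)\<^sup>2)" "\<tau> n * \<sigma> n"] pos[OF \<tau>1[of n]] pos[OF \<sigma>1[of n]]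
          unfolding S_def distrib_left by simp
      qed (use g1 in simp)
      \<comment> \<open>Both sides carry the square of \<open>g n 1\<close>, which drops out; the
        remaining bound on \<open>\<epsilon>^2\<close> is independent of the kernels and tends to
        0.\<close>
      finally have *: "\<epsilon>\<^sup>2 * (g n 1)\<^sup>2 < S n / pi * (g n 1)\<^sup>2"
        by (simp add: power_mult_distrib power2_eq_square mult_ac)
      then show ?thesis by (rule mult_right_less_imp_less) simp
    qed
    then have "\<epsilon>\<^sup>2 \<le> 0 / pi"
      by (intro LIMSEQ_le_const[OF tendsto_divide[OF S0 tendsto_const]]) (auto intro: less_imp_le)
    then show False using e by simp
  qed
  then obtain \<delta> where d: "0 < \<delta>" "\<forall>B h t s. ?Q B h \<longrightarrow> t \<in> K \<longrightarrow> \<bar>s - t\<bar> < \<delta> \<longrightarrow> ?P t s h" by blast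
  show ?thesis
  proof (rule that[OF d(1)])
    fix B :: "'a \<times> 'a \<Rightarrow> real" and h t s
    assume "pos_def_kernel B" "continuous_on UNIV h" "\<And>x y. norm x = 1 \<Longrightarrow> norm y = 1 \<Longrightarrow> B (x, y) = h (x \<bullet> y)"
      "\<And>u. \<bar>h u\<bar> \<le> h 1" "t \<in> K" "\<bar>s - t\<bar> < \<delta>"
    then show "?P t s h" by (intro d(2)[rule_format]) auto
  qed
qed

section \<open>Averages near a fixed inner product\<close>

text \<open>Pairs of unit vectors with the same inner product are related by a rotation, so the
  invariant companion is a function \<open>h\<close> of the inner product. Its value at 1 is the
  trace divided by the total area, which is how the trace enters all later estimates.\<close>

lemma zonal_profile:
  fixes A :: "(real^'n) \<times> (real^'n) \<Rightarrow> real"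
  assumes dim: "3 \<le> CARD('n)" and cont: "continuous_on (sphere 0 1 \<times> sphere 0 1) A" and pd: "pos_def_kernel A"
  obtains B :: "(real^'n) \<times> (real^'n) \<Rightarrow> real" and h where
    "pos_def_kernel B" "continuous_on UNIV h" "\<And>x y. norm x = 1 \<Longrightarrow> norm y = 1 \<Longrightarrow> B (x, y) = h (x \<bullet> y)"
    "\<And>u. \<bar>h u\<bar> \<le> h 1" "(\<integral>x. A (x, x) \<partial>\<omega>) = h 1 * measure \<omega> (sphere (0::real^'n) 1)"
    "\<And>w. continuous_on UNIV w \<Longrightarrow> (\<integral>p. w (fst p \<bullet> snd p) * A p \<partial>(\<omega> \<Otimes>\<^sub>M \<omega>)) =
        (\<integral>p. w (fst p \<bullet> snd p) * h (fst p \<bullet> snd p) \<partial>(\<omega> \<Otimes>\<^sub>M (\<omega> :: (real^'n) measure)))"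
    "\<And>t. \<bar>t\<bar> \<le> 1 \<Longrightarrow> (\<forall>x y. norm x = 1 \<longrightarrow> norm y = 1 \<longrightarrow> x \<bullet> y = t \<longrightarrow> A (x, y) = 0) \<Longrightarrow> h t = 0"
proof -
  obtain B where ZB: "zonal_companion A B" and contB: "continuous_on (sphere 0 1 \<times> sphere 0 1) B"
    and inv: "\<And>R x y. orthogonal_transformation R \<Longrightarrow> norm x = 1 \<Longrightarrow> norm y = 1 \<Longrightarrow> B (R x, R y) = B (x, y)"
    using invariant_zonal_companion[OF cont pd] by metis
  have pB: "pos_def_kernel B" by (rule zonal_companionD(1)[OF ZB])
  obtain T where T: "T \<subseteq> (Basis :: (real^'n) set)" "card T = 2"
    by (rule obtain_subset_with_card_n[of 2 "Basis :: (real^'n) set"]) (use dim in auto)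
  then obtain e0 e1 where e: "T = {e0, e1}" "e0 \<noteq> e1" by (auto simp: card_2_iff)
  have ip: "e0 \<bullet> e0 = 1" "e1 \<bullet> e1 = 1" "e0 \<bullet> e1 = 0" "e1 \<bullet> e0 = 0"
    using e T(1) by (auto simp: inner_Basis)
  \<comment> \<open>Clamping extends the profile to the whole real line, where it stays continuous
    and bounded by \<open>h 1\<close>; the substitution lemmas ask for such an
    \<open>h\<close>.\<close>
  define cl where "cl u = max (- 1) (min 1 u)" for u :: real
  define y where "y u = cl u *\<^sub>R e0 + sqrt (1 - (cl u)\<^sup>2) *\<^sub>R e1" for u
  have cl1: "\<bar>cl u\<bar> \<le> 1" for u by (auto simp: cl_def)
  have cl: "cl u = u" if "\<bar>u\<bar> \<le> 1" for u using that by (auto simp: cl_def)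
  have yy: "y u \<bullet> y u = 1" for u
    using cl1[of u] by (simp add: y_def inner_add_left inner_add_right ip abs_square_le_1 flip: power2_eq_square)
  then have ny: "norm (y u) = 1" for u by (simp add: norm_eq_1)
  have n0: "norm e0 = 1" using ip by (simp add: norm_eq_1)
  have e0y: "e0 \<bullet> y u = cl u" for u by (simp add: y_def inner_add_right ip)
  define h where "h u = B (e0, y u)" for u
  have conth: "continuous_on UNIV h"
    unfolding h_def y_def cl_def
    by (rule continuous_on_compose2[OF contB]) (use ny n0 in \<open>auto intro!: continuous_intros simp: y_def cl_def\<close>)
  have Bh: "B (x, z) = h (x \<bullet> z)" if xz: "norm x = 1" "norm z = 1" for x z
  proof -
    have "\<bar>x \<bullet> z\<bar> \<le> 1" using Cauchy_Schwarz_ineq2[of x z] xz by simp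
    then have "x \<bullet> z = e0 \<bullet> y (x \<bullet> z)" by (simp add: e0y cl)
    then obtain R where "orthogonal_transformation R" "R x = e0" "R z = y (x \<bullet> z)"
      using orthogonal_transformation_two_points[OF xz n0 ny] by metis
    then show ?thesis using inv[OF _ xz, of R] by (simp add: h_def)
  qed
  have diag: "B (x, x) = h 1" if "norm x = 1" for x using Bh[OF that that] that by (simp add: norm_eq_1)
  show ?thesis
  proof (rule that[OF pB conth Bh])
    show "\<bar>h u\<bar> \<le> h 1" for u
      using pos_def_kernel_abs_le[OF pB n0 ny, of u] diag[OF n0] diag[OF ny, of u] by (simp add: h_def[of u])
    have "(\<integral>x. A (x, x) \<partial>\<omega>) = (\<integral>x. B (x, x) \<partial>\<omega>)" by (rule zonal_companionD(2)[OF ZB, symmetric])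
    also have "\<dots> = (\<integral>x. h 1 \<partial>(\<omega> :: (real^'n) measure))"
      by (intro Bochner_Integration.integral_cong refl) (simp add: diag)
    finally show "(\<integral>x. A (x, x) \<partial>\<omega>) = h 1 * measure \<omega> (sphere (0::real^'n) 1)" by simp
    show "(\<integral>p. w (fst p \<bullet> snd p) * A p \<partial>(\<omega> \<Otimes>\<^sub>M \<omega>)) =
        (\<integral>p. w (fst p \<bullet> snd p) * h (fst p \<bullet> snd p) \<partial>(\<omega> \<Otimes>\<^sub>M (\<omega> :: (real^'n) measure)))"
      if w: "continuous_on UNIV w" for w
      unfolding zonal_companionD(3)[OF ZB w, symmetric]
      by (intro Bochner_Integration.integral_cong refl) (auto simp: Bh)
    show "h t = 0" if "\<bar>t\<bar> \<le> 1" "\<forall>x y. norm x = 1 \<longrightarrow> norm y = 1 \<longrightarrow> x \<bullet> y = t \<longrightarrow> A (x, y) = 0" for t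
      unfolding h_def by (rule zonal_companion_zero[OF ZB that(2) n0 ny]) (simp add: e0y cl that(1))
  qed
qed

section \<open>Normalized bumps in the inner product\<close>

definition tent :: "real \<Rightarrow> real \<Rightarrow> real \<Rightarrow> real" where
  "tent t \<delta> u = max 0 (\<delta> - \<bar>u - t\<bar>)"

lemma continuous_on_tent: "continuous_on S (tent t \<delta>)"
  unfolding tent_def by (intro continuous_intros)

lemma tent_nonneg: "0 \<le> tent t \<delta> u"
  by (simp add: tent_def)

lemma tent_support: "tent t \<delta> u \<noteq> 0 \<Longrightarrow> \<bar>u - t\<bar> < \<delta>"
  by (auto simp: tent_def max_def split: if_splits)

text \<open>The normalizing integral depends on the sphere, hence the type argument. Total mass 1
  over all pairs makes integration against a bump an average over pairs with inner product near
  \<open>t\<close>.\<close>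

definition bump :: "'a::euclidean_space itself \<Rightarrow> real \<Rightarrow> real \<Rightarrow> real \<Rightarrow> real" where
  "bump _ t \<delta> u = tent t \<delta> u / (\<integral>p. tent t \<delta> (fst p \<bullet> snd p) \<partial>(\<omega> \<Otimes>\<^sub>M (\<omega> :: 'a measure)))"

lemma continuous_on_inner_sphere:
  fixes w :: "real \<Rightarrow> real"
  assumes "continuous_on UNIV w"
  shows "continuous_on S (\<lambda>p :: 'a::euclidean_space \<times> 'a. w (fst p \<bullet> snd p))"
  by (rule continuous_on_compose2[OF assms]) (auto intro!: continuous_intros)

lemma exists_inner_eq:
  assumes "2 \<le> DIM('a::euclidean_space)" "\<bar>t\<bar> \<le> 1"
  obtains x y :: "'a::euclidean_space" where "norm x = 1" "norm y = 1" "x \<bullet> y = t"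
proof -
  obtain T where T: "T \<subseteq> (Basis :: 'a set)" "card T = 2"
    by (rule obtain_subset_with_card_n[OF assms(1)])
  then obtain e0 e1 where e: "T = {e0, e1}" "e0 \<noteq> e1" by (auto simp: card_2_iff)
  have ip: "e0 \<bullet> e0 = 1" "e1 \<bullet> e1 = 1" "e0 \<bullet> e1 = 0" "e1 \<bullet> e0 = 0"
    using e T(1) by (auto simp: inner_Basis)
  have "t\<^sup>2 \<le> 1" using assms(2) by (simp add: abs_square_le_1)
  then show ?thesis
    using ip by (intro that[of e0 "t *\<^sub>R e0 + sqrt (1 - t\<^sup>2) *\<^sub>R e1"])
      (simp_all add: norm_eq_1 inner_add_left inner_add_right flip: power2_eq_square)
qed

lemma integral_tent_pos:
  assumes "2 \<le> DIM('a::euclidean_space)" "\<bar>t\<bar> \<le> 1" "0 < \<delta>"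
  shows "0 < (\<integral>p. tent t \<delta> (fst p \<bullet> snd p) \<partial>(\<omega> \<Otimes>\<^sub>M (\<omega> :: 'a measure)))" (is "0 < ?I")
proof (rule ccontr)
  assume "\<not> 0 < ?I"
  moreover have "0 \<le> ?I" by (intro integral_nonneg_AE) (auto simp: tent_nonneg)
  ultimately have I: "?I = 0" by simp
  obtain x y :: 'a where xy: "norm x = 1" "norm y = 1" "x \<bullet> y = t" using exists_inner_eq[OF assms(1,2)] .
  have "tent t \<delta> (fst (x, y) \<bullet> snd (x, y)) = 0"
    by (rule integral_surface_pair_eq_0_imp[OF continuous_on_inner_sphere[OF continuous_on_tent] _ I xy(1,2)])
      (simp add: tent_nonneg)
  then show False using xy assms(3) by (simp add: tent_def)
qed

lemma continuous_on_bump: "continuous_on S (bump TYPE('a::euclidean_space) t \<delta>)"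
  unfolding bump_def divide_inverse by (intro continuous_intros continuous_on_tent)

lemma bump_nonneg: "0 \<le> bump TYPE('a::euclidean_space) t \<delta> u"
  unfolding bump_def by (intro divide_nonneg_nonneg integral_nonneg_AE) (auto simp: tent_nonneg)

lemma bump_support: "bump TYPE('a::euclidean_space) t \<delta> u \<noteq> 0 \<Longrightarrow> \<bar>u - t\<bar> < \<delta>"
  using tent_support by (auto simp: bump_def)

lemma integrable_inner_kernel:
  assumes "continuous_on UNIV (w :: real \<Rightarrow> real)"
  shows "integrable (\<omega> \<Otimes>\<^sub>M (\<omega> :: 'a::euclidean_space measure)) (\<lambda>p. w (fst p \<bullet> snd p))"
  by (intro integrable_continuous_on_surface_pair continuous_on_inner_sphere assms)

lemma integral_bump:
  assumes "2 \<le> DIM('a::euclidean_space)" "\<bar>t\<bar> \<le> 1" "0 < \<delta>"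
  shows "(\<integral>p. bump TYPE('a) t \<delta> (fst p \<bullet> snd p) \<partial>(\<omega> \<Otimes>\<^sub>M (\<omega> :: 'a measure))) = 1"
  using integral_tent_pos[OF assms] by (simp add: bump_def)

text \<open>Against a function of the inner product, \<open>A\<close> may be replaced by its profile
  \<open>h\<close>, and the average of \<open>h\<close> over a narrow bump is close to
  \<open>h t\<close> with an error proportional to the trace. So \<open>\<delta>0\<close> does not
  depend on \<open>A\<close>. The comparison of two widths serves the densities, whose kernels need
  not vanish anywhere; the second estimate serves feasible kernels.\<close>

lemma bump_average:
  fixes K :: "real set"
  assumes K: "compact K" "K \<subseteq> {-1<..<1}" and e: "0 < \<epsilon>" and dim: "3 \<le> CARD('n::finite)"
  obtains \<delta>0 where "0 < \<delta>0"
    "\<And>(A :: (real^'n) \<times> (real^'n) \<Rightarrow> real) t \<delta> \<delta>'.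
       continuous_on (sphere 0 1 \<times> sphere 0 1) A \<Longrightarrow> pos_def_kernel A \<Longrightarrow> t \<in> K \<Longrightarrow>
       0 < \<delta> \<Longrightarrow> \<delta> \<le> \<delta>0 \<Longrightarrow> 0 < \<delta>' \<Longrightarrow> \<delta>' \<le> \<delta>0 \<Longrightarrow>
       \<bar>(\<integral>p. bump TYPE(real^'n) t \<delta> (fst p \<bullet> snd p) * A p \<partial>(\<omega> \<Otimes>\<^sub>M \<omega>)) -
        (\<integral>p. bump TYPE(real^'n) t \<delta>' (fst p \<bullet> snd p) * A p \<partial>(\<omega> \<Otimes>\<^sub>M \<omega>))\<bar> \<le> \<epsilon> * (\<integral>x. A (x, x) \<partial>\<omega>)"
    "\<And>(A :: (real^'n) \<times> (real^'n) \<Rightarrow> real) t \<delta>.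
       continuous_on (sphere 0 1 \<times> sphere 0 1) A \<Longrightarrow> pos_def_kernel A \<Longrightarrow> t \<in> K \<Longrightarrow>
       0 < \<delta> \<Longrightarrow> \<delta> \<le> \<delta>0 \<Longrightarrow> (\<And>x y. norm x = 1 \<Longrightarrow> norm y = 1 \<Longrightarrow> x \<bullet> y = t \<Longrightarrow> A (x, y) = 0) \<Longrightarrow>
       \<bar>\<integral>p. bump TYPE(real^'n) t \<delta> (fst p \<bullet> snd p) * A p \<partial>(\<omega> \<Otimes>\<^sub>M \<omega>)\<bar> \<le> \<epsilon> * (\<integral>x. A (x, x) \<partial>\<omega>)"
proof -
  let ?\<Omega> = "measure \<omega> (sphere (0::real^'n) 1)"
  obtain a0 :: "real^'n" where "norm a0 = 1" using vector_choose_size[of 1] by auto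
  then have \<Omega>: "0 < ?\<Omega>" using measure_surface_pos[of UNIV a0] by simp
  have dim3: "3 \<le> DIM(real^'n)" and dim2: "2 \<le> DIM(real^'n)" using dim by auto
  \<comment> \<open>The total area converts \<open>h 1\<close> into the trace, and the factor 1/2
    pays for comparing both widths with \<open>h t\<close>.\<close>
  define \<epsilon>' where "\<epsilon>' = \<epsilon> * ?\<Omega> / 2"
  have e': "0 < \<epsilon>'" using e \<Omega> by (simp add: \<epsilon>'_def)
  obtain d where d: "0 < d" "\<And>(B :: (real^'n) \<times> (real^'n) \<Rightarrow> real) h t s. pos_def_kernel B \<Longrightarrow> continuous_on UNIV h \<Longrightarrow>
        (\<And>x y. norm x = 1 \<Longrightarrow> norm y = 1 \<Longrightarrow> B (x, y) = h (x \<bullet> y)) \<Longrightarrow> (\<And>u. \<bar>h u\<bar> \<le> h 1) \<Longrightarrow>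
        t \<in> K \<Longrightarrow> \<bar>s - t\<bar> < d \<Longrightarrow> \<bar>s\<bar> < 1 \<and> \<bar>h t - h s\<bar> \<le> \<epsilon>' * h 1"
    by (rule zonal_equicontinuous[OF K e' dim3]) (rule that, assumption, blast)
  have main: "\<exists>H. (\<forall>t\<in>K. \<forall>\<delta>. 0 < \<delta> \<and> \<delta> \<le> d \<longrightarrow>
      \<bar>(\<integral>p. bump TYPE(real^'n) t \<delta> (fst p \<bullet> snd p) * A p \<partial>(\<omega> \<Otimes>\<^sub>M \<omega>)) - H t\<bar> \<le> \<epsilon> / 2 * (\<integral>x. A (x, x) \<partial>\<omega>)) \<and>
      (\<forall>t\<in>K. (\<forall>x y. norm x = 1 \<longrightarrow> norm y = 1 \<longrightarrow> x \<bullet> y = t \<longrightarrow> A (x, y) = 0) \<longrightarrow> H t = 0)"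
    if A: "continuous_on (sphere 0 1 \<times> sphere 0 1) A" "pos_def_kernel A" for A :: "(real^'n) \<times> (real^'n) \<Rightarrow> real"
  proof -
    obtain B :: "(real^'n) \<times> (real^'n) \<Rightarrow> real" and h where Bh:
      "pos_def_kernel B" "continuous_on UNIV h" "\<And>x y. norm x = 1 \<Longrightarrow> norm y = 1 \<Longrightarrow> B (x, y) = h (x \<bullet> y)"
      "\<And>u. \<bar>h u\<bar> \<le> h 1" and tr: "(\<integral>x. A (x, x) \<partial>\<omega>) = h 1 * ?\<Omega>"
      and w: "\<And>w. continuous_on UNIV w \<Longrightarrow> (\<integral>p. w (fst p \<bullet> snd p) * A p \<partial>(\<omega> \<Otimes>\<^sub>M \<omega>)) =
        (\<integral>p. w (fst p \<bullet> snd p) * h (fst p \<bullet> snd p) \<partial>(\<omega> \<Otimes>\<^sub>M (\<omega> :: (real^'n) measure)))"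
      and z: "\<And>t. \<bar>t\<bar> \<le> 1 \<Longrightarrow> (\<forall>x y. norm x = 1 \<longrightarrow> norm y = 1 \<longrightarrow> x \<bullet> y = t \<longrightarrow> A (x, y) = 0) \<Longrightarrow> h t = 0"
      by (rule zonal_profile[OF dim A]) (rule that)
    show ?thesis
    proof (intro exI[of _ h] conjI ballI allI impI)
      fix t \<delta> assume t: "t \<in> K" and \<delta>: "0 < \<delta> \<and> \<delta> \<le> d"
      let ?b = "\<lambda>p :: (real^'n) \<times> (real^'n). bump TYPE(real^'n) t \<delta> (fst p \<bullet> snd p)"
      have t1: "\<bar>t\<bar> \<le> 1" using subsetD[OF K(2) t] by (simp add: abs_le_iff)
      have ib: "integrable (\<omega> \<Otimes>\<^sub>M \<omega>) ?b" by (intro integrable_inner_kernel continuous_on_bump)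
      have ibh: "integrable (\<omega> \<Otimes>\<^sub>M \<omega>) (\<lambda>p. ?b p * h (fst p \<bullet> snd p))"
        by (intro integrable_continuous_on_surface_pair continuous_on_mult continuous_on_inner_sphere continuous_on_bump Bh(2))
      have "(\<integral>p. ?b p * A p \<partial>(\<omega> \<Otimes>\<^sub>M \<omega>)) - h t = (\<integral>p. ?b p * (h (fst p \<bullet> snd p) - h t) \<partial>(\<omega> \<Otimes>\<^sub>M \<omega>))"
        using w[OF continuous_on_bump, of t \<delta>] ib ibh integral_bump[OF dim2 t1, of \<delta>] \<delta>
        by (simp add: right_diff_distrib)
      also have "\<bar>\<dots>\<bar> \<le> (\<integral>p. ?b p * (\<epsilon>' * h 1) \<partial>(\<omega> \<Otimes>\<^sub>M \<omega>))"
      proof (rule integral_abs_bound_integral)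
        show "integrable (\<omega> \<Otimes>\<^sub>M \<omega>) (\<lambda>p. ?b p * (h (fst p \<bullet> snd p) - h t))"
          using ib ibh by (simp add: right_diff_distrib)
        fix p :: "(real^'n) \<times> (real^'n)"
        show "\<bar>?b p * (h (fst p \<bullet> snd p) - h t)\<bar> \<le> ?b p * (\<epsilon>' * h 1)"
        proof (cases "?b p = 0")
          case False
          then have near: "\<bar>fst p \<bullet> snd p - t\<bar> < d" using bump_support[OF False] \<delta> by linarith
          have "\<bar>h t - h (fst p \<bullet> snd p)\<bar> \<le> \<epsilon>' * h 1"
            by (rule conjunct2[OF d(2)]) (fact Bh t near)+
          then have "\<bar>h (fst p \<bullet> snd p) - h t\<bar> \<le> \<epsilon>' * h 1" by linarith
          then show ?thesis by (simp add: abs_mult bump_nonneg mult_left_mono)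
        qed simp
      qed (use ib in simp)
      also have "\<dots> = \<epsilon> / 2 * (\<integral>x. A (x, x) \<partial>\<omega>)"
        using integral_bump[OF dim2 t1, of \<delta>] \<delta> by (simp add: tr \<epsilon>'_def)
      finally show "\<bar>(\<integral>p. ?b p * A p \<partial>(\<omega> \<Otimes>\<^sub>M \<omega>)) - h t\<bar> \<le> \<epsilon> / 2 * (\<integral>x. A (x, x) \<partial>\<omega>)" .
    next
      fix t assume t: "t \<in> K" and "\<forall>x y. norm x = 1 \<longrightarrow> norm y = 1 \<longrightarrow> x \<bullet> y = t \<longrightarrow> A (x, y) = 0"
      moreover have "\<bar>t\<bar> \<le> 1" using subsetD[OF K(2) t] by (simp add: abs_le_iff)
      ultimately show "h t = 0" by (intro z) auto
    qed
  qed
  show ?thesis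
  proof (rule that[OF d(1)])
    fix A :: "(real^'n) \<times> (real^'n) \<Rightarrow> real" and t \<delta> \<delta>'
    assume A: "continuous_on (sphere 0 1 \<times> sphere 0 1) A" "pos_def_kernel A" and t: "t \<in> K"
      and \<delta>: "0 < \<delta>" "\<delta> \<le> d" "0 < \<delta>'" "\<delta>' \<le> d"
    obtain H where "\<forall>t\<in>K. \<forall>\<delta>. 0 < \<delta> \<and> \<delta> \<le> d \<longrightarrow>
      \<bar>(\<integral>p. bump TYPE(real^'n) t \<delta> (fst p \<bullet> snd p) * A p \<partial>(\<omega> \<Otimes>\<^sub>M \<omega>)) - H t\<bar> \<le> \<epsilon> / 2 * (\<integral>x. A (x, x) \<partial>\<omega>)"
      using main[OF A] by blast
    from this[rule_format, OF t, of \<delta>] this[rule_format, OF t, of \<delta>'] \<delta>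
    show "\<bar>(\<integral>p. bump TYPE(real^'n) t \<delta> (fst p \<bullet> snd p) * A p \<partial>(\<omega> \<Otimes>\<^sub>M \<omega>)) -
        (\<integral>p. bump TYPE(real^'n) t \<delta>' (fst p \<bullet> snd p) * A p \<partial>(\<omega> \<Otimes>\<^sub>M \<omega>))\<bar> \<le> \<epsilon> * (\<integral>x. A (x, x) \<partial>\<omega>)"
      by linarith
  next
    fix A :: "(real^'n) \<times> (real^'n) \<Rightarrow> real" and t \<delta>
    assume A: "continuous_on (sphere 0 1 \<times> sphere 0 1) A" "pos_def_kernel A" and t: "t \<in> K"
      and \<delta>: "0 < \<delta>" "\<delta> \<le> d" and z: "\<And>x y. norm x = 1 \<Longrightarrow> norm y = 1 \<Longrightarrow> x \<bullet> y = t \<Longrightarrow> A (x, y) = 0"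
    have tr: "0 \<le> (\<integral>x. A (x, x) \<partial>\<omega>)"
      by (intro integral_nonneg_AE AE_I2) (auto intro: pos_def_kernel_diag_nonneg[OF A(2)])
    obtain H where H: "\<forall>t\<in>K. \<forall>\<delta>. 0 < \<delta> \<and> \<delta> \<le> d \<longrightarrow>
      \<bar>(\<integral>p. bump TYPE(real^'n) t \<delta> (fst p \<bullet> snd p) * A p \<partial>(\<omega> \<Otimes>\<^sub>M \<omega>)) - H t\<bar> \<le> \<epsilon> / 2 * (\<integral>x. A (x, x) \<partial>\<omega>)"
      "\<forall>t\<in>K. (\<forall>x y. norm x = 1 \<longrightarrow> norm y = 1 \<longrightarrow> x \<bullet> y = t \<longrightarrow> A (x, y) = 0) \<longrightarrow> H t = 0"
      using main[OF A] by blast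
    have "H t = 0" using H(2) t z by blast
    moreover have "\<epsilon> / 2 * (\<integral>x. A (x, x) \<partial>\<omega>) \<le> \<epsilon> * (\<integral>x. A (x, x) \<partial>\<omega>)"
      using tr e by (intro mult_right_mono) auto
    ultimately show "\<bar>\<integral>p. bump TYPE(real^'n) t \<delta> (fst p \<bullet> snd p) * A p \<partial>(\<omega> \<Otimes>\<^sub>M \<omega>)\<bar> \<le> \<epsilon> * (\<integral>x. A (x, x) \<partial>\<omega>)"
      using H(1)[rule_format, OF t, of \<delta>] \<delta> by auto
  qed
qed

section \<open>Weak limits of densities\<close>

text \<open>A cube of side \<open>1 / 2 ^ m\<close> is named by its lower corner, which in general
  is not on the sphere.\<close>

definition dyadic_cell :: "nat \<Rightarrow> 'a::euclidean_space \<Rightarrow> 'a" where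
  "dyadic_cell m x = (\<Sum>b\<in>Basis. of_int \<lfloor>2 ^ m * (x \<bullet> b)\<rfloor> *\<^sub>R b)"

lemma dyadic_cell_eq_iff:
  "dyadic_cell m x = dyadic_cell m y \<longleftrightarrow> (\<forall>b\<in>Basis. \<lfloor>2 ^ m * (x \<bullet> b)\<rfloor> = \<lfloor>2 ^ m * (y \<bullet> b)\<rfloor>)"
  unfolding dyadic_cell_def by (subst euclidean_eq_iff) simp

lemma dyadic_cell_measurable [measurable]: "dyadic_cell m \<in> borel_measurable borel"
  unfolding dyadic_cell_def by measurable

text \<open>The coordinate index at level \<open>m\<close> is the one at level \<open>k\<close>
  divided by \<open>2 ^ (k - m)\<close>, rounded down.\<close>

lemma dyadic_cell_mono:
  assumes "m \<le> k" "dyadic_cell k x = dyadic_cell k y"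
  shows "dyadic_cell m x = dyadic_cell m y"
proof -
  have "\<lfloor>2 ^ m * u\<rfloor> = \<lfloor>2 ^ k * u\<rfloor> div 2 ^ (k - m)" for u :: real
  proof -
    have "(2::real) ^ m * u = (2 ^ k * u) / real_of_int (2 ^ (k - m))"
    proof -
      have "(2::real) ^ k = 2 ^ m * 2 ^ (k - m)" using assms(1) by (simp flip: power_add)
      then show ?thesis by simp
    qed
    then show ?thesis by (simp only: floor_divide_real_eq_div zero_le_power zero_le_numeral)
  qed
  then show ?thesis using assms(2) unfolding dyadic_cell_eq_iff by simp
qed

lemma dyadic_cell_dist:
  fixes x y :: "'a::euclidean_space"
  assumes "dyadic_cell m x = dyadic_cell m y"
  shows "dist x y \<le> DIM('a) / 2 ^ m"
proof -
  have "\<bar>(x - y) \<bullet> b\<bar> \<le> 1 / 2 ^ m" if "b \<in> Basis" for b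
  proof -
    have "\<lfloor>2 ^ m * (x \<bullet> b)\<rfloor> = \<lfloor>2 ^ m * (y \<bullet> b)\<rfloor>" using assms that by (simp add: dyadic_cell_eq_iff)
    then have "\<bar>2 ^ m * (x \<bullet> b) - 2 ^ m * (y \<bullet> b)\<bar> \<le> 1" by linarith
    then have "2 ^ m * \<bar>(x - y) \<bullet> b\<bar> \<le> 1"
      by (simp add: inner_diff_left abs_mult flip: right_diff_distrib)
    then show ?thesis by (simp add: field_simps)
  qed
  then have "(\<Sum>b\<in>Basis. \<bar>(x - y) \<bullet> b\<bar>) \<le> DIM('a) * (1 / 2 ^ m)"
    using sum_bounded_above[of Basis "\<lambda>b. \<bar>(x - y) \<bullet> b\<bar>" "1 / 2 ^ m"] by simp
  then show ?thesis using norm_le_l1[of "x - y"] by (simp add: dist_norm)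
qed

lemma finite_dyadic_cells: "finite (dyadic_cell m ` sphere (0::'a::euclidean_space) 1)"
proof (rule finite_subset)
  let ?F = "\<lambda>k :: 'a \<Rightarrow> int. \<Sum>b\<in>Basis. of_int (k b) *\<^sub>R b"
  let ?K = "PiE Basis (\<lambda>b :: 'a. {- (2 ^ m)..(2 ^ m :: int)})"
  show "dyadic_cell m ` sphere (0::'a) 1 \<subseteq> ?F ` ?K"
  proof
    fix c assume "c \<in> dyadic_cell m ` sphere (0::'a) 1"
    then obtain x :: 'a where x: "norm x = 1" "c = dyadic_cell m x" by auto
    let ?k = "restrict (\<lambda>b. \<lfloor>2 ^ m * (x \<bullet> b)\<rfloor>) Basis"
    have "?k \<in> ?K"
    proof
      fix b :: 'a assume b: "b \<in> Basis"
      then have "\<bar>x \<bullet> b\<bar> \<le> 1" using Basis_le_norm[OF b, of x] x by simp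
      then have "\<bar>2 ^ m * (x \<bullet> b)\<bar> \<le> 2 ^ m" by (simp add: abs_mult)
      then have "- (2 ^ m) \<le> 2 ^ m * (x \<bullet> b)" "2 ^ m * (x \<bullet> b) \<le> 2 ^ m" by (auto simp: abs_le_iff)
      then have "real_of_int (- (2 ^ m)) \<le> 2 ^ m * (x \<bullet> b)" "2 ^ m * (x \<bullet> b) \<le> real_of_int (2 ^ m)" by auto
      then have "- (2 ^ m) \<le> \<lfloor>2 ^ m * (x \<bullet> b)\<rfloor>" "\<lfloor>2 ^ m * (x \<bullet> b)\<rfloor> \<le> 2 ^ m"
        by (simp only: le_floor_iff) (metis floor_mono floor_of_int \<open>2 ^ m * (x \<bullet> b) \<le> real_of_int (2 ^ m)\<close>)
      then show "?k b \<in> {- (2 ^ m)..2 ^ m}" using b by simp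
    qed auto
    moreover have "c = ?F ?k" using x by (simp add: dyadic_cell_def)
    ultimately show "c \<in> ?F ` ?K" by blast
  qed
  show "finite (?F ` ?K)" by (intro finite_imageI finite_PiE) auto
qed

section \<open>Cell masses and what they determine\<close>

definition cells :: "nat \<Rightarrow> 'a::euclidean_space set" where
  "cells m = dyadic_cell m ` sphere 0 1"

definition cell_set :: "nat \<Rightarrow> 'a \<Rightarrow> 'a::euclidean_space set" where
  "cell_set m c = dyadic_cell m -` {c} \<inter> sphere 0 1"

text \<open>A point of the sphere in the cell; it has a meaning only for \<open>c\<close> in
  \<open>cells m\<close>.\<close>

definition cell_point :: "nat \<Rightarrow> 'a \<Rightarrow> 'a::euclidean_space" where
  "cell_point m c = (SOME x. norm x = 1 \<and> dyadic_cell m x = c)"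

lemma finite_cells: "finite (cells m :: 'a::euclidean_space set)"
  unfolding cells_def by (rule finite_dyadic_cells)

lemma cell_point:
  assumes "c \<in> cells m"
  shows "norm (cell_point m c) = 1" "dyadic_cell m (cell_point m c) = c"
proof -
  have "\<exists>x. norm x = 1 \<and> dyadic_cell m x = c" using assms by (auto simp: cells_def)
  from someI_ex[OF this] show "norm (cell_point m c) = 1" "dyadic_cell m (cell_point m c) = c"
    by (auto simp: cell_point_def)
qed

lemma cell_set_sets [measurable]: "cell_set m c \<in> sets \<omega>"
  unfolding cell_set_def by (intro surface_setsI measurable_sets_borel[OF dyadic_cell_measurable]) auto

lemma sum_cells_indicator:
  fixes g :: "'a::euclidean_space \<Rightarrow> 'b::real_vector"
  assumes "norm x = 1"
  shows "(\<Sum>c\<in>cells m. indicator (cell_set m c) x *\<^sub>R g c) = g (dyadic_cell m x)"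
proof -
  have "(\<Sum>c\<in>cells m. indicator (cell_set m c) x *\<^sub>R g c) = (\<Sum>c\<in>cells m. if c = dyadic_cell m x then g c else 0)"
    using assms by (intro sum.cong) (auto simp: cell_set_def indicator_def)
  also have "\<dots> = g (dyadic_cell m x)"
    using assms by (simp add: finite_cells) (auto simp: cells_def)
  finally show ?thesis .
qed

lemma integral_cells:
  fixes f :: "'a::euclidean_space \<Rightarrow> real" and a :: "'a \<Rightarrow> real"
  assumes f: "integrable \<omega> f"
  shows "integrable \<omega> (\<lambda>x. a (dyadic_cell m x) * f x)"
    and "(\<integral>x. a (dyadic_cell m x) * f x \<partial>\<omega>) = (\<Sum>c\<in>cells m. a c * (\<integral>x. indicator (cell_set m c) x * f x \<partial>\<omega>))"
proof -
  have eq: "a (dyadic_cell m x) * f x = (\<Sum>c\<in>cells m. a c * (indicator (cell_set m c) x * f x))" if "x \<in> space \<omega>" for x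
  proof -
    have "a (dyadic_cell m x) = (\<Sum>c\<in>cells m. indicator (cell_set m c) x * a c)"
      using sum_cells_indicator[of x m a] that by simp
    then show ?thesis
      by (simp only: sum_distrib_right) (intro sum.cong refl, simp add: mult_ac)
  qed
  have int: "integrable \<omega> (\<lambda>x. a c * (indicator (cell_set m c) x * f x))" for c
    using integrable_mult_indicator[OF cell_set_sets f] by simp
  show "integrable \<omega> (\<lambda>x. a (dyadic_cell m x) * f x)"
    by (subst Bochner_Integration.integrable_cong[OF refl eq]) (auto intro!: Bochner_Integration.integrable_sum int)
  have "(\<integral>x. a (dyadic_cell m x) * f x \<partial>\<omega>) = (\<integral>x. (\<Sum>c\<in>cells m. a c * (indicator (cell_set m c) x * f x)) \<partial>\<omega>)"
    by (rule Bochner_Integration.integral_cong[OF refl eq])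
  also have "\<dots> = (\<Sum>c\<in>cells m. (\<integral>x. a c * (indicator (cell_set m c) x * f x) \<partial>\<omega>))"
    by (rule Bochner_Integration.integral_sum) (rule int)
  finally show "(\<integral>x. a (dyadic_cell m x) * f x \<partial>\<omega>) = (\<Sum>c\<in>cells m. a c * (\<integral>x. indicator (cell_set m c) x * f x \<partial>\<omega>))"
    by simp
qed

text \<open>Every fine cell lies in one coarse cell, which is found through the representative of
  the fine cell. Being a finite linear relation between masses, this survives limits and becomes the
  martingale property.\<close>

lemma cell_mass_refine:
  fixes f :: "'a::euclidean_space \<Rightarrow> real"
  assumes f: "integrable \<omega> f" and "m \<le> k"
  shows "(\<integral>x. indicator (cell_set m c) x * f x \<partial>\<omega>) =
    (\<Sum>d\<in>cells k. of_bool (dyadic_cell m (cell_point k d) = c) * (\<integral>x. indicator (cell_set k d) x * f x \<partial>\<omega>))"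
proof -
  have "dyadic_cell m x = dyadic_cell m (cell_point k (dyadic_cell k x))" if "norm x = 1" for x :: 'a
  proof (rule dyadic_cell_mono[OF \<open>m \<le> k\<close>])
    have "dyadic_cell k x \<in> cells k" using that by (auto simp: cells_def)
    then show "dyadic_cell k x = dyadic_cell k (cell_point k (dyadic_cell k x))" by (simp add: cell_point)
  qed
  then have "(\<integral>x. indicator (cell_set m c) x * f x \<partial>\<omega>) =
      (\<integral>x. of_bool (dyadic_cell m (cell_point k (dyadic_cell k x)) = c) * f x \<partial>\<omega>)"
    by (intro Bochner_Integration.integral_cong refl) (auto simp: cell_set_def indicator_def)
  also have "\<dots> = (\<Sum>d\<in>cells k. of_bool (dyadic_cell m (cell_point k d) = c) * (\<integral>x. indicator (cell_set k d) x * f x \<partial>\<omega>))"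
    by (rule integral_cells(2)[OF f])
  finally show ?thesis .
qed

lemma integrable_kernel_product:
  fixes f :: "'a::euclidean_space \<Rightarrow> real"
  assumes W: "continuous_on (sphere 0 1 \<times> sphere 0 1) W" and f: "integrable \<omega> f"
  shows "integrable (\<omega> \<Otimes>\<^sub>M \<omega>) (\<lambda>p. W p * (f (fst p) * f (snd p)))"
proof -
  obtain b where b: "\<And>x y. norm x = 1 \<Longrightarrow> norm y = 1 \<Longrightarrow> \<bar>W (x, y)\<bar> \<le> b"
    using bounded_continuous_on_sphere_pair[OF W] by metis
  have [measurable]: "f \<in> borel_measurable \<omega>" using f by simp
  have Wm[measurable]: "W \<in> borel_measurable (\<omega> \<Otimes>\<^sub>M \<omega>)" by (rule borel_measurable_continuous_on_surface_pair[OF W])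
  have ff: "integrable (\<omega> \<Otimes>\<^sub>M \<omega>) (\<lambda>p. f (fst p) * f (snd p))"
    using surface2.Fubini_integrable[of "\<lambda>p. f (fst p) * f (snd p)"] f by (simp add: abs_mult)
  show ?thesis
  proof (rule Bochner_Integration.integrable_bound[OF integrable_mult_right[OF ff, of b]])
    show "AE p in \<omega> \<Otimes>\<^sub>M \<omega>. norm (W p * (f (fst p) * f (snd p))) \<le> norm (b * (f (fst p) * f (snd p)))"
      using b by (intro AE_I2) (auto simp: abs_mult intro!: mult_right_mono order_trans[OF b abs_ge_self])
  qed measurable
qed

text \<open>Replacing \<open>W\<close> by its values at the representatives of the cells costs at
  most \<open>\<eta>\<close>, as \<open>f\<close> has total mass 1. What remains depends on
  \<open>f\<close> only through finitely many masses, so convergence of masses gives convergence of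
  kernel forms.\<close>

lemma kernel_form_cells:
  fixes W :: "'a::euclidean_space \<times> 'a \<Rightarrow> real"
  assumes W: "continuous_on (sphere 0 1 \<times> sphere 0 1) W"
    and \<eta>: "\<And>x y x' y'. norm x = 1 \<Longrightarrow> norm y = 1 \<Longrightarrow> norm x' = 1 \<Longrightarrow> norm y' = 1 \<Longrightarrow>
       dyadic_cell m x = dyadic_cell m x' \<Longrightarrow> dyadic_cell m y = dyadic_cell m y' \<Longrightarrow> \<bar>W (x, y) - W (x', y')\<bar> \<le> \<eta>"
    and f: "integrable \<omega> f" "\<And>x. 0 \<le> f x" "(\<integral>x. f x \<partial>\<omega>) = 1"
  shows "\<bar>(\<integral>p. W p * (f (fst p) * f (snd p)) \<partial>(\<omega> \<Otimes>\<^sub>M \<omega>)) -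
    (\<Sum>c\<in>cells m. \<Sum>d\<in>cells m. W (cell_point m c, cell_point m d) *
       ((\<integral>x. indicator (cell_set m c) x * f x \<partial>\<omega>) * (\<integral>x. indicator (cell_set m d) x * f x \<partial>\<omega>)))\<bar> \<le> \<eta>"
proof -
  obtain b where b: "\<And>x y. norm x = 1 \<Longrightarrow> norm y = 1 \<Longrightarrow> \<bar>W (x, y)\<bar> \<le> b"
    using bounded_continuous_on_sphere_pair[OF W] by metis
  have [measurable]: "f \<in> borel_measurable \<omega>" using f by simp
  have Wm[measurable]: "W \<in> borel_measurable (\<omega> \<Otimes>\<^sub>M \<omega>)" by (rule borel_measurable_continuous_on_surface_pair[OF W])
  have ff: "integrable (\<omega> \<Otimes>\<^sub>M \<omega>) (\<lambda>p. f (fst p) * f (snd p))"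
    using surface2.Fubini_integrable[of "\<lambda>p. f (fst p) * f (snd p)"] f(1) by (simp add: abs_mult)
  have ff1: "(\<integral>p. f (fst p) * f (snd p) \<partial>(\<omega> \<Otimes>\<^sub>M \<omega>)) = 1"
    using surface2.integral_fst'[OF ff] f(3) by simp
  have Wff: "integrable (\<omega> \<Otimes>\<^sub>M \<omega>) (\<lambda>p. W p * (f (fst p) * f (snd p)))"
    by (rule integrable_kernel_product[OF W f(1)])
  let ?c = "\<lambda>x :: 'a. cell_point m (dyadic_cell m x)"
  define V where "V p = W (?c (fst p), ?c (snd p))" for p
  have cc: "norm (?c x) = 1" "dyadic_cell m (?c x) = dyadic_cell m x" if "norm x = 1" for x
    using cell_point[of "dyadic_cell m x" m] that by (auto simp: cells_def)
  have V1: "V p * (f (fst p) * f (snd p)) = (\<Sum>c\<in>cells m. \<Sum>d\<in>cells m. W (cell_point m c, cell_point m d) *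
       ((indicator (cell_set m c) (fst p) * f (fst p)) * (indicator (cell_set m d) (snd p) * f (snd p))))"
    if p: "p \<in> space (\<omega> \<Otimes>\<^sub>M \<omega>)" for p
  proof -
    have "V p = (\<Sum>c\<in>cells m. indicator (cell_set m c) (fst p) *\<^sub>R (\<Sum>d\<in>cells m. indicator (cell_set m d) (snd p) *\<^sub>R W (cell_point m c, cell_point m d)))"
      using p sum_cells_indicator[of "snd p" m "\<lambda>d. W (?c (fst p), cell_point m d)"]
        sum_cells_indicator[of "fst p" m "\<lambda>c. \<Sum>d\<in>cells m. indicator (cell_set m d) (snd p) *\<^sub>R W (cell_point m c, cell_point m d)"]
      by (auto simp: V_def)
    then show ?thesis by (simp add: sum_distrib_left sum_distrib_right mult_ac)
  qed
  have fint: "integrable \<omega> (\<lambda>x. indicator (cell_set m c) x * f x)" for c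
    using integrable_mult_indicator[OF cell_set_sets f(1)] by simp
  have fc: "integrable (\<omega> \<Otimes>\<^sub>M \<omega>) (\<lambda>p. (indicator (cell_set m c) (fst p) * f (fst p)) * (indicator (cell_set m d) (snd p) * f (snd p)))" for c d
    by (rule Bochner_Integration.integrable_bound[OF ff]) (measurable, auto simp: indicator_def f(2))
  have fc1: "(\<integral>p. (indicator (cell_set m c) (fst p) * f (fst p)) * (indicator (cell_set m d) (snd p) * f (snd p)) \<partial>(\<omega> \<Otimes>\<^sub>M \<omega>)) =
     (\<integral>x. indicator (cell_set m c) x * f x \<partial>\<omega>) * (\<integral>x. indicator (cell_set m d) x * f x \<partial>\<omega>)" for c d
    using surface2.integral_fst'[OF fc[of c d]] by (simp add: mult.commute)
  have Vff: "integrable (\<omega> \<Otimes>\<^sub>M \<omega>) (\<lambda>p. V p * (f (fst p) * f (snd p)))"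
    by (subst Bochner_Integration.integrable_cong[OF refl V1])
      (auto intro!: Bochner_Integration.integrable_sum integrable_mult_right fc)
  have "(\<integral>p. V p * (f (fst p) * f (snd p)) \<partial>(\<omega> \<Otimes>\<^sub>M \<omega>)) = (\<Sum>c\<in>cells m. \<Sum>d\<in>cells m. W (cell_point m c, cell_point m d) *
       ((\<integral>x. indicator (cell_set m c) x * f x \<partial>\<omega>) * (\<integral>x. indicator (cell_set m d) x * f x \<partial>\<omega>)))"
    unfolding fc1[symmetric]
    by (subst Bochner_Integration.integral_cong[OF refl V1])
      (auto simp: Bochner_Integration.integral_sum fc intro!: Bochner_Integration.integrable_sum integrable_mult_right fc)
  moreover have "\<bar>(\<integral>p. W p * (f (fst p) * f (snd p)) \<partial>(\<omega> \<Otimes>\<^sub>M \<omega>)) - (\<integral>p. V p * (f (fst p) * f (snd p)) \<partial>(\<omega> \<Otimes>\<^sub>M \<omega>))\<bar> \<le> \<eta>"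
  proof -
    have "\<bar>(\<integral>p. W p * (f (fst p) * f (snd p)) \<partial>(\<omega> \<Otimes>\<^sub>M \<omega>)) - (\<integral>p. V p * (f (fst p) * f (snd p)) \<partial>(\<omega> \<Otimes>\<^sub>M \<omega>))\<bar> =
      \<bar>\<integral>p. (W p - V p) * (f (fst p) * f (snd p)) \<partial>(\<omega> \<Otimes>\<^sub>M \<omega>)\<bar>"
      using Wff Vff by (simp add: left_diff_distrib)
    also have "\<dots> \<le> (\<integral>p. \<eta> * (f (fst p) * f (snd p)) \<partial>(\<omega> \<Otimes>\<^sub>M \<omega>))"
    proof (rule integral_abs_bound_integral)
      show "integrable (\<omega> \<Otimes>\<^sub>M \<omega>) (\<lambda>p. (W p - V p) * (f (fst p) * f (snd p)))"
        using Wff Vff by (simp add: left_diff_distrib)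
      fix p :: "'a \<times> 'a" assume "p \<in> space (\<omega> \<Otimes>\<^sub>M \<omega>)"
      then have p: "norm (fst p) = 1" "norm (snd p) = 1" by auto
      have "\<bar>W (fst p, snd p) - V p\<bar> \<le> \<eta>"
        unfolding V_def by (rule \<eta>) (use p cc in auto)
      then show "\<bar>(W p - V p) * (f (fst p) * f (snd p))\<bar> \<le> \<eta> * (f (fst p) * f (snd p))"
        using f(2) by (simp add: abs_mult mult_right_mono)
    qed (use ff in simp)
    finally show ?thesis by (simp add: ff1)
  qed
  ultimately show ?thesis by simp
qed

lemma integral_cell_step:
  "(\<integral>x. indicator (cell_set m c) x * a (dyadic_cell m x) \<partial>\<omega>) = a c * measure \<omega> (cell_set m c)"
proof -
  have "(\<integral>x. indicator (cell_set m c) x * a (dyadic_cell m x) \<partial>\<omega>) = (\<integral>x. a c * indicator (cell_set m c) x \<partial>\<omega>)"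
    by (intro Bochner_Integration.integral_cong refl) (auto simp: cell_set_def indicator_def)
  also have "\<dots> = a c * measure \<omega> (cell_set m c)"
    by (simp add: cell_set_def Int_absorb2)
  finally show ?thesis .
qed

lemma integrable_cell_step: "integrable \<omega> (\<lambda>x. a (dyadic_cell m x) :: real)"
  using integral_cells(1)[of "\<lambda>_. 1" a m] by simp

lemma cell_mass_null:
  assumes "measure \<omega> (cell_set m c) = 0"
  shows "(\<integral>x. indicator (cell_set m c) x * f x \<partial>\<omega>) = (0::real)"
proof (rule integral_eq_zero_AE)
  have "emeasure \<omega> (cell_set m c) = 0" using assms by (simp add: surface.emeasure_eq_measure)
  then have "AE x in \<omega>. x \<notin> cell_set m c" by (intro AE_not_in) (auto simp: null_sets_def)
  then show "AE x in \<omega>. indicator (cell_set m c) x * f x = 0" by eventually_elim simp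
qed

text \<open>The step function with the masses of \<open>f\<close> is the orthogonal projection of
  \<open>f\<close> onto step functions, and the sum is its energy. Cells of measure zero carry no
  mass, so the division by 0 is harmless.\<close>

lemma cell_energy_le:
  fixes f :: "'a::euclidean_space \<Rightarrow> real" and m :: nat
  defines "q \<equiv> \<lambda>c. \<integral>x. indicator (cell_set m c) x * f x \<partial>\<omega>"
  assumes f: "integrable \<omega> f" "integrable \<omega> (\<lambda>x. (f x)\<^sup>2)"
  shows "(\<Sum>c\<in>cells m. q c / measure \<omega> (cell_set m c) * q c) \<le> (\<integral>x. (f x)\<^sup>2 \<partial>\<omega>)"
proof -
  let ?a = "\<lambda>c. q c / measure \<omega> (cell_set m c)" let ?S = "\<Sum>c\<in>cells m. ?a c * q c"
  let ?G = "\<lambda>x. ?a (dyadic_cell m x)"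
  have q: "?a c * measure \<omega> (cell_set m c) = q c" for c
    using cell_mass_null[of m c f] by (auto simp: q_def)
  have Gf: "integrable \<omega> (\<lambda>x. ?G x * f x)" "(\<integral>x. ?G x * f x \<partial>\<omega>) = ?S"
    using integral_cells[OF f(1), of ?a m] by (simp_all add: q_def)
  have GG: "integrable \<omega> (\<lambda>x. ?G x * ?G x)" "(\<integral>x. ?G x * ?G x \<partial>\<omega>) = ?S"
    using integral_cells[OF integrable_cell_step, of ?a m ?a m] by (simp_all only: integral_cell_step[where a="?a"] q)
  have "0 \<le> (\<integral>x. (f x - ?G x)\<^sup>2 \<partial>\<omega>)" by simp
  also have "\<dots> = (\<integral>x. (f x)\<^sup>2 - 2 * (?G x * f x) + ?G x * ?G x \<partial>\<omega>)"
  proof (intro Bochner_Integration.integral_cong refl)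
    have "(u - v)\<^sup>2 = u\<^sup>2 - 2 * (v * u) + v * v" for u v :: real by (simp add: power2_eq_square algebra_simps)
    then show "(f x - ?G x)\<^sup>2 = (f x)\<^sup>2 - 2 * (?G x * f x) + ?G x * ?G x" for x .
  qed
  also have "\<dots> = (\<integral>x. (f x)\<^sup>2 \<partial>\<omega>) - 2 * ?S + ?S"
    using f(2) Gf GG
    by (simp only: Bochner_Integration.integral_add Bochner_Integration.integral_diff Bochner_Integration.integrable_diff
        integrable_mult_right integral_mult_right_zero)
  finally show ?thesis by simp
qed

section \<open>Extraction of a weak limit\<close>

text \<open>
  Along a subsequence the masses of all dyadic cells converge, and the step functions with the limit
  masses form a bounded martingale.
\<close>

lemma weak_limit_density:
  fixes f :: "nat \<Rightarrow> 'a::euclidean_space \<Rightarrow> real"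
  assumes f0: "\<And>l x. 0 \<le> f l x" and fi: "\<And>l. integrable \<omega> (f l)" and f1: "\<And>l. (\<integral>x. f l x \<partial>\<omega>) = 1"
    and f2: "\<And>l. integrable \<omega> (\<lambda>x. (f l x)\<^sup>2)" and fC: "\<And>l. (\<integral>x. (f l x)\<^sup>2 \<partial>\<omega>) \<le> C l" and C: "C \<longlonglongrightarrow> C0"
  obtains k g where "strict_mono (k :: nat \<Rightarrow> nat)" "\<And>x. 0 \<le> g x" "integrable \<omega> g" "(\<integral>x. g x \<partial>\<omega>) = 1"
    "integrable \<omega> (\<lambda>x. (g x)\<^sup>2)" "(\<integral>x. (g x)\<^sup>2 \<partial>\<omega>) \<le> C0"
    "\<And>W. continuous_on (sphere 0 1 \<times> sphere 0 1) W \<Longrightarrow>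
      (\<lambda>l. \<integral>p. W p * (f (k l) (fst p) * f (k l) (snd p)) \<partial>(\<omega> \<Otimes>\<^sub>M \<omega>)) \<longlonglongrightarrow> (\<integral>p. W p * (g (fst p) * g (snd p)) \<partial>(\<omega> \<Otimes>\<^sub>M \<omega>))"
proof -
  let ?\<Omega> = "measure \<omega> (sphere (0::'a) 1)"
  define mass where "mass l m c = (\<integral>x. indicator (cell_set m c) x * f l x \<partial>\<omega>)" for l m c
  have int_mass: "integrable \<omega> (\<lambda>x. indicator (cell_set m c) x * f l x)" for l m c
    using integrable_mult_indicator[OF cell_set_sets fi] by simp
  have mass: "0 \<le> mass l m c" "mass l m c \<le> 1" for l m c
  proof -
    show "0 \<le> mass l m c" unfolding mass_def by (intro integral_nonneg_AE) (auto simp: f0)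
    have "mass l m c \<le> (\<integral>x. f l x \<partial>\<omega>)" unfolding mass_def
      by (intro integral_mono int_mass fi) (auto simp: indicator_def f0)
    then show "mass l m c \<le> 1" by (simp add: f1)
  qed
  \<comment> \<open>There are countably many cells in all levels together, so one diagonal
    subsequence serves all of them.\<close>
  have "countable (SIGMA m:UNIV. (cells m :: 'a set))"
    by (rule countable_SIGMA) (simp_all add: countable_finite finite_cells)
  then obtain k where k: "strict_mono (k :: nat \<Rightarrow> nat)"
    and "\<And>q. q \<in> (SIGMA m:UNIV. (cells m :: 'a set)) \<Longrightarrow> \<exists>l. (\<lambda>n. mass (k n) (fst q) (snd q)) \<longlonglongrightarrow> l"
    by (rule function_convergent_subsequence[where f="\<lambda>l q. mass l (fst q) (snd q)" and M=1]) (use mass in auto)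
  then have "\<exists>l. (\<lambda>n. mass (k n) m c) \<longlonglongrightarrow> l" if "c \<in> cells m" for m c
    using that by fastforce
  then have conv: "convergent (\<lambda>n. mass (k n) m c)" if "c \<in> cells m" for m c
    using that unfolding convergent_def by simp
  define p where "p m c = lim (\<lambda>n. mass (k n) m c)" for m c
  have p: "(\<lambda>n. mass (k n) m c) \<longlonglongrightarrow> p m c" if "c \<in> cells m" for m c
    using conv[OF that] unfolding p_def convergent_LIMSEQ_iff .
  define w where "w m c = measure \<omega> (cell_set m c)" for m and c :: 'a
  \<comment> \<open>Where a cell has measure zero, its limit mass is zero as well, and the quotient
    is 0.\<close>
  define F where "F m x = p m (dyadic_cell m x) / w m (dyadic_cell m x)" for m x
  have p0: "0 \<le> p m c" if "c \<in> cells m" for m c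
    by (rule LIMSEQ_le_const[OF p[OF that]]) (auto simp: mass)
  have pw: "p m c / w m c * w m c = p m c" if "c \<in> cells m" for m c
  proof (cases "w m c = 0")
    case True
    then have "mass l m c = 0" for l unfolding mass_def w_def by (rule cell_mass_null)
    then have "(\<lambda>n. mass (k n) m c) \<longlonglongrightarrow> 0" by simp
    from LIMSEQ_unique[OF p[OF that] this] show ?thesis by simp
  qed simp
  have F0: "0 \<le> F m x" if "norm x = 1" for m x
    unfolding F_def w_def using that by (intro divide_nonneg_nonneg p0) (simp_all add: cells_def)
  have Fi: "integrable \<omega> (F m)" for m
    unfolding F_def using integrable_cell_step[of "\<lambda>c. p m c / w m c" m] by simp
  then have [measurable]: "F m \<in> borel_measurable \<omega>" for m by simp
  have F_cell: "(\<integral>x. indicator (cell_set m c) x * F m x \<partial>\<omega>) = p m c" if "c \<in> cells m" for m c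
    unfolding F_def using integral_cell_step[of m c "\<lambda>c. p m c / w m c"] pw[OF that] by (simp only: w_def)
  have F_mass: "(\<integral>x. indicator (cell_set m c) x * F n x \<partial>\<omega>) = p m c" if "c \<in> cells m" "m \<le> n" for m n c
  proof -
    have "(\<lambda>l. mass (k l) m c) \<longlonglongrightarrow> (\<Sum>d\<in>cells n. of_bool (dyadic_cell m (cell_point n d) = c) * p n d)"
      unfolding mass_def cell_mass_refine[OF fi \<open>m \<le> n\<close>]
      by (intro tendsto_sum tendsto_mult tendsto_const) (use p in \<open>auto simp: mass_def\<close>)
    then have "p m c = (\<Sum>d\<in>cells n. of_bool (dyadic_cell m (cell_point n d) = c) * p n d)"
      using p[OF that(1)] LIMSEQ_unique by blast
    then show ?thesis
      unfolding cell_mass_refine[OF Fi \<open>m \<le> n\<close>] by (simp add: F_cell cong: sum.cong)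
  qed
  define N where "N m = (\<Sum>c\<in>cells m. p m c / w m c * p m c)" for m
  \<comment> \<open>The martingale property: pairing with the coarser step function sees only coarse
    masses. Hence increments are orthogonal, and their squared norms are differences of the bounded
    increasing sequence \<open>N\<close>.\<close>
  have FF: "integrable \<omega> (\<lambda>x. F m x * F n x)" "(\<integral>x. F m x * F n x \<partial>\<omega>) = N m" if "m \<le> n" for m n
  proof -
    show "integrable \<omega> (\<lambda>x. F m x * F n x)"
      using integral_cells(1)[OF Fi[of n], of "\<lambda>c. p m c / w m c" m] by (simp add: F_def[of m])
    show "(\<integral>x. F m x * F n x \<partial>\<omega>) = N m"
      using integral_cells(2)[OF Fi[of n], of "\<lambda>c. p m c / w m c" m] F_mass[OF _ that]
      by (simp add: F_def[of m] N_def cong: sum.cong)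
  qed
  have NC: "N m \<le> C0" for m
  proof (rule LIMSEQ_le)
    show "(\<lambda>l. \<Sum>c\<in>cells m. mass (k l) m c / w m c * mass (k l) m c) \<longlonglongrightarrow> N m"
      unfolding N_def divide_inverse by (intro tendsto_sum tendsto_mult tendsto_const p)
    show "(\<lambda>l. C (k l)) \<longlonglongrightarrow> C0" using LIMSEQ_subseq_LIMSEQ[OF C k] by (simp add: o_def)
    show "\<exists>n. \<forall>l\<ge>n. (\<Sum>c\<in>cells m. mass (k l) m c / w m c * mass (k l) m c) \<le> C (k l)"
      using order_trans[OF cell_energy_le[OF fi f2] fC] unfolding mass_def w_def by blast
  qed
  have diff: "integrable \<omega> (\<lambda>x. (F n x - F m x)\<^sup>2)" "(\<integral>x. (F n x - F m x)\<^sup>2 \<partial>\<omega>) = N n - N m" if "m \<le> n" for m n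
  proof -
    have eq: "(F n x - F m x)\<^sup>2 = F n x * F n x - 2 * (F m x * F n x) + F m x * F m x" for x
      by (simp add: power2_eq_square algebra_simps)
    show "integrable \<omega> (\<lambda>x. (F n x - F m x)\<^sup>2)" unfolding eq
      using FF(1)[of n n] FF(1)[of m m] FF(1)[OF that] by simp
    show "(\<integral>x. (F n x - F m x)\<^sup>2 \<partial>\<omega>) = N n - N m" unfolding eq
      using FF[of n n] FF[of m m] FF[OF that] by simp
  qed
  have Nmono: "N m \<le> N n" if "m \<le> n" for m n
  proof -
    have "0 \<le> N n - N m" unfolding diff(2)[OF that, symmetric] by simp
    then show ?thesis by simp
  qed
  have "incseq N" using Nmono by (simp add: incseq_def)
  then obtain N0 where "N \<longlonglongrightarrow> N0" using incseq_convergent[of N C0] NC by blast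
  then have "Cauchy N" by (rule LIMSEQ_imp_Cauchy)
  have cauchy: "\<exists>M. \<forall>i\<ge>M. \<forall>j\<ge>M. (\<integral>x. norm (F i x - F j x) \<partial>\<omega>) < e" if e: "0 < e" for e
  proof -
    \<comment> \<open>L1 distances are bounded by L2 distances through
      \<open>2 * \<bar>u\<bar> \<le> u^2 / \<eta> + \<eta>\<close>. With this choice the constant
      term integrates to less than \<open>e\<close>, and so does the square term once
      \<open>N\<close> varies by less than \<open>\<eta> * e\<close>.\<close>
    define \<eta> where "\<eta> = e / (?\<Omega> + 1)"
    have pos: "0 < ?\<Omega> + 1" by (intro add_nonneg_pos) auto
    then have \<eta>1: "0 < \<eta>" unfolding \<eta>_def using e by (intro divide_pos_pos)
    have "\<eta> * (?\<Omega> + 1) = e" unfolding \<eta>_def using pos by simp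
    then have \<eta>: "0 < \<eta>" "\<eta> * ?\<Omega> < e" using \<eta>1 by (simp_all add: distrib_left)
    obtain M where M: "\<And>i j. i \<ge> M \<Longrightarrow> j \<ge> M \<Longrightarrow> \<bar>N i - N j\<bar> < \<eta> * e"
      using CauchyD[OF \<open>Cauchy N\<close>, of "\<eta> * e"] \<eta> e by auto
    have *: "(\<integral>x. norm (F n x - F m x) \<partial>\<omega>) < e" if "m \<ge> M" "n \<ge> m" for m n
    proof -
      have "norm u \<le> (u\<^sup>2 / \<eta> + \<eta>) / 2" for u :: real
      proof -
        have "0 \<le> (\<bar>u\<bar> - \<eta>)\<^sup>2" by simp
        then have "2 * \<bar>u\<bar> * \<eta> \<le> u\<^sup>2 + \<eta> * \<eta>" by (simp add: power2_eq_square algebra_simps)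
        then show ?thesis using \<eta>(1) by (simp add: field_simps)
      qed
      then have "(\<integral>x. norm (F n x - F m x) \<partial>\<omega>) \<le> (\<integral>x. ((F n x - F m x)\<^sup>2 / \<eta> + \<eta>) / 2 \<partial>\<omega>)"
        using diff(1)[OF that(2)] Fi by (intro integral_mono) auto
      also have "\<dots> = ((N n - N m) / \<eta> + \<eta> * ?\<Omega>) / 2"
        using diff[OF that(2)] by (simp add: mult.commute)
      also have "\<dots> < e"
      proof -
        have "(N n - N m) / \<eta> < e" using M[of n m] that \<eta>(1) by (simp add: pos_divide_less_eq mult.commute)
        then show ?thesis using \<eta>(2) by simp
      qed
      finally show ?thesis .
    qed
    have "(\<integral>x. norm (F i x - F j x) \<partial>\<omega>) < e" if "i \<ge> M" "j \<ge> M" for i j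
      using *[of j i] *[of i j] that by (cases "j \<le> i") (auto simp: abs_minus_commute)
    then show ?thesis by blast
  qed
  obtain r where r: "strict_mono r" "AE x in \<omega>. Cauchy (\<lambda>i. F (r i) x)"
    using cauchy_L1_AE_cauchy_subseq[OF Fi cauchy] by blast
  \<comment> \<open>The maximum makes \<open>g\<close> nonnegative also on the null set where the
    sequence does not converge.\<close>
  define g where "g x = max 0 (lim (\<lambda>i. F (r i) x))" for x
  have gm[measurable]: "g \<in> borel_measurable \<omega>"
    unfolding g_def by (intro borel_measurable_max borel_measurable_const borel_measurable_lim_metric) measurable
  have g0: "0 \<le> g x" for x by (simp add: g_def)
  have lim: "AE x in \<omega>. (\<lambda>i. F (r i) x) \<longlonglongrightarrow> g x"
    using r(2) AE_space
  proof eventually_elim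
    case (elim x)
    then have l: "(\<lambda>i. F (r i) x) \<longlonglongrightarrow> lim (\<lambda>i. F (r i) x)"
      by (simp add: Cauchy_convergent_iff convergent_LIMSEQ_iff)
    moreover have "0 \<le> lim (\<lambda>i. F (r i) x)" by (rule LIMSEQ_le_const[OF l]) (use F0 elim in auto)
    ultimately show ?case by (simp add: g_def)
  qed
  \<comment> \<open>Fatou's lemma carries bounds on the step functions over to \<open>g\<close>. It
    is used for the energy, with the square as \<open>u\<close>, and for the L1 distance to a fixed
    \<open>F i\<close>.\<close>
  have fatou: "(\<integral>\<^sup>+x. ennreal (u (g x) x) \<partial>\<omega>) \<le> ennreal b"
    if u: "\<And>x. continuous_on UNIV (\<lambda>y. u y x)" and um[measurable]: "\<And>i. (\<lambda>x. u (F i x) x) \<in> borel_measurable \<omega>"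
      and b: "\<And>i. i \<ge> M \<Longrightarrow> (\<integral>\<^sup>+x. ennreal (u (F i x) x) \<partial>\<omega>) \<le> ennreal b" for u :: "real \<Rightarrow> 'a \<Rightarrow> real" and b M
  proof -
    have "(\<integral>\<^sup>+x. ennreal (u (g x) x) \<partial>\<omega>) = (\<integral>\<^sup>+x. liminf (\<lambda>i. ennreal (u (F (r i) x) x)) \<partial>\<omega>)"
    proof (rule nn_integral_cong_AE)
      show "AE x in \<omega>. ennreal (u (g x) x) = liminf (\<lambda>i. ennreal (u (F (r i) x) x))"
        using lim
      proof eventually_elim
        case (elim x)
        have "(\<lambda>i. u (F (r i) x) x) \<longlonglongrightarrow> u (g x) x"
          by (rule continuous_on_tendsto_compose[OF u elim]) auto
        then have "(\<lambda>i. ennreal (u (F (r i) x) x)) \<longlonglongrightarrow> ennreal (u (g x) x)" by (rule tendsto_ennrealI)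
        then show ?case by (simp add: lim_imp_Liminf)
      qed
    qed
    also have "\<dots> \<le> liminf (\<lambda>i. \<integral>\<^sup>+x. ennreal (u (F (r i) x) x) \<partial>\<omega>)"
      by (rule nn_integral_liminf) measurable
    also have "\<dots> \<le> limsup (\<lambda>i. \<integral>\<^sup>+x. ennreal (u (F (r i) x) x) \<partial>\<omega>)" by (rule Liminf_le_Limsup) simp
    also have "\<dots> \<le> ennreal b"
    proof (rule Limsup_bounded)
      show "\<forall>\<^sub>F i in sequentially. (\<integral>\<^sup>+x. ennreal (u (F (r i) x) x) \<partial>\<omega>) \<le> ennreal b"
        unfolding eventually_sequentially using b seq_suble[OF r(1)] order_trans by blast
    qed
    finally show ?thesis .
  qed
  have C0: "0 \<le> C0"
  proof (rule LIMSEQ_le_const[OF C])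
    have "0 \<le> (\<integral>x. (f n x)\<^sup>2 \<partial>\<omega>)" for n by simp
    then show "\<exists>N. \<forall>n\<ge>N. 0 \<le> C n" using order_trans[OF _ fC] by blast
  qed
  have "(\<integral>\<^sup>+x. ennreal ((g x)\<^sup>2) \<partial>\<omega>) \<le> ennreal C0"
  proof (rule fatou[where M=0])
    show "(\<integral>\<^sup>+x. ennreal ((F i x)\<^sup>2) \<partial>\<omega>) \<le> ennreal C0" for i
    proof -
      have "(\<integral>\<^sup>+x. ennreal ((F i x)\<^sup>2) \<partial>\<omega>) = ennreal (N i)"
        using FF[of i i] by (subst nn_integral_eq_integral) (auto simp: power2_eq_square)
      then show ?thesis using NC by (simp add: ennreal_leI)
    qed
  qed (auto intro!: continuous_intros)
  then have g2: "integrable \<omega> (\<lambda>x. (g x)\<^sup>2)" and gC: "(\<integral>x. (g x)\<^sup>2 \<partial>\<omega>) \<le> C0"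
  proof -
    assume *: "(\<integral>\<^sup>+x. ennreal ((g x)\<^sup>2) \<partial>\<omega>) \<le> ennreal C0"
    then show "integrable \<omega> (\<lambda>x. (g x)\<^sup>2)"
      by (intro integrableI_nonneg) (auto intro: le_less_trans)
    show "(\<integral>x. (g x)\<^sup>2 \<partial>\<omega>) \<le> C0"
      using * C0 by (subst integral_eq_nn_integral) (auto intro: enn2real_leI)
  qed
  have gi: "integrable \<omega> g"
    by (rule L2_imp_integrable[OF finite_measure_surface]) (simp add: L2_def g2)
  have L1: "\<exists>M. \<forall>i\<ge>M. (\<integral>x. \<bar>F i x - g x\<bar> \<partial>\<omega>) \<le> e" if e: "0 < e" for e
  proof -
    obtain M where M: "\<And>i j. i \<ge> M \<Longrightarrow> j \<ge> M \<Longrightarrow> (\<integral>x. norm (F i x - F j x) \<partial>\<omega>) < e" using cauchy[OF e] by blast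
    have "(\<integral>x. \<bar>F i x - g x\<bar> \<partial>\<omega>) \<le> e" if i: "i \<ge> M" for i
    proof -
      have "(\<integral>\<^sup>+x. ennreal \<bar>F i x - g x\<bar> \<partial>\<omega>) \<le> ennreal e"
      proof (rule fatou[where M=M and u="\<lambda>y x. \<bar>F i x - y\<bar>"])
        show "(\<integral>\<^sup>+x. ennreal \<bar>F i x - F j x\<bar> \<partial>\<omega>) \<le> ennreal e" if "M \<le> j" for j
          using M[OF i that] Fi by (subst nn_integral_eq_integral) (auto intro!: ennreal_leI)
      qed (auto intro!: continuous_intros)
      then show ?thesis using e by (subst integral_eq_nn_integral) (auto intro: enn2real_leI)
    qed
    then show ?thesis by blast
  qed
  have int_lim: "(\<lambda>i. \<integral>x. a x * F i x \<partial>\<omega>) \<longlonglongrightarrow> (\<integral>x. a x * g x \<partial>\<omega>)"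
    if a[measurable]: "a \<in> borel_measurable \<omega>" and a1: "\<And>x. \<bar>a x\<bar> \<le> 1" for a :: "'a \<Rightarrow> real"
  proof (rule LIMSEQ_I)
    fix e :: real assume "0 < e"
    then obtain M where M: "\<forall>i\<ge>M. (\<integral>x. \<bar>F i x - g x\<bar> \<partial>\<omega>) \<le> e / 2" using L1[of "e / 2"] by auto
    have ia: "integrable \<omega> (\<lambda>x. a x * h x)" if "integrable \<omega> h" for h :: "'a \<Rightarrow> real"
      by (rule Bochner_Integration.integrable_bound[OF that]) (use a1 that in \<open>auto simp: abs_mult intro!: mult_left_le_one_le\<close>)
    have "norm ((\<integral>x. a x * F i x \<partial>\<omega>) - (\<integral>x. a x * g x \<partial>\<omega>)) < e" if "i \<ge> M" for i
    proof -
      have "norm ((\<integral>x. a x * F i x \<partial>\<omega>) - (\<integral>x. a x * g x \<partial>\<omega>)) = \<bar>\<integral>x. a x * (F i x - g x) \<partial>\<omega>\<bar>"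
        using ia[OF Fi] ia[OF gi] by (simp add: right_diff_distrib)
      also have "\<dots> \<le> (\<integral>x. \<bar>F i x - g x\<bar> \<partial>\<omega>)"
        using ia[of "\<lambda>x. F i x - g x"] Fi gi a1
        by (intro integral_abs_bound_integral) (auto simp: abs_mult intro!: mult_left_le_one_le)
      also have "\<dots> < e" using M that \<open>0 < e\<close> by fastforce
      finally show ?thesis .
    qed
    then show "\<exists>M. \<forall>i\<ge>M. norm ((\<integral>x. a x * F i x \<partial>\<omega>) - (\<integral>x. a x * g x \<partial>\<omega>)) < e" by blast
  qed
  \<comment> \<open>From level \<open>m\<close> on, the mass of the cell under the step functions is
    constant, so L1 convergence transfers it to \<open>g\<close>.\<close>
  have g_mass: "(\<integral>x. indicator (cell_set m c) x * g x \<partial>\<omega>) = p m c" if "c \<in> cells m" for m c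
  proof (rule LIMSEQ_unique[OF int_lim])
    show "(\<lambda>i. \<integral>x. indicator (cell_set m c) x * F i x \<partial>\<omega>) \<longlonglongrightarrow> p m c"
      by (rule tendsto_eventually) (use F_mass[OF that] in \<open>auto simp: eventually_sequentially\<close>)
  qed (auto simp: indicator_def)
  have g1: "(\<integral>x. g x \<partial>\<omega>) = 1"
  proof -
    have tot: "(\<integral>x. h x \<partial>\<omega>) = (\<Sum>c\<in>cells 0. (\<integral>x. indicator (cell_set 0 c) x * h x \<partial>\<omega>))" if "integrable \<omega> h" for h :: "'a \<Rightarrow> real"
      using integral_cells(2)[OF that, of "\<lambda>_. 1" 0] by simp
    have "(\<lambda>l. \<Sum>c\<in>cells 0. mass (k l) 0 c) \<longlonglongrightarrow> (\<Sum>c\<in>cells 0. p 0 c)" by (intro tendsto_sum p)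
    moreover have "(\<Sum>c\<in>cells 0. mass l 0 c) = 1" for l using tot[OF fi] f1 by (simp add: mass_def)
    ultimately have "(\<Sum>c\<in>cells 0. p 0 c) = 1" using LIMSEQ_unique[of "\<lambda>_. 1"] by auto
    then show ?thesis using tot[OF gi] g_mass by (simp cong: sum.cong)
  qed
  show ?thesis
  proof (rule that[OF k g0 gi g1 g2 gC])
    fix W :: "'a \<times> 'a \<Rightarrow> real" assume W: "continuous_on (sphere 0 1 \<times> sphere 0 1) W"
    let ?A = "\<lambda>h. \<integral>p. W p * (h (fst p) * h (snd p)) \<partial>(\<omega> \<Otimes>\<^sub>M \<omega>)"
    show "(\<lambda>l. ?A (f (k l))) \<longlonglongrightarrow> ?A g"
    proof (rule LIMSEQ_I)
      fix e :: real assume e: "0 < e"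
      obtain d where d: "0 < d" "\<And>x y x' y'. norm x = 1 \<Longrightarrow> norm y = 1 \<Longrightarrow> norm x' = 1 \<Longrightarrow> norm y' = 1 \<Longrightarrow>
          dist x x' < d \<Longrightarrow> dist y y' < d \<Longrightarrow> \<bar>W (x, y) - W (x', y')\<bar> < e / 3"
        by (rule uniform_continuity_sphere_pair[OF W, of "e / 3"]) (use e in simp, rule that)
      \<comment> \<open>The mesh is below the modulus of continuity of \<open>W\<close> for
        \<open>e / 3\<close>. The forms of \<open>f (k l)\<close> and of \<open>g\<close> then
        differ from their cell sums by at most \<open>e / 3\<close> each, and the cell sums
        converge.\<close>
      obtain m where m: "DIM('a) / d < 2 ^ m" using real_arch_pow[of 2 "DIM('a) / d"] by auto
      then have "DIM('a) / 2 ^ m < d" using d(1) by (simp add: field_simps)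
      then have mesh: "dist x y < d" if "dyadic_cell m x = dyadic_cell m y" for x y :: 'a
        using dyadic_cell_dist[OF that] by linarith
      let ?S = "\<lambda>q. \<Sum>c\<in>cells m. \<Sum>d\<in>cells m. W (cell_point m c, cell_point m d) * (q c * q d)"
      have near: "\<bar>W (x, y) - W (x', y')\<bar> \<le> e / 3"
        if "norm x = 1" "norm y = 1" "norm x' = 1" "norm y' = 1"
          "dyadic_cell m x = dyadic_cell m x'" "dyadic_cell m y = dyadic_cell m y'" for x y x' y'
        by (rule less_imp_le[OF d(2)[OF that(1-4) mesh[OF that(5)] mesh[OF that(6)]]])
      have form: "\<bar>?A h - ?S (\<lambda>c. \<integral>x. indicator (cell_set m c) x * h x \<partial>\<omega>)\<bar> \<le> e / 3"
        if "integrable \<omega> h" "\<And>x. 0 \<le> h x" "(\<integral>x. h x \<partial>\<omega>) = 1" for h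
        by (rule kernel_form_cells[OF W]) (fact near that)+
      have "(\<lambda>l. ?S (mass (k l) m)) \<longlonglongrightarrow> ?S (p m)" by (intro tendsto_sum tendsto_mult tendsto_const p)
      then obtain L where L: "\<And>l. l \<ge> L \<Longrightarrow> \<bar>?S (mass (k l) m) - ?S (p m)\<bar> < e / 3"
        using LIMSEQ_D[of _ "?S (p m)" "e / 3"] e by fastforce
      have "\<bar>?A (f (k l)) - ?S (mass (k l) m)\<bar> \<le> e / 3" for l
        unfolding mass_def by (rule form[OF fi f0 f1])
      moreover have "\<bar>?A g - ?S (p m)\<bar> \<le> e / 3"
        using form[OF gi g0 g1] by (simp add: g_mass cong: sum.cong)
      moreover have "\<bar>u - z\<bar> < e" if "\<bar>u - v\<bar> \<le> e / 3" "\<bar>z - y\<bar> \<le> e / 3" "\<bar>v - y\<bar> < e / 3" for u v y z :: real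
        using that by linarith
      ultimately have "norm (?A (f (k l)) - ?A g) < e" if "l \<ge> L" for l
        unfolding real_norm_def using L[OF that] by blast
      then show "\<exists>L. \<forall>l\<ge>L. norm (?A (f (k l)) - ?A g) < e" by blast
    qed
  qed
qed

section \<open>Spherical caps and reflections\<close>

lemma measure_cap_cong:
  fixes a b :: "real^'n"
  assumes "norm a = 1" "norm b = 1"
  shows "measure \<omega> (ball a r \<inter> sphere 0 1) = measure \<omega> (ball b r \<inter> sphere 0 1)"
proof -
  have "norm b = norm a" using assms by simp
  define R where "R = reflection (a - b)"
  have R: "orthogonal_transformation R" "R a = b"
    using assms by (auto simp: R_def reflection_diff orthogonal_transformation_reflection)
  have [simp]: "norm (R x) = norm x" for x by (simp add: R_def)
  have d: "dist b (R x) = dist a x" for x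
    using R by (metis orthogonal_transformation_isometry)
  have "measure \<omega> (ball b r \<inter> sphere 0 1) = measure (distr \<omega> \<omega> R) (ball b r \<inter> sphere 0 1)"
    by (simp add: distr_surface_orthogonal[OF R(1)])
  also have "\<dots> = measure \<omega> (R -` (ball b r \<inter> sphere 0 1) \<inter> space \<omega>)"
    by (rule measure_distr[OF measurable_orthogonal_surface[OF R(1)]]) (auto intro: surface_setsI)
  also have "R -` (ball b r \<inter> sphere 0 1) \<inter> space \<omega> = ball a r \<inter> sphere 0 1"
    by (auto simp: d)
  finally show ?thesis ..
qed

text \<open>Comparing subsets of the sphere through their cones replaces charts of the sphere by
  Lipschitz maps of the whole space.\<close>

lemma measure_surface_Lipschitz:
  fixes f :: "'a::euclidean_space \<Rightarrow> 'a"
  assumes S: "S \<in> sets borel" and U: "U \<in> sets borel" and L: "0 \<le> L"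
    and lip: "\<And>x y. norm (f x - f y) \<le> L * norm (x - y)" and sub: "sector 1 U \<subseteq> f ` sector 1 S"
  shows "measure \<omega> (U \<inter> sphere 0 1) \<le> (2 * L * DIM('a)) ^ DIM('a) * measure \<omega> (S \<inter> sphere 0 1)"
proof -
  have "measure lebesgue (sector 1 U) \<le> (2 * L * DIM('a)) ^ DIM('a) * measure lebesgue (sector 1 S)"
    by (rule measure_Lipschitz_image_le[OF _ _ L lip _ sub])
      (use S U in \<open>auto intro: bounded_subset[OF bounded_cball sector_subset]\<close>)
  then have "DIM('a) * measure lebesgue (sector 1 U) \<le> DIM('a) * ((2 * L * DIM('a)) ^ DIM('a) * measure lebesgue (sector 1 S))"
    by (rule mult_left_mono) simp
  then show ?thesis unfolding measure_surface[OF S] measure_surface[OF U] by (simp add: mult_ac)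
qed

lemma sectorI: "x \<noteq> 0 \<Longrightarrow> norm x \<le> r \<Longrightarrow> x /\<^sub>R norm x \<in> A \<Longrightarrow> x \<in> sector r A"
  by (simp add: sector_def)

text \<open>
  If \<open>u \<bullet> x > 0\<close>, then \<open>u\<close> is a positive multiple of \<open>x - reflection u x\<close>, so that \<open>z \<mapsto> \<parallel>z\<parallel> x - z\<close> maps
  the cone over the reflected points onto the cone over the unit vectors \<open>u\<close>.
\<close>

lemma measure_reflection_vimage_le:
  fixes x :: "'a::euclidean_space"
  assumes x: "norm x = 1" and c: "0 < c" and S: "S \<in> sets borel"
  shows "measure \<omega> ({u. c \<le> u \<bullet> x \<and> reflection u x \<in> S} \<inter> sphere 0 1) \<le>
    (2 * (1 / c) * DIM('a)) ^ DIM('a) * measure \<omega> (S \<inter> sphere 0 1)"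
proof (rule measure_surface_Lipschitz[OF S])
  have [measurable]: "S \<in> sets borel" by fact
  show "{u. c \<le> u \<bullet> x \<and> reflection u x \<in> S} \<in> sets borel"
    unfolding reflection_def by measurable
  let ?f = "\<lambda>z. (1 / (2 * c)) *\<^sub>R (norm z *\<^sub>R x - z)"
  show "norm (?f y - ?f z) \<le> 1 / c * norm (y - z)" for y z
  proof -
    have "norm ((norm y - norm z) *\<^sub>R x - (y - z)) \<le> \<bar>norm y - norm z\<bar> + norm (y - z)"
      using norm_triangle_ineq4[of "(norm y - norm z) *\<^sub>R x" "y - z"] x by simp
    also have "\<dots> \<le> 2 * norm (y - z)" using norm_triangle_ineq3[of y z] by simp
    finally have "(1 / (2 * c)) * norm ((norm y - norm z) *\<^sub>R x - (y - z)) \<le> (1 / (2 * c)) * (2 * norm (y - z))"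
      using c by (intro mult_left_mono) auto
    moreover have "?f y - ?f z = (1 / (2 * c)) *\<^sub>R ((norm y - norm z) *\<^sub>R x - (y - z))"
      by (simp add: algebra_simps)
    ultimately show ?thesis using c by simp
  qed
  show "sector 1 {u. c \<le> u \<bullet> x \<and> reflection u x \<in> S} \<subseteq> ?f ` sector 1 S"
  proof
    fix v assume v: "v \<in> sector 1 {u. c \<le> u \<bullet> x \<and> reflection u x \<in> S}"
    define u where "u = v /\<^sub>R norm v"
    have u: "c \<le> u \<bullet> x" "reflection u x \<in> S" "norm u = 1" "norm v \<le> 1" "0 < norm v" "v = norm v *\<^sub>R u"
      using v by (auto simp: sector_def u_def)
    let ?x = "reflection u x"
    have nx: "norm ?x = 1" using x by simp
    have ux: "0 < u \<bullet> x" using u(1) c by simp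
    \<comment> \<open>The length at which the reflected point must be placed for \<open>?f\<close>
      to return \<open>v\<close>. It is at most 1 because \<open>norm v \<le> 1\<close> and
      \<open>c \<le> u \<bullet> x\<close>.\<close>
    define s where "s = norm v * c / (u \<bullet> x)"
    have s: "0 < s" "s \<le> 1"
      using u ux c mult_mono[of "norm v" 1 c "u \<bullet> x"] by (auto simp: s_def field_simps)
    have "u \<bullet> u = 1" using u(3) by (simp add: norm_eq_1)
    then have "x - ?x = (2 * (u \<bullet> x)) *\<^sub>R u" by (simp add: reflection_def)
    then have "?f (s *\<^sub>R ?x) = (s / (2 * c)) *\<^sub>R ((2 * (u \<bullet> x)) *\<^sub>R u)"
      using s nx by (simp flip: scaleR_diff_right)
    also have "\<dots> = ((s / (2 * c)) * (2 * (u \<bullet> x))) *\<^sub>R u" by simp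
    also have "(s / (2 * c)) * (2 * (u \<bullet> x)) = norm v" using ux c by (simp add: s_def)
    also have "norm v *\<^sub>R u = v" using u(6) by simp
    finally have "v = ?f (s *\<^sub>R ?x)" ..
    moreover have "s *\<^sub>R ?x \<in> sector 1 S"
    proof (rule sectorI)
      have "?x \<noteq> 0" using nx by (metis norm_zero zero_neq_one)
      then show "s *\<^sub>R ?x \<noteq> 0" using s by simp
    qed (use s nx u(2) in \<open>simp_all add: x\<close>)
    ultimately show "v \<in> ?f ` sector 1 S" by blast
  qed
qed (use c in auto)

lemma measure_surface_uminus:
  fixes A :: "(real^'n) set"
  assumes A: "A \<in> sets borel"
  shows "measure \<omega> (uminus -` A \<inter> sphere 0 1) = measure \<omega> (A \<inter> sphere 0 1)"
proof -
  have R: "orthogonal_transformation (uminus :: real^'n \<Rightarrow> _)"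
    by (simp add: orthogonal_transformation linear_iff)
  have "measure \<omega> (A \<inter> sphere 0 1) = measure (distr \<omega> \<omega> uminus) (A \<inter> sphere 0 1)"
    by (simp add: distr_surface_orthogonal[OF R])
  also have "\<dots> = measure \<omega> (uminus -` (A \<inter> sphere 0 1) \<inter> space \<omega>)"
    by (rule measure_distr[OF measurable_orthogonal_surface[OF R]]) (auto intro: surface_setsI A)
  also have "uminus -` (A \<inter> sphere 0 1) \<inter> space \<omega> = uminus -` A \<inter> sphere 0 1" by auto
  finally show ?thesis ..
qed

lemma reflection_uminus [simp]: "reflection (- u) = reflection u"
  by (auto simp: reflection_def fun_eq_iff)

text \<open>The same with \<open>z \<mapsto> (a \<bullet> z) a + 25 (z - (a \<bullet> z) a)\<close>, which widens a cap around \<open>a\<close>.\<close>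

lemma measure_cap_doubling:
  fixes a :: "'a::euclidean_space"
  assumes a: "norm a = 1" and \<delta>: "0 < \<delta>" "\<delta> \<le> 1"
  shows "measure \<omega> (ball a \<delta> \<inter> sphere 0 1) \<le> (2 * (25 :: real) * DIM('a)) ^ DIM('a) * measure \<omega> (ball a (\<delta> / 5) \<inter> sphere 0 1)"
proof (rule measure_surface_Lipschitz)
  let ?f = "\<lambda>z. 25 *\<^sub>R z - (24 * (a \<bullet> z)) *\<^sub>R a"
  have aa: "a \<bullet> a = 1" using a by (simp add: norm_eq_1)
  show "norm (?f y - ?f z) \<le> 25 * norm (y - z)" for y z
  proof (rule power2_le_imp_le)
    have "?f y - ?f z = 25 *\<^sub>R (y - z) - (24 * (a \<bullet> (y - z))) *\<^sub>R a" by (simp add: algebra_simps inner_diff_right)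
    then have "(norm (?f y - ?f z))\<^sup>2 = (25 *\<^sub>R (y - z) - (24 * (a \<bullet> (y - z))) *\<^sub>R a) \<bullet> (25 *\<^sub>R (y - z) - (24 * (a \<bullet> (y - z))) *\<^sub>R a)"
      by (simp add: power2_norm_eq_inner)
    also have "\<dots> = 625 * ((y - z) \<bullet> (y - z)) - 624 * (a \<bullet> (y - z))\<^sup>2"
      unfolding inner_diff_left[of "25 *\<^sub>R (y - z)"] inner_diff_right[of _ "25 *\<^sub>R (y - z)"]
      by (simp add: inner_commute[of "y - z" a] aa power2_eq_square)
    also have "\<dots> \<le> (25 * norm (y - z))\<^sup>2" by (simp add: power_mult_distrib power2_norm_eq_inner)
    finally show "(norm (?f y - ?f z))\<^sup>2 \<le> (25 * norm (y - z))\<^sup>2" .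
  qed simp
  show "sector 1 (ball a \<delta>) \<subseteq> ?f ` sector 1 (ball a (\<delta> / 5))"
  proof
    fix v assume v: "v \<in> sector 1 (ball a \<delta>)"
    define u where "u = v /\<^sub>R norm v"
    have u: "norm (u - a) < \<delta>" "norm u = 1" "norm v \<le> 1" "0 < norm v" "v = norm v *\<^sub>R u"
      using v by (auto simp: sector_def u_def dist_norm norm_minus_commute)
    define \<alpha> where "\<alpha> = a \<bullet> u"
    have uu: "u \<bullet> u = 1" using u(2) by (simp add: norm_eq_1)
    have "(norm (u - a))\<^sup>2 = 2 - 2 * \<alpha>"
      by (simp add: power2_norm_eq_inner inner_diff_left inner_diff_right inner_commute uu aa \<alpha>_def)
    moreover have "(norm (u - a))\<^sup>2 < \<delta>\<^sup>2" using u(1) by (intro power_strict_mono) auto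
    moreover have "\<delta>\<^sup>2 \<le> 1" using \<delta> by (simp add: power_le_one)
    ultimately have \<alpha>: "1 / 2 < \<alpha>" by simp
    have \<alpha>1: "\<alpha> \<le> 1" using Cauchy_Schwarz_ineq2[of a u] a u(2) by (simp add: \<alpha>_def)
    define b where "b = u - \<alpha> *\<^sub>R a"
    have ab: "a \<bullet> b = 0" "b \<bullet> a = 0" by (simp_all add: b_def inner_diff_right inner_diff_left aa \<alpha>_def inner_commute)
    have nb: "norm b < \<delta>"
    proof -
      have "(norm b)\<^sup>2 = 1 - \<alpha>\<^sup>2"
        unfolding power2_norm_eq_inner
        by (simp add: b_def inner_diff_left inner_diff_right uu aa inner_commute[of u a] power2_eq_square flip: \<alpha>_def)
      also have "\<dots> = (1 - \<alpha>) * (1 + \<alpha>)" by (simp add: power2_eq_square algebra_simps)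
      also have "\<dots> \<le> (1 - \<alpha>) * 2" using \<alpha>1 by (intro mult_left_mono) auto
      also have "\<dots> = (norm (u - a))\<^sup>2" using \<open>(norm (u - a))\<^sup>2 = 2 - 2 * \<alpha>\<close> by simp
      finally have "norm b \<le> norm (u - a)" by (rule power2_le_imp_le) simp
      then show ?thesis using u(1) by simp
    qed
    \<comment> \<open>The preimage of \<open>u\<close>: its part \<open>b\<close> orthogonal to
      \<open>a\<close> is shrunk by 25. Since \<open>norm q\<close> exceeds 1/2, the direction of
      \<open>q\<close> is within \<open>4 * norm b / 25\<close> of \<open>a\<close>, which is less
      than \<open>\<delta> / 5\<close>.\<close>
    define q where "q = \<alpha> *\<^sub>R a + (1 / 25) *\<^sub>R b"
    have fq: "?f (norm v *\<^sub>R q) = v"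
    proof -
      have "a \<bullet> q = \<alpha>" by (simp add: q_def inner_add_right aa ab)
      then have "?f (norm v *\<^sub>R q) = norm v *\<^sub>R (25 *\<^sub>R q - (24 * \<alpha>) *\<^sub>R a)"
        by (simp add: algebra_simps)
      also have "25 *\<^sub>R q - (24 * \<alpha>) *\<^sub>R a = (25 * \<alpha> - 24 * \<alpha>) *\<^sub>R a + b"
        unfolding scaleR_diff_left by (simp add: q_def scaleR_add_right)
      also have "\<dots> = u" by (simp add: b_def)
      finally show ?thesis using u(5) by simp
    qed
    have nq: "(norm q)\<^sup>2 = \<alpha>\<^sup>2 + (norm b)\<^sup>2 / 625"
      unfolding power2_norm_eq_inner by (simp add: q_def inner_add_left inner_add_right aa ab power2_eq_square)
    have "(norm u)\<^sup>2 = \<alpha>\<^sup>2 + (norm b)\<^sup>2"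
    proof -
      have "u = \<alpha> *\<^sub>R a + b" by (simp add: b_def)
      then have "u \<bullet> u = \<alpha> * \<alpha> + b \<bullet> b" by (simp add: inner_add_left inner_add_right aa ab)
      then show ?thesis unfolding power2_norm_eq_inner by (simp add: power2_eq_square)
    qed
    moreover have "(norm q)\<^sup>2 \<le> \<alpha>\<^sup>2 + (norm b)\<^sup>2"
      unfolding nq using zero_le_power2[of "norm b"] by linarith
    ultimately have "(norm q)\<^sup>2 \<le> 1\<^sup>2" using u(2) by simp
    then have q1: "norm q \<le> 1" by (rule power2_le_imp_le) simp
    have "\<alpha>\<^sup>2 \<le> (norm q)\<^sup>2" using nq by simp
    then have q\<alpha>: "\<alpha> \<le> norm q" by (rule power2_le_imp_le) simp
    have q0: "0 < norm q" using q\<alpha> \<alpha> by linarith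
    have "norm q \<le> \<alpha> + norm b / 25"
      using norm_triangle_ineq[of "\<alpha> *\<^sub>R a" "(1 / 25) *\<^sub>R b"] a \<alpha> by (simp add: q_def)
    then have dq: "\<bar>\<alpha> - norm q\<bar> \<le> norm b / 25" using q\<alpha> by simp
    have "q - norm q *\<^sub>R a = (\<alpha> - norm q) *\<^sub>R a + (1 / 25) *\<^sub>R b" by (simp add: q_def algebra_simps)
    then have "norm (q - norm q *\<^sub>R a) \<le> norm b / 25 + norm b / 25"
      using norm_triangle_ineq[of "(\<alpha> - norm q) *\<^sub>R a" "(1 / 25) *\<^sub>R b"] a dq by simp
    also have "\<dots> < \<delta> / 5 * norm q"
    proof -
      have "norm b / 25 + norm b / 25 < \<delta> / 10" using nb \<delta> by simp
      also have "\<dots> = \<delta> / 5 * (1 / 2)" by simp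
      also have "\<dots> \<le> \<delta> / 5 * norm q" using q\<alpha> \<alpha> \<delta> by (intro mult_left_mono) auto
      finally show ?thesis .
    qed
    finally have "norm (q /\<^sub>R norm q - a) < \<delta> / 5"
    proof -
      assume "norm (q - norm q *\<^sub>R a) < \<delta> / 5 * norm q"
      moreover have "q /\<^sub>R norm q - a = (q - norm q *\<^sub>R a) /\<^sub>R norm q"
        using q0 by (simp add: scaleR_diff_right)
      then have "norm (q /\<^sub>R norm q - a) = norm (q - norm q *\<^sub>R a) / norm q"
        by (simp add: divide_inverse mult.commute)
      ultimately show ?thesis using q0 by (simp only: pos_divide_less_eq)
    qed
    then have near: "q /\<^sub>R norm q \<in> ball a (\<delta> / 5)" by (simp only: mem_ball dist_norm norm_minus_commute)
    have "norm v *\<^sub>R q \<in> sector 1 (ball a (\<delta> / 5))"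
    proof (rule sectorI)
      have "(norm v *\<^sub>R q) /\<^sub>R norm (norm v *\<^sub>R q) = q /\<^sub>R norm q"
        using u(4) q0 by (simp add: divide_simps)
      then show "(norm v *\<^sub>R q) /\<^sub>R norm (norm v *\<^sub>R q) \<in> ball a (\<delta> / 5)" using near by (simp only:)
    qed (use u(3,4) q0 q1 mult_le_one[of "norm v" "norm q"] in auto)
    then show "v \<in> ?f ` sector 1 (ball a (\<delta> / 5))" by (rule image_eqI[where x="norm v *\<^sub>R q", rotated]) (rule fq[symmetric])
  qed
qed auto

section \<open>Bump mass near a pair of points and averages over reflections\<close>

text \<open>Finitely many rotated copies of the product of two balls cover the pairs \<open>x\<close>, \<open>y\<close> with \<open>x \<bullet> y\<close> close to \<open>s\<close>.\<close>

lemma borel_measurable_indicator_pair: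
  fixes A B :: "'a::euclidean_space set"
  assumes [measurable]: "A \<in> sets borel" "B \<in> sets borel"
  shows "(\<lambda>p. indicator A (fst p) * indicator B (snd p) :: real) \<in> borel_measurable (\<omega> \<Otimes>\<^sub>M \<omega>)"
proof -
  have "(\<lambda>p. indicator A (fst p) * indicator B (snd p) :: real) \<in> borel_measurable (borel \<Otimes>\<^sub>M borel)" by measurable
  from measurable_compose[OF measurable_ident_surface_pair this] show ?thesis .
qed

lemma bump_mass_near:
  fixes x0 y0 :: "real^'n"
  assumes dim: "2 \<le> CARD('n)" and x0: "norm x0 = 1" and y0: "norm y0 = 1" and r: "0 < r"
  obtains N \<delta>1 :: real where "0 < N" "0 < \<delta>1"
    "\<And>\<delta>. 0 < \<delta> \<Longrightarrow> \<delta> \<le> \<delta>1 \<Longrightarrow> 1 \<le> N * (\<integral>p. bump TYPE(real^'n) (x0 \<bullet> y0) \<delta> (fst p \<bullet> snd p) *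
      (indicator (ball x0 r) (fst p) * indicator (ball y0 r) (snd p)) \<partial>(\<omega> \<Otimes>\<^sub>M \<omega>))"
proof -
  define s where "s = x0 \<bullet> y0"
  let ?V = "sphere (0::real^'n) 1 \<times> sphere (0::real^'n) 1"
  let ?E = "{p \<in> ?V. fst p \<bullet> snd p = s}"
  let ?O = "\<lambda>p :: (real^'n) \<times> (real^'n). ball (fst p) r \<times> ball (snd p) r"
  have V: "compact ?V" by (intro compact_Times compact_sphere)
  have ci: "continuous_on S (\<lambda>p :: (real^'n) \<times> (real^'n). fst p \<bullet> snd p)" for S by (intro continuous_intros)
  have E: "compact ?E"
  proof -
    have "closed ((\<lambda>p :: (real^'n) \<times> (real^'n). fst p \<bullet> snd p) -` {s})"
      by (intro closed_vimage continuous_intros)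
    from compact_Int_closed[OF V this] show ?thesis by (simp add: vimage_def Int_def)
  qed
  obtain F where F: "F \<subseteq> ?E" "finite F" "?E \<subseteq> (\<Union>p\<in>F. ?O p)"
  proof (rule compactE_image[OF E, of ?E ?O])
    show "open (?O p)" for p by (intro open_Times open_ball)
    show "?E \<subseteq> (\<Union>p\<in>?E. ?O p)"
    proof
      fix p assume "p \<in> ?E"
      moreover have "p \<in> ?O p" using r by (cases p) simp
      ultimately show "p \<in> (\<Union>p\<in>?E. ?O p)" by blast
    qed
  qed
  have "(x0, y0) \<in> ?E" using x0 y0 by (simp add: s_def)
  then have Fne: "F \<noteq> {}" using F(3) by blast
  \<comment> \<open>On the compact set of pairs outside the cover the inner product misses
    \<open>s\<close>, hence stays \<open>d\<close> away from it; a bump of width at most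
    \<open>d\<close> lives on the cover.\<close>
  have "compact (?V - (\<Union>p\<in>F. ?O p))" by (intro compact_diff V open_UN) (auto intro: open_Times)
  then have "compact ((\<lambda>p. fst p \<bullet> snd p) ` (?V - (\<Union>p\<in>F. ?O p)))"
    by (rule compact_continuous_image[OF ci])
  moreover have "(\<lambda>p. fst p \<bullet> snd p) ` (?V - (\<Union>p\<in>F. ?O p)) \<inter> {s} = {}" using F(3) by auto
  ultimately have "\<exists>d>0. \<forall>u\<in>(\<lambda>p. fst p \<bullet> snd p) ` (?V - (\<Union>p\<in>F. ?O p)). \<forall>v\<in>{s}. d \<le> dist u v"
    by (intro separate_compact_closed closed_singleton)
  then obtain d where d0: "0 < d" "\<forall>u\<in>(\<lambda>p. fst p \<bullet> snd p) ` (?V - (\<Union>p\<in>F. ?O p)). \<forall>v\<in>{s}. d \<le> dist u v"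
    by (elim exE conjE)
  have d: "d \<le> dist (fst p \<bullet> snd p) s" if "p \<in> ?V - (\<Union>p\<in>F. ?O p)" for p
    using d0(2)[rule_format, OF imageI[OF that] singletonI] .
  let ?b = "\<lambda>\<delta> p :: (real^'n) \<times> (real^'n). bump TYPE(real^'n) s \<delta> (fst p \<bullet> snd p)"
  let ?i = "\<lambda>q p :: (real^'n) \<times> (real^'n). indicator (ball (fst q) r) (fst p) * indicator (ball (snd q) r) (snd p) :: real"
  have bm: "?b \<delta> \<in> borel_measurable (\<omega> \<Otimes>\<^sub>M \<omega>)" for \<delta>
    by (intro borel_measurable_continuous_on_surface_pair continuous_on_inner_sphere continuous_on_bump)
  have im: "?i q \<in> borel_measurable (\<omega> \<Otimes>\<^sub>M \<omega>)" for q
    by (intro borel_measurable_indicator_pair) auto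
  have bint: "integrable (\<omega> \<Otimes>\<^sub>M \<omega>) (?b \<delta>)" for \<delta> by (intro integrable_inner_kernel continuous_on_bump)
  have biint: "integrable (\<omega> \<Otimes>\<^sub>M \<omega>) (\<lambda>p. ?b \<delta> p * ?i q p)" for \<delta> q
    by (rule Bochner_Integration.integrable_bound[OF bint[of \<delta>]])
      (use bm im in \<open>auto intro!: borel_measurable_times simp: indicator_def bump_nonneg\<close>)
  have s1: "\<bar>s\<bar> \<le> 1" using Cauchy_Schwarz_ineq2[of x0 y0] x0 y0 by (simp add: s_def)
  \<comment> \<open>A rotation takes \<open>(x0, y0)\<close> to the center of any other copy, so
    every copy has the same bump mass and the number of copies can serve as
    \<open>N\<close>.\<close>
  have same: "(\<integral>p. ?b \<delta> p * ?i q p \<partial>(\<omega> \<Otimes>\<^sub>M \<omega>)) = (\<integral>p. ?b \<delta> p * ?i (x0, y0) p \<partial>(\<omega> \<Otimes>\<^sub>M \<omega>))"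
    if q: "q \<in> F" for q \<delta>
  proof -
    have "norm (fst q) = 1" "norm (snd q) = 1" "x0 \<bullet> y0 = fst q \<bullet> snd q"
      using F(1) q by (auto simp: s_def)
    then obtain R where R: "orthogonal_transformation R" "R x0 = fst q" "R y0 = snd q"
      using orthogonal_transformation_two_points[OF x0 y0] by metis
    have dR: "dist (fst q) (R x) = dist x0 x" "dist (snd q) (R x) = dist y0 x" for x
      using R by (metis orthogonal_transformation_isometry)+
    have iR: "R x \<bullet> R y = x \<bullet> y" for x y using R(1) by (simp add: orthogonal_transformation_def)
    have "(\<integral>p. ?b \<delta> p * ?i q p \<partial>(\<omega> \<Otimes>\<^sub>M \<omega>)) =
       (\<integral>p. ?b \<delta> (R (fst p), R (snd p)) * ?i q (R (fst p), R (snd p)) \<partial>(\<omega> \<Otimes>\<^sub>M \<omega>))"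
      by (rule integral_surface_pair_orthogonal[OF R(1), symmetric]) (intro borel_measurable_times bm im)
    also have "\<dots> = (\<integral>p. ?b \<delta> p * ?i (x0, y0) p \<partial>(\<omega> \<Otimes>\<^sub>M \<omega>))"
      by (intro Bochner_Integration.integral_cong refl) (simp add: iR dR indicator_def)
    finally show ?thesis .
  qed
  show ?thesis
  proof (rule that[of "real (card F)" d])
    show "0 < real (card F)" using F(2) Fne by (simp add: card_gt_0_iff)
    fix \<delta> assume \<delta>: "0 < \<delta>" "\<delta> \<le> d"
    have "1 = (\<integral>p. ?b \<delta> p \<partial>(\<omega> \<Otimes>\<^sub>M \<omega>))" using integral_bump[OF _ s1 \<delta>(1), where 'a="real^'n"] dim by simp
    also have "\<dots> \<le> (\<integral>p. (\<Sum>q\<in>F. ?b \<delta> p * ?i q p) \<partial>(\<omega> \<Otimes>\<^sub>M \<omega>))"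
    proof (rule integral_mono[OF bint])
      show "integrable (\<omega> \<Otimes>\<^sub>M \<omega>) (\<lambda>p. \<Sum>q\<in>F. ?b \<delta> p * ?i q p)" by (intro Bochner_Integration.integrable_sum biint)
      fix p :: "(real^'n) \<times> (real^'n)" assume p: "p \<in> space (\<omega> \<Otimes>\<^sub>M \<omega>)"
      show "?b \<delta> p \<le> (\<Sum>q\<in>F. ?b \<delta> p * ?i q p)"
      proof (cases "?b \<delta> p = 0")
        case True
        then show ?thesis by (simp only: mult_zero_left sum.neutral_const order_refl)
      next
        case False
        then have "dist (fst p \<bullet> snd p) s < d" using bump_support[OF False] \<delta> by (simp add: dist_real_def)
        then have "p \<in> (\<Union>q\<in>F. ?O q)" using d[of p] p by (cases "p \<in> (\<Union>q\<in>F. ?O q)") (auto simp: space_pair_measure)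
        then obtain q where q: "q \<in> F" "p \<in> ?O q" by blast
        then have "?b \<delta> p = ?b \<delta> p * ?i q p" by (cases p) simp
        also have "\<dots> \<le> (\<Sum>q\<in>F. ?b \<delta> p * ?i q p)"
          by (rule member_le_sum[OF q(1) _ F(2)]) (simp add: bump_nonneg)
        finally show ?thesis .
      qed
    qed
    also have "\<dots> = (\<Sum>q\<in>F. (\<integral>p. ?b \<delta> p * ?i q p \<partial>(\<omega> \<Otimes>\<^sub>M \<omega>)))"
      by (rule Bochner_Integration.integral_sum) (rule biint)
    also have "\<dots> = real (card F) * (\<integral>p. ?b \<delta> p * ?i (x0, y0) p \<partial>(\<omega> \<Otimes>\<^sub>M \<omega>))"
      by (simp add: same cong: sum.cong)
    finally show "1 \<le> real (card F) * (\<integral>p. bump TYPE(real^'n) (x0 \<bullet> y0) \<delta> (fst p \<bullet> snd p) *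
      (indicator (ball x0 r) (fst p) * indicator (ball y0 r) (snd p)) \<partial>(\<omega> \<Otimes>\<^sub>M \<omega>))"
      by (simp add: s_def)
  qed (rule d0(1))
qed

lemma reflection_near:
  fixes u e x :: "'a::euclidean_space"
  assumes u: "norm u = 1" and e: "norm e = 1" and x: "norm x = 1"
  shows "norm (reflection u x - reflection e x) \<le> 4 * norm (u - e)"
proof -
  have uu: "u \<bullet> u = 1" "e \<bullet> e = 1" using u e by (simp_all add: norm_eq_1)
  have "reflection e x - reflection u x = 2 *\<^sub>R ((u \<bullet> x) *\<^sub>R (u - e) + ((u - e) \<bullet> x) *\<^sub>R e)"
    by (simp add: reflection_def uu algebra_simps inner_diff_left)
  then have "norm (reflection e x - reflection u x) \<le> 2 * (\<bar>u \<bullet> x\<bar> * norm (u - e) + \<bar>(u - e) \<bullet> x\<bar> * norm e)"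
    using norm_triangle_ineq[of "(u \<bullet> x) *\<^sub>R (u - e)" "((u - e) \<bullet> x) *\<^sub>R e"] by simp
  also have "\<dots> \<le> 2 * (1 * norm (u - e) + norm (u - e) * 1)"
    using Cauchy_Schwarz_ineq2[of u x] Cauchy_Schwarz_ineq2[of "u - e" x] u e x
    by (intro mult_left_mono add_mono mult_mono) auto
  finally show ?thesis by (simp add: norm_minus_commute)
qed

text \<open>Each reflection preserves inner products and the product measure, so the form of
  \<open>K\<close> equals its own average over all mirrors \<open>u\<close>. By Fubini this average
  counts, for every pair, the mirrors that send both points into \<open>K\<close>; near
  \<open>(x0, y0)\<close> there are at least \<open>\<beta>\<close> of them.\<close>

lemma average_over_reflections:
  fixes K :: "(real^'n) set" and w :: "real \<Rightarrow> real"
  assumes K: "K \<in> sets borel" and w: "continuous_on UNIV w" "\<And>u. 0 \<le> w u" and \<beta>: "0 \<le> \<beta>"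
    and low: "\<And>x y. x \<in> ball x0 r \<Longrightarrow> y \<in> ball y0 r \<Longrightarrow> norm x = 1 \<Longrightarrow> norm y = 1 \<Longrightarrow>
       \<beta> \<le> measure \<omega> {u \<in> sphere 0 1. reflection u x \<in> K \<and> reflection u y \<in> K}"
  shows "\<beta> * (\<integral>p. w (fst p \<bullet> snd p) * (indicator (ball x0 r) (fst p) * indicator (ball y0 r) (snd p)) \<partial>(\<omega> \<Otimes>\<^sub>M \<omega>))
    \<le> measure \<omega> (sphere (0::real^'n) 1) * (\<integral>p. w (fst p \<bullet> snd p) * (indicator K (fst p) * indicator K (snd p)) \<partial>(\<omega> \<Otimes>\<^sub>M \<omega>))"
proof -
  have [measurable]: "K \<in> sets borel" by fact
  let ?W = "\<lambda>p :: (real^'n) \<times> (real^'n). w (fst p \<bullet> snd p)"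
  have cW: "continuous_on (sphere 0 1 \<times> sphere 0 1) ?W" by (rule continuous_on_inner_sphere[OF w(1)])
  obtain bw where bw: "0 < bw" "\<And>x y :: real^'n. norm x = 1 \<Longrightarrow> norm y = 1 \<Longrightarrow> \<bar>w (x \<bullet> y)\<bar> \<le> bw"
    using bounded_continuous_on_sphere_pair[OF cW] by auto
  have wm[measurable]: "w \<in> borel_measurable borel" using w(1) by (rule borel_measurable_continuous_onI)
  let ?H = "\<lambda>u p. ?W p * (indicator K (reflection u (fst p)) * indicator K (reflection u (snd p)))"
  interpret P: pair_sigma_finite "\<omega> :: (real^'n) measure" "\<omega> \<Otimes>\<^sub>M (\<omega> :: (real^'n) measure)"
    by (intro pair_sigma_finite.intro surface.sigma_finite_measure_axioms surface_pair.sigma_finite_measure_axioms)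
  interpret PF: finite_measure "\<omega> \<Otimes>\<^sub>M (\<omega> \<Otimes>\<^sub>M (\<omega> :: (real^'n) measure))"
    by (intro finite_measure_pair_measure finite_measure_surface finite_measure_surface_pair)
  have Hm: "case_prod ?H \<in> borel_measurable (\<omega> \<Otimes>\<^sub>M (\<omega> \<Otimes>\<^sub>M \<omega>))"
  proof -
    have b: "case_prod ?H \<in> borel_measurable (borel \<Otimes>\<^sub>M (borel \<Otimes>\<^sub>M borel))"
      unfolding reflection_def case_prod_beta' by measurable
    have "(\<lambda>q. (fst q, snd q)) \<in> \<omega> \<Otimes>\<^sub>M (\<omega> \<Otimes>\<^sub>M (\<omega> :: (real^'n) measure)) \<rightarrow>\<^sub>M borel \<Otimes>\<^sub>M (borel \<Otimes>\<^sub>M borel)"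
      by (rule measurable_Pair[OF measurable_compose[OF measurable_fst measurable_ident_surface]
          measurable_compose[OF measurable_snd measurable_ident_surface_pair]])
    then show ?thesis using measurable_compose[OF _ b, of "\<lambda>q. q"] by simp
  qed
  have Hint: "integrable (\<omega> \<Otimes>\<^sub>M (\<omega> \<Otimes>\<^sub>M \<omega>)) (case_prod ?H)"
    by (rule PF.integrable_const_bound[OF _ Hm, of bw])
      (use bw in \<open>auto simp: space_pair_measure indicator_def less_imp_le\<close>)
  have Wm: "?W \<in> borel_measurable (\<omega> \<Otimes>\<^sub>M \<omega>)" by (rule borel_measurable_continuous_on_surface_pair[OF cW])
  note ind = borel_measurable_indicator_pair
  define J where "J = (\<integral>p. ?W p * (indicator K (fst p) * indicator K (snd p)) \<partial>(\<omega> \<Otimes>\<^sub>M \<omega>))"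
  have inner1: "(\<integral>p. ?H u p \<partial>(\<omega> \<Otimes>\<^sub>M \<omega>)) = J" for u
    unfolding J_def
    using integral_surface_pair_orthogonal[OF orthogonal_transformation_reflection[of u],
        of "\<lambda>p. ?W p * (indicator K (fst p) * indicator K (snd p))"] Wm ind[OF K K]
    by simp
  have inner2: "(\<integral>u. ?H u p \<partial>\<omega>) = ?W p * measure \<omega> {u \<in> sphere 0 1. reflection u (fst p) \<in> K \<and> reflection u (snd p) \<in> K}" for p
  proof -
    let ?S = "{u \<in> sphere 0 1. reflection u (fst p) \<in> K \<and> reflection u (snd p) \<in> K}"
    have "(\<integral>u. ?H u p \<partial>\<omega>) = (\<integral>u. ?W p * indicator ?S u \<partial>\<omega>)"
      by (intro Bochner_Integration.integral_cong refl) (auto simp: indicator_def)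
    also have "\<dots> = ?W p * measure \<omega> (?S \<inter> sphere 0 1)" by simp
    also have "?S \<inter> sphere 0 1 = ?S" by auto
    finally show ?thesis .
  qed
  have "\<beta> * (\<integral>p. ?W p * (indicator (ball x0 r) (fst p) * indicator (ball y0 r) (snd p)) \<partial>(\<omega> \<Otimes>\<^sub>M \<omega>)) =
     (\<integral>p. \<beta> * (?W p * (indicator (ball x0 r) (fst p) * indicator (ball y0 r) (snd p))) \<partial>(\<omega> \<Otimes>\<^sub>M \<omega>))" by simp
  also have "\<dots> \<le> (\<integral>p. (\<integral>u. ?H u p \<partial>\<omega>) \<partial>(\<omega> \<Otimes>\<^sub>M \<omega>))"
  proof (rule integral_mono)
    show "integrable (\<omega> \<Otimes>\<^sub>M \<omega>) (\<lambda>p. \<beta> * (?W p * (indicator (ball x0 r) (fst p) * indicator (ball y0 r) (snd p))))"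
      using bw \<beta> Wm ind[of "ball x0 r" "ball y0 r"]
      by (intro integrable_mult_right integrable_surface_pair_bounded[where B=bw])
        (auto simp: indicator_def less_imp_le)
    show "integrable (\<omega> \<Otimes>\<^sub>M \<omega>) (\<lambda>p. (\<integral>u. ?H u p \<partial>\<omega>))"
      by (rule P.integrable_snd[OF Hint])
    fix p :: "(real^'n) \<times> (real^'n)" assume p: "p \<in> space (\<omega> \<Otimes>\<^sub>M \<omega>)"
    show "\<beta> * (?W p * (indicator (ball x0 r) (fst p) * indicator (ball y0 r) (snd p))) \<le> (\<integral>u. ?H u p \<partial>\<omega>)"
    proof (cases "fst p \<in> ball x0 r \<and> snd p \<in> ball y0 r")
      case True
      then have "\<beta> \<le> measure \<omega> {u \<in> sphere 0 1. reflection u (fst p) \<in> K \<and> reflection u (snd p) \<in> K}"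
        using low[of "fst p" "snd p"] p by auto
      from mult_left_mono[OF this w(2)] True show ?thesis unfolding inner2 by (simp add: mult.commute)
    next
      case False
      then show ?thesis unfolding inner2 using w(2) by (auto simp: indicator_def)
    qed
  qed
  also have "\<dots> = (\<integral>u. (\<integral>p. ?H u p \<partial>(\<omega> \<Otimes>\<^sub>M \<omega>)) \<partial>\<omega>)" by (rule P.Fubini_integral[OF Hint])
  also have "\<dots> = measure \<omega> (sphere (0::real^'n) 1) * J" unfolding inner1 by simp
  finally show ?thesis by (simp add: J_def)
qed

section \<open>Density points\<close>

text \<open>A form of Lebesgue density with one radius for all points. Neighbourhoods of a compact
  \<open>K\<close> shrink to \<open>K\<close> in measure, so for a small radius few pairs of a point
  in \<open>K\<close> and a nearby point outside exist. Markov's inequality then bounds the set of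
  points of \<open>K\<close> that see too much of the complement.\<close>

lemma density_subset:
  fixes K :: "(real^'n) set"
  assumes K: "compact K" "K \<subseteq> sphere 0 1" and pos: "0 < \<epsilon>" "0 < \<kappa>" "0 < \<delta>0"
  obtains \<delta> K' where "0 < \<delta>" "\<delta> \<le> \<delta>0" "K' \<in> sets \<omega>" "K' \<subseteq> K" "measure \<omega> K < measure \<omega> K' + \<epsilon>"
    "\<And>x. x \<in> K' \<Longrightarrow> measure \<omega> ((ball x \<delta> - K) \<inter> sphere 0 1) < \<kappa> * measure \<omega> (ball x \<delta> \<inter> sphere 0 1)"
proof (cases "K = {}")
  case True
  then show ?thesis using that[of \<delta>0 "{}"] pos by simp
next
  case False
  then obtain z where z: "z \<in> K" "norm z = 1" using K(2) by (meson ex_in_conv mem_sphere_0 subsetD)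
  have Kb[measurable]: "K \<in> sets borel" using K(1) by (intro borel_closed compact_imp_closed)
  have Ks: "K \<in> sets \<omega>" using K(2) Kb by (simp add: surface_sets_iff)
  define A where "A = (\<lambda>n :: nat. (\<Union>x\<in>K. ball x (\<delta>0 / real (Suc n))) \<inter> sphere 0 1)"
  have As: "A n \<in> sets \<omega>" for n
    unfolding A_def by (intro surface_setsI borel_open open_UN ballI open_ball)
  have "decseq A"
  proof (rule decseq_SucI)
    fix n
    have "\<delta>0 / real (Suc (Suc n)) \<le> \<delta>0 / real (Suc n)" using pos by (intro divide_left_mono) auto
    then show "A (Suc n) \<le> A n" unfolding A_def by (meson Int_mono UN_mono order_refl subset_ball)
  qed
  moreover have "(\<Inter>n. A n) = K"
  proof (intro equalityI subsetI)
    fix y assume y: "y \<in> (\<Inter>n. A n)"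
    have "\<exists>x\<in>K. dist x y < e" if e: "0 < e" for e
    proof -
      obtain n where "\<delta>0 / e < real n" using reals_Archimedean2 by blast
      then have "\<delta>0 < e * real (Suc n)" using e by (simp add: field_simps)
      then have "\<delta>0 / real (Suc n) < e" by (simp add: field_simps)
      moreover have "y \<in> A n" using y by blast
      then obtain x where "x \<in> K" "dist x y < \<delta>0 / real (Suc n)" unfolding A_def by auto
      ultimately show ?thesis by (meson less_trans)
    qed
    then have "y \<in> closure K" by (simp add: closure_approachable)
    then show "y \<in> K" using K(1) by (simp add: compact_imp_closed)
  next
    fix y assume "y \<in> K"
    moreover have "0 < \<delta>0 / real (Suc n)" for n using pos by simp
    ultimately show "y \<in> (\<Inter>n. A n)" unfolding A_def using K(2) by force
  qed
  ultimately have lim: "(\<lambda>n. measure \<omega> (A n)) \<longlonglongrightarrow> measure \<omega> K"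
    using surface.finite_Lim_measure_decseq[of A] As by auto
  have "eventually (\<lambda>n. measure \<omega> (A n) < measure \<omega> K + \<kappa> * \<epsilon>) sequentially"
    by (rule order_tendstoD[OF lim]) (use pos in simp)
  then obtain n where n: "measure \<omega> (A n) < measure \<omega> K + \<kappa> * \<epsilon>" by (auto simp: eventually_sequentially)
  define \<delta> where "\<delta> = \<delta>0 / real (Suc n)"
  have \<delta>: "0 < \<delta>" "\<delta> \<le> \<delta>0" using pos by (auto simp: \<delta>_def field_simps)
  define \<beta> where "\<beta> = measure \<omega> (ball z \<delta> \<inter> sphere 0 1)"
  have \<beta>0: "0 < \<beta>" unfolding \<beta>_def using \<delta> z by (intro measure_surface_pos) auto
  have \<beta>: "measure \<omega> (ball x \<delta> \<inter> sphere 0 1) = \<beta>" if "norm x = 1" for x :: "real^'n"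
    unfolding \<beta>_def by (rule measure_cap_cong[OF that z(2)])
  define h where "h = (\<lambda>x. measure \<omega> ((ball x \<delta> - K) \<inter> sphere 0 1))"
  let ?H = "\<lambda>x y :: real^'n. indicator K x * (indicator {p. dist (fst p) (snd p) < \<delta>} (x, y) * indicator (- K) y) :: real"
  have Hm: "case_prod ?H \<in> borel_measurable (\<omega> \<Otimes>\<^sub>M \<omega>)"
  proof -
    have "case_prod ?H \<in> borel_measurable (borel \<Otimes>\<^sub>M borel)" unfolding case_prod_beta' by measurable
    from measurable_compose[OF measurable_ident_surface_pair this] show ?thesis .
  qed
  have Hint: "integrable (\<omega> \<Otimes>\<^sub>M \<omega>) (case_prod ?H)"
    by (rule integrable_surface_pair_bounded[OF Hm, of 1]) (auto simp: indicator_def)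
  have H1: "(\<integral>y. ?H x y \<partial>\<omega>) = indicator K x * h x" for x
  proof -
    have "(\<integral>y. ?H x y \<partial>\<omega>) = (\<integral>y. indicator K x * indicator (ball x \<delta> - K) y \<partial>\<omega>)"
      by (intro Bochner_Integration.integral_cong refl) (auto simp: indicator_def)
    then show ?thesis by (simp add: h_def)
  qed
  have hm: "(\<lambda>x. indicator K x * h x) \<in> borel_measurable \<omega>"
    using surface.borel_measurable_lebesgue_integral[OF Hm] unfolding H1 .
  let ?K' = "{x \<in> space \<omega>. indicator K x * h x < \<kappa> * \<beta>} \<inter> K"
  have K's: "?K' \<in> sets \<omega>" using hm Ks by (intro sets.Int borel_measurable_less) auto
  have eqs: "(K - ?K') \<inter> space \<omega> = K - ?K'" using K(2) by auto
  \<comment> \<open>The pairs are counted twice. From the side of \<open>K\<close>, each discarded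
    point sees at least \<open>\<kappa> * \<beta>\<close> of the complement; from the other side, a
    point sees at most a cap, and nothing unless it lies in \<open>A n - K\<close>.\<close>
  have "\<kappa> * \<beta> * measure \<omega> (K - ?K') = (\<integral>x. \<kappa> * \<beta> * indicator (K - ?K') x \<partial>\<omega>)"
    by (simp only: integral_mult_right_zero Bochner_Integration.integral_indicator eqs)
  also have "\<dots> \<le> (\<integral>x. (\<integral>y. ?H x y \<partial>\<omega>) \<partial>\<omega>)"
  proof (rule integral_mono)
    show "integrable \<omega> (\<lambda>x. \<kappa> * \<beta> * indicator (K - ?K') x)"
      using Ks K's by (intro integrable_mult_right integrable_real_indicator sets.Diff) (auto simp: surface.emeasure_finite less_top[symmetric])
    show "integrable \<omega> (\<lambda>x. \<integral>y. ?H x y \<partial>\<omega>)" using surface2.integrable_fst[OF Hint] .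
    fix x :: "real^'n" assume x: "x \<in> space \<omega>"
    have "0 \<le> h x" by (simp add: h_def)
    then show "\<kappa> * \<beta> * indicator (K - ?K') x \<le> (\<integral>y. ?H x y \<partial>\<omega>)"
      unfolding H1 using x by (auto simp: indicator_def not_less)
  qed
  also have "\<dots> = (\<integral>y. (\<integral>x. ?H x y \<partial>\<omega>) \<partial>\<omega>)" using surface2.Fubini_integral[OF Hint] by simp
  also have "\<dots> \<le> (\<integral>y. \<beta> * indicator (A n - K) y \<partial>\<omega>)"
  proof (rule integral_mono)
    show "integrable \<omega> (\<lambda>y. \<beta> * indicator (A n - K) y)"
      using Ks As by (intro integrable_mult_right integrable_real_indicator sets.Diff) (auto simp: surface.emeasure_finite less_top[symmetric])
    show "integrable \<omega> (\<lambda>y. \<integral>x. ?H x y \<partial>\<omega>)" using surface2.integrable_snd[OF Hint] .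
    fix y :: "real^'n" assume y: "y \<in> space \<omega>"
    have "(\<integral>x. ?H x y \<partial>\<omega>) = (\<integral>x. indicator (- K) y * indicator (K \<inter> ball y \<delta>) x \<partial>\<omega>)"
      by (intro Bochner_Integration.integral_cong refl) (auto simp: indicator_def dist_commute)
    then have eq: "(\<integral>x. ?H x y \<partial>\<omega>) = indicator (- K) y * measure \<omega> (K \<inter> ball y \<delta> \<inter> sphere 0 1)" by simp
    show "(\<integral>x. ?H x y \<partial>\<omega>) \<le> \<beta> * indicator (A n - K) y"
    proof (cases "y \<in> A n \<or> y \<in> K")
      case True
      have "measure \<omega> (K \<inter> ball y \<delta> \<inter> sphere 0 1) \<le> measure \<omega> (ball y \<delta> \<inter> sphere 0 1)"
        by (intro surface.finite_measure_mono surface_setsI) auto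
      then show ?thesis unfolding eq using True \<beta>[of y] y by (auto simp: indicator_def)
    next
      case False
      then have "K \<inter> ball y \<delta> = {}" using y by (auto simp: A_def \<delta>_def dist_commute)
      then show ?thesis unfolding eq using \<beta>0 by (simp add: indicator_def)
    qed
  qed
  also have "\<dots> = \<beta> * measure \<omega> ((A n - K) \<inter> sphere 0 1)" by simp
  also have "(A n - K) \<inter> sphere 0 1 = A n - K" using K(2) by (auto simp: A_def)
  also have "measure \<omega> (A n - K) = measure \<omega> (A n) - measure \<omega> K"
    using As Ks K(2) \<delta>(1) by (intro surface.finite_measure_Diff) (auto simp: A_def \<delta>_def)
  also have "\<beta> * (measure \<omega> (A n) - measure \<omega> K) < \<beta> * (\<kappa> * \<epsilon>)" using n \<beta>0 by (intro mult_strict_left_mono) auto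
  finally have "(\<kappa> * \<beta>) * measure \<omega> (K - ?K') < (\<kappa> * \<beta>) * \<epsilon>" by (simp only: mult.assoc mult.left_commute)
  then have "measure \<omega> (K - ?K') < \<epsilon>" using pos \<beta>0 by (simp only: mult_less_cancel_left_pos mult_pos_pos)
  moreover have "measure \<omega> (K - ?K') = measure \<omega> K - measure \<omega> ?K'"
    using Ks K's by (intro surface.finite_measure_Diff) auto
  ultimately have "measure \<omega> K < measure \<omega> ?K' + \<epsilon>" by linarith
  moreover have "measure \<omega> ((ball x \<delta> - K) \<inter> sphere 0 1) < \<kappa> * measure \<omega> (ball x \<delta> \<inter> sphere 0 1)" if "x \<in> ?K'" for x
    using that \<beta>[of x] by (auto simp: h_def)
  ultimately show ?thesis using that[OF \<delta> K's] by blast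
qed

text \<open>The mirror \<open>e\<close> swaps \<open>x0\<close> and \<open>y0\<close>, so a mirror
  \<open>u\<close> near \<open>e\<close> sends \<open>x\<close> near \<open>y0\<close> and
  \<open>y\<close> near \<open>x0\<close>: an error \<open>\<rho>\<close> from the point and
  \<open>4 * \<rho>\<close> from the mirror give the radius \<open>5 * \<rho>\<close>. The only bad
  mirrors send a point into the part of that ball missed by \<open>K\<close>, and by
  \<open>measure_reflection_vimage_le\<close> they have measure at most \<open>C * m\<close> for
  each of the two points.\<close>

lemma many_reflections:
  fixes K :: "(real^'n) set"
  assumes K[measurable]: "K \<in> sets borel" and norms: "norm e = 1" "norm x = 1" "norm y = 1"
    and swap: "reflection e x0 = y0" "reflection e y0 = x0"
    and c: "0 < c" "2 * c \<le> e \<bullet> x0" "e \<bullet> y0 \<le> - (2 * c)" and \<rho>: "2 * \<rho> \<le> c"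
    and near: "dist x0 x < \<rho>" "dist y0 y < \<rho>" and n0: "norm x0 = 1" "norm y0 = 1"
    and small: "measure \<omega> ((ball x0 (5 * \<rho>) - K) \<inter> sphere 0 1) \<le> m" "measure \<omega> ((ball y0 (5 * \<rho>) - K) \<inter> sphere 0 1) \<le> m"
    and C: "C = (2 * (1 / c) * DIM(real^'n)) ^ DIM(real^'n)"
  shows "measure \<omega> (ball e \<rho> \<inter> sphere 0 1) \<le> measure \<omega> {u \<in> sphere 0 1. reflection u x \<in> K \<and> reflection u y \<in> K} + 2 * C * m"
proof -
  define X where "X = {u. c \<le> u \<bullet> x \<and> reflection u x \<in> ball y0 (5 * \<rho>) - K}"
  define Y where "Y = {u. c \<le> u \<bullet> y \<and> reflection u y \<in> ball x0 (5 * \<rho>) - K}"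
  define G where "G = {u. reflection u x \<in> K \<and> reflection u y \<in> K}"
  have [measurable]: "(\<lambda>u :: real^'n. reflection u a) \<in> borel_measurable borel" for a
    unfolding reflection_def by measurable
  have [measurable]: "ball a r - K \<in> sets borel" for a r by (intro sets.Diff borel_open open_ball K)
  have X[measurable]: "X \<in> sets borel" unfolding X_def by measurable
  have Y[measurable]: "Y \<in> sets borel" unfolding Y_def by measurable
  have G[measurable]: "G \<in> sets borel" unfolding G_def by measurable
  \<comment> \<open>The inner product of \<open>u\<close> with \<open>y\<close> is negative, while
    the bound on mirrors needs a positive one. Since \<open>u\<close> and \<open>- u\<close> define
    the same reflection, \<open>Y\<close> is used for \<open>- u\<close>.\<close>
  have uY: "uminus -` Y \<in> sets borel" using measurable_sets_borel[of uminus borel Y] Y by simp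
  have C0: "0 \<le> C" using c(1) by (simp add: C)
  have mX: "measure \<omega> (X \<inter> sphere 0 1) \<le> C * m"
    using measure_reflection_vimage_le[OF norms(2) c(1), of "ball y0 (5 * \<rho>) - K"] mult_left_mono[OF small(2) C0]
    unfolding X_def C by (auto intro: order_trans)
  have mY: "measure \<omega> (uminus -` Y \<inter> sphere 0 1) \<le> C * m"
    using measure_reflection_vimage_le[OF norms(3) c(1), of "ball x0 (5 * \<rho>) - K"] mult_left_mono[OF small(1) C0]
    unfolding measure_surface_uminus[OF Y] unfolding Y_def C by (auto intro: order_trans)
  have "ball e \<rho> \<inter> sphere 0 1 \<subseteq> (G \<inter> sphere 0 1) \<union> (X \<inter> sphere 0 1) \<union> (uminus -` Y \<inter> sphere 0 1)"
  proof
    fix u assume u: "u \<in> ball e \<rho> \<inter> sphere 0 1"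
    have n1: "norm u = 1" and ue: "norm (u - e) < \<rho>" using u by (auto simp: dist_norm norm_minus_commute)
    have Rx: "dist y0 (reflection u x) < 5 * \<rho>"
    proof -
      have "dist y0 (reflection u x) \<le> dist (reflection e x0) (reflection e x) + dist (reflection e x) (reflection u x)"
        unfolding swap(1) by (rule dist_triangle)
      moreover have "dist (reflection e x0) (reflection e x) = dist x0 x"
        by (meson orthogonal_transformation_isometry orthogonal_transformation_reflection)
      moreover have "dist (reflection e x) (reflection u x) \<le> 4 * norm (u - e)"
        using reflection_near[OF n1 norms(1,2)] by (simp add: dist_norm norm_minus_commute)
      ultimately show ?thesis using near ue by linarith
    qed
    have Ry: "dist x0 (reflection u y) < 5 * \<rho>"
    proof -
      have "dist x0 (reflection u y) \<le> dist (reflection e y0) (reflection e y) + dist (reflection e y) (reflection u y)"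
        unfolding swap(2) by (rule dist_triangle)
      moreover have "dist (reflection e y0) (reflection e y) = dist y0 y"
        by (meson orthogonal_transformation_isometry orthogonal_transformation_reflection)
      moreover have "dist (reflection e y) (reflection u y) \<le> 4 * norm (u - e)"
        using reflection_near[OF n1 norms(1,3)] by (simp add: dist_norm norm_minus_commute)
      ultimately show ?thesis using near ue by linarith
    qed
    have "\<bar>u \<bullet> x - e \<bullet> x0\<bar> \<le> norm (u - e) + norm (x - x0)" by (rule inner_diff_le_unit[OF norms(2,1)])
    then have ux: "c \<le> u \<bullet> x" using ue near(1) c \<rho> by (simp add: dist_norm norm_minus_commute)
    have "\<bar>u \<bullet> y - e \<bullet> y0\<bar> \<le> norm (u - e) + norm (y - y0)" by (rule inner_diff_le_unit[OF norms(3,1)])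
    then have uy: "c \<le> - u \<bullet> y" using ue near(2) c \<rho> by (simp add: dist_norm norm_minus_commute)
    show "u \<in> (G \<inter> sphere 0 1) \<union> (X \<inter> sphere 0 1) \<union> (uminus -` Y \<inter> sphere 0 1)"
      using Rx Ry ux uy n1 by (auto simp: G_def X_def Y_def)
  qed
  then have "measure \<omega> (ball e \<rho> \<inter> sphere 0 1) \<le> measure \<omega> ((G \<inter> sphere 0 1) \<union> (X \<inter> sphere 0 1) \<union> (uminus -` Y \<inter> sphere 0 1))"
    by (rule surface.finite_measure_mono) (intro sets.Un surface_setsI G X uY)
  also have "\<dots> \<le> measure \<omega> ((G \<inter> sphere 0 1) \<union> (X \<inter> sphere 0 1)) + measure \<omega> (uminus -` Y \<inter> sphere 0 1)"
    by (rule measure_Un_le) (intro sets.Un surface_setsI G X uY)+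
  also have "measure \<omega> ((G \<inter> sphere 0 1) \<union> (X \<inter> sphere 0 1)) \<le> measure \<omega> (G \<inter> sphere 0 1) + measure \<omega> (X \<inter> sphere 0 1)"
    by (rule measure_Un_le) (intro surface_setsI G X)+
  also have "G \<inter> sphere 0 1 = {u \<in> sphere 0 1. reflection u x \<in> K \<and> reflection u y \<in> K}" by (auto simp: G_def)
  finally show ?thesis using mX mY by simp
qed

text \<open>Bumps are available only at the countably many numbers in \<open>T\<close>. Moving
  \<open>y0\<close> slightly along the great circle through \<open>x0\<close> and \<open>y0\<close>
  changes the inner product to an element of \<open>T\<close>; the circle exists because
  \<open>x0\<close> and \<open>y0\<close> are not parallel.\<close>

lemma approximate_inner:
  fixes x0 y0 :: "'a::euclidean_space"
  assumes norms: "norm x0 = 1" "norm y0 = 1" and t: "\<bar>x0 \<bullet> y0\<bar> < 1" "x0 \<bullet> y0 \<in> closure T" and T: "T \<subseteq> {-1..1}" and r: "0 < r"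
  obtains y1 where "norm y1 = 1" "x0 \<bullet> y1 \<in> T" "dist y0 y1 < r"
proof -
  define t where "t = x0 \<bullet> y0"
  have xx: "x0 \<bullet> x0 = 1" "y0 \<bullet> y0 = 1" using norms by (simp_all add: norm_eq_1)
  have "t\<^sup>2 < 1" using t(1) by (simp add: t_def abs_square_less_1)
  then have q: "0 < sqrt (1 - t\<^sup>2)" "(sqrt (1 - t\<^sup>2))\<^sup>2 = 1 - t\<^sup>2" by simp_all
  define v where "v = (1 / sqrt (1 - t\<^sup>2)) *\<^sub>R (y0 - t *\<^sub>R x0)"
  have xv: "x0 \<bullet> v = 0" by (simp add: v_def inner_diff_right xx t_def)
  have "(y0 - t *\<^sub>R x0) \<bullet> (y0 - t *\<^sub>R x0) = 1 - t\<^sup>2"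
    by (simp add: inner_diff_left inner_diff_right xx inner_commute t_def[symmetric] power2_eq_square)
  then have vv: "v \<bullet> v = 1" using q by (simp add: v_def power2_eq_square)
  let ?y = "\<lambda>s. s *\<^sub>R x0 + sqrt (1 - s\<^sup>2) *\<^sub>R v"
  have yt: "?y t = y0" using q by (simp add: v_def)
  have "isCont ?y t" by (intro continuous_intros)
  then obtain d where d: "0 < d" "\<And>s. dist s t < d \<Longrightarrow> dist (?y s) (?y t) < r"
    using r unfolding continuous_at_eps_delta by blast
  obtain s where s: "s \<in> T" "dist s t < d" using t(2) d(1) unfolding closure_approachable t_def by blast
  have "s\<^sup>2 \<le> 1" using s(1) T by (force simp: abs_square_le_1)
  then have "?y s \<bullet> ?y s = 1"
    by (simp add: inner_add_left inner_add_right xx xv vv inner_commute[of v x0] power2_eq_square[symmetric])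
  then have "norm (?y s) = 1" by (simp add: norm_eq_1)
  moreover have "x0 \<bullet> ?y s = s" by (simp add: inner_add_right xx xv)
  moreover have "dist y0 (?y s) < r" using d(2)[OF s(2)] unfolding yt by (simp add: dist_commute)
  ultimately show ?thesis using that[of "?y s"] s(1) by simp
qed

text \<open>Near two adjacent density points of \<open>K\<close>, a fixed share of mirrors carries a
  fixed share of every narrow bump's mass into pairs of points of \<open>K\<close>. This contradicts
  the vanishing of the bump averages of \<open>K\<close>.\<close>

lemma density_points_not_adjacent:
  fixes K :: "(real^'n) set"
  assumes dim: "2 \<le> CARD('n)" and K: "K \<in> sets borel" and T: "T \<subseteq> {-1..1}"
    and zero: "\<And>t \<eta> \<delta>0. t \<in> T \<Longrightarrow> 0 < \<eta> \<Longrightarrow> 0 < \<delta>0 \<Longrightarrow> \<exists>\<delta>>0. \<delta> \<le> \<delta>0 \<and>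
      (\<integral>p. bump TYPE(real^'n) t \<delta> (fst p \<bullet> snd p) * (indicator K (fst p) * indicator K (snd p)) \<partial>(\<omega> \<Otimes>\<^sub>M \<omega>)) \<le> \<eta>"
    and n0: "norm x0 = 1" "norm y0 = 1" and t: "\<bar>x0 \<bullet> y0\<bar> < 1" "x0 \<bullet> y0 \<in> closure T"
    and c: "0 < c" "4 * c \<le> dist x0 y0" and \<rho>: "0 < \<rho>" "2 * \<rho> \<le> c"
    and small: "measure \<omega> ((ball x0 (5 * \<rho>) - K) \<inter> sphere 0 1) \<le> m" "measure \<omega> ((ball y0 (5 * \<rho>) - K) \<inter> sphere 0 1) \<le> m"
    and m: "3 * (2 * (1 / c) * DIM(real^'n)) ^ DIM(real^'n) * m \<le> measure \<omega> (ball x0 \<rho> \<inter> sphere 0 1)"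
  shows False
proof -
  \<comment> \<open>The unit normal of the mirror that swaps the two points; its inner products with
    them are plus and minus half their distance, hence at least \<open>2 * c\<close> in absolute
    value.\<close>
  define e where "e = (x0 - y0) /\<^sub>R norm (x0 - y0)"
  have ne: "0 < norm (x0 - y0)" using c unfolding dist_norm by linarith
  have xx: "x0 \<bullet> x0 = 1" "y0 \<bullet> y0 = 1" using n0 by (simp_all add: norm_eq_1)
  have e: "norm e = 1" using ne by (simp add: e_def)
  have sq: "norm (x0 - y0) * norm (x0 - y0) = 2 - 2 * (x0 \<bullet> y0)"
    by (simp add: power2_eq_square[symmetric] power2_norm_eq_inner inner_diff_left inner_diff_right xx inner_commute)
  have "e \<bullet> x0 = (1 - x0 \<bullet> y0) / norm (x0 - y0)" "e \<bullet> y0 = - ((1 - x0 \<bullet> y0) / norm (x0 - y0))"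
    using ne by (simp_all add: e_def inner_diff_left xx inner_commute divide_inverse algebra_simps del: scaleR_diff_right)
  moreover have "1 - x0 \<bullet> y0 = norm (x0 - y0) / 2 * norm (x0 - y0)" using sq by simp
  ultimately have ex: "e \<bullet> x0 = norm (x0 - y0) / 2" and ey: "e \<bullet> y0 = - (norm (x0 - y0) / 2)"
    using ne by simp_all
  have rsc: "reflection (a *\<^sub>R u) w = reflection u w" if "a \<noteq> 0" for a and u w :: "real^'n"
    using that by (simp add: reflection_def)
  have sw1: "reflection e x0 = y0" unfolding e_def using rsc ne reflection_diff[of x0 y0] n0 by simp
  have sw2: "reflection e y0 = x0"
    using rsc[of "-1" "x0 - y0" y0] rsc[of "inverse (norm (x0 - y0))" "x0 - y0" y0] ne reflection_diff[of y0 x0] n0 by (simp add: e_def)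
  define C where "C = (2 * (1 / c) * DIM(real^'n)) ^ DIM(real^'n)"
  define \<beta> where "\<beta> = measure \<omega> (ball x0 \<rho> \<inter> sphere 0 1)"
  have \<beta>0: "0 < \<beta>" unfolding \<beta>_def using n0 \<rho> by (intro measure_surface_pos) auto
  have \<beta>e: "measure \<omega> (ball e \<rho> \<inter> sphere 0 1) = \<beta>" unfolding \<beta>_def by (rule measure_cap_cong[OF e n0(1)])
  have many: "\<beta> / 3 \<le> measure \<omega> {u \<in> sphere 0 1. reflection u x \<in> K \<and> reflection u y \<in> K}"
    if "norm x = 1" "norm y = 1" "dist x0 x < \<rho>" "dist y0 y < \<rho>" for x y
  proof -
    have "2 * c \<le> e \<bullet> x0" "e \<bullet> y0 \<le> - (2 * c)" using c(2) by (simp_all add: ex ey dist_norm)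
    from many_reflections[OF K e that(1,2) sw1 sw2 c(1) this \<rho>(2) that(3,4) n0 small C_def]
    have "\<beta> \<le> measure \<omega> {u \<in> sphere 0 1. reflection u x \<in> K \<and> reflection u y \<in> K} + 2 * C * m" by (simp add: \<beta>e)
    moreover have "3 * C * m \<le> \<beta>" using m by (simp add: C_def \<beta>_def)
    ultimately show ?thesis by linarith
  qed
  \<comment> \<open>Half the radius, so that a ball of radius \<open>\<rho> / 2\<close> around the
    displaced point \<open>y1\<close> stays within \<open>\<rho>\<close> of
    \<open>y0\<close>.\<close>
  have "0 < \<rho> / 2" using \<rho> by simp
  from approximate_inner[OF n0 t T this] obtain y1 where y1: "norm y1 = 1" "x0 \<bullet> y1 \<in> T" "dist y0 y1 < \<rho> / 2" by metis
  obtain N \<delta>1 where N: "0 < N" "0 < \<delta>1"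
    "\<And>\<delta>. 0 < \<delta> \<Longrightarrow> \<delta> \<le> \<delta>1 \<Longrightarrow> 1 \<le> N * (\<integral>p. bump TYPE(real^'n) (x0 \<bullet> y1) \<delta> (fst p \<bullet> snd p) *
      (indicator (ball x0 (\<rho>/2)) (fst p) * indicator (ball y1 (\<rho>/2)) (snd p)) \<partial>(\<omega> \<Otimes>\<^sub>M \<omega>))"
    by (rule bump_mass_near[OF dim n0(1) y1(1) \<open>0 < \<rho> / 2\<close>]) blast
  define S where "S = measure \<omega> (sphere (0::real^'n) 1)"
  have S: "0 < S" using measure_surface_pos[of UNIV x0] n0 by (simp add: S_def)
  \<comment> \<open>Then \<open>N * S * \<eta>\<close> is \<open>\<beta> / 6\<close>, half of the
    lower bound \<open>\<beta> / 3\<close> that the mirrors enforce.\<close>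
  define \<eta> where "\<eta> = \<beta> / (6 * N * S)"
  have "0 < \<eta>" using \<beta>0 N S by (simp add: \<eta>_def)
  from zero[OF y1(2) this N(2)] obtain \<delta> where \<delta>: "0 < \<delta>" "\<delta> \<le> \<delta>1"
    "(\<integral>p. bump TYPE(real^'n) (x0 \<bullet> y1) \<delta> (fst p \<bullet> snd p) * (indicator K (fst p) * indicator K (snd p)) \<partial>(\<omega> \<Otimes>\<^sub>M \<omega>)) \<le> \<eta>" by blast
  define J where "J = (\<integral>p. bump TYPE(real^'n) (x0 \<bullet> y1) \<delta> (fst p \<bullet> snd p) *
      (indicator (ball x0 (\<rho>/2)) (fst p) * indicator (ball y1 (\<rho>/2)) (snd p)) \<partial>(\<omega> \<Otimes>\<^sub>M \<omega>))"
  have J: "1 \<le> N * J" unfolding J_def by (rule N(3)[OF \<delta>(1,2)])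
  have "\<beta> / 3 * J \<le> S * (\<integral>p. bump TYPE(real^'n) (x0 \<bullet> y1) \<delta> (fst p \<bullet> snd p) * (indicator K (fst p) * indicator K (snd p)) \<partial>(\<omega> \<Otimes>\<^sub>M \<omega>))"
    unfolding J_def S_def
  proof (rule average_over_reflections[OF K continuous_on_bump bump_nonneg])
    show "0 \<le> \<beta> / 3" using \<beta>0 by simp
    fix x y assume "x \<in> ball x0 (\<rho> / 2)" "y \<in> ball y1 (\<rho> / 2)" and nn: "norm x = 1" "norm y = 1"
    then have "dist x0 x < \<rho>" "dist y0 y < \<rho>" using y1(3) \<rho> dist_triangle[of y0 y y1] by auto
    then show "\<beta> / 3 \<le> measure \<omega> {u \<in> sphere 0 1. reflection u x \<in> K \<and> reflection u y \<in> K}" by (rule many[OF nn])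
  qed
  also have "\<dots> \<le> S * \<eta>" using \<delta>(3) S by (intro mult_left_mono) auto
  finally have "N * (\<beta> / 3 * J) \<le> N * (S * \<eta>)" using N(1) by (intro mult_left_mono) auto
  moreover have "N * (S * \<eta>) = \<beta> / 6" using N S by (simp add: \<eta>_def)
  moreover have "\<beta> / 3 * 1 \<le> \<beta> / 3 * (N * J)" using J \<beta>0 by (intro mult_left_mono) auto
  moreover have "N * (\<beta> / 3 * J) = \<beta> / 3 * (N * J)" by simp
  ultimately show False using \<beta>0 by linarith
qed

text \<open>Discarding less than the excess of the measure of \<open>K\<close> over \<open>a\<close>
  leaves only density points, no two of which are adjacent. They form an independent set of measure
  above \<open>a\<close>, which is absurd.\<close>

lemma essentially_independent:
  fixes K :: "(real^'n) set"
  assumes dim: "2 \<le> CARD('n)" and D: "closed D" "D \<subseteq> {-1<..<1}" and T: "T \<subseteq> D" "D \<subseteq> closure T"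
    and K: "compact K" "K \<subseteq> sphere 0 1"
    and zero: "\<And>t \<eta> \<delta>0. t \<in> T \<Longrightarrow> 0 < \<eta> \<Longrightarrow> 0 < \<delta>0 \<Longrightarrow> \<exists>\<delta>>0. \<delta> \<le> \<delta>0 \<and>
      (\<integral>p. bump TYPE(real^'n) t \<delta> (fst p \<bullet> snd p) * (indicator K (fst p) * indicator K (snd p)) \<partial>(\<omega> \<Otimes>\<^sub>M \<omega>)) \<le> \<eta>"
    and a: "\<And>I :: (real^'n) set. I \<in> sets \<omega> \<Longrightarrow> (\<forall>x\<in>I. \<forall>y\<in>I. x \<bullet> y \<notin> D) \<Longrightarrow> measure \<omega> I \<le> a"
  shows "measure \<omega> K \<le> a"
proof (rule ccontr)
  assume "\<not> measure \<omega> K \<le> a"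
  then have \<epsilon>: "0 < measure \<omega> K - a" by simp
  have Kb: "K \<in> sets borel" using K(1) by (intro borel_closed compact_imp_closed)
  have "\<exists>g>0. \<forall>t\<in>D. \<forall>v\<in>{1}. g \<le> dist t v"
  proof (rule separate_compact_closed)
    have "bounded D" by (rule bounded_subset[OF bounded_closed_interval[of "-1" 1]]) (use D(2) in force)
    then show "compact D" using D(1) by (simp add: compact_eq_bounded_closed)
  qed (use D(2) in auto)
  then obtain g where g: "0 < g" "\<And>t. t \<in> D \<Longrightarrow> t \<le> 1 - g" using D(2) by (force simp: dist_real_def)
  \<comment> \<open>Inner products in \<open>D\<close> are at most \<open>1 - g\<close>, so adjacent
    points are at least \<open>sqrt (2 * g)\<close> apart, which is \<open>4 * c\<close>.\<close>
  define c where "c = sqrt (2 * g) / 4"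
  have c: "0 < c" using g by (simp add: c_def)
  define C1 where "C1 = (2 * (1 / c) * DIM(real^'n)) ^ DIM(real^'n)"
  define C2 where "C2 = (2 * (25 :: real) * DIM(real^'n)) ^ DIM(real^'n)"
  have C: "0 < C1" "0 < C2" using c by (simp_all add: C1_def C2_def)
  \<comment> \<open>Density is known at radius \<open>\<delta>\<close>, but the mirrors are compared
    with a cap of radius \<open>\<delta> / 5\<close>: \<open>C2\<close> pays for this change of
    scale, \<open>C1\<close> for the bad mirrors, and 3 leaves a third of the mirrors good.\<close>
  define \<kappa> where "\<kappa> = 1 / (3 * C1 * C2)"
  have \<kappa>: "0 < \<kappa>" using C by (simp add: \<kappa>_def)
  have "0 < min 1 c" using c by simp
  from density_subset[OF K \<epsilon> \<kappa> this] obtain \<delta> K' where \<delta>: "0 < \<delta>" "\<delta> \<le> min 1 c" and K': "K' \<in> sets \<omega>" "K' \<subseteq> K"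
    "measure \<omega> K < measure \<omega> K' + (measure \<omega> K - a)"
    and dens: "\<And>x. x \<in> K' \<Longrightarrow> measure \<omega> ((ball x \<delta> - K) \<inter> sphere 0 1) < \<kappa> * measure \<omega> (ball x \<delta> \<inter> sphere 0 1)"
    by metis
  have "x0 \<bullet> y0 \<notin> D" if xy: "x0 \<in> K'" "y0 \<in> K'" for x0 y0
  proof
    assume t: "x0 \<bullet> y0 \<in> D"
    have n0: "norm x0 = 1" "norm y0 = 1" using xy K'(2) K(2) by auto
    have xx: "x0 \<bullet> x0 = 1" "y0 \<bullet> y0 = 1" using n0 by (simp_all add: norm_eq_1)
    have "2 * g \<le> (dist x0 y0)\<^sup>2" using g(2)[OF t]
      by (simp add: dist_norm power2_norm_eq_inner inner_diff_left inner_diff_right xx inner_commute)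
    then have d: "4 * c \<le> dist x0 y0" unfolding c_def using real_le_lsqrt real_le_rsqrt by (simp add: real_sqrt_le_iff' real_le_lsqrt)
    have five: "5 * (\<delta> / 5) = \<delta>" by simp
    define m where "m = \<kappa> * measure \<omega> (ball x0 \<delta> \<inter> sphere 0 1)"
    show False
    proof (rule density_points_not_adjacent[OF dim Kb _ zero n0 _ _ c d, where \<rho>="\<delta>/5" and m=m and T=T], unfold five)
      show "T \<subseteq> {-1..1}" using T D by force
      show "\<bar>x0 \<bullet> y0\<bar> < 1" using t D by force
      show "x0 \<bullet> y0 \<in> closure T" using t T by blast
      show "0 < \<delta> / 5" "2 * (\<delta> / 5) \<le> c" using \<delta> c by auto
      show "measure \<omega> ((ball x0 \<delta> - K) \<inter> sphere 0 1) \<le> m" unfolding m_def using dens[OF xy(1)] by simp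
      show "measure \<omega> ((ball y0 \<delta> - K) \<inter> sphere 0 1) \<le> m"
        unfolding m_def measure_cap_cong[OF n0] using dens[OF xy(2)] by simp
      have "3 * C1 * m = measure \<omega> (ball x0 \<delta> \<inter> sphere 0 1) / C2" using C by (simp add: m_def \<kappa>_def field_simps)
      also have "\<dots> \<le> measure \<omega> (ball x0 (\<delta> / 5) \<inter> sphere 0 1)"
        using measure_cap_doubling[OF n0(1) \<delta>(1)] \<delta>(2) C by (simp add: C2_def pos_divide_le_eq mult.commute)
      finally show "3 * (2 * (1 / c) * DIM(real^'n)) ^ DIM(real^'n) * m \<le> measure \<omega> (ball x0 (\<delta> / 5) \<inter> sphere 0 1)"
        by (simp only: C1_def)
    qed
  qed
  then have "measure \<omega> K' \<le> a" using a[OF K'(1)] by blast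
  then show False using K'(3) by simp
qed

section \<open>Upper bound\<close>

text \<open>A zonal function has the same integral around every point, so one constant normalizes
  all translates.\<close>

lemma mollifier:
  assumes dim: "2 \<le> CARD('n::finite)" and r: "0 < r"
  obtains k :: "real \<Rightarrow> real" where "continuous_on UNIV k" "\<And>u. 0 \<le> k u"
    "\<And>x z :: real^'n. norm x = 1 \<Longrightarrow> norm z = 1 \<Longrightarrow> k (x \<bullet> z) \<noteq> 0 \<Longrightarrow> dist x z < r"
    "\<And>x :: real^'n. norm x = 1 \<Longrightarrow> (\<integral>z. k (x \<bullet> z) \<partial>\<omega>) = 1"
proof -
  \<comment> \<open>For unit vectors the squared distance is \<open>2 - 2 * (x \<bullet> z)\<close>,
    so an inner product within \<open>h\<close> of 1 means a distance below
    \<open>r\<close>.\<close>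
  define h where "h = r\<^sup>2 / 2"
  have h: "0 < h" using r by (simp add: h_def)
  obtain e :: "real^'n" where e: "norm e = 1" using vector_choose_size[of 1] by auto
  define m where "m = (\<integral>z. tent 1 h (e \<bullet> z) \<partial>\<omega>)"
  have ct: "continuous_on S (\<lambda>z. tent 1 h (x \<bullet> z))" for S and x :: "real^'n"
    unfolding tent_def by (intro continuous_intros)
  have same: "(\<integral>z. tent 1 h (x \<bullet> z) \<partial>\<omega>) = m" if x: "norm x = 1" for x :: "real^'n"
  proof -
    have "reflection (e - x) e = x" using e x by (intro reflection_diff) simp
    then have "reflection (e - x) e \<bullet> reflection (e - x) z = x \<bullet> reflection (e - x) z" for z by (simp only:)
    then have eq: "x \<bullet> reflection (e - x) z = e \<bullet> z" for z by (metis inner_reflection)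
    have "(\<integral>z. tent 1 h (x \<bullet> reflection (e - x) z) \<partial>\<omega>) = (\<integral>z. tent 1 h (x \<bullet> z) \<partial>\<omega>)"
      by (rule integral_surface_orthogonal[OF orthogonal_transformation_reflection borel_measurable_continuous_on_surface[OF ct]])
    then show ?thesis by (simp only: eq m_def)
  qed
  have "0 < (\<integral>p. tent 1 h (fst p \<bullet> snd p) \<partial>(\<omega> \<Otimes>\<^sub>M (\<omega> :: (real^'n) measure)))"
    by (rule integral_tent_pos) (use dim h in simp_all)
  also have "\<dots> = (\<integral>x. \<integral>y. tent 1 h (fst (x, y) \<bullet> snd (x, y)) \<partial>\<omega> \<partial>(\<omega> :: (real^'n) measure))"
    by (rule surface2.integral_fst'[symmetric]) (rule integrable_inner_kernel[OF continuous_on_tent])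
  also have "\<dots> = (\<integral>x. m \<partial>(\<omega> :: (real^'n) measure))"
    by (intro Bochner_Integration.integral_cong refl) (simp add: same)
  finally have m0: "0 < m" by (simp add: zero_less_mult_iff)
  show ?thesis
  proof (rule that[of "\<lambda>u. tent 1 h u / m"])
    show "continuous_on UNIV (\<lambda>u. tent 1 h u / m)" using m0 by (intro continuous_intros continuous_on_tent) auto
    show "0 \<le> tent 1 h u / m" for u using m0 by (simp add: tent_nonneg)
    show "(\<integral>z. tent 1 h (x \<bullet> z) / m \<partial>\<omega>) = 1" if "norm x = 1" for x :: "real^'n"
      using same[OF that] m0 by simp
    fix x z :: "real^'n" assume n: "norm x = 1" "norm z = 1" and "tent 1 h (x \<bullet> z) / m \<noteq> 0"
    then have "tent 1 h (x \<bullet> z) \<noteq> 0" by auto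
    from tent_support[OF this] have "2 - 2 * (x \<bullet> z) < r\<^sup>2" using abs_ge_minus_self[of "x \<bullet> z - 1"] unfolding h_def by linarith
    also have "2 - 2 * (x \<bullet> z) = (dist x z)\<^sup>2"
      using n by (simp add: dist_norm power2_norm_eq_inner inner_diff_left inner_diff_right inner_commute norm_eq_1)
    finally show "dist x z < r" using r by (simp add: power2_less_imp_less)
  qed
qed

text \<open>Weak duality: a feasible \<open>A\<close> pairs nonnegatively with \<open>Z\<close>, and
  its pairing with \<open>J\<close> is the objective. The level \<open>r0\<close> depends on the
  bounds of \<open>Z\<close> and on \<open>c\<close>, but not on \<open>A\<close>.\<close>

lemma gamma_bound_le_certificate:
  fixes D :: "real set" and k W :: "real \<Rightarrow> real"
  assumes k: "continuous_on UNIV k" "\<And>u. 0 \<le> k u" "\<And>x :: real^'n. norm x = 1 \<Longrightarrow> (\<integral>z. k (x \<bullet> z) \<partial>\<omega>) = 1"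
    and W: "continuous_on UNIV W" and b: "0 \<le> b" and M: "0 \<le> M" and c: "0 < c"
    and WA: "\<And>A :: (real^'n) \<times> (real^'n) \<Rightarrow> real. continuous_on (sphere 0 1 \<times> sphere 0 1) A \<Longrightarrow> pos_def_kernel A \<Longrightarrow>
      (\<And>x y. norm x = 1 \<Longrightarrow> norm y = 1 \<Longrightarrow> x \<bullet> y \<in> D \<Longrightarrow> A (x, y) = 0) \<Longrightarrow>
      (\<integral>p. W (fst p \<bullet> snd p) * A p \<partial>(\<omega> \<Otimes>\<^sub>M \<omega>)) \<le> \<eta> * (\<integral>x. A (x, x) \<partial>\<omega>)"
    and pos: "\<And>(x :: nat \<Rightarrow> real^'n) N. (\<And>i. i < N \<Longrightarrow> norm (x i) = 1) \<Longrightarrow>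
      c * real N * real N \<le> (\<Sum>i<N. \<Sum>j<N. b * (\<integral>z. k (x i \<bullet> z) * k (x j \<bullet> z) \<partial>\<omega>) + M * W (x i \<bullet> x j) - 1)"
  obtains r0 where "\<And>r. r0 \<le> r \<Longrightarrow> gamma_bound r \<omega> (sphere_edges D :: (real^'n) set set) \<le> ereal (b + M * \<eta>)"
proof -
  let ?K = "\<lambda>p :: (real^'n) \<times> (real^'n). \<integral>z. k (fst p \<bullet> z) * k (snd p \<bullet> z) \<partial>\<omega>"
  let ?W = "\<lambda>p :: (real^'n) \<times> (real^'n). W (fst p \<bullet> snd p)"
  have ck: "continuous_on S (\<lambda>z. k (x \<bullet> z))" for S and x :: "real^'n"
    by (rule continuous_on_compose2[OF k(1), of S "\<lambda>z. x \<bullet> z"]) (intro continuous_intros, simp)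
  have km[measurable]: "k \<in> borel_measurable borel" using k(1) by (rule borel_measurable_continuous_onI)
  obtain B where B: "0 < B" "\<And>x y :: real^'n. norm x = 1 \<Longrightarrow> norm y = 1 \<Longrightarrow> \<bar>k (x \<bullet> y)\<bar> \<le> B"
    using bounded_continuous_on_sphere_pair[OF continuous_on_inner_sphere[OF k(1)]] by auto
  obtain BW where BW: "0 < BW" "\<And>x y :: real^'n. norm x = 1 \<Longrightarrow> norm y = 1 \<Longrightarrow> \<bar>W (x \<bullet> y)\<bar> \<le> BW"
    using bounded_continuous_on_sphere_pair[OF continuous_on_inner_sphere[OF W]] by auto
  have kint: "integrable \<omega> (\<lambda>z. k (x \<bullet> z))" for x :: "real^'n" by (rule integrable_continuous_on_surface[OF ck])
  have kkint: "integrable \<omega> (\<lambda>z. k (x \<bullet> z) * k (y \<bullet> z))" for x y :: "real^'n"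
    by (intro integrable_continuous_on_surface continuous_intros ck)
  have K0: "0 \<le> ?K p" for p by (intro Bochner_Integration.integral_nonneg) (simp add: k(2))
  have KB: "?K (x, y) \<le> B" if n: "norm x = 1" "norm y = 1" for x y :: "real^'n"
  proof -
    have "?K (x, y) \<le> (\<integral>z. B * k (y \<bullet> z) \<partial>\<omega>)"
    proof (rule integral_mono)
      show "integrable \<omega> (\<lambda>z. k (fst (x, y) \<bullet> z) * k (snd (x, y) \<bullet> z))" by (simp add: kkint)
      show "integrable \<omega> (\<lambda>z. B * k (y \<bullet> z))" by (intro integrable_mult_right kint)
      fix z :: "real^'n" assume "z \<in> space \<omega>"
      then show "k (fst (x, y) \<bullet> z) * k (snd (x, y) \<bullet> z) \<le> B * k (y \<bullet> z)"
        using B(2)[OF n(1), of z] k(2)[of "y \<bullet> z"] by (auto intro!: mult_right_mono)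
    qed
    then show ?thesis by (simp add: k(3)[OF n(2)])
  qed
  have Km: "?K \<in> borel_measurable (\<omega> \<Otimes>\<^sub>M \<omega>)"
  proof (rule surface.borel_measurable_lebesgue_integral)
    have b: "(\<lambda>(p, z). k (fst p \<bullet> z) * k (snd p \<bullet> z)) \<in> borel_measurable ((borel \<Otimes>\<^sub>M borel) \<Otimes>\<^sub>M (borel :: (real^'n) measure))"
      unfolding case_prod_beta' by measurable
    have "(\<lambda>q. (fst q, snd q)) \<in> (\<omega> \<Otimes>\<^sub>M \<omega>) \<Otimes>\<^sub>M (\<omega> :: (real^'n) measure) \<rightarrow>\<^sub>M (borel \<Otimes>\<^sub>M borel) \<Otimes>\<^sub>M borel"
      by (rule measurable_Pair[OF measurable_compose[OF measurable_fst measurable_ident_surface_pair]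
          measurable_compose[OF measurable_snd measurable_ident_surface]])
    then have "(\<lambda>q. q) \<in> (\<omega> \<Otimes>\<^sub>M \<omega>) \<Otimes>\<^sub>M (\<omega> :: (real^'n) measure) \<rightarrow>\<^sub>M (borel \<Otimes>\<^sub>M borel) \<Otimes>\<^sub>M borel" by simp
    from measurable_compose[OF this b]
    show "(\<lambda>(p, z). k (fst p \<bullet> z) * k (snd p \<bullet> z)) \<in> borel_measurable ((\<omega> \<Otimes>\<^sub>M \<omega>) \<Otimes>\<^sub>M (\<omega> :: (real^'n) measure))" .
  qed
  have Ksym: "?K (x, y) = ?K (y, x)" for x y by (simp add: mult.commute)
  have K1: "(\<integral>y. ?K (x, y) \<partial>\<omega>) = 1" if n: "norm x = 1" for x :: "real^'n"
  proof -
    let ?f = "\<lambda>y z :: real^'n. k (x \<bullet> z) * k (z \<bullet> y)"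
    have fi: "integrable (\<omega> \<Otimes>\<^sub>M \<omega>) (case_prod ?f)"
    proof (rule integrable_continuous_on_surface_pair)
      have "continuous_on (sphere 0 1 \<times> sphere 0 1) (\<lambda>p. k (x \<bullet> snd p))"
        by (rule continuous_on_compose2[OF k(1), of _ "\<lambda>p. x \<bullet> snd p"]) (intro continuous_intros, simp)
      then have "continuous_on (sphere 0 1 \<times> sphere 0 1) (\<lambda>p. k (x \<bullet> snd p) * k (fst p \<bullet> snd p))"
        by (intro continuous_on_mult continuous_on_inner_sphere[OF k(1)])
      then show "continuous_on (sphere 0 1 \<times> sphere 0 1) (case_prod ?f)" by (simp add: case_prod_beta' inner_commute)
    qed
    have "(\<integral>y. ?K (x, y) \<partial>\<omega>) = (\<integral>y. \<integral>z. ?f y z \<partial>\<omega> \<partial>\<omega>)" by (simp add: inner_commute)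
    also have "\<dots> = (\<integral>z. \<integral>y. ?f y z \<partial>\<omega> \<partial>\<omega>)" by (rule surface2.Fubini_integral[OF fi, symmetric])
    also have "\<dots> = (\<integral>z. k (x \<bullet> z) \<partial>\<omega>)"
      by (intro Bochner_Integration.integral_cong refl) (simp add: k(3))
    finally show ?thesis using k(3)[OF n] by simp
  qed
  define Z where "Z = (\<lambda>p. b * ?K p + M * ?W p - 1)"
  have Wm: "?W \<in> borel_measurable (\<omega> \<Otimes>\<^sub>M \<omega>)"
    by (rule borel_measurable_continuous_on_surface_pair[OF continuous_on_inner_sphere[OF W]])
  have Zm: "Z \<in> borel_measurable (\<omega> \<Otimes>\<^sub>M \<omega>)"
    unfolding Z_def by (intro borel_measurable_add borel_measurable_diff borel_measurable_times borel_measurable_const Km Wm)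
  have ZB: "\<bar>Z (x, y)\<bar> \<le> b * B + M * BW + 1" and ZB': "Z (x, y) \<le> b * B + M * BW" if n: "norm x = 1" "norm y = 1" for x y
  proof -
    have "b * ?K (x, y) \<le> b * B" "0 \<le> b * ?K (x, y)" by (intro mult_left_mono KB n b) (intro mult_nonneg_nonneg K0 b)
    moreover have "\<bar>M * ?W (x, y)\<bar> \<le> M * BW" using BW(2)[OF n] M by (simp add: abs_mult mult_left_mono)
    ultimately show "\<bar>Z (x, y)\<bar> \<le> b * B + M * BW + 1" "Z (x, y) \<le> b * B + M * BW" unfolding Z_def by linarith+
  qed
  have ZL: "Z \<in> L2_sym \<omega>"
    unfolding L2_sym_def
  proof (intro CollectI conjI)
    show "Z \<in> L2 (\<omega> \<Otimes>\<^sub>M \<omega>)"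
      by (rule L2_bounded[OF finite_measure_surface_pair Zm]) (use ZB in auto)
    show "AE (x, y) in \<omega> \<Otimes>\<^sub>M \<omega>. Z (x, y) = Z (y, x)"
      by (rule AE_I2) (simp add: Z_def mult.commute inner_commute)
  qed
  \<comment> \<open>The level from which the upper bound of \<open>Z\<close> on the diagonal is at
    most \<open>c * (r + 2)\<close>.\<close>
  define r0 where "r0 = nat \<lceil>(b * B + M * BW) / c\<rceil>"
  show ?thesis
  proof (rule that[of r0])
    fix r assume "r0 \<le> r"
    then have "(b * B + M * BW) / c \<le> real r + 2" unfolding r0_def by linarith
    then have r: "b * B + M * BW \<le> c * (real r + 2)" using c by (simp add: pos_divide_le_eq mult.commute)
    have ZC: "Z \<in> C_cone r \<omega>"
    proof (rule C_coneI_mean_pos[OF ZL _ c _ r])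
      show "Z (x, x) \<le> b * B + M * BW" if "x \<in> space \<omega>" for x using that by (intro ZB') auto
      show "c * real N * real N \<le> (\<Sum>i<N. \<Sum>j<N. Z (x i, x j))" if "\<And>i. i < N \<Longrightarrow> x i \<in> space \<omega>" for x N
        using pos[of N x] that by (simp add: Z_def)
    qed
    show "gamma_bound r \<omega> (sphere_edges D :: (real^'n) set set) \<le> ereal (b + M * \<eta>)"
      unfolding gamma_bound_def
    proof (rule SUP_least)
      fix A :: "(real^'n) \<times> (real^'n) \<Rightarrow> real" assume "A \<in> gamma_feasible r \<omega> (sphere_edges D)"
      then have Ad: "A \<in> C_cone_dual r \<omega>" and cA: "continuous_on (sphere 0 1 \<times> sphere 0 1) A" and psd: "psd_kernel \<omega> A"
        and tr: "(\<integral>x. A (x, x) \<partial>\<omega>) = 1"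
        and Az: "\<And>x y. norm x = 1 \<Longrightarrow> norm y = 1 \<Longrightarrow> x \<bullet> y \<in> D \<Longrightarrow> A (x, y) = 0"
        by (auto simp: gamma_feasible_def edge_in_sphere_edges_iff)
      have pd: "pos_def_kernel A" by (rule psd_kernel_imp_pos_def[OF cA psd])
      obtain BA where BA: "0 < BA" "\<And>x y. norm x = 1 \<Longrightarrow> norm y = 1 \<Longrightarrow> \<bar>A (x, y)\<bar> \<le> BA"
        using bounded_continuous_on_sphere_pair[OF cA] by auto
      have Am: "A \<in> borel_measurable (\<omega> \<Otimes>\<^sub>M \<omega>)" by (rule borel_measurable_continuous_on_surface_pair[OF cA])
      have Ai: "integrable (\<omega> \<Otimes>\<^sub>M \<omega>) A" by (rule integrable_continuous_on_surface_pair[OF cA])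
      have WAi: "integrable (\<omega> \<Otimes>\<^sub>M \<omega>) (\<lambda>p. ?W p * A p)"
        by (intro integrable_continuous_on_surface_pair continuous_on_mult cA continuous_on_inner_sphere[OF W])
      have cd: "continuous_on (sphere 0 1) (\<lambda>x. A (x, x))"
        by (rule continuous_on_compose2[OF cA, of _ "\<lambda>x. (x, x)"]) (auto intro!: continuous_intros)
      have dm: "(\<lambda>x. A (x, x)) \<in> borel_measurable \<omega>" by (rule borel_measurable_continuous_on_surface[OF cd])
      have KB2: "\<bar>a * ?K (x, y)\<bar> \<le> BA * B" if "norm x = 1" "norm y = 1" "\<bar>a\<bar> \<le> BA" for x y a
        unfolding abs_mult using that KB[OF that(1,2)] K0[of "(x, y)"] BA(1) by (intro mult_mono) auto
      have KAi: "integrable (\<omega> \<Otimes>\<^sub>M \<omega>) (\<lambda>p. A p * ?K p)"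
        by (rule integrable_surface_pair_bounded[OF borel_measurable_times[OF Am Km]]) (rule KB2, auto intro: BA(2))
      have d1: "integrable (\<omega> \<Otimes>\<^sub>M \<omega>) (\<lambda>p. A (fst p, fst p) * ?K p)"
        by (rule integrable_surface_pair_bounded[OF borel_measurable_times[OF measurable_compose[OF measurable_fst dm] Km], where B="BA * B"])
          (use KB2 BA(2) in \<open>simp only: fst_conv\<close>)
      have d2: "integrable (\<omega> \<Otimes>\<^sub>M \<omega>) (\<lambda>p. A (snd p, snd p) * ?K p)"
        by (rule integrable_surface_pair_bounded[OF borel_measurable_times[OF measurable_compose[OF measurable_snd dm] Km], where B="BA * B"])
          (use KB2 BA(2) in \<open>simp only: snd_conv\<close>)
      have i1: "(\<integral>p. A (fst p, fst p) * ?K p \<partial>(\<omega> \<Otimes>\<^sub>M \<omega>)) = 1"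
      proof -
        have "(\<integral>p. A (fst p, fst p) * ?K p \<partial>(\<omega> \<Otimes>\<^sub>M \<omega>)) = (\<integral>x. \<integral>y. A (fst (x, y), fst (x, y)) * ?K (x, y) \<partial>\<omega> \<partial>\<omega>)"
          by (rule surface2.integral_fst'[OF d1, symmetric])
        also have "\<dots> = (\<integral>x. A (x, x) * (\<integral>y. ?K (x, y) \<partial>\<omega>) \<partial>\<omega>)" by simp
        also have "\<dots> = (\<integral>x. A (x, x) \<partial>\<omega>)" by (intro Bochner_Integration.integral_cong refl) (use K1 in simp)
        finally show ?thesis using tr by simp
      qed
      have i2: "(\<integral>p. A (snd p, snd p) * ?K p \<partial>(\<omega> \<Otimes>\<^sub>M \<omega>)) = 1"
      proof -
        have d2': "integrable (\<omega> \<Otimes>\<^sub>M \<omega>) (\<lambda>(x, y). A (y, y) * ?K (x, y))" using d2 by (simp add: case_prod_beta')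
        have "(\<integral>p. A (snd p, snd p) * ?K p \<partial>(\<omega> \<Otimes>\<^sub>M \<omega>)) = (\<integral>p. (case p of (x, y) \<Rightarrow> A (y, y) * ?K (x, y)) \<partial>(\<omega> \<Otimes>\<^sub>M \<omega>))"
          by (simp add: case_prod_beta')
        also have "\<dots> = (\<integral>y. \<integral>x. A (y, y) * ?K (x, y) \<partial>\<omega> \<partial>\<omega>)"
          by (rule surface2.integral_snd[OF d2', symmetric])
        also have "\<dots> = (\<integral>y. A (y, y) * (\<integral>x. ?K (y, x) \<partial>\<omega>) \<partial>\<omega>)" by (simp add: Ksym[of _ y for y] mult.commute)
        also have "\<dots> = (\<integral>x. A (x, x) \<partial>\<omega>)" by (intro Bochner_Integration.integral_cong refl) (use K1 in simp)
        finally show ?thesis using tr by simp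
      qed
      \<comment> \<open>A value of \<open>A\<close> is at most the mean of two diagonal values, and
        \<open>?K\<close> has marginals 1, so each diagonal term integrates to the trace.\<close>
      have AK: "(\<integral>p. A p * ?K p \<partial>(\<omega> \<Otimes>\<^sub>M \<omega>)) \<le> 1"
      proof -
        have "(\<integral>p. A p * ?K p \<partial>(\<omega> \<Otimes>\<^sub>M \<omega>)) \<le> (\<integral>p. (A (fst p, fst p) * ?K p + A (snd p, snd p) * ?K p) / 2 \<partial>(\<omega> \<Otimes>\<^sub>M \<omega>))"
        proof (rule integral_mono[OF KAi])
          show "integrable (\<omega> \<Otimes>\<^sub>M \<omega>) (\<lambda>p. (A (fst p, fst p) * ?K p + A (snd p, snd p) * ?K p) / 2)"
            by (intro integrable_divide_zero Bochner_Integration.integrable_add d1 d2)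
          fix p :: "(real^'n) \<times> (real^'n)" assume "p \<in> space (\<omega> \<Otimes>\<^sub>M \<omega>)"
          then have "A p \<le> (A (fst p, fst p) + A (snd p, snd p)) / 2"
            using pos_def_kernel_abs_le[OF pd, of "fst p" "snd p"] by auto
          from mult_right_mono[OF this K0[of p]]
          show "A p * ?K p \<le> (A (fst p, fst p) * ?K p + A (snd p, snd p) * ?K p) / 2"
            by (simp only: times_divide_eq_left distrib_right)
        qed
        also have "\<dots> = 1" using d1 d2 by (simp only: integral_divide_zero Bochner_Integration.integral_add i1 i2) simp
        finally show ?thesis .
      qed
      have "(\<integral>p. ?W p * A p \<partial>(\<omega> \<Otimes>\<^sub>M \<omega>)) \<le> \<eta> * (\<integral>x. A (x, x) \<partial>\<omega>)" by (rule WA[OF cA pd]) (rule Az)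
      also have "\<dots> = \<eta>" by (subst tr) (rule mult_1_right)
      finally have WA1: "(\<integral>p. ?W p * A p \<partial>(\<omega> \<Otimes>\<^sub>M \<omega>)) \<le> \<eta>" .
      have "0 \<le> kernel_inner \<omega> A Z" using Ad ZC by (auto simp: C_cone_dual_def)
      also have "kernel_inner \<omega> A Z = (\<integral>p. b * (A p * ?K p) + M * (?W p * A p) - A p \<partial>(\<omega> \<Otimes>\<^sub>M \<omega>))"
        unfolding kernel_inner_def Z_def by (intro Bochner_Integration.integral_cong refl) (simp only: algebra_simps)
      also have "\<dots> = b * (\<integral>p. A p * ?K p \<partial>(\<omega> \<Otimes>\<^sub>M \<omega>)) + M * (\<integral>p. ?W p * A p \<partial>(\<omega> \<Otimes>\<^sub>M \<omega>)) - (\<integral>p. A p \<partial>(\<omega> \<Otimes>\<^sub>M \<omega>))"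
        using KAi WAi Ai by (subst Bochner_Integration.integral_diff) auto
      finally have "(\<integral>p. A p \<partial>(\<omega> \<Otimes>\<^sub>M \<omega>)) \<le> b + M * \<eta>"
        using mult_left_mono[OF AK b] mult_left_mono[OF WA1 M] by simp
      then show "ereal (\<integral>x. (\<integral>y. A (x, y) \<partial>\<omega>) \<partial>\<omega>) \<le> ereal (b + M * \<eta>)"
        using surface2.integral_fst'[OF Ai] by simp
    qed
  qed
qed

text \<open>Either every finite point set satisfies the strict inequality, and the certificate
  works, or a violating set is smeared out into a continuous density. The mollifier radius is chosen
  from the modulus of \<open>W\<close>, so that smearing changes the average of \<open>W\<close> by
  at most \<open>e\<close>.\<close>

lemma certificate_or_density:
  fixes D :: "real set" and W :: "real \<Rightarrow> real"
  assumes dim: "2 \<le> CARD('n::finite)" and W: "continuous_on UNIV W" "\<And>u. 0 \<le> W u"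
    and b: "0 \<le> b" and M: "0 \<le> M" and c: "0 < c" and e: "0 < e"
    and WA: "\<And>A :: (real^'n) \<times> (real^'n) \<Rightarrow> real. continuous_on (sphere 0 1 \<times> sphere 0 1) A \<Longrightarrow> pos_def_kernel A \<Longrightarrow>
      (\<And>x y. norm x = 1 \<Longrightarrow> norm y = 1 \<Longrightarrow> x \<bullet> y \<in> D \<Longrightarrow> A (x, y) = 0) \<Longrightarrow>
      (\<integral>p. W (fst p \<bullet> snd p) * A p \<partial>(\<omega> \<Otimes>\<^sub>M \<omega>)) \<le> \<eta> * (\<integral>x. A (x, x) \<partial>\<omega>)"
  obtains (certificate) r0 where "\<And>r. r0 \<le> r \<Longrightarrow> gamma_bound r \<omega> (sphere_edges D :: (real^'n) set set) \<le> ereal (b + M * \<eta>)"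
    | (density) f :: "real^'n \<Rightarrow> real" where "continuous_on UNIV f" "\<And>x. 0 \<le> f x" "(\<integral>x. f x \<partial>\<omega>) = 1"
        "b * (\<integral>x. (f x)\<^sup>2 \<partial>\<omega>) \<le> 1 + c"
        "M * (\<integral>p. W (fst p \<bullet> snd p) * (f (fst p) * f (snd p)) \<partial>(\<omega> \<Otimes>\<^sub>M \<omega>)) \<le> 1 + c + M * e"
proof -
  let ?W = "\<lambda>p :: (real^'n) \<times> (real^'n). W (fst p \<bullet> snd p)"
  have cW: "continuous_on S ?W" for S by (rule continuous_on_inner_sphere[OF W(1)])
  obtain r where r: "0 < r" "\<And>x y x' y' :: real^'n. norm x = 1 \<Longrightarrow> norm y = 1 \<Longrightarrow> norm x' = 1 \<Longrightarrow> norm y' = 1 \<Longrightarrow>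
      dist x x' < r \<Longrightarrow> dist y y' < r \<Longrightarrow> \<bar>W (x \<bullet> y) - W (x' \<bullet> y')\<bar> < e"
    using uniform_continuity_sphere_pair[OF cW e] by auto
  obtain k :: "real \<Rightarrow> real" where k: "continuous_on UNIV k" "\<And>u. 0 \<le> k u"
    "\<And>x z :: real^'n. norm x = 1 \<Longrightarrow> norm z = 1 \<Longrightarrow> k (x \<bullet> z) \<noteq> 0 \<Longrightarrow> dist x z < r"
    "\<And>x :: real^'n. norm x = 1 \<Longrightarrow> (\<integral>z. k (x \<bullet> z) \<partial>\<omega>) = 1"
  proof (rule mollifier[OF dim r(1)], goal_cases)
    case (1 k)
    show ?case by (rule 1(1)[of k, OF 1(2-5)])
  qed
  have ck: "continuous_on S (\<lambda>z. k (x \<bullet> z))" for S and x :: "real^'n"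
    by (rule continuous_on_compose2[OF k(1), of S "\<lambda>z. x \<bullet> z"]) (intro continuous_intros, simp)
  have ck2: "continuous_on S (\<lambda>p. k (x \<bullet> fst p))" "continuous_on S (\<lambda>p. k (x \<bullet> snd p))" for S :: "((real^'n) \<times> (real^'n)) set" and x
    by (rule continuous_on_compose2[OF k(1), of S "\<lambda>p. x \<bullet> fst p"], intro continuous_intros, simp)
       (rule continuous_on_compose2[OF k(1), of S "\<lambda>p. x \<bullet> snd p"], intro continuous_intros, simp)
  let ?K = "\<lambda>x y :: real^'n. \<integral>z. k (x \<bullet> z) * k (y \<bullet> z) \<partial>\<omega>"
  show thesis
  proof (cases "\<forall>(x :: nat \<Rightarrow> real^'n) N. (\<forall>i<N. norm (x i) = 1) \<longrightarrow>
      c * real N * real N \<le> (\<Sum>i<N. \<Sum>j<N. b * ?K (x i) (x j) + M * W (x i \<bullet> x j) - 1)")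
    case True
    show thesis
    proof (rule gamma_bound_le_certificate[OF k(1,2,4) W(1) b M c WA])
      show "c * real N * real N \<le> (\<Sum>i<N. \<Sum>j<N. b * ?K (x i) (x j) + M * W (x i \<bullet> x j) - 1)"
        if "\<And>i. i < N \<Longrightarrow> norm (x i) = 1" for x :: "nat \<Rightarrow> real^'n" and N using True that by blast
    qed (use certificate in auto)
  next
    case False
    then obtain x :: "nat \<Rightarrow> real^'n" and N where x: "\<And>i. i < N \<Longrightarrow> norm (x i) = 1"
      and less: "(\<Sum>i<N. \<Sum>j<N. b * ?K (x i) (x j) + M * W (x i \<bullet> x j) - 1) < c * real N * real N"
      by (auto simp: not_le)
    have N: "0 < real N" using less by (cases N) auto
    \<comment> \<open>The mean of the mollified points; its energy is the mean of the kernel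
      \<open>?K\<close> over all pairs, because \<open>?K\<close> is the convolution square of the
      mollifier.\<close>
    define f where "f = (\<lambda>z. (\<Sum>i<N. k (x i \<bullet> z)) / real N)"
    have cf: "continuous_on S f" for S unfolding f_def using N by (intro continuous_intros ck) auto
    have f0: "0 \<le> f z" for z unfolding f_def by (intro divide_nonneg_nonneg sum_nonneg k(2)) simp
    have ki: "integrable \<omega> (\<lambda>z. k (x i \<bullet> z))" for i by (rule integrable_continuous_on_surface[OF ck])
    have kki: "integrable \<omega> (\<lambda>z. k (x i \<bullet> z) * k (x j \<bullet> z))" for i j
      by (intro integrable_continuous_on_surface continuous_on_mult ck)
    have "(\<integral>z. f z \<partial>\<omega>) = (\<Sum>i<N. \<integral>z. k (x i \<bullet> z) \<partial>\<omega>) / real N"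
      unfolding f_def by (simp add: Bochner_Integration.integral_sum[OF ki])
    then have f1: "(\<integral>z. f z \<partial>\<omega>) = 1" using N k(4) x by simp
    have "(\<integral>z. (f z)\<^sup>2 \<partial>\<omega>) = (\<integral>z. (\<Sum>i<N. \<Sum>j<N. k (x i \<bullet> z) * k (x j \<bullet> z)) / (real N * real N) \<partial>\<omega>)"
      unfolding f_def by (intro Bochner_Integration.integral_cong refl) (simp only: power2_eq_square times_divide_times_eq sum_product)
    also have "\<dots> = (\<Sum>i<N. \<Sum>j<N. ?K (x i) (x j)) / (real N * real N)"
      by (simp add: Bochner_Integration.integral_sum kki Bochner_Integration.integrable_sum)
    finally have f2: "(\<integral>z. (f z)\<^sup>2 \<partial>\<omega>) = (\<Sum>i<N. \<Sum>j<N. ?K (x i) (x j)) / (real N * real N)" .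
    let ?kk = "\<lambda>i j p. k (x i \<bullet> fst p) * k (x j \<bullet> snd p)"
    have kkc: "continuous_on S (?kk i j)" for S i j by (intro continuous_on_mult ck2)
    have kkp: "integrable (\<omega> \<Otimes>\<^sub>M \<omega>) (?kk i j)" for i j by (rule integrable_continuous_on_surface_pair[OF kkc])
    have Wkk: "integrable (\<omega> \<Otimes>\<^sub>M \<omega>) (\<lambda>p. ?W p * ?kk i j p)" for i j
      by (intro integrable_continuous_on_surface_pair continuous_on_mult[OF cW] kkc)
    have kk1: "(\<integral>p. ?kk i j p \<partial>(\<omega> \<Otimes>\<^sub>M \<omega>)) = 1" if "i < N" "j < N" for i j
      using surface2.integral_fst'[OF kkp[of i j]] by (simp add: k(4) x that)
    have Wij: "(\<integral>p. ?W p * ?kk i j p \<partial>(\<omega> \<Otimes>\<^sub>M \<omega>)) \<le> W (x i \<bullet> x j) + e" if ij: "i < N" "j < N" for i j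
    proof -
      have "(\<integral>p. ?W p * ?kk i j p \<partial>(\<omega> \<Otimes>\<^sub>M \<omega>)) \<le> (\<integral>p. (W (x i \<bullet> x j) + e) * ?kk i j p \<partial>(\<omega> \<Otimes>\<^sub>M \<omega>))"
      proof (rule integral_mono[OF Wkk integrable_mult_right[OF kkp]])
        fix p :: "(real^'n) \<times> (real^'n)" assume p: "p \<in> space (\<omega> \<Otimes>\<^sub>M \<omega>)"
        show "?W p * ?kk i j p \<le> (W (x i \<bullet> x j) + e) * ?kk i j p"
        proof (cases "k (x i \<bullet> fst p) = 0 \<or> k (x j \<bullet> snd p) = 0")
          case False
          have n: "norm (fst p) = 1" "norm (snd p) = 1" using p by auto
          have "\<bar>W (x i \<bullet> x j) - W (fst p \<bullet> snd p)\<bar> < e"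
            using False by (intro r(2) x ij n k(3)) auto
          then show ?thesis by (intro mult_right_mono mult_nonneg_nonneg k(2)) linarith
        qed auto
      qed
      also have "\<dots> = W (x i \<bullet> x j) + e" by (simp only: integral_mult_right_zero kk1[OF ij] mult_1_right)
      finally show ?thesis .
    qed
    have ff: "f u * f v = (\<Sum>i<N. \<Sum>j<N. k (x i \<bullet> u) * k (x j \<bullet> v)) / (real N * real N)" for u v
      by (simp only: f_def times_divide_times_eq sum_product)
    have "(\<integral>p. ?W p * (f (fst p) * f (snd p)) \<partial>(\<omega> \<Otimes>\<^sub>M \<omega>)) =
      (\<integral>p. (\<Sum>i<N. \<Sum>j<N. ?W p * ?kk i j p) / (real N * real N) \<partial>(\<omega> \<Otimes>\<^sub>M \<omega>))"
      by (intro Bochner_Integration.integral_cong refl) (simp only: ff sum_distrib_left times_divide_eq_right)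
    also have "\<dots> = (\<Sum>i<N. \<Sum>j<N. (\<integral>p. ?W p * ?kk i j p \<partial>(\<omega> \<Otimes>\<^sub>M \<omega>))) / (real N * real N)"
      by (simp only: integral_divide_zero Bochner_Integration.integral_sum Wkk Bochner_Integration.integrable_sum)
    also have "\<dots> \<le> (\<Sum>i<N. \<Sum>j<N. W (x i \<bullet> x j) + e) / (real N * real N)"
      using Wij by (intro divide_right_mono sum_mono) auto
    also have "\<dots> = (\<Sum>i<N. \<Sum>j<N. W (x i \<bullet> x j)) / (real N * real N) + e"
      using N by (simp add: sum.distrib add_divide_distrib)
    finally have f3: "(\<integral>p. ?W p * (f (fst p) * f (snd p)) \<partial>(\<omega> \<Otimes>\<^sub>M \<omega>)) \<le> (\<Sum>i<N. \<Sum>j<N. W (x i \<bullet> x j)) / (real N * real N) + e" .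
    define sK where "sK = (\<Sum>i<N. \<Sum>j<N. ?K (x i) (x j))"
    define sW where "sW = (\<Sum>i<N. \<Sum>j<N. W (x i \<bullet> x j))"
    have "(\<Sum>i<N. \<Sum>j<N. b * ?K (x i) (x j) + M * W (x i \<bullet> x j) - 1) = b * sK + M * sW - real N * real N"
      by (simp only: sum_subtractf sum.distrib sum_distrib_left[symmetric] sK_def sW_def) simp
    then have "b * sK + M * sW < (1 + c) * (real N * real N)" using less by (simp add: algebra_simps)
    then have "(b * sK + M * sW) / (real N * real N) \<le> 1 + c" using N by (simp add: pos_divide_le_eq)
    then have main: "b * (sK / (real N * real N)) + M * (sW / (real N * real N)) \<le> 1 + c" by (simp add: add_divide_distrib)
    \<comment> \<open>Both terms of \<open>main\<close> are nonnegative, so each of them alone obeys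
      the bound on their sum.\<close>
    have "0 \<le> sW" unfolding sW_def by (intro sum_nonneg W(2))
    then have "0 \<le> M * (sW / (real N * real N))" using M by simp
    then have m1: "b * (\<integral>z. (f z)\<^sup>2 \<partial>\<omega>) \<le> 1 + c" using main unfolding f2 sK_def by linarith
    have "0 \<le> sK" unfolding sK_def by (intro sum_nonneg Bochner_Integration.integral_nonneg mult_nonneg_nonneg k(2))
    then have "0 \<le> b * (sK / (real N * real N))" using b by simp
    then have m2: "M * (\<integral>p. ?W p * (f (fst p) * f (snd p)) \<partial>(\<omega> \<Otimes>\<^sub>M \<omega>)) \<le> 1 + c + M * e"
      using mult_left_mono[OF f3 M] main unfolding sW_def[symmetric] by (simp only: distrib_left)
    show thesis by (rule density[OF cf f0 f1 m1 m2])
  qed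
qed

text \<open>It makes \<open>bump_average\<close> applicable to the product kernel of a density,
  whose trace is the energy of the density.\<close>

lemma pos_def_kernel_rank_one: "pos_def_kernel (\<lambda>p. f (fst p) * f (snd p))"
proof -
  have "0 \<le> (\<Sum>i<n. \<Sum>j<n. c i * c j * (f (x i) * f (x j)))" for n :: nat and x c
  proof -
    have "(\<Sum>i<n. \<Sum>j<n. c i * c j * (f (x i) * f (x j))) = (\<Sum>i<n. c i * f (x i)) * (\<Sum>j<n. c j * f (x j))"
      unfolding sum_product by (intro sum.cong refl) (simp only: ac_simps)
    then show ?thesis by simp
  qed
  then show ?thesis by (simp add: pos_def_kernel_def mult.commute)
qed

lemma gamma_bound_le_eventually:
  fixes D :: "real set"
  assumes dim: "3 \<le> CARD('n::finite)" and D: "closed D" "D \<subseteq> {-1<..<1}" and \<epsilon>: "0 < \<epsilon>"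
    and a: "\<And>I :: (real^'n) set. I \<in> sets \<omega> \<Longrightarrow> (\<forall>x\<in>I. \<forall>y\<in>I. x \<bullet> y \<notin> D) \<Longrightarrow> measure \<omega> I \<le> a"
  shows "\<exists>r0. \<forall>r\<ge>r0. gamma_bound r \<omega> (sphere_edges D :: (real^'n) set set) \<le> ereal (a + 3 * \<epsilon>)"
proof (rule ccontr)
  assume no: "\<not> ?thesis"
  have a0: "0 \<le> a" using a[of "{}"] by simp
  \<comment> \<open>Strictly larger than \<open>a\<close>, so that the final inequality fails. The
    third \<open>\<epsilon>\<close> of the claim is reserved for \<open>M * \<eta>\<close>.\<close>
  define b where "b = a + 2 * \<epsilon>"
  have b: "0 < b" "a < b" using a0 \<epsilon> by (auto simp: b_def)
  have dim2: "2 \<le> CARD('n)" using dim by simp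
  have "bounded D" by (rule bounded_subset[OF bounded_closed_interval[of "-1" 1]]) (use D(2) in force)
  then have cD: "compact D" using D(1) by (simp add: compact_eq_bounded_closed)
  \<comment> \<open>Each \<open>W l\<close> can hold only finitely many bumps, so they are placed at
    a countable dense set, exhausted as \<open>l\<close> grows.\<close>
  obtain T where T: "countable T" "T \<subseteq> D" "D \<subseteq> closure T" by (rule separable[of D])
  define t where "t = from_nat_into T"
  obtain L :: nat where L: "1 / \<epsilon> < real L" using reals_Archimedean2 by blast
  \<comment> \<open>One number drives all parameters: weight \<open>q l\<close>, slack and smearing
    error \<open>1 / q l\<close>, pairing bound \<open>1 / (q l)^2\<close>. The weight times the
    pairing bound is then \<open>1 / q l\<close>, which \<open>L\<close> keeps below
    \<open>\<epsilon>\<close>.\<close>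
  define q where "q l = real l + real L + 1" for l :: nat
  have q: "0 < q l" "1 \<le> q l" "real l + 1 \<le> q l" for l by (auto simp: q_def)
  have q\<epsilon>: "1 / q l \<le> \<epsilon>" for l
  proof -
    have "1 / \<epsilon> \<le> q l" using L by (simp add: q_def)
    then show ?thesis using \<epsilon> q(1)[of l] by (simp add: field_simps)
  qed
  have q1: "1 / q l \<le> 1" for l using q(2)[of l] by simp
  let ?b = "\<lambda>s \<delta> p :: (real^'n) \<times> (real^'n). bump TYPE(real^'n) s \<delta> (fst p \<bullet> snd p)"
  have cb: "continuous_on S (?b s \<delta>)" for S s \<delta> by (rule continuous_on_inner_sphere[OF continuous_on_bump])
  \<comment> \<open>A cube because \<open>W l\<close> has at most \<open>q l\<close> bumps: the sum
    is then bounded by \<open>1 / (q l)^2\<close> times the trace.\<close>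
  let ?Q = "\<lambda>l d. 0 < d \<and> d \<le> 1 / q l \<and> (\<forall>(A :: (real^'n) \<times> (real^'n) \<Rightarrow> real) s. continuous_on (sphere 0 1 \<times> sphere 0 1) A \<longrightarrow>
      pos_def_kernel A \<longrightarrow> s \<in> D \<longrightarrow> (\<forall>x y. norm x = 1 \<longrightarrow> norm y = 1 \<longrightarrow> x \<bullet> y = s \<longrightarrow> A (x, y) = 0) \<longrightarrow>
      (\<integral>p. ?b s d p * A p \<partial>(\<omega> \<Otimes>\<^sub>M \<omega>)) \<le> 1 / q l ^ 3 * (\<integral>x. A (x, x) \<partial>\<omega>))"
  have "\<exists>d. ?Q l d" for l
  proof -
    have "0 < 1 / q l ^ 3" using q(1)[of l] by simp
    obtain \<delta>0 where d0: "0 < \<delta>0"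
      "\<And>(A :: (real^'n) \<times> (real^'n) \<Rightarrow> real) t \<delta>.
       continuous_on (sphere 0 1 \<times> sphere 0 1) A \<Longrightarrow> pos_def_kernel A \<Longrightarrow> t \<in> D \<Longrightarrow>
       0 < \<delta> \<Longrightarrow> \<delta> \<le> \<delta>0 \<Longrightarrow> (\<And>x y. norm x = 1 \<Longrightarrow> norm y = 1 \<Longrightarrow> x \<bullet> y = t \<Longrightarrow> A (x, y) = 0) \<Longrightarrow>
       \<bar>\<integral>p. ?b t \<delta> p * A p \<partial>(\<omega> \<Otimes>\<^sub>M \<omega>)\<bar> \<le> 1 / q l ^ 3 * (\<integral>x. A (x, x) \<partial>\<omega>)"
    proof (rule bump_average[OF cD D(2) \<open>0 < 1 / q l ^ 3\<close> dim], goal_cases)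
      case (1 \<delta>0)
      show ?case by (rule 1(1)[of \<delta>0, OF 1(2,4)])
    qed
    have "0 < min \<delta>0 (1 / q l)" using d0(1) q(1)[of l] by simp
    then show ?thesis
    proof (intro exI[of _ "min \<delta>0 (1 / q l)"] conjI allI impI)
      fix A :: "(real^'n) \<times> (real^'n) \<Rightarrow> real" and s
      assume A: "continuous_on (sphere 0 1 \<times> sphere 0 1) A" "pos_def_kernel A" "s \<in> D"
        "\<forall>x y. norm x = 1 \<longrightarrow> norm y = 1 \<longrightarrow> x \<bullet> y = s \<longrightarrow> A (x, y) = 0"
      have "\<bar>\<integral>p. ?b s (min \<delta>0 (1 / q l)) p * A p \<partial>(\<omega> \<Otimes>\<^sub>M \<omega>)\<bar> \<le> 1 / q l ^ 3 * (\<integral>x. A (x, x) \<partial>\<omega>)"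
        by (rule d0(2)[OF A(1-3) \<open>0 < min \<delta>0 (1 / q l)\<close>]) (use A(4) in auto)
      then show "(\<integral>p. ?b s (min \<delta>0 (1 / q l)) p * A p \<partial>(\<omega> \<Otimes>\<^sub>M \<omega>)) \<le> 1 / q l ^ 3 * (\<integral>x. A (x, x) \<partial>\<omega>)" by linarith
    qed auto
  qed
  then have "\<exists>d. \<forall>l. ?Q l (d l)" by (intro choice allI)
  then obtain d where dQ: "\<forall>l. ?Q l (d l)" ..
  note dl = dQ[THEN spec]
  note d = dl[THEN conjunct1] dl[THEN conjunct2, THEN conjunct1]
  note dA = dl[THEN conjunct2, THEN conjunct2, rule_format]
  \<comment> \<open>The membership test matters when \<open>T\<close> is empty:
    \<open>from_nat_into\<close> then returns arbitrary values, and \<open>J l\<close> must be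
    empty.\<close>
  define J where "J l = {j \<in> {..l}. t j \<in> T}" for l
  have Jf: "finite (J l)" for l by (simp add: J_def)
  have JD: "t j \<in> D" if "j \<in> J l" for j l using that T(2) by (auto simp: J_def)
  have Jc: "real (card (J l)) \<le> q l" for l
  proof -
    have "card (J l) \<le> card {..l}" unfolding J_def by (intro card_mono) auto
    then show ?thesis using q(3)[of l] by simp
  qed
  define W where "W l u = (\<Sum>j\<in>J l. bump TYPE(real^'n) (t j) (d l) u)" for l u
  have cW: "continuous_on UNIV (W l)" for l unfolding W_def by (intro continuous_on_sum continuous_on_bump)
  have W0: "0 \<le> W l u" for l u unfolding W_def by (intro sum_nonneg bump_nonneg)
  have WA: "(\<integral>p. W l (fst p \<bullet> snd p) * A p \<partial>(\<omega> \<Otimes>\<^sub>M \<omega>)) \<le> 1 / (q l)\<^sup>2 * (\<integral>x. A (x, x) \<partial>\<omega>)"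
    if A: "continuous_on (sphere 0 1 \<times> sphere 0 1) A" "pos_def_kernel A"
      "\<And>x y. norm x = 1 \<Longrightarrow> norm y = 1 \<Longrightarrow> x \<bullet> y \<in> D \<Longrightarrow> A (x, y) = 0" for A :: "(real^'n) \<times> (real^'n) \<Rightarrow> real" and l
  proof -
    have tr: "0 \<le> (\<integral>x. A (x, x) \<partial>\<omega>)"
      by (rule integral_nonneg_AE, rule AE_I2) (use pos_def_kernel_diag_nonneg[OF A(2)] in auto)
    have i: "integrable (\<omega> \<Otimes>\<^sub>M \<omega>) (\<lambda>p. ?b s \<delta> p * A p)" for s \<delta>
      by (intro integrable_continuous_on_surface_pair continuous_on_mult cb A(1))
    have "(\<integral>p. W l (fst p \<bullet> snd p) * A p \<partial>(\<omega> \<Otimes>\<^sub>M \<omega>)) = (\<Sum>j\<in>J l. \<integral>p. ?b (t j) (d l) p * A p \<partial>(\<omega> \<Otimes>\<^sub>M \<omega>))"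
      unfolding W_def sum_distrib_right by (rule Bochner_Integration.integral_sum) (rule i)
    also have "\<dots> \<le> (\<Sum>j\<in>J l. 1 / q l ^ 3 * (\<integral>x. A (x, x) \<partial>\<omega>))"
      by (intro sum_mono dA A JD) (use A(3) JD in auto)
    also have "\<dots> = real (card (J l)) * (1 / q l ^ 3 * (\<integral>x. A (x, x) \<partial>\<omega>))" by simp
    also have "\<dots> \<le> q l * (1 / q l ^ 3 * (\<integral>x. A (x, x) \<partial>\<omega>))"
      using Jc tr q(1)[of l] by (intro mult_right_mono mult_nonneg_nonneg) auto
    also have "\<dots> = 1 / (q l)\<^sup>2 * (\<integral>x. A (x, x) \<partial>\<omega>)" using q(1)[of l] by (simp add: power2_eq_square power3_eq_cube)
    finally show ?thesis .
  qed
  let ?F = "\<lambda>l (f :: real^'n \<Rightarrow> real). continuous_on UNIV f \<and> (\<forall>x. 0 \<le> f x) \<and> (\<integral>x. f x \<partial>\<omega>) = 1 \<and>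
      b * (\<integral>x. (f x)\<^sup>2 \<partial>\<omega>) \<le> 1 + 1 / q l \<and>
      q l * (\<integral>p. W l (fst p \<bullet> snd p) * (f (fst p) * f (snd p)) \<partial>(\<omega> \<Otimes>\<^sub>M \<omega>)) \<le> 1 + 1 / q l + q l * (1 / q l)"
  have "\<exists>f. ?F l f" for l
  proof (rule certificate_or_density[where D=D and W="W l" and b=b and M="q l" and c="1 / q l" and e="1 / q l" and \<eta>="1 / (q l)\<^sup>2",
        OF dim2 cW W0], goal_cases)
    case (5 A)
    show ?case by (rule WA[OF 5(1,2)]) (rule 5(3))
  next
    case (6 r0)
    have "b + q l * (1 / (q l)\<^sup>2) \<le> a + 3 * \<epsilon>" using q\<epsilon>[of l] q(1)[of l] by (simp add: b_def power2_eq_square)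
    then have "ereal (b + q l * (1 / (q l)\<^sup>2)) \<le> ereal (a + 3 * \<epsilon>)" by simp
    then have "\<forall>r\<ge>r0. gamma_bound r \<omega> (sphere_edges D :: (real^'n) set set) \<le> ereal (a + 3 * \<epsilon>)"
      using 6 order_trans by blast
    then show ?case using no by blast
  next
    case (7 f)
    then show ?case by blast
  qed (use b q in \<open>auto simp: less_imp_le\<close>)
  then have "\<exists>f. \<forall>l. ?F l (f l)" by (intro choice allI)
  then obtain f where "\<forall>l. ?F l (f l)" ..
  note fF = this[THEN spec]
  note f = fF[THEN conjunct1] fF[THEN conjunct2, THEN conjunct1, THEN spec] fF[THEN conjunct2, THEN conjunct2, THEN conjunct1]
  note f2 = fF[THEN conjunct2, THEN conjunct2, THEN conjunct2, THEN conjunct1]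
  note fW = fF[THEN conjunct2, THEN conjunct2, THEN conjunct2, THEN conjunct2]
  have cf: "continuous_on S (f l)" for S l using f(1) continuous_on_subset by blast
  have fi: "integrable \<omega> (f l)" for l by (rule integrable_continuous_on_surface[OF cf])
  have fi2: "integrable \<omega> (\<lambda>x. (f l x)\<^sup>2)" for l by (intro integrable_continuous_on_surface continuous_on_power cf)
  have fC: "(\<integral>x. (f l x)\<^sup>2 \<partial>\<omega>) \<le> (1 + 1 / q l) / b" for l using f2[of l] b by (simp add: pos_le_divide_eq mult.commute)
  have fE: "(\<integral>x. (f l x)\<^sup>2 \<partial>\<omega>) \<le> 2 / b" for l
  proof -
    have "(1 + 1 / q l) / b \<le> 2 / b" using q1[of l] b by (intro divide_right_mono) auto
    then show ?thesis using fC[of l] by linarith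
  qed
  have fW3: "(\<integral>p. W l (fst p \<bullet> snd p) * (f l (fst p) * f l (snd p)) \<partial>(\<omega> \<Otimes>\<^sub>M \<omega>)) \<le> 3 / q l" for l
  proof -
    have "q l * (1 / q l) = 1" using q(1)[of l] by simp
    then have "q l * (\<integral>p. W l (fst p \<bullet> snd p) * (f l (fst p) * f l (snd p)) \<partial>(\<omega> \<Otimes>\<^sub>M \<omega>)) \<le> 3"
      using fW[of l] q1[of l] by linarith
    then show ?thesis using q(1)[of l] by (simp add: pos_le_divide_eq mult.commute)
  qed
  have qlim: "(\<lambda>l. 1 / q l) \<longlonglongrightarrow> 0"
  proof (rule tendsto_sandwich[OF _ _ tendsto_const lim_inverse_n'])
    show "eventually (\<lambda>l. 0 \<le> 1 / q l) sequentially" using q(1) by (simp add: less_imp_le)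
    show "eventually (\<lambda>l. 1 / q l \<le> 1 / real l) sequentially"
      using eventually_gt_at_top[of 0] by eventually_elim (use q(3) in \<open>auto intro!: frac_le simp: q_def\<close>)
  qed
  have Clim: "(\<lambda>l. (1 + 1 / q l) / b) \<longlonglongrightarrow> 1 / b"
    using tendsto_divide[OF tendsto_add[OF tendsto_const qlim] tendsto_const, of b 1] b by simp
  obtain k g where k: "strict_mono (k :: nat \<Rightarrow> nat)" and g: "\<And>x. 0 \<le> g x" "integrable \<omega> g" "(\<integral>x. g x \<partial>\<omega>) = 1"
    "integrable \<omega> (\<lambda>x. (g x)\<^sup>2)" "(\<integral>x. (g x)\<^sup>2 \<partial>\<omega>) \<le> 1 / b"
    and lim: "\<And>W. continuous_on (sphere 0 1 \<times> sphere 0 1) W \<Longrightarrow>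
      (\<lambda>l. \<integral>p. W p * (f (k l) (fst p) * f (k l) (snd p)) \<partial>(\<omega> \<Otimes>\<^sub>M \<omega>)) \<longlonglongrightarrow> (\<integral>p. W p * (g (fst p) * g (snd p)) \<partial>(\<omega> \<Otimes>\<^sub>M \<omega>))"
  proof (rule weak_limit_density[OF f(2) fi f(3) fi2 fC Clim], goal_cases)
    case (1 k g)
    show ?case by (rule 1(1)[of k g, OF 1(2-8)])
  qed
  \<comment> \<open>The widths \<open>d l\<close> shrink with \<open>l\<close>, whereas a weak limit
    needs a fixed kernel. The product kernels of the densities are positive definite with trace at
    most \<open>2 / b\<close>, so \<open>bump_average\<close> exchanges the width \<open>d l\<close>
    for a fixed \<open>\<delta>\<close> at a cost uniform in \<open>l\<close>.\<close>
  have zero: "\<exists>\<delta>>0. \<delta> \<le> \<delta>0 \<and> (\<integral>p. ?b s \<delta> p * (g (fst p) * g (snd p)) \<partial>(\<omega> \<Otimes>\<^sub>M \<omega>)) \<le> \<eta>"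
    if s: "s \<in> T" and \<eta>: "0 < \<eta>" and \<delta>0: "0 < \<delta>0" for s \<eta> \<delta>0
  proof -
    obtain j where j: "t j = s" using s T(1) from_nat_into_surj[of T s] by (auto simp: t_def)
    have sD: "s \<in> D" using s T by blast
    \<comment> \<open>With the trace bound \<open>2 / b\<close> the exchange of widths costs
      \<open>\<eta> / 4\<close>; the bump inside \<open>W l\<close> contributes at most
      \<open>3 / q l\<close>, soon below \<open>\<eta> / 2\<close>.\<close>
    have "0 < \<eta> * b / 8" using \<eta> b by simp
    obtain \<delta>1 where d1: "0 < \<delta>1"
      "\<And>(A :: (real^'n) \<times> (real^'n) \<Rightarrow> real) t \<delta> \<delta>'.
       continuous_on (sphere 0 1 \<times> sphere 0 1) A \<Longrightarrow> pos_def_kernel A \<Longrightarrow> t \<in> D \<Longrightarrow>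
       0 < \<delta> \<Longrightarrow> \<delta> \<le> \<delta>1 \<Longrightarrow> 0 < \<delta>' \<Longrightarrow> \<delta>' \<le> \<delta>1 \<Longrightarrow>
       \<bar>(\<integral>p. ?b t \<delta> p * A p \<partial>(\<omega> \<Otimes>\<^sub>M \<omega>)) - (\<integral>p. ?b t \<delta>' p * A p \<partial>(\<omega> \<Otimes>\<^sub>M \<omega>))\<bar> \<le> \<eta> * b / 8 * (\<integral>x. A (x, x) \<partial>\<omega>)"
    proof (rule bump_average[OF cD D(2) \<open>0 < \<eta> * b / 8\<close> dim], goal_cases)
      case (1 \<delta>1)
      show ?case by (rule 1(1)[of \<delta>1, OF 1(2,3)])
    qed
    define \<delta> where "\<delta> = min \<delta>0 \<delta>1"
    have \<delta>: "0 < \<delta>" "\<delta> \<le> \<delta>0" "\<delta> \<le> \<delta>1" using \<delta>0 d1(1) by (auto simp: \<delta>_def)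
    have "eventually (\<lambda>l. 1 / q l < min \<delta>1 (\<eta> / 6)) sequentially"
      by (rule order_tendstoD[OF qlim]) (use d1 \<eta> in simp)
    then obtain l0 where l0: "\<And>l. l0 \<le> l \<Longrightarrow> 1 / q l < min \<delta>1 (\<eta> / 6)" by (auto simp: eventually_sequentially)
    have bound: "(\<integral>p. ?b s \<delta> p * (f l (fst p) * f l (snd p)) \<partial>(\<omega> \<Otimes>\<^sub>M \<omega>)) \<le> \<eta>" if l: "max l0 j \<le> l" for l
    proof -
      let ?A = "\<lambda>p. f l (fst p) * f l (snd p)"
      have cA: "continuous_on S ?A" for S
        by (intro continuous_on_mult continuous_on_compose2[OF f(1)] continuous_on_fst continuous_on_snd continuous_on_id) auto
      have ql: "1 / q l < \<delta>1" "3 / q l \<le> \<eta> / 2" using l0[of l] l by auto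
      have "\<bar>(\<integral>p. ?b s \<delta> p * ?A p \<partial>(\<omega> \<Otimes>\<^sub>M \<omega>)) - (\<integral>p. ?b s (d l) p * ?A p \<partial>(\<omega> \<Otimes>\<^sub>M \<omega>))\<bar>
        \<le> \<eta> * b / 8 * (\<integral>x. f l (fst (x, x)) * f l (snd (x, x)) \<partial>\<omega>)"
        by (rule d1(2)[OF cA pos_def_kernel_rank_one sD \<delta>(1,3) d(1)]) (use d(2)[of l] ql in linarith)
      also have "\<dots> = \<eta> * b / 8 * (\<integral>x. (f l x)\<^sup>2 \<partial>\<omega>)" by (simp add: power2_eq_square)
      also have "\<dots> \<le> \<eta> * b / 8 * (2 / b)" using fE[of l] \<eta> b by (intro mult_left_mono) auto
      also have "\<dots> = \<eta> / 4" using b by simp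
      finally have 1: "(\<integral>p. ?b s \<delta> p * ?A p \<partial>(\<omega> \<Otimes>\<^sub>M \<omega>)) \<le> (\<integral>p. ?b s (d l) p * ?A p \<partial>(\<omega> \<Otimes>\<^sub>M \<omega>)) + \<eta> / 4" by linarith
      have "(\<integral>p. ?b s (d l) p * ?A p \<partial>(\<omega> \<Otimes>\<^sub>M \<omega>)) \<le> (\<integral>p. W l (fst p \<bullet> snd p) * ?A p \<partial>(\<omega> \<Otimes>\<^sub>M \<omega>))"
      proof (rule integral_mono)
        show "integrable (\<omega> \<Otimes>\<^sub>M \<omega>) (\<lambda>p. ?b s (d l) p * ?A p)"
          by (intro integrable_continuous_on_surface_pair continuous_on_mult[OF cb] cA)
        show "integrable (\<omega> \<Otimes>\<^sub>M \<omega>) (\<lambda>p. W l (fst p \<bullet> snd p) * ?A p)"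
          by (intro integrable_continuous_on_surface_pair continuous_on_mult[OF continuous_on_inner_sphere[OF cW]] cA)
        fix p :: "(real^'n) \<times> (real^'n)"
        have jJ: "j \<in> J l" using l s by (simp add: J_def j)
        have "?b (t j) (d l) p \<le> W l (fst p \<bullet> snd p)"
          unfolding W_def by (rule member_le_sum[OF jJ bump_nonneg Jf])
        then show "?b s (d l) p * ?A p \<le> W l (fst p \<bullet> snd p) * ?A p"
          unfolding j by (intro mult_right_mono mult_nonneg_nonneg f(2))
      qed
      then show ?thesis using 1 fW3[of l] ql(2) \<eta> by linarith
    qed
    have "(\<integral>p. ?b s \<delta> p * (g (fst p) * g (snd p)) \<partial>(\<omega> \<Otimes>\<^sub>M \<omega>)) \<le> \<eta>"
    proof (rule LIMSEQ_le_const2[OF lim[OF cb]], intro exI allI impI)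
      fix l assume "max l0 j \<le> l"
      then have "max l0 j \<le> k l" using seq_suble[OF k, of l] by linarith
      then show "(\<integral>p. ?b s \<delta> p * (f (k l) (fst p) * f (k l) (snd p)) \<partial>(\<omega> \<Otimes>\<^sub>M \<omega>)) \<le> \<eta>" by (rule bound)
    qed
    then show ?thesis using \<delta> by blast
  qed
  define S where "S = measure \<omega> (sphere (0::real^'n) 1)"
  have S: "0 < S"
  proof -
    obtain e :: "real^'n" where "norm e = 1" using vector_choose_size[of 1] by auto
    then show ?thesis using measure_surface_pos[of UNIV e] by (simp add: S_def)
  qed
  \<comment> \<open>Values of \<open>g\<close> up to \<open>\<theta>\<close> contribute at most
    \<open>\<theta> * S\<close>, a quarter of the gap \<open>1 - a / b\<close>.\<close>
  define \<theta> where "\<theta> = (1 - a / b) / (4 * S)"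
  have ab: "a / b < 1" using b by simp
  have \<theta>: "0 < \<theta>" using ab S by (simp add: \<theta>_def)
  \<comment> \<open>On \<open>P\<close> the indicator is at most \<open>g / \<theta>\<close>, so
    vanishing bump averages pass from \<open>g\<close> to every compact subset of
    \<open>P\<close>.\<close>
  define P where "P = {x \<in> space \<omega>. \<theta> < g x}"
  have gm: "g \<in> borel_measurable \<omega>" using g(2) by simp
  have Ps: "P \<in> sets \<omega>" unfolding P_def using gm by (intro borel_measurable_less) auto
  have "measure \<omega> P \<le> a"
  proof (rule measure_surface_le_compact[OF Ps])
    fix K assume K: "compact K" "K \<subseteq> P"
    have Kb: "K \<in> sets borel" using K(1) by (intro borel_closed compact_imp_closed)
    have Ks: "K \<subseteq> sphere 0 1" using K(2) by (auto simp: P_def)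
    show "measure \<omega> K \<le> a"
    proof (rule essentially_independent[OF dim2 D T(2,3) K(1) Ks _ a])
      fix s \<eta> \<delta>0 :: real assume "s \<in> T" "0 < \<eta>" "0 < \<delta>0"
      moreover have "0 < \<eta> * \<theta>\<^sup>2" using \<open>0 < \<eta>\<close> \<theta> by simp
      ultimately obtain \<delta> where \<delta>: "0 < \<delta>" "\<delta> \<le> \<delta>0"
        "(\<integral>p. ?b s \<delta> p * (g (fst p) * g (snd p)) \<partial>(\<omega> \<Otimes>\<^sub>M \<omega>)) \<le> \<eta> * \<theta>\<^sup>2" using zero[of s "\<eta> * \<theta>\<^sup>2" \<delta>0] by blast
      have ig: "integrable (\<omega> \<Otimes>\<^sub>M \<omega>) (\<lambda>p. ?b s \<delta> p * (g (fst p) * g (snd p)))" by (rule integrable_kernel_product[OF cb g(2)])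
      have Ki: "integrable \<omega> (indicator K :: real^'n \<Rightarrow> real)"
        using Kb Ks by (intro integrable_real_indicator) (auto simp: surface_sets_iff surface.emeasure_finite less_top[symmetric])
      have "(\<integral>p. ?b s \<delta> p * (indicator K (fst p) * indicator K (snd p)) \<partial>(\<omega> \<Otimes>\<^sub>M \<omega>)) \<le>
        (\<integral>p. ?b s \<delta> p * (g (fst p) * g (snd p)) / \<theta>\<^sup>2 \<partial>(\<omega> \<Otimes>\<^sub>M \<omega>))"
      proof (rule integral_mono)
        show "integrable (\<omega> \<Otimes>\<^sub>M \<omega>) (\<lambda>p. ?b s \<delta> p * (indicator K (fst p) * indicator K (snd p)))"
          by (rule integrable_kernel_product[OF cb Ki])
        show "integrable (\<omega> \<Otimes>\<^sub>M \<omega>) (\<lambda>p. ?b s \<delta> p * (g (fst p) * g (snd p)) / \<theta>\<^sup>2)"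
          by (intro integrable_divide_zero ig)
        fix p :: "(real^'n) \<times> (real^'n)"
        have ind: "indicator K x \<le> g x / \<theta>" for x
          using K(2) g(1)[of x] \<theta> by (auto simp: indicator_def P_def)
        have "indicator K (fst p) * indicator K (snd p) \<le> g (fst p) / \<theta> * (g (snd p) / \<theta>)"
          using g(1) \<theta> by (intro mult_mono ind) (auto simp: less_imp_le)
        then have "?b s \<delta> p * (indicator K (fst p) * indicator K (snd p)) \<le> ?b s \<delta> p * (g (fst p) / \<theta> * (g (snd p) / \<theta>))"
          by (intro mult_left_mono bump_nonneg)
        then show "?b s \<delta> p * (indicator K (fst p) * indicator K (snd p)) \<le> ?b s \<delta> p * (g (fst p) * g (snd p)) / \<theta>\<^sup>2"
          by (simp add: power2_eq_square)
      qed
      also have "\<dots> \<le> \<eta>" using \<delta>(3) \<theta> by (simp add: pos_divide_le_eq)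
      finally show "\<exists>\<delta>>0. \<delta> \<le> \<delta>0 \<and> (\<integral>p. ?b s \<delta> p * (indicator K (fst p) * indicator K (snd p)) \<partial>(\<omega> \<Otimes>\<^sub>M \<omega>)) \<le> \<eta>"
        using \<delta>(1,2) by blast
    qed
  qed
  then have Pa: "1 / (2 * b) * measure \<omega> P \<le> 1 / (2 * b) * a" using b by (intro mult_left_mono) auto
  have Pi: "integrable \<omega> (indicator P :: real^'n \<Rightarrow> real)"
    using Ps by (intro integrable_real_indicator) (auto simp: surface.emeasure_finite less_top[symmetric])
  \<comment> \<open>Cauchy-Schwarz in additive form:
    \<open>g \<le> b / 2 * g^2 + 1 / (2 * b)\<close> on \<open>P\<close> and
    \<open>g \<le> \<theta>\<close> elsewhere. The sum is
    \<open>1/2 + (a / b) / 2 + (1 - a / b) / 4\<close>, less than 1.\<close>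
  have "1 = (\<integral>x. g x \<partial>\<omega>)" using g(3) by simp
  also have "\<dots> \<le> (\<integral>x. b / 2 * (g x)\<^sup>2 + 1 / (2 * b) * indicator P x + \<theta> \<partial>\<omega>)"
  proof (rule integral_mono[OF g(2)])
    show "integrable \<omega> (\<lambda>x. b / 2 * (g x)\<^sup>2 + 1 / (2 * b) * indicator P x + \<theta>)"
      by (intro Bochner_Integration.integrable_add integrable_mult_right g(4) Pi surface.integrable_const)
    fix x :: "real^'n" assume x: "x \<in> space \<omega>"
    show "g x \<le> b / 2 * (g x)\<^sup>2 + 1 / (2 * b) * indicator P x + \<theta>"
    proof (cases "x \<in> P")
      case True
      have "0 \<le> (b * g x - 1)\<^sup>2 / (2 * b)" using b by simp
      also have "\<dots> = b / 2 * (g x)\<^sup>2 + 1 / (2 * b) - g x" using b by (simp add: power2_eq_square field_simps)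
      finally show ?thesis using True \<theta> by simp
    next
      case False
      then have "g x \<le> \<theta>" using x by (simp add: P_def)
      moreover have "0 \<le> b / 2 * (g x)\<^sup>2" using b by simp
      ultimately show ?thesis using False by simp
    qed
  qed
  also have "\<dots> = b / 2 * (\<integral>x. (g x)\<^sup>2 \<partial>\<omega>) + 1 / (2 * b) * measure \<omega> P + \<theta> * S"
    using g(4) Pi Ps sets.sets_into_space[OF Ps] by (simp add: S_def Int_absorb2 mult.commute)
  also have "\<dots> \<le> b / 2 * (1 / b) + 1 / (2 * b) * a + \<theta> * S" using mult_left_mono[OF g(5), of "b / 2"] b Pa by linarith
  also have "\<dots> = 1 / 2 + (a / b) / 2 + (1 - a / b) / 4" using b S by (simp add: \<theta>_def)
  also have "\<dots> < 1"
  proof -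
    have "1 / 2 + u / 2 + (1 - u) / 4 < 1" if "u < 1" for u :: real using that by (simp add: field_simps)
    from this[OF ab] show ?thesis .
  qed
  finally show False by simp
qed

theorem theorem5p5:
  fixes D :: "real set"
  assumes "CARD('n::finite) \<ge> 3"
    and "closed D"
    and "D \<subseteq> {-1<..<1}"
  shows "(\<lambda>r. gamma_bound r surface_measure (sphere_edges D :: (real ^ 'n) set set))
           \<longlonglongrightarrow> indep_number surface_measure (sphere_edges D :: (real ^ 'n) set set)"
proof -
  let ?E = "sphere_edges D :: (real^'n) set set"
  let ?\<alpha> = "indep_number \<omega> ?E"
  have le: "ereal (measure \<omega> I) \<le> ?\<alpha>" if "I \<in> sets \<omega>" "\<forall>x\<in>I. \<forall>y\<in>I. x \<bullet> y \<notin> D" for I :: "(real^'n) set"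
  proof -
    have "indep_set ?E I" using that indep_sphere_edges_iff[of I D] by (simp add: surface_sets_iff)
    then have "enn2ereal (emeasure \<omega> I) \<le> ?\<alpha>" unfolding indep_number_def using that(1) by (intro SUP_upper) auto
    then show ?thesis by (simp add: surface.emeasure_eq_measure enn2ereal_ennreal)
  qed
  have "0 \<le> ?\<alpha>" using le[of "{}"] by (simp add: zero_ereal_def)
  moreover have "?\<alpha> \<le> ereal (measure \<omega> (sphere (0::real^'n) 1))"
    unfolding indep_number_def
  proof (rule SUP_least)
    fix I :: "(real^'n) set" assume "I \<in> {I \<in> sets \<omega>. indep_set ?E I}"
    then have "measure \<omega> I \<le> measure \<omega> (sphere (0::real^'n) 1)"
      by (intro surface.finite_measure_mono) (auto simp: surface_sets_iff)
    then show "enn2ereal (emeasure \<omega> I) \<le> ereal (measure \<omega> (sphere (0::real^'n) 1))"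
      by (simp add: surface.emeasure_eq_measure enn2ereal_ennreal)
  qed
  \<comment> \<open>Finite total area makes the independence number real, so that an error can be
    added to it.\<close>
  ultimately obtain a where a: "?\<alpha> = ereal a" by (cases ?\<alpha>) auto
  have D1: "1 \<notin> D" using assms(3) by auto
  show ?thesis
  proof (rule order_tendstoI)
    fix x assume "x < ?\<alpha>"
    \<comment> \<open>No limit is involved on this side: the lower bound holds for every
      \<open>r\<close>.\<close>
    then show "eventually (\<lambda>r. x < gamma_bound r \<omega> ?E) sequentially"
      using gamma_bound_ge[OF assms(2) D1] by (intro always_eventually allI) (rule less_le_trans)
  next
    fix x assume "?\<alpha> < x"
    then obtain z where z: "ereal a < ereal z" "ereal z < x" using ereal_dense2[of ?\<alpha> x] by (auto simp: a)
    define \<epsilon> where "\<epsilon> = (z - a) / 3"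
    have \<epsilon>: "0 < \<epsilon>" "a + 3 * \<epsilon> = z" using z(1) by (auto simp: \<epsilon>_def field_simps)
    have "\<exists>r0. \<forall>r\<ge>r0. gamma_bound r \<omega> ?E \<le> ereal (a + 3 * \<epsilon>)"
      by (rule gamma_bound_le_eventually[OF assms \<epsilon>(1)]) (use le a in auto)
    then show "eventually (\<lambda>r. gamma_bound r \<omega> ?E < x) sequentially"
      using z(2) \<epsilon>(2) by (auto simp: eventually_sequentially intro: le_less_trans)
  qed
qed

end
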